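(* Let $k\in\mathbb{Z}_{\ge0}^{S}$ have exactly one nonzero entry, say $k_{\sigma}=k\neq 0$ for a unique $\sigma\in S$, and write $k=d\cdot q+r$ with $d\ge 0$ and $0\le r<q$. Let $a\in\mathcal{O}_{C}$. Assume that one of the following three conditions holds: (i) $k\le\frac{1}{2}q^{2}$, $r<q-d$ and $v_{F}(a)\in[0,1]$; (ii) $k\le\frac{1}{2}q^{2}$, $2v_{F}(a)-1\le r<q-d$ and $v_{F}(a)\in[1,e]$; (iii) $k\le\min\left(p\cdot q-1,\frac{1}{2}q^{2}\right)$, $d-1\le r$ and $v_{F}(a)\ge d$. Then the $\mathcal{O}_{C}$-lattice $\Theta_{k,a}$ is separated, i.e. $\bigcap_{n\ge0}\varpi^{n}\Theta_{k,a}=0$ (equivalently, $\Theta_{k,a}$ contains no $C$-line).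
   Context: $p$ is a prime; $F$ is a finite extension of $\mathbb{Q}_{p}$ with ring of integers $\mathcal{O}_{F}$, fixed uniformizer $\varpi$, residue field of cardinality $q$ and ramification index $e$. $C$ is a finite extension of $\mathbb{Q}_{p}$ such that $S=\mathrm{Hom}_{\mathbb{Q}_p\text{-alg}}(F,C)$ has $[F:\mathbb{Q}_{p}]$ elements and $C$ contains a (fixed) square root of $\sigma(\varpi)$ for each $\sigma\in S$. $v_{F}$ is the valuation on $\overline{\mathbb{Q}}_{p}$ normalized by $v_{F}(\varpi)=1$. In statements about $\mathcal{O}_C$-modules, $\varpi^{n}$ ($n\in\mathbb{Z}$) means $\sigma(\varpi)^{n}$ for any fixed $\sigma\in S$. Let $G=GL_{2}(F)$, $K=GL_{2}(\mathcal{O}_{F})$, $Z$ the center of $G$, $\alpha=\mathrm{diag}(1,\varpi)$, and $\chi:G\to F^{\times}$, $\chi(g)=\varpi^{-v_{F}(\det g)}$. For $k=(k_\sigma)\in\mathbb{Z}_{\ge0}^{S}$ let $V_{k}=\bigotimes_{\sigma\in S}V^{\sigma}_{k_\sigma}$, where $V^{\sigma}_{k_\sigma}$ is the $C$-space of homogeneous polynomials of degree $k_\sigma$ in $x_\sigma,y_\sigma$, on which $g=\begin{pmatrix}a&b\\c&d\end{pmatrix}\in G$ acts by $x_\sigma^{k_\sigma-i}y_\sigma^{i}\mapsto \sigma(\chi(g))^{k_\sigma/2}(\sigma(a)x_\sigma+\sigma(c)y_\sigma)^{k_\sigma-i}(\sigma(b)x_\sigma+\sigma(d)y_\sigma)^{i}$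 (using the fixed square roots); $G$ acts on $V_k$ diagonally, giving $\rho_{k}$. Let $V_{k}^{0}$ be the $\mathcal{O}_{C}$-span of the tensor products of monomials; it is $KZ$-stable. Let $U_{k}\in\mathrm{End}_C(V_k)$ act on $\bigotimes_\sigma x_\sigma^{k_\sigma-i_\sigma}y_\sigma^{i_\sigma}$ by multiplication by $\prod_\sigma\sigma(\varpi)^{k_\sigma-i_\sigma}$, and let $\psi:G\to\mathrm{End}_{C}(V_{k})$ be the unique function supported on $KZ\alpha^{-1}KZ$ with $\psi(\kappa_{1}\alpha^{-1}\kappa_{2})=\rho_{k}(\kappa_{1})\circ U_{k}\circ\rho_{k}(\kappa_{2})$ for $\kappa_1,\kappa_2\in KZ$. For $W\in\{V_k,V_k^0\}$, $\mathrm{ind}_{KZ}^{G}W$ is the module of functions $f:G\to W$ with $f(\kappa g)=\rho_k(\kappa)f(g)$ for $\kappa\in KZ$, supported on finitely many cosets $KZg$, with $G$ acting by $(gf)(x)=f(xg)$; $[g,v]$ denotes the element supported on $KZg^{-1}$ with value $v$ at $g^{-1}$. The Hecke operator $T$ on $\mathrm{ind}_{KZ}^{G}V_{k}$ is $T([g,v])=\sum_{xKZ\in G/KZ}[gx,\psi(x^{-1})(v)]$; it preserves $\mathrm{ind}_{KZ}^{G}V_{k}^{0}$. For $a\in\mathcal{O}_C$, $\Pi_{k,a}=\mathrm{ind}_{KZ}^{G}V_{k}/(T-a)(\mathrm{ind}_{KZ}^{G}V_{k})$ and $\Theta_{k,a}$ is the image of $\mathrm{ind}_{KZ}^{G}V_{k}^{0}$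 in $\Pi_{k,a}$. *)

theory Defs
  imports
    "HOL-Analysis.Analysis"
    "HOL-Library.Poly_Mapping"
    "HOL-Computational_Algebra.Polynomial"
    "HOL-Computational_Algebra.Primes"
    "HOL-Computational_Algebra.Fraction_Field"
begin

section \<open>The p-adic numbers\<close>

class prime_card = finite +
  assumes prime_card: "prime (card (UNIV :: 'a set))"

text \<open>The prime \<open>p\<close> is \<open>CARD('p)\<close>. The type \<open>'p padic_int\<close> is the inverse limit of the rings
  \<open>\<int>/p\<^sup>n\<close>, the \<open>n\<close>-th component being represented by an integer in \<open>{0..<p ^ n}\<close>.\<close>

typedef (overloaded) 'p padic_int =
  "{x :: nat \<Rightarrow> int. \<forall>n. x (Suc n) mod int CARD('p::prime_card) ^ n = x n}"
  by (rule exI[of _ "\<lambda>_. 0"]) simp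

setup_lifting type_definition_padic_int

lemma mod_pow_Suc [simp]: "(x :: int) mod p ^ Suc n mod p ^ n = x mod p ^ n"
  by (rule mod_mod_cancel) simp

lemma mod_pow_Suc' [simp]: "(x :: int) mod (p * p ^ n) mod p ^ n = x mod p ^ n"
  by (rule mod_mod_cancel) simp

lemma padic_int_rep_mod:
  assumes "\<forall>n. x (Suc n) mod int p ^ n = x n"
  shows "x n mod int p ^ n = x n"
  using assms by (metis mod_mod_trivial)

lemma padic_int_rep_mod_le:
  assumes "\<forall>n. x (Suc n) mod int p ^ n = x n" and "m \<le> n"
  shows "x n mod int p ^ m = x m"
  using assms(2)
proof (induction n rule: dec_induct)
  case base
  then show ?case using padic_int_rep_mod[OF assms(1)] .
next
  case (step n)
  have "x (Suc n) mod int p ^ m = x (Suc n) mod int p ^ n mod int p ^ m"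
    using step.hyps by (simp add: mod_mod_cancel le_imp_power_dvd)
  also have "\<dots> = x m" using step.IH assms(1) by metis
  finally show ?case .
qed

instantiation padic_int :: (prime_card) comm_ring_1
begin

lift_definition zero_padic_int :: "'a padic_int" is "\<lambda>_. 0" by simp

lift_definition one_padic_int :: "'a padic_int" is "\<lambda>n. 1 mod int CARD('a) ^ n" by simp

lift_definition plus_padic_int :: "'a padic_int \<Rightarrow> 'a padic_int \<Rightarrow> 'a padic_int"
  is "\<lambda>x y n. (x n + y n) mod int CARD('a) ^ n"
  by simp (metis mod_add_eq)

lift_definition uminus_padic_int :: "'a padic_int \<Rightarrow> 'a padic_int"
  is "\<lambda>x n. (- x n) mod int CARD('a) ^ n"
  by simp (metis mod_minus_eq)

lift_definition minus_padic_int :: "'a padic_int \<Rightarrow> 'a padic_int \<Rightarrow> 'a padic_int"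
  is "\<lambda>x y n. (x n - y n) mod int CARD('a) ^ n"
  by simp (metis mod_diff_eq)

lift_definition times_padic_int :: "'a padic_int \<Rightarrow> 'a padic_int \<Rightarrow> 'a padic_int"
  is "\<lambda>x y n. (x n * y n) mod int CARD('a) ^ n"
  by simp (metis mod_mult_eq)

instance
proof
  fix a b c :: "'a padic_int"
  show "a + b + c = a + (b + c)"
    by transfer (auto simp: fun_eq_iff mod_simps algebra_simps)
  show "a + b = b + a"
    by transfer (auto simp: fun_eq_iff algebra_simps)
  show "0 + a = a"
    by transfer (auto simp: fun_eq_iff padic_int_rep_mod)
  show "- a + a = 0"
    by transfer (auto simp: fun_eq_iff mod_simps)
  show "a - b = a + - b"
    by transfer (auto simp: fun_eq_iff mod_simps)
  show "a * b * c = a * (b * c)"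
    by transfer (auto simp: fun_eq_iff mod_simps algebra_simps)
  show "a * b = b * a"
    by transfer (auto simp: fun_eq_iff algebra_simps)
  show "1 * a = a"
    by transfer (auto simp: fun_eq_iff mod_simps padic_int_rep_mod)
  show "(a + b) * c = a * c + b * c"
    by transfer (auto simp: fun_eq_iff mod_simps algebra_simps)
  have "(1::int) mod int CARD('a) ^ 1 \<noteq> 0"
    using prime_gt_1_nat[OF prime_card[where 'a='a]] by simp
  then show "(0::'a padic_int) \<noteq> 1"
    by transfer (metis)
qed

end

lemma int_prime_power_dvd_mult:
  fixes p :: int
  assumes "prime p" "p ^ (m + n) dvd a * b"
  shows "p ^ m dvd a \<or> p ^ n dvd b"
  using assms(2)
proof (induction m arbitrary: a)
  case 0
  then show ?case by simp
next
  case (Suc m)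
  show ?case
  proof (cases "p dvd a")
    case True
    then obtain a' where a: "a = p * a'" by blast
    with Suc.prems have "p ^ (m + n) dvd a' * b"
      using prime_gt_0_int[OF assms(1)] by (simp add: mult.assoc)
    from Suc.IH[OF this] show ?thesis
      by (auto simp: a)
  next
    case False
    then have "p ^ (Suc m + n) dvd b"
      using prime_power_dvd_multD[OF prime_imp_prime_elem[OF assms(1)] Suc.prems] by simp
    then have "p ^ n dvd b"
      by (rule dvd_trans[rotated]) (simp add: le_imp_power_dvd)
    then show ?thesis ..
  qed
qed

instance padic_int :: (prime_card) idom
proof
  fix a b :: "'a padic_int"
  assume "a \<noteq> 0" "b \<noteq> 0"
  then show "a * b \<noteq> 0"
  proof transfer
    fix x y :: "nat \<Rightarrow> int"
    define p where "p = CARD('a)"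
    assume x: "\<forall>n. x (Suc n) mod int CARD('a) ^ n = x n"
      and y: "\<forall>n. y (Suc n) mod int CARD('a) ^ n = y n"
      and "x \<noteq> (\<lambda>_. 0)" "y \<noteq> (\<lambda>_. 0)"
    then obtain m n where m: "x m \<noteq> 0" and n: "y n \<noteq> 0" by (metis ext)
    have "prime (int p)" using prime_card[where 'a='a] by (simp add: p_def)
    moreover have "\<not> int p ^ m dvd x (m + n)"
      using padic_int_rep_mod_le[of x "CARD('a)" m "m + n"] x m
      by (simp add: p_def mod_eq_0_iff_dvd[symmetric])
    moreover have "\<not> int p ^ n dvd y (m + n)"
      using padic_int_rep_mod_le[of y "CARD('a)" n "m + n"] y n
      by (simp add: p_def mod_eq_0_iff_dvd[symmetric])
    ultimately have "\<not> int p ^ (m + n) dvd x (m + n) * y (m + n)"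
      using int_prime_power_dvd_mult by blast
    then have "(x (m + n) * y (m + n)) mod int CARD('a) ^ (m + n) \<noteq> 0"
      by (simp add: p_def mod_eq_0_iff_dvd)
    then show "(\<lambda>n. x n * y n mod int CARD('a) ^ n) \<noteq> (\<lambda>_. 0)"
      by metis
  qed
qed

type_synonym 'p padic = "'p padic_int fract"

section \<open>Finite extensions of the p-adic numbers\<close>

definition is_ring_hom :: "('a::comm_ring_1 \<Rightarrow> 'b::comm_ring_1) \<Rightarrow> bool" where
  "is_ring_hom f \<longleftrightarrow>
     f 1 = 1 \<and> (\<forall>x y. f (x + y) = f x + f y) \<and> (\<forall>x y. f (x * y) = f x * f y)"

text \<open>An extension field of \<open>\<rat>\<^sub>p\<close> is a field \<open>'k\<close> together with its structure map
  \<open>\<iota> :: 'p padic \<Rightarrow> 'k\<close>.\<close>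

definition finite_extension :: "('p::prime_card padic \<Rightarrow> 'k::field) \<Rightarrow> bool" where
  "finite_extension \<iota> \<longleftrightarrow>
     is_ring_hom \<iota> \<and> (\<exists>B. finite B \<and> module.span (\<lambda>c x. \<iota> c * x) B = UNIV)"

definition ext_degree :: "('p::prime_card padic \<Rightarrow> 'k::field) \<Rightarrow> nat" where
  "ext_degree \<iota> = vector_space.dim (\<lambda>c x. \<iota> c * x) UNIV"

text \<open>The ring of integers is the integral closure of \<open>\<int>\<^sub>p\<close>.\<close>

definition integers :: "('p::prime_card padic \<Rightarrow> 'k::field) \<Rightarrow> 'k set" where
  "integers \<iota> = {x. \<exists>P :: 'p padic_int poly. lead_coeff P = 1 \<and>
                      poly (map_poly (\<lambda>c. \<iota> (Fract c 1)) P) x = 0}"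

definition integer_units :: "('p::prime_card padic \<Rightarrow> 'k::field) \<Rightarrow> 'k set" where
  "integer_units \<iota> = {x \<in> integers \<iota>. \<exists>y\<in>integers \<iota>. x * y = 1}"

text \<open>A uniformizer is a generator of the maximal ideal, which consists of the non-units.\<close>

definition uniformizer :: "('p::prime_card padic \<Rightarrow> 'k::field) \<Rightarrow> 'k \<Rightarrow> bool" where
  "uniformizer \<iota> w \<longleftrightarrow> integers \<iota> - integer_units \<iota> = {w * y | y. y \<in> integers \<iota>}"

text \<open>The valuation on \<open>'k\<^sup>\<times>\<close> normalized by the uniformizer \<open>w\<close>; only meaningful for
  nonzero arguments.\<close>

definition ord :: "('p::prime_card padic \<Rightarrow> 'k::field) \<Rightarrow> 'k \<Rightarrow> 'k \<Rightarrow> int" where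
  "ord \<iota> w x = (THE n. \<exists>u\<in>integer_units \<iota>. x = w powi n * u)"

definition residue_card :: "('p::prime_card padic \<Rightarrow> 'k::field) \<Rightarrow> 'k \<Rightarrow> nat" where
  "residue_card \<iota> w =
     card ((\<lambda>x. {x + w * y | y. y \<in> integers \<iota>}) ` integers \<iota>)"

definition ramification_index :: "('p::prime_card padic \<Rightarrow> 'k::field) \<Rightarrow> 'k \<Rightarrow> nat" where
  "ramification_index \<iota> w = nat (ord \<iota> w (of_nat CARD('p)))"

definition embeddings ::
    "('p::prime_card padic \<Rightarrow> 'f::field) \<Rightarrow> ('p padic \<Rightarrow> 'c::field) \<Rightarrow> ('f \<Rightarrow> 'c) set" where
  "embeddings \<iota>F \<iota>C = {\<sigma>. is_ring_hom \<sigma> \<and> (\<forall>x. \<sigma> (\<iota>F x) = \<iota>C x)}"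

section \<open>Polynomials and sums\<close>

datatype 's xyvar = Xv 's | Yv 's

text \<open>Polynomials over \<open>'c\<close> in the variables \<open>x\<^sub>\<sigma>, y\<^sub>\<sigma>\<close>.\<close>

type_synonym ('s, 'c) mpoly = "('s xyvar \<Rightarrow>\<^sub>0 nat) \<Rightarrow>\<^sub>0 'c"

definition mvar :: "'s xyvar \<Rightarrow> ('s, 'c::field) mpoly" where
  "mvar v = Poly_Mapping.single (Poly_Mapping.single v 1) 1"

definition mscale :: "'c \<Rightarrow> ('s, 'c::field) mpoly \<Rightarrow> ('s, 'c) mpoly" where
  "mscale c P = Poly_Mapping.single 0 c * P"

text \<open>The sum of a family with only finitely many nonzero members.\<close>

definition fsum :: "('a \<Rightarrow> 'b::comm_monoid_add) \<Rightarrow> 'a set \<Rightarrow> 'b" where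
  "fsum h A = (\<Sum>a\<in>{a\<in>A. h a \<noteq> 0}. h a)"

section \<open>The representations and the Hecke operator\<close>

text \<open>\<open>sq \<sigma>\<close> is the fixed square root of \<open>\<sigma> \<pi>\<close>.\<close>

locale padic_setup =
  fixes \<iota>F :: "'p::prime_card padic \<Rightarrow> 'f::field"
    and \<iota>C :: "'p padic \<Rightarrow> 'c::field"
    and \<pi> :: 'f
    and sq :: "('f \<Rightarrow> 'c) \<Rightarrow> 'c"
  assumes finite_extension_F: "finite_extension \<iota>F"
    and finite_extension_C: "finite_extension \<iota>C"
    and uniformizer: "uniformizer \<iota>F \<pi>"
    and card_embeddings: "card (embeddings \<iota>F \<iota>C) = ext_degree \<iota>F"
    and sq: "\<And>\<sigma>. \<sigma> \<in> embeddings \<iota>F \<iota>C \<Longrightarrow> (sq \<sigma>)\<^sup>2 = \<sigma> \<pi>"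
begin

abbreviation S :: "('f \<Rightarrow> 'c) set" where
  "S \<equiv> embeddings \<iota>F \<iota>C"

text \<open>The restriction to \<open>'c\<close> of the valuation \<open>v\<^sub>F\<close>, with value \<open>\<infinity>\<close> at \<open>0\<close>: it is the unique
  valuation with valuation ring \<open>integers \<iota>C\<close> and value 1 at the uniformizer.\<close>

definition is_vF :: "('c \<Rightarrow> ereal) \<Rightarrow> bool" where
  "is_vF v \<longleftrightarrow>
     (\<forall>x. v x = \<infinity> \<longleftrightarrow> x = 0) \<and> (\<forall>x. v x \<noteq> -\<infinity>) \<and>
     (\<forall>x y. v (x * y) = v x + v y) \<and> (\<forall>x y. min (v x) (v y) \<le> v (x + y)) \<and>
     (\<forall>x. 0 \<le> v x \<longleftrightarrow> x \<in> integers \<iota>C) \<and> (\<forall>\<sigma>\<in>S. v (\<sigma> \<pi>) = 1)"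

definition G :: "('f^2^2) set" where
  "G = {g. invertible g}"

definition K :: "('f^2^2) set" where
  "K = {g. (\<forall>i j. g $ i $ j \<in> integers \<iota>F) \<and> det g \<in> integer_units \<iota>F}"

definition Z :: "('f^2^2) set" where
  "Z = {z \<in> G. \<forall>g\<in>G. z ** g = g ** z}"

definition KZ :: "('f^2^2) set" where
  "KZ = {\<kappa> ** z | \<kappa> z. \<kappa> \<in> K \<and> z \<in> Z}"

definition \<alpha> :: "'f^2^2" where
  "\<alpha> = vector [vector [1, 0], vector [0, \<pi>]]"

text \<open>The tensor product of the spaces of homogeneous polynomials is realized as the space of
  multihomogeneous polynomials, the tensor product of monomials being their product.\<close>

definition monomials :: "(('f \<Rightarrow> 'c) \<Rightarrow> nat) \<Rightarrow> (('f \<Rightarrow> 'c) xyvar \<Rightarrow>\<^sub>0 nat) set" where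
  "monomials k =
     {m. (\<forall>\<sigma>\<in>S. Poly_Mapping.lookup m (Xv \<sigma>) + Poly_Mapping.lookup m (Yv \<sigma>) = k \<sigma>) \<and>
         (\<forall>\<sigma>. \<sigma> \<notin> S \<longrightarrow>
            Poly_Mapping.lookup m (Xv \<sigma>) = 0 \<and> Poly_Mapping.lookup m (Yv \<sigma>) = 0)}"

definition V :: "(('f \<Rightarrow> 'c) \<Rightarrow> nat) \<Rightarrow> ('f \<Rightarrow> 'c, 'c) mpoly set" where
  "V k = {P. Poly_Mapping.keys P \<subseteq> monomials k}"

definition V0 :: "(('f \<Rightarrow> 'c) \<Rightarrow> nat) \<Rightarrow> ('f \<Rightarrow> 'c, 'c) mpoly set" where
  "V0 k = {P \<in> V k. \<forall>m. Poly_Mapping.lookup P m \<in> integers \<iota>C}"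

text \<open>Since \<open>\<chi> g = \<pi> powi (- ord (det g))\<close>, the factor \<open>\<sigma>(\<chi>(g))\<close> to the power \<open>k\<^sub>\<sigma>/2\<close>
  is \<open>sq \<sigma> powi (- k \<sigma> * ord (det g))\<close>.\<close>

definition rho ::
    "(('f \<Rightarrow> 'c) \<Rightarrow> nat) \<Rightarrow> 'f^2^2 \<Rightarrow> ('f \<Rightarrow> 'c, 'c) mpoly \<Rightarrow> ('f \<Rightarrow> 'c, 'c) mpoly" where
  "rho k g P =
     (\<Sum>m\<in>Poly_Mapping.keys P. mscale (Poly_Mapping.lookup P m)
        (\<Prod>\<sigma>\<in>S. mscale (sq \<sigma> powi (- int (k \<sigma>) * ord \<iota>F \<pi> (det g)))
           ((mscale (\<sigma> (g $ 1 $ 1)) (mvar (Xv \<sigma>)) + mscale (\<sigma> (g $ 2 $ 1)) (mvar (Yv \<sigma>)))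
              ^ Poly_Mapping.lookup m (Xv \<sigma>) *
            (mscale (\<sigma> (g $ 1 $ 2)) (mvar (Xv \<sigma>)) + mscale (\<sigma> (g $ 2 $ 2)) (mvar (Yv \<sigma>)))
              ^ Poly_Mapping.lookup m (Yv \<sigma>))))"

definition U :: "('f \<Rightarrow> 'c, 'c) mpoly \<Rightarrow> ('f \<Rightarrow> 'c, 'c) mpoly" where
  "U P = (\<Sum>m\<in>Poly_Mapping.keys P.
            Poly_Mapping.single m
              ((\<Prod>\<sigma>\<in>S. \<sigma> \<pi> ^ Poly_Mapping.lookup m (Xv \<sigma>)) * Poly_Mapping.lookup P m))"

text \<open>The value does not depend on the decomposition of \<open>g\<close> when \<open>v \<in> V k\<close>.\<close>

definition psi ::
    "(('f \<Rightarrow> 'c) \<Rightarrow> nat) \<Rightarrow> 'f^2^2 \<Rightarrow> ('f \<Rightarrow> 'c, 'c) mpoly \<Rightarrow> ('f \<Rightarrow> 'c, 'c) mpoly" where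
  "psi k g v =
     (if \<exists>\<kappa>1\<in>KZ. \<exists>\<kappa>2\<in>KZ. g = \<kappa>1 ** matrix_inv \<alpha> ** \<kappa>2
      then THE w. \<exists>\<kappa>1\<in>KZ. \<exists>\<kappa>2\<in>KZ. g = \<kappa>1 ** matrix_inv \<alpha> ** \<kappa>2 \<and>
                    w = rho k \<kappa>1 (U (rho k \<kappa>2 v))
      else 0)"

text \<open>Functions on \<open>G\<close> are represented by functions on all matrices which vanish off \<open>G\<close>.\<close>

definition ind ::
    "(('f \<Rightarrow> 'c) \<Rightarrow> nat) \<Rightarrow> ('f \<Rightarrow> 'c, 'c) mpoly set \<Rightarrow> ('f^2^2 \<Rightarrow> ('f \<Rightarrow> 'c, 'c) mpoly) set" where
  "ind k W = {f. (\<forall>g. g \<notin> G \<longrightarrow> f g = 0) \<and> (\<forall>g\<in>G. f g \<in> W) \<and>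
                 (\<forall>\<kappa>\<in>KZ. \<forall>g\<in>G. f (\<kappa> ** g) = rho k \<kappa> (f g)) \<and>
                 finite {{\<kappa> ** g | \<kappa>. \<kappa> \<in> KZ} | g. g \<in> G \<and> f g \<noteq> 0}}"

text \<open>The element \<open>[g, v]\<close>: its value at \<open>\<kappa> ** matrix_inv g\<close> is \<open>rho k \<kappa> v\<close>.\<close>

definition bracket ::
    "(('f \<Rightarrow> 'c) \<Rightarrow> nat) \<Rightarrow> 'f^2^2 \<Rightarrow> ('f \<Rightarrow> 'c, 'c) mpoly \<Rightarrow> 'f^2^2 \<Rightarrow> ('f \<Rightarrow> 'c, 'c) mpoly" where
  "bracket k g v x = (if x ** g \<in> KZ then rho k (x ** g) v else 0)"

definition cosets :: "('f^2^2) set set" where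
  "cosets = {{x ** \<kappa> | \<kappa>. \<kappa> \<in> KZ} | x. x \<in> G}"

definition rep :: "('f^2^2) set \<Rightarrow> 'f^2^2" where
  "rep D = (SOME x. x \<in> D)"

text \<open>Every \<open>f\<close> in the induced module is the sum of the elements \<open>[g, f (matrix_inv g)]\<close> over
  \<open>gKZ \<in> G/KZ\<close>. The Hecke operator is thus determined by
  \<open>T [g, v] = (\<Sum>xKZ \<in> G/KZ. [gx, psi (matrix_inv x) v])\<close>, whose summands do not depend on the
  choice of \<open>x\<close> in its coset.\<close>

definition T_gen ::
    "(('f \<Rightarrow> 'c) \<Rightarrow> nat) \<Rightarrow> 'f^2^2 \<Rightarrow> ('f \<Rightarrow> 'c, 'c) mpoly \<Rightarrow> 'f^2^2 \<Rightarrow> ('f \<Rightarrow> 'c, 'c) mpoly" where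
  "T_gen k g v y = fsum (\<lambda>D. bracket k (g ** rep D) (psi k (matrix_inv (rep D)) v) y) cosets"

definition T ::
    "(('f \<Rightarrow> 'c) \<Rightarrow> nat) \<Rightarrow> ('f^2^2 \<Rightarrow> ('f \<Rightarrow> 'c, 'c) mpoly) \<Rightarrow> 'f^2^2 \<Rightarrow> ('f \<Rightarrow> 'c, 'c) mpoly" where
  "T k f y = fsum (\<lambda>D. T_gen k (rep D) (f (matrix_inv (rep D))) y) cosets"

text \<open>Elements of the quotient \<open>\<Pi>\<close> of \<open>ind k (V k)\<close> by the image of \<open>T - a\<close> are cosets of that
  image.\<close>

definition T_image ::
    "(('f \<Rightarrow> 'c) \<Rightarrow> nat) \<Rightarrow> 'c \<Rightarrow> ('f^2^2 \<Rightarrow> ('f \<Rightarrow> 'c, 'c) mpoly) set" where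
  "T_image k a = {\<lambda>y. T k f y - mscale a (f y) | f. f \<in> ind k (V k)}"

definition Pi_class ::
    "(('f \<Rightarrow> 'c) \<Rightarrow> nat) \<Rightarrow> 'c \<Rightarrow> ('f^2^2 \<Rightarrow> ('f \<Rightarrow> 'c, 'c) mpoly)
       \<Rightarrow> ('f^2^2 \<Rightarrow> ('f \<Rightarrow> 'c, 'c) mpoly) set" where
  "Pi_class k a f = {\<lambda>y. f y + b y | b. b \<in> T_image k a}"

definition Pi_zero ::
    "(('f \<Rightarrow> 'c) \<Rightarrow> nat) \<Rightarrow> 'c \<Rightarrow> ('f^2^2 \<Rightarrow> ('f \<Rightarrow> 'c, 'c) mpoly) set" where
  "Pi_zero k a = Pi_class k a (\<lambda>_. 0)"

definition Pi_scale ::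
    "(('f \<Rightarrow> 'c) \<Rightarrow> nat) \<Rightarrow> 'c \<Rightarrow> 'c \<Rightarrow> ('f^2^2 \<Rightarrow> ('f \<Rightarrow> 'c, 'c) mpoly) set
       \<Rightarrow> ('f^2^2 \<Rightarrow> ('f \<Rightarrow> 'c, 'c) mpoly) set" where
  "Pi_scale k a c D = {\<lambda>y. mscale c (f y) + b y | f b. f \<in> D \<and> b \<in> T_image k a}"

definition Theta ::
    "(('f \<Rightarrow> 'c) \<Rightarrow> nat) \<Rightarrow> 'c \<Rightarrow> ('f^2^2 \<Rightarrow> ('f \<Rightarrow> 'c, 'c) mpoly) set set" where
  "Theta k a = Pi_class k a ` ind k (V0 k)"

text \<open>In \<open>\<O>\<^sub>C\<close>-modules, multiplication by \<open>\<pi>\<^sup>n\<close> is multiplication by \<open>(\<tau> \<pi>) ^ n\<close>, where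
  \<open>\<tau> \<in> S\<close> is arbitrary.\<close>

definition Theta_separated :: "(('f \<Rightarrow> 'c) \<Rightarrow> nat) \<Rightarrow> 'c \<Rightarrow> bool" where
  "Theta_separated k a \<longleftrightarrow>
     (\<forall>\<tau>\<in>S. (\<Inter>n::nat. Pi_scale k a (\<tau> \<pi> ^ n) ` Theta k a) = {Pi_zero k a})"

end

end

theory Submission
  imports Defs
begin

text \<open>
  Put \<open>w = \<sigma>(\<pi>)\<close> and identify \<open>V\<^sub>k\<close> with the polynomials of degree at most \<open>k\<close> in one
  variable \<open>X\<close>. The cosets \<open>KZ g\<close> are reached from two base points by words \<open>s\<close> over a system
  \<open>R\<close> of representatives of the residue field. If \<open>P\<^sub>s\<close> denotes the value of \<open>f\<close> at the
  word \<open>s\<close>, then the value of \<open>(T - a) f\<close> at \<open>ms\<close> is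
  \<open>P\<^sub>s(w X - m) + \<Sum>\<^sub>l D\<^sub>l P\<^sub>l\<^sub>m\<^sub>s - a P\<^sub>m\<^sub>s\<close>, where \<open>D\<^sub>l\<close> sends \<open>X\<^sup>i\<close> to
  \<open>w\<^sup>k\<^sup>-\<^sup>i (X + l)\<^sup>i\<close>.

  The heart of the matter is an a priori bound: if \<open>P\<close> has finite support and all these values
  are integral, then the coefficients of all \<open>P\<^sub>s\<close> have valuation at least \<open>-c\<close>, with \<open>c\<close>
  independent of \<open>P\<close>. One moves from the ends of the support towards the root. The relations
  bound the Taylor coefficients of \<open>P\<^sub>s\<close> of order at most \<open>d\<close> at the \<open>q\<close> points \<open>-m\<close>, whose
  differences are units, and Hermite interpolation then bounds \<open>P\<^sub>s\<close>, since
  \<open>k < (d + 1) q\<close>. The children contribute sums over \<open>R\<close>, in which exponents that agree modulo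
  \<open>q - 1\<close> can be merged because the representatives are chosen close to Teichmueller
  representatives; the binomial coefficients are known modulo \<open>p\<close> by Lucas' theorem.

  If \<open>f\<^sub>0 = \<pi>\<^sup>m f\<^sub>m + (T - a) h\<^sub>m\<close> with \<open>f\<^sub>m\<close> integral for every \<open>m\<close>, the bound shows that
  \<open>h\<^sub>m\<close> is divisible by \<open>\<pi>\<^sup>m\<^sup>-\<^sup>c\<close> outside a finite subtree that depends on \<open>f\<^sub>0\<close> only.
  Thus \<open>f\<^sub>0\<close> is a limit of elements of the image under \<open>T - a\<close> of the functions supported on that
  subtree. This image is spanned by finitely many bounded elements, hence closed, so \<open>f\<^sub>0\<close> lies
  in the image of \<open>T - a\<close>.
\<close>

section \<open>Valued fields and Hermite interpolation\<close>

text \<open>Interpolation loses valuation at every level, so repeating it along the tree gives no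
  bound independent of the depth. The proof therefore works with quantities whose bounds reproduce
  themselves. If \<open>v a = \<nu>\<close> is small, these are P_s(w X - m) and w^u times the
  coefficient of X^(k-u) in P_s, the form in which the parent sees P_s; both stay at least -\<nu>.
  If \<open>v a \<ge> d\<close>, P_s itself stays at least -d. The obstacle is the top of P_s,
  because for small u the factor w^u is too weak. The coefficient of X^(k-u) is recovered from the
  lower ones with the same index modulo q - 1; \<open>r + d < q\<close> and
  \<open>2 * \<nu> - 1 \<le> r\<close> are what lets Lucas' theorem remove the contributions of the
  children there. For r = 0 that argument breaks down. The top coefficients then obey a linear
  recursion, and elimination between consecutive generations leaves a factor with leading term a^2,
  of valuation 2 \<nu>. For k = q even this does not make them small enough; there P_s is shown to
  stay close to a fixed line, along which passing to a child multiplies by a scalar \<rho>.\<close>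

locale valued_field =
  fixes v :: "'c::field \<Rightarrow> ereal"
  assumes v_infty_iff: "v x = \<infinity> \<longleftrightarrow> x = 0"
    and v_not_minf: "v x \<noteq> -\<infinity>"
    and v_mult: "v (x * y) = v x + v y"
    and v_add: "min (v x) (v y) \<le> v (x + y)"
begin

text \<open>A predicate with a real index: zero satisfies every bound, and the arithmetic of bounds
  stays in the reals instead of \<open>ereal\<close>.\<close>

definition vge :: "real \<Rightarrow> 'c \<Rightarrow> bool" where
  "vge c x \<longleftrightarrow> ereal c \<le> v x"

definition pge :: "real \<Rightarrow> 'c poly \<Rightarrow> bool" where
  "pge c P \<longleftrightarrow> (\<forall>i. vge c (coeff P i))"

lemma v_0 [simp]: "v 0 = \<infinity>"
  by (simp add: v_infty_iff)

lemma v_finite: "x \<noteq> 0 \<Longrightarrow> \<exists>c. v x = ereal c"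
  using v_infty_iff[of x] v_not_minf[of x] by (cases "v x") auto

lemma v_1 [simp]: "v 1 = 0"
proof -
  obtain c where "v 1 = ereal c" using v_finite[of 1] by auto
  with v_mult[of 1 1] show ?thesis by (simp add: zero_ereal_def)
qed

lemma v_minus1: "v (-1) = 0"
proof -
  obtain c where "v (-1) = ereal c" using v_finite[of "-1"] by auto
  with v_mult[of "-1" "-1"] show ?thesis by (simp add: zero_ereal_def)
qed

lemma v_minus [simp]: "v (- x) = v x"
  using v_mult[of "-1" x] v_minus1 by simp

lemma vge_0 [simp]: "vge c 0"
  by (simp add: vge_def)

lemma vge_1 [simp]: "vge 0 1"
  by (simp add: vge_def zero_ereal_def)

lemma vge_minus [simp]: "vge c (- x) \<longleftrightarrow> vge c x"
  by (simp add: vge_def)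

lemma vge_mono: "vge c x \<Longrightarrow> d \<le> c \<Longrightarrow> vge d x"
  unfolding vge_def by (meson ereal_less_eq(3) order_trans)

lemma vge_add: "vge c x \<Longrightarrow> vge c y \<Longrightarrow> vge c (x + y)"
  unfolding vge_def using v_add[of x y] by (metis min.boundedI order_trans)

lemma vge_diff: "vge c x \<Longrightarrow> vge c y \<Longrightarrow> vge c (x - y)"
  using vge_add[of c x "- y"] by simp

lemma vge_cong_diff: "vge c (x - y) \<Longrightarrow> vge c x \<longleftrightarrow> vge c y"
  using vge_add[of c "x - y" y] vge_diff[of c x "x - y"] by auto

lemma vge_sum: "(\<And>i. i \<in> A \<Longrightarrow> vge c (f i)) \<Longrightarrow> vge c (sum f A)"
  by (induction A rule: infinite_finite_induct) (auto intro: vge_add)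

lemma vge_mult: "vge c x \<Longrightarrow> vge d y \<Longrightarrow> vge (c + d) (x * y)"
  unfolding vge_def v_mult by (metis add_mono plus_ereal.simps(1))

lemma vge_mult': "vge c x \<Longrightarrow> vge d y \<Longrightarrow> b \<le> c + d \<Longrightarrow> vge b (x * y)"
  using vge_mult vge_mono by blast

lemma vge_mult_int: "vge 0 x \<Longrightarrow> vge c y \<Longrightarrow> vge c (x * y)"
  using vge_mult[of 0 x c y] by simp

lemma vge_of_nat [simp]: "vge 0 (of_nat n)"
  by (induction n) (auto intro: vge_add)

lemma vge_of_int [simp]: "vge 0 (of_int n)"
  by (cases n rule: int_cases2) auto

lemma vge_power0: "vge 0 x \<Longrightarrow> vge 0 (x ^ n)"
  by (induction n) (auto intro: vge_mult_int)

lemma vge_cancel: "v x = ereal n \<Longrightarrow> vge c (x * y) \<longleftrightarrow> vge (c - n) y"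
  unfolding vge_def v_mult by (cases "v y") auto

lemma vge_exact: "v x = ereal n \<Longrightarrow> vge n x"
  by (simp add: vge_def)

lemma v_power: "v x = ereal n \<Longrightarrow> v (x ^ m) = ereal (n * real m)"
  by (induction m) (auto simp: v_mult algebra_simps zero_ereal_def)

lemma v_inverse: "v x = ereal n \<Longrightarrow> v (inverse x) = ereal (- n)"
proof -
  assume x: "v x = ereal n"
  then have "x \<noteq> 0" using v_0 by force
  then have "v x + v (inverse x) = 0" using v_mult[of x "inverse x"] by simp
  then show ?thesis using x by (cases "v (inverse x)") (auto simp: zero_ereal_def)
qed

lemma v_divide: "v x = ereal m \<Longrightarrow> v y = ereal n \<Longrightarrow> v (x / y) = ereal (m - n)"
  by (simp add: divide_inverse v_mult v_inverse)

lemma vge_divide: "vge c x \<Longrightarrow> v y = ereal n \<Longrightarrow> vge (c - n) (x / y)"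
  using vge_mult[of c x "- n" "inverse y"] v_inverse[of y n] by (simp add: divide_inverse vge_def)

lemma v_add_dominant:
  assumes "v x = ereal n" "vge c y" "n < c"
  shows "v (x + y) = ereal n"
proof -
  have "vge n (x + y)"
    using assms vge_exact vge_mono[of c y n] by (auto intro: vge_add)
  moreover have "\<not> ereal n < v (x + y)"
  proof
    assume "ereal n < v (x + y)"
    moreover have "ereal n < v y" using assms by (metis less_ereal.simps(1) less_le_trans vge_def)
    ultimately have "ereal n < min (v (x + y)) (v (- y))" by simp
    also have "\<dots> \<le> v x" using v_add[of "x + y" "- y"] by simp
    finally show False using assms by simp
  qed
  ultimately show ?thesis unfolding vge_def by simp
qed

lemma pge_0 [simp]: "pge c 0"
  by (simp add: pge_def)

lemma pge_coeff: "pge c P \<Longrightarrow> vge c (coeff P i)"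
  by (simp add: pge_def)

lemma pge_mono: "pge c P \<Longrightarrow> d \<le> c \<Longrightarrow> pge d P"
  by (auto simp: pge_def intro: vge_mono)

lemma pge_add: "pge c P \<Longrightarrow> pge c Q \<Longrightarrow> pge c (P + Q)"
  by (auto simp: pge_def intro: vge_add)

lemma pge_diff: "pge c P \<Longrightarrow> pge c Q \<Longrightarrow> pge c (P - Q)"
  by (auto simp: pge_def intro: vge_diff)

lemma pge_minus [simp]: "pge c (- P) \<longleftrightarrow> pge c P"
  by (auto simp: pge_def)

lemma pge_sum: "(\<And>i. i \<in> A \<Longrightarrow> pge c (f i)) \<Longrightarrow> pge c (sum f A)"
  by (induction A rule: infinite_finite_induct) (auto intro: pge_add)

lemma pge_smult: "vge c x \<Longrightarrow> pge d P \<Longrightarrow> pge (c + d) (smult x P)"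
  by (auto simp: pge_def intro: vge_mult)

lemma pge_smult': "vge c x \<Longrightarrow> pge d P \<Longrightarrow> b \<le> c + d \<Longrightarrow> pge b (smult x P)"
  using pge_smult pge_mono by blast

lemma pge_pCons [simp]: "pge c (pCons x P) \<longleftrightarrow> vge c x \<and> pge c P"
  unfolding pge_def by (metis coeff_pCons_0 coeff_pCons_Suc not0_implies_Suc)

lemma pge_1 [simp]: "pge 0 1"
  by (simp add: one_pCons)

lemma pge_mult: "pge c P \<Longrightarrow> pge d Q \<Longrightarrow> pge (c + d) (P * Q)"
  unfolding pge_def coeff_mult by (auto intro!: vge_sum vge_mult)

lemma pge_mult_int: "pge 0 P \<Longrightarrow> pge c Q \<Longrightarrow> pge c (P * Q)"
  using pge_mult[of 0 P c Q] by simp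

lemma pge_power0: "pge 0 P \<Longrightarrow> pge 0 (P ^ n)"
  by (induction n) (auto intro: pge_mult_int)

lemma pge_monom: "vge c x \<Longrightarrow> pge c (monom x n)"
  by (simp add: pge_def)

lemma pge_pcompose: "pge c P \<Longrightarrow> pge 0 Q \<Longrightarrow> pge c (pcompose P Q)"
  by (induction P) (auto simp: pcompose_pCons intro!: pge_add pge_mult_int)

lemma vge_poly: "pge c P \<Longrightarrow> vge 0 x \<Longrightarrow> vge c (poly P x)"
  by (induction P) (auto intro!: vge_add vge_mult_int)

text \<open>The Taylor coefficient of order \<open>j\<close> at \<open>x\<close>, taken from the
  shifted polynomial: derivatives would bring in factorials, whose valuations are positive.\<close>

definition tay :: "'c poly \<Rightarrow> 'c \<Rightarrow> nat \<Rightarrow> 'c" where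
  "tay P x j = coeff (pcompose P [:x, 1:]) j"

lemma tay_add: "tay (P + Q) x j = tay P x j + tay Q x j"
  by (simp add: tay_def pcompose_add)

lemma tay_diff: "tay (P - Q) x j = tay P x j - tay Q x j"
  by (simp add: tay_def pcompose_diff)

lemma tay_smult: "tay (smult c P) x j = c * tay P x j"
  by (simp add: tay_def pcompose_smult)

lemma tay_0: "tay P x 0 = poly P x"
  by (simp add: tay_def pcompose_coeff_0)

lemma vge_tay: "pge c P \<Longrightarrow> vge 0 x \<Longrightarrow> vge c (tay P x j)"
  unfolding tay_def by (intro pge_coeff pge_pcompose) auto

lemma pcompose_power: "pcompose (P ^ n) (Q::'c poly) = pcompose P Q ^ n"
  by (induction n) (simp_all add: pcompose_mult one_pCons pcompose_pCons)

lemma coeff_pcompose_scale: "coeff (pcompose P [:0, y:]) j = y ^ j * coeff (P::'c poly) j"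
proof (induction P arbitrary: j)
  case 0
  then show ?case by simp
next
  case (pCons a P)
  then show ?case by (cases j) (auto simp: pcompose_pCons)
qed

lemma coeff_pcompose_linear: "coeff (pcompose P [:x, y:]) j = y ^ j * tay P x j"
proof -
  have "pcompose P [:x, y:] = pcompose (pcompose P [:x, 1:]) [:0, y:]"
    by (simp add: pcompose_assoc[symmetric] pcompose_pCons)
  then show ?thesis by (simp add: tay_def coeff_pcompose_scale)
qed

text \<open>About y the linear factor is X - x = (X - y) + (y - x).\<close>

lemma tay_linear_mult:
  fixes x :: 'c
  shows "tay ([:- x, 1:] * Q + [:b:]) y j =
     (y - x) * tay Q y j + (if j = 0 then b else tay Q y (j - 1))"
proof -
  have "pcompose ([:- x, 1:] * Q + [:b:]) [:y, 1:] =
      pCons 0 (pcompose Q [:y, 1:]) + smult (y - x) (pcompose Q [:y, 1:]) + [:b:]"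
    by (simp only: pcompose_add pcompose_mult pcompose_pCons pcompose_0 pcompose_const mult_zero_right)
      (simp add: algebra_simps smult_add_left smult_diff_left)
  then show ?thesis by (cases j) (auto simp: tay_def)
qed

text \<open>Induction on the total multiplicity, splitting off X - x at a node. At x the Taylor
  coefficients of the quotient are those of \<open>P\<close> moved down by one. At another node y
  they solve a triangular system with diagonal y - x, a unit, so no valuation is lost.\<close>

lemma hermite:
  assumes N: "finite N" "\<And>x. x \<in> N \<Longrightarrow> vge 0 x"
    "\<And>x y. x \<in> N \<Longrightarrow> y \<in> N \<Longrightarrow> x \<noteq> y \<Longrightarrow> v (x - y) = 0"
  shows "P = 0 \<or> degree P < sum m N \<Longrightarrow>
    (\<And>x j. x \<in> N \<Longrightarrow> j < m x \<Longrightarrow> vge c (tay P x j)) \<Longrightarrow> pge c P"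
proof (induction "sum m N" arbitrary: P m)
  case 0
  then show ?case by auto
next
  case (Suc n)
  then obtain x where x: "x \<in> N" "0 < m x"
    by (metis Suc_neq_Zero gr0I sum.neutral)
  define Q where "Q = synthetic_div P x"
  have P: "P = [:- x, 1:] * Q + [:poly P x:]"
    using synthetic_div_correct'[of x P] by (simp add: Q_def)
  define m' where "m' = m(x := m x - 1)"
  have "sum m N = m x + sum m (N - {x})" using N x by (simp add: sum.remove)
  moreover have "sum m' N = m' x + sum m' (N - {x})" using N x by (simp add: sum.remove)
  moreover have "sum m' (N - {x}) = sum m (N - {x})" by (auto simp: m'_def intro: sum.cong)
  ultimately have sm: "sum m N = Suc (sum m' N)" using x by (simp add: m'_def)
  have "poly P x = tay P x 0" by (simp add: tay_0)
  then have Px: "vge c (poly P x)" using Suc.prems(2) x by simp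
  have tQ: "vge c (tay Q y j)" if "y \<in> N" "j < m' y" for y j
    using that(2)
  proof (induction j)
    case 0
    show ?case
    proof (cases "y = x")
      case True
      have "tay P x 1 = tay Q x 0" by (subst P, subst tay_linear_mult) simp
      moreover have "1 < m x" using 0 True by (simp add: m'_def)
      ultimately show ?thesis using Suc.prems(2)[of x 1] x True by simp
    next
      case False
      have "tay P y 0 = (y - x) * tay Q y 0 + poly P x" by (subst P, subst tay_linear_mult) simp
      then have "(y - x) * tay Q y 0 = tay P y 0 - poly P x" by simp
      moreover have "vge c (tay P y 0 - poly P x)"
        using Suc.prems(2)[of y 0] 0 False that Px by (intro vge_diff) (auto simp: m'_def)
      ultimately show ?thesis using vge_cancel[of "y - x" 0 c] N(3)[OF that(1) x(1) False]
        by (metis diff_zero zero_ereal_def)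
    qed
  next
    case (Suc j)
    show ?case
    proof (cases "y = x")
      case True
      have "tay P x (Suc (Suc j)) = tay Q x (Suc j)" by (subst P, subst tay_linear_mult) simp
      moreover have "Suc (Suc j) < m x" using Suc.prems True by (simp add: m'_def)
      ultimately show ?thesis using Suc.prems(1) \<open>\<And>x j. x \<in> N \<Longrightarrow> j < m x \<Longrightarrow> vge c (tay P x j)\<close> x True
        by metis
    next
      case False
      have "tay P y (Suc j) = (y - x) * tay Q y (Suc j) + tay Q y j"
        by (subst P, subst tay_linear_mult) simp
      then have "(y - x) * tay Q y (Suc j) = tay P y (Suc j) - tay Q y j" by simp
      moreover have "vge c (tay P y (Suc j) - tay Q y j)"
        using \<open>\<And>x j. x \<in> N \<Longrightarrow> j < m x \<Longrightarrow> vge c (tay P x j)\<close>[of y "Suc j"] Suc False that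
        by (intro vge_diff) (auto simp: m'_def)
      ultimately show ?thesis using vge_cancel[of "y - x" 0 c] N(3)[OF that(1) x(1) False]
        by (metis diff_zero zero_ereal_def)
    qed
  qed
  have "Q = 0 \<or> degree Q < sum m' N"
  proof (cases "degree P = 0")
    case True
    then have "Q = 0" by (simp add: Q_def synthetic_div_eq_0_iff)
    then show ?thesis by simp
  next
    case False
    then have "degree Q = degree P - 1" by (simp add: Q_def degree_synthetic_div)
    then show ?thesis using Suc.prems(1) sm False by auto
  qed
  then have "pge c Q" using Suc.hyps(1)[of m' Q] Suc.hyps(2) sm tQ by simp
  then have "pge c ([:- x, 1:] * Q + [:poly P x:])"
    using Px N(2)[OF x(1)] by (intro pge_add pge_mult_int) auto
  then show ?case using P by simp
qed

text \<open>In long division by a monic integral polynomial, every coefficient of the quotient is a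
  leading coefficient of some intermediate dividend, so the bound survives each step.\<close>

lemma monic_division:
  assumes G: "lead_coeff G = 1" "pge 0 G" "0 < degree G" and B: "pge c B"
  shows "\<exists>L C. B = L + G * C \<and> degree L < degree G \<and> pge c L \<and> pge c C"
  using B
proof (induction "degree B" arbitrary: B rule: less_induct)
  case less
  show ?case
  proof (cases "degree B < degree G")
    case True
    then show ?thesis using less.prems by (intro exI[of _ B] exI[of _ 0]) auto
  next
    case False
    define n where "n = degree B - degree G"
    define M where "M = monom (lead_coeff B) n"
    define B' where "B' = B - G * M"
    have "B \<noteq> 0" using False G by auto
    then have "degree (G * M) = degree B"
      using G False by (subst degree_mult_eq) (auto simp: M_def n_def degree_monom_eq)
    moreover have "coeff (G * M) (degree B) = lead_coeff B"
      using coeff_degree_mult[of G M] G by (metis \<open>degree (G * M) = degree B\<close> M_def lead_coeff_monom lead_coeff_mult mult_1)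
    ultimately have "degree B' < degree B \<or> B' = 0"
      unfolding B'_def
      by (metis (no_types, lifting) coeff_diff degree_diff_le eq_iff_diff_eq_0 leading_coeff_0_iff
          order_le_less order_refl)
    moreover have M: "pge c M" using less.prems by (auto simp: M_def intro!: pge_monom pge_coeff)
    then have B': "pge c B'" using less.prems G unfolding B'_def by (intro pge_diff pge_mult_int)
    ultimately have "\<exists>L C. B' = L + G * C \<and> degree L < degree G \<and> pge c L \<and> pge c C"
      using less.hyps[of B'] G(3) by (metis add.right_neutral degree_0 mult_zero_right pge_0)
    then obtain L C where "B' = L + G * C" "degree L < degree G" "pge c L" "pge c C" by blast
    then show ?thesis using M
      by (intro exI[of _ L] exI[of _ "C + M"]) (auto simp: B'_def algebra_simps intro: pge_add)
  qed
qed

text \<open>Modulo the constant term \<open>x\<close>, the polynomial \<open>pCons x E\<close> is X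
  times \<open>E\<close>.\<close>

lemma power_pCons_split:
  assumes "vge 0 x" "pge 0 E"
  shows "\<exists>Q. pge 0 Q \<and> (pCons x E) ^ m = monom 1 m * E ^ m + smult x Q"
proof (induction m)
  case 0
  then show ?case by (intro exI[of _ 0]) auto
next
  case (Suc m)
  then obtain Q where Q: "pge 0 Q" "(pCons x E) ^ m = monom 1 m * E ^ m + smult x Q" by blast
  have pc: "pCons x E = [:x:] + monom 1 1 * E" by (simp add: monom_Suc)
  have "(pCons x E) ^ Suc m = pCons x E * (monom 1 m * E ^ m) + pCons x E * smult x Q"
    using Q by (simp add: algebra_simps)
  also have "pCons x E * (monom 1 m * E ^ m) = monom 1 (Suc m) * E ^ Suc m + smult x (monom 1 m * E ^ m)"
    by (simp add: monom_Suc algebra_simps)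
  finally have "(pCons x E) ^ Suc m = monom 1 (Suc m) * E ^ Suc m + smult x (monom 1 m * E ^ m + pCons x E * Q)"
    by (simp add: smult_add_right)
  moreover have "pge 0 (monom 1 m * E ^ m + pCons x E * Q)"
    using assms Q by (intro pge_add pge_mult_int pge_power0) (auto simp: pge_monom)
  ultimately show ?case by blast
qed

lemma coeff_monom_mult_less: "j < m \<Longrightarrow> coeff (monom 1 m * (P::'a::comm_semiring_1 poly)) j = 0"
  by (simp add: coeff_monom_mult)

text \<open>About x one has E = E(x) + (X - x) E1. Hence E^m agrees with (X - x)^m E1^m up to a
  multiple of E(x), and the latter has no Taylor coefficients of order below m.\<close>

lemma vge_tay_power_mult:
  assumes "vge 0 x" "pge 0 E" "vge b (poly E x)" "pge c C" "j < m"
  shows "vge (b + c) (tay (E ^ m * C) x j)"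
proof -
  define F where "F = pcompose E [:x, 1:]"
  obtain y E1 where F: "F = pCons y E1" by (cases F)
  have "pge 0 F" using assms unfolding F_def by (intro pge_pcompose) auto
  then have y: "vge 0 y" "pge 0 E1" using F by auto
  have "y = poly E x" using F by (metis F_def coeff_pCons_0 tay_0 tay_def)
  then have yb: "vge b y" using assms by simp
  obtain Q where Q: "pge 0 Q" "F ^ m = monom 1 m * E1 ^ m + smult y Q"
    using power_pCons_split[OF y] F by blast
  define C' where "C' = pcompose C [:x, 1:]"
  have C': "pge c C'" unfolding C'_def using assms by (intro pge_pcompose) auto
  have "tay (E ^ m * C) x j = coeff (F ^ m * C') j"
    by (simp add: tay_def F_def C'_def pcompose_mult pcompose_power)
  also have "F ^ m * C' = monom 1 m * (E1 ^ m * C') + smult y (Q * C')"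
    using Q by (simp add: algebra_simps)
  also have "coeff \<dots> j = y * coeff (Q * C') j"
    using assms by (simp add: coeff_monom_mult_less)
  finally show ?thesis using yb Q C' by (auto intro!: vge_mult pge_coeff pge_mult_int)
qed

text \<open>Successive approximation without a limit: a gain of \<delta> per round, capped at c,
  reaches c after finitely many rounds.\<close>

lemma bootstrap:
  assumes "0 < (\<delta>::real)" "Q x0" "\<And>x. x \<le> c \<Longrightarrow> Q x \<Longrightarrow> Q (min c (x + \<delta>))" "x0 \<le> c"
  shows "Q c"
proof -
  have "Q (min c (x0 + real n * \<delta>))" for n
  proof (induction n)
    case 0
    then show ?case using assms by (simp add: min_def)
  next
    case (Suc n)
    have "min c (min c (x0 + real n * \<delta>) + \<delta>) = min c (x0 + real (Suc n) * \<delta>)"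
      using assms(1) by (auto simp: min_def algebra_simps)
    then show ?case using assms(3)[OF _ Suc] by simp
  qed
  moreover obtain n :: nat where "(c - x0) / \<delta> \<le> real n" using real_arch_simple by blast
  then have "c \<le> x0 + real n * \<delta>" using assms(1) by (simp add: field_simps)
  ultimately show ?thesis by (metis min.absorb1)
qed

end

section \<open>Hecke relations along words\<close>

text \<open>Coefficientwise form of (1 + X)^(q+n) = (1 + X^q) (1 + X)^n modulo p; in Vandermonde's
  sum only the terms i = 0 and i = q survive.\<close>

lemma choose_add_mod_prime:
  assumes "\<And>i. 0 < i \<Longrightarrow> i < q \<Longrightarrow> p dvd (q choose i)" "0 < (q::nat)"
  shows "((q + n) choose m) mod p = ((n choose m) + (if q \<le> m then n choose (m - q) else 0)) mod p"
proof -
  have "((q + n) choose m) = (\<Sum>i\<le>m. (q choose i) * (n choose (m - i)))"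
    by (simp add: vandermonde)
  also have "\<dots> mod p = (\<Sum>i\<le>m. (if i = 0 then n choose m else 0) + (if i = q then n choose (m - q) else 0)) mod p"
  proof -
    have "((q choose i) * (n choose (m - i))) mod p =
        ((if i = 0 then n choose m else 0) + (if i = q then n choose (m - q) else 0)) mod p" for i
    proof -
      consider "i = 0" | "0 < i" "i < q" | "i = q" | "q < i" by linarith
      then show ?thesis
      proof cases
        case 2
        then have "p dvd (q choose i) * (n choose (m - i))" using assms by simp
        with 2 show ?thesis by simp
      next
        case 4
        then have "q choose i = 0" by (rule binomial_eq_0)
        with 4 show ?thesis by (simp del: binomial_eq_0_iff)
      qed (use assms in auto)
    qed
    then show ?thesis
      by (subst (1 2) mod_sum_eq[symmetric]) (simp only:)
  qed
  also have "(\<Sum>i\<le>m. (if i = 0 then n choose m else 0) + (if i = q then n choose (m - q) else 0)) =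
      (n choose m) + (if q \<le> m then n choose (m - q) else 0)"
    by (simp add: sum.distrib)
  finally show ?thesis .
qed

text \<open>Lucas' theorem for the leading digit in base q, by induction on that digit. The
  divisibility of the inner binomial coefficients takes the place of q being a power of p; it is
  what is later proved about the residue cardinality.\<close>

lemma lucas_mod:
  assumes "\<And>i. 0 < i \<Longrightarrow> i < q \<Longrightarrow> p dvd (q choose i)" "0 < (q::nat)" "s < q" "t < q"
  shows "((d * q + s) choose (j * q + t)) mod p = ((d choose j) * (s choose t)) mod p"
proof (induction d arbitrary: j)
  case 0
  show ?case
  proof (cases j)
    case (Suc j')
    have "s choose (q + j' * q + t) = 0" using assms by (intro binomial_eq_0) auto
    with Suc show ?thesis by (simp add: binomial_eq_0)
  qed simp
next
  case (Suc d)
  have "((Suc d * q + s) choose (j * q + t)) mod p =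
      (((d * q + s) choose (j * q + t)) + (if q \<le> j * q + t then (d * q + s) choose (j * q + t - q) else 0)) mod p"
    using choose_add_mod_prime[OF assms(1,2), of "d * q + s"] by (simp add: algebra_simps)
  also have "\<dots> = ((Suc d choose j) * (s choose t)) mod p"
  proof (cases j)
    case 0
    then show ?thesis using assms Suc[of 0] by simp
  next
    case (Suc j')
    have "j * q + t - q = j' * q + t" using Suc by simp
    moreover have "q \<le> j * q + t" using Suc by simp
    ultimately have "(((d * q + s) choose (j * q + t)) + (if q \<le> j * q + t then (d * q + s) choose (j * q + t - q) else 0)) mod p
       = (((d * q + s) choose (j * q + t)) + ((d * q + s) choose (j' * q + t))) mod p" by simp
    also have "\<dots> = ((d choose j) * (s choose t) + (d choose j') * (s choose t)) mod p"
      using Suc.IH[of j] Suc.IH[of j'] by (metis mod_add_eq)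
    finally show ?thesis using Suc by (simp add: algebra_simps)
  qed
  finally show ?case .
qed

lemma coeff_X_plus_power:
  "coeff ([:x, 1::'c::field:] ^ i) n = of_nat (i choose n) * x ^ (i - n)"
proof (cases "n \<le> i")
  case True
  then show ?thesis by (simp add: coeff_linear_poly_power)
next
  case False
  then have "degree ([:x, 1:] ^ i) < n" by (simp add: degree_power_eq)
  then have "coeff ([:x, 1:] ^ i) n = 0" by (rule coeff_eq_0)
  moreover have "i choose n = 0" using False by (intro binomial_eq_0) auto
  ultimately show ?thesis by (metis mult_zero_left of_nat_0)
qed

text \<open>By Bezout, 1 is an integral combination of n and p; if both had positive valuation, so
  would 1.\<close>

lemma (in valued_field) v_of_nat_not_dvd:
  assumes "prime p" "vge 1 (of_nat p)" "\<not> p dvd n"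
  shows "v (of_nat n) = 0"
proof -
  have "coprime n p" using assms by (metis coprime_commute prime_imp_coprime)
  then obtain x y where "x * int n + y * int p = 1"
    by (metis bezout_int coprime_imp_gcd_eq_1 coprime_int_iff gcd_int_int_eq of_nat_1)
  then have *: "of_int x * of_nat n + of_int y * of_nat p = (1::'c)"
    by (metis of_int_1 of_int_add of_int_mult of_int_of_nat_eq)
  have "\<not> 0 < v (of_nat n :: 'c)"
  proof
    assume "0 < v (of_nat n :: 'c)"
    moreover have "0 < v (of_nat p :: 'c)" using assms unfolding vge_def by (metis less_le_trans ereal_less(2) zero_less_one)
    moreover have "0 \<le> v (of_int x :: 'c)" "0 \<le> v (of_int y :: 'c)" using vge_of_int unfolding vge_def zero_ereal_def by auto
    ultimately have "0 < min (v (of_int x * of_nat n :: 'c)) (v (of_int y * of_nat p))"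
      by (simp add: v_mult add_nonneg_pos)
    also have "\<dots> \<le> v 1" using v_add[of "of_int x * of_nat n" "of_int y * of_nat p"] * by simp
    finally show False by simp
  qed
  moreover have "0 \<le> v (of_nat n :: 'c)" using vge_of_nat[of n] unfolding vge_def zero_ereal_def .
  ultimately show ?thesis by simp
qed

text \<open>Letters are abstract, and \<open>dg\<close> maps them to residue representatives in the
  coefficient field. The assumption \<open>2 * d \<le> q\<close> is the shape in which the bound of
  k by half of q^2 is used.\<close>

locale tree_core = valued_field v for v :: "'c::field \<Rightarrow> ereal" +
  fixes w :: 'c and R :: "'b set" and dg :: "'b \<Rightarrow> 'c" and p q k d r :: nat
  assumes vw: "v w = 1"
    and R: "finite R" "card R = q"
    and dg_int: "\<And>x. x \<in> R \<Longrightarrow> vge 0 (dg x)"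
    and dg_diff: "\<And>x y. x \<in> R \<Longrightarrow> y \<in> R \<Longrightarrow> x \<noteq> y \<Longrightarrow> v (dg x - dg y) = 0"
    and prime_p: "prime p"
    and vp: "vge 1 (of_nat p)"
    and p_dvd_choose: "\<And>i. 0 < i \<Longrightarrow> i < q \<Longrightarrow> p dvd (q choose i)"
    and k_eq: "k = d * q + r" and r_less: "r < q" and q2: "2 \<le> q" and dq: "2 * d \<le> q"
begin

definition dn :: "'b \<Rightarrow> 'c poly \<Rightarrow> 'c poly" where
  "dn l P = (\<Sum>i\<le>k. smult (coeff P i * w ^ (k - i)) ([:dg l, 1:] ^ i))"

text \<open>The coefficients in the normalization in which they enter \<open>dn\<close>.\<close>
definition bu :: "'c poly \<Rightarrow> nat \<Rightarrow> 'c" where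
  "bu P u = w ^ u * coeff P (k - u)"

lemma vw': "v w = ereal 1" using vw by (simp add: one_ereal_def)

lemma v_wpow: "v (w ^ n) = ereal (real n)"
  using v_power[OF vw'] by simp

lemma vge_wpow: "vge (real n) (w ^ n)"
  using v_wpow vge_exact by blast

lemma vge_w0: "vge 0 w" using vge_wpow[of 1] vge_mono by auto

lemma p_dvd_q: "p dvd q" using p_dvd_choose[of 1] q2 by simp

lemma vge_dvd: "vge e (of_nat p) \<Longrightarrow> p dvd n \<Longrightarrow> vge e (of_nat n)"
  by (elim dvdE) (simp, metis mult.commute vge_mult_int vge_of_nat)

lemma vge_mod_eq:
  assumes "m mod p = n mod p" "vge e (of_nat p)"
  shows "vge e (of_nat m - of_nat n :: 'c)"
proof -
  have "int p dvd int m - int n" using assms by (metis mod_eq_dvd_iff of_nat_mod)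
  then obtain z where "int m - int n = int p * z" by blast
  then have "of_nat m - of_nat n = of_int z * (of_nat p :: 'c)"
    by (metis mult.commute of_int_diff of_int_mult of_int_of_nat_eq)
  then show ?thesis using assms by (simp add: vge_mult_int)
qed

lemma lucas:
  assumes "s < q" "t < q" "vge e (of_nat p)"
  shows "vge e (of_nat ((i * q + s) choose (j * q + t)) - of_nat ((i choose j) * (s choose t)) :: 'c)"
  using lucas_mod[OF p_dvd_choose, of s t i j] assms q2 by (intro vge_mod_eq) auto

lemma coeff_dn:
  "coeff (dn l P) n = (\<Sum>u\<le>k. bu P u * (of_nat ((k - u) choose n) * dg l ^ (k - u - n)))"
proof -
  have "coeff (dn l P) n = (\<Sum>i\<le>k. coeff P i * w ^ (k - i) * (of_nat (i choose n) * dg l ^ (i - n)))"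
    by (simp add: dn_def coeff_sum coeff_X_plus_power)
  also have "\<dots> = (\<Sum>u\<le>k. bu P u * (of_nat ((k - u) choose n) * dg l ^ (k - u - n)))"
    by (rule sum.reindex_bij_witness[of _ "\<lambda>u. k - u" "\<lambda>u. k - u"]) (auto simp: bu_def mult_ac)
  finally show ?thesis .
qed

lemma dn_coeff_ge:
  assumes "l \<in> R" "\<And>u. u \<le> k \<Longrightarrow> vge c (bu P u)"
  shows "pge c (dn l P)"
  unfolding pge_def coeff_dn
proof (intro allI vge_sum)
  fix i u assume u: "u \<in> {..k}"
  have "vge 0 (of_nat ((k - u) choose i) * dg l ^ (k - u - i))"
    using assms by (intro vge_mult_int vge_power0 dg_int) auto
  then show "vge c (bu P u * (of_nat ((k - u) choose i) * dg l ^ (k - u - i)))"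
    using vge_mult[of c "bu P u" 0] assms(2)[of u] u by simp
qed

lemma bu_ge: "pge c P \<Longrightarrow> vge (c + real u) (bu P u)"
  unfolding bu_def using vge_mult[OF vge_wpow pge_coeff, of c P u "k - u"] by (simp add: add.commute)

lemma nodes:
  "finite ((\<lambda>l. - dg l) ` R)" "\<And>x. x \<in> (\<lambda>l. - dg l) ` R \<Longrightarrow> vge 0 x"
  "\<And>x y. x \<in> (\<lambda>l. - dg l) ` R \<Longrightarrow> y \<in> (\<lambda>l. - dg l) ` R \<Longrightarrow> x \<noteq> y \<Longrightarrow> v (x - y) = 0"
  "card ((\<lambda>l. - dg l) ` R) = q"
proof -
  show "finite ((\<lambda>l. - dg l) ` R)" using R by simp
  show "\<And>x. x \<in> (\<lambda>l. - dg l) ` R \<Longrightarrow> vge 0 x" using dg_int by auto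
  show "v (x - y) = 0" if xy: "x \<in> (\<lambda>l. - dg l) ` R" "y \<in> (\<lambda>l. - dg l) ` R" "x \<noteq> y" for x y
  proof -
    obtain i j where "i \<in> R" "j \<in> R" "x = - dg i" "y = - dg j" using xy by auto
    then show ?thesis using dg_diff[of j i] xy by auto
  qed
  have "inj_on (\<lambda>l. - dg l) R"
  proof (rule inj_onI, rule ccontr)
    fix x y assume "x \<in> R" "y \<in> R" "- dg x = - dg y" "x \<noteq> y"
    with dg_diff[of x y] show False by simp
  qed
  then show "card ((\<lambda>l. - dg l) ` R) = q" using R by (simp add: card_image)
qed

lemma interpolate:
  assumes "degree B < m * q" "\<And>l j. l \<in> R \<Longrightarrow> j < m \<Longrightarrow> vge c (tay B (- dg l) j)"
  shows "pge c B"
  using hermite[OF nodes(1-3), of B "\<lambda>_. m" c] assms nodes(4) by (auto simp: mult.commute)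

text \<open>Under the hypotheses called \<open>teich\<close> the nodes \<open>- dg l\<close> are
  approximate roots. Powers of this polynomial then stand in for the polynomials that vanish to a
  given order at all nodes.\<close>

definition E :: "'c poly" where "E = monom 1 q - monom 1 1"

text \<open>Multiplication by \<open>Z1\<close> only mixes coefficients whose indices agree modulo \<open>q - 1\<close>.\<close>
definition Z1 :: "'c poly" where "Z1 = monom 1 (q - 1) - 1"

lemma degree_E: "degree E = q" "lead_coeff E = 1" "pge 0 E"
proof -
  show "degree E = q"
  proof -
    have "degree (- monom (1::'c) 1) < degree (monom (1::'c) q)" using q2 by (simp add: degree_monom_eq)
    then have "degree (monom 1 q + - monom (1::'c) 1) = degree (monom (1::'c) q)"
      by (rule degree_add_eq_left)
    then show ?thesis by (simp add: E_def degree_monom_eq)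
  qed
  then show "lead_coeff E = 1" using q2 by (simp add: E_def)
  show "pge 0 E" unfolding E_def by (intro pge_diff pge_monom) auto
qed

lemma E_Z1: "E = Z1 * monom 1 1"
  using q2 by (simp add: E_def Z1_def algebra_simps mult_monom)

lemma degree_E_power: "degree (E ^ m) = m * q" "lead_coeff (E ^ m) = 1" "pge 0 (E ^ m)"
proof -
  have "E \<noteq> 0" using degree_E q2 by auto
  then show "degree (E ^ m) = m * q" by (simp add: degree_power_eq degree_E)
  show "lead_coeff (E ^ m) = 1" using degree_E(2) by (simp add: lead_coeff_power)
  show "pge 0 (E ^ m)" by (intro pge_power0 degree_E)
qed

text \<open>The multiple of E^m has small Taylor coefficients of order below m at all nodes. So the
  remainder inherits the bounds on those of \<open>B\<close>, and its degree is small enough for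
  interpolation to apply.\<close>

lemma remainder_ge:
  assumes teich: "\<And>l. l \<in> R \<Longrightarrow> vge b (poly E (- dg l))"
    and B: "pge c0 B" "\<And>l j. l \<in> R \<Longrightarrow> j < m \<Longrightarrow> vge c (tay B (- dg l) j)" "c \<le> b + c0" "0 < m"
  shows "\<exists>L C. B = L + E ^ m * C \<and> pge c L \<and> degree L < m * q \<and> pge c0 C"
proof -
  have "0 < degree (E ^ m)" using degree_E_power B q2 by simp
  then obtain L C where L: "B = L + E ^ m * C" "degree L < m * q" "pge c0 L" "pge c0 C"
    using monic_division[of "E ^ m" c0 B] degree_E_power B by metis
  have "vge c (tay L (- dg l) j)" if "l \<in> R" "j < m" for l j
  proof -
    have "vge (b + c0) (tay (E ^ m * C) (- dg l) j)"
      using that L teich degree_E dg_int by (intro vge_tay_power_mult) auto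
    then have "vge c (tay (E ^ m * C) (- dg l) j)" using B vge_mono by blast
    moreover have "tay L (- dg l) j = tay B (- dg l) j - tay (E ^ m * C) (- dg l) j"
      using L(1) by (simp add: tay_add)
    ultimately show ?thesis using B that by (simp add: vge_diff)
  qed
  then have "pge c L" using interpolate L by blast
  then show ?thesis using L by blast
qed

text \<open>Along one class of indices modulo q - 1, multiplication by \<open>Z1\<close> is a
  difference operator.\<close>

lemma coeff_Z1:
  assumes "coeff C 0 = 0" "s \<le> q - 1" "1 \<le> s"
  shows "coeff (Z1 * C) (s + l * (q - 1)) =
    (if l = 0 then 0 else coeff C (s + (l - 1) * (q - 1))) - coeff C (s + l * (q - 1))"
proof -
  have "coeff (Z1 * C) (s + l * (q - 1)) =
     (if s + l * (q - 1) < q - 1 then 0 else coeff C (s + l * (q - 1) - (q - 1))) - coeff C (s + l * (q - 1))"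
    by (simp add: Z1_def left_diff_distrib coeff_monom_mult)
  moreover have "s + l * (q - 1) - (q - 1) = s + (l - 1) * (q - 1)" if "l \<noteq> 0"
    using that by (cases l) auto
  moreover have "\<not> s + l * (q - 1) < q - 1" if "l \<noteq> 0" using that by (cases l) auto
  ultimately show ?thesis using assms by (cases "l = 0") auto
qed

text \<open>The difference operator is inverted by summation from the low end, which needs only an
  initial segment of the class.\<close>

lemma class_down:
  assumes "coeff C 0 = 0" "s \<le> q - 1" "1 \<le> s"
    and "\<And>l. l < n \<Longrightarrow> vge x (coeff (Z1 ^ m * C) (s + l * (q - 1)))" "l < n"
  shows "vge x (coeff C (s + l * (q - 1)))"
  using assms(4,5)
proof (induction m arbitrary: l)
  case 0
  then show ?case by simp
next
  case (Suc m)
  have z: "coeff (Z1 ^ m * C) 0 = 0" using assms(1) by (simp add: coeff_mult_0)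
  have "vge x (coeff (Z1 ^ m * C) (s + l * (q - 1)))" if "l < n" for l
    using that
  proof (induction l)
    case 0
    then show ?case using Suc.prems(1)[of 0] coeff_Z1[OF z assms(2,3), of 0] by (simp add: mult.assoc)
  next
    case (Suc l)
    have "vge x (coeff (Z1 ^ m * C) (s + l * (q - 1)) - coeff (Z1 * (Z1 ^ m * C)) (s + Suc l * (q - 1)))"
      using Suc \<open>\<And>l. l < n \<Longrightarrow> vge x (coeff (Z1 ^ Suc m * C) (s + l * (q - 1)))\<close>[of "Suc l"]
      by (intro vge_diff) (simp_all add: mult.assoc)
    then show ?case using coeff_Z1[OF z assms(2,3), of "Suc l"] by simp
  qed
  then show ?case using Suc by blast
qed

lemma class_up:
  assumes "coeff C 0 = 0" "s \<le> q - 1" "1 \<le> s"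
    and "\<And>l. vge x (coeff C (s + l * (q - 1)))"
  shows "vge x (coeff (Z1 ^ m * C) (s + l * (q - 1)))"
proof (induction m arbitrary: l)
  case 0
  then show ?case using assms by simp
next
  case (Suc m)
  have z: "coeff (Z1 ^ m * C) 0 = 0" using assms(1) by (simp add: coeff_mult_0)
  have "vge x (coeff (Z1 * (Z1 ^ m * C)) (s + l * (q - 1)))"
    unfolding coeff_Z1[OF z assms(2,3)] 
    by (rule vge_diff) (auto simp: Suc simp del: One_nat_def)
  then show ?case by (simp add: mult.assoc)
qed

text \<open>Split B = L + E^(u+1) C. The remainder L is well bounded, and the rest is Z1^(u+1) C'
  with C' = X^(u+1) C. The index k - u is the d-th member of the class of s = d + r - u modulo q -
  1. In this class C' is bounded on the first members by inverting the difference operator and zero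
  afterwards; applying the operator again bounds the top coefficient.\<close>

lemma top_coeff_ge:
  assumes teich: "\<And>l. l \<in> R \<Longrightarrow> vge (real d) (poly E (- dg l))"
    and B: "degree B \<le> k" "pge (- real d) B"
      "\<And>l j. l \<in> R \<Longrightarrow> j \<le> u \<Longrightarrow> vge (- real j) (tay B (- dg l) j)"
    and u: "u < d" "r + d < q"
    and low: "\<And>l. l < d - u \<Longrightarrow> vge (- real u) (coeff B (d + r - u + l * (q - 1)))"
  shows "vge (- real u) (coeff B (k - u))"
proof -
  define s where "s = d + r - u"
  have s: "s \<le> q - 1" "1 \<le> s" using u by (auto simp: s_def)
  have "vge (- real u) (tay B (- dg l) j)" if "l \<in> R" "j < Suc u" for l j
    using B(3)[of l j] that by (auto intro: vge_mono)
  then obtain L C where L: "B = L + E ^ Suc u * C" "pge (- real u) L" "degree L < Suc u * q"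
    using remainder_ge[of "real d" "- real d" B "Suc u" "- real u"] teich B by auto
  define C' where "C' = monom 1 (Suc u) * C"
  have EC: "E ^ Suc u * C = Z1 ^ Suc u * C'"
    unfolding E_Z1 C'_def by (simp only: power_mult_distrib monom_power mult_ac power_one mult_1)
  have C0: "coeff C' 0 = 0" by (simp add: C'_def coeff_monom_mult)
  have dk: "Suc u * q \<le> d * q" using u by (intro mult_right_mono) auto
  then have dL: "degree L \<le> k" using L k_eq by linarith
  \<comment> \<open>By degree, \<open>C'\<close> has at most the first \<open>d - u\<close> members
    of the class, exactly those for which \<open>low\<close> gives information.\<close>
  have z: "coeff C' (s + l * (q - 1)) = 0" if l: "d - u \<le> l" for l
  proof (cases "C = 0")
    case True
    then show ?thesis by (simp add: C'_def)
  next
    case False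
    have "degree (E ^ Suc u * C) = Suc u * q + degree C"
      using False degree_E_power(1,2)[of "Suc u"] by (metis degree_mult_eq leading_coeff_0_iff zero_neq_one)
    moreover have "degree (E ^ Suc u * C) \<le> k"
    proof -
      have "E ^ Suc u * C = B - L" using L by simp
      then show ?thesis using degree_diff_le[OF B(1) dL] by simp
    qed
    ultimately have "Suc u * q + degree C \<le> k" by simp
    moreover have "degree C' \<le> Suc u + degree C"
      unfolding C'_def using degree_mult_le[of "monom 1 (Suc u)" C] by (simp add: degree_monom_eq)
    moreover have "k + Suc u < s + l * (q - 1) + Suc u * q"
    proof -
      have "(d - u) * (q - 1) \<le> l * (q - 1)" using l by simp
      moreover have "(d - u) * (q - 1) + Suc u * (q - 1) = Suc d * (q - 1)"
      proof -
        have "(d - u) + Suc u = Suc d" using u by simp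
        then show ?thesis by (metis add_mult_distrib)
      qed
      moreover have "Suc u * q = Suc u * (q - 1) + Suc u" using q2 by (cases q) auto
      moreover have "Suc d * (q - 1) + d = d * q + q - 1" using q2 by (cases q) (auto simp: algebra_simps)
      moreover have "u < q - 1" using u dq q2 by linarith
      ultimately show ?thesis using k_eq u unfolding s_def by linarith
    qed
    ultimately have "degree C' < s + l * (q - 1)" by linarith
    then show ?thesis by (rule coeff_eq_0)
  qed
  have "vge (- real u) (coeff (Z1 ^ Suc u * C') (s + l * (q - 1)))" if "l < d - u" for l
  proof -
    have "coeff (Z1 ^ Suc u * C') (s + l * (q - 1)) = coeff B (s + l * (q - 1)) - coeff L (s + l * (q - 1))"
      using L(1) EC by simp
    then show ?thesis using low[OF that] L(2) by (auto simp: s_def intro!: vge_diff pge_coeff)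
  qed
  then have "vge (- real u) (coeff C' (s + l * (q - 1)))" if "l < d - u" for l
    using class_down[OF C0 s, of "d - u" "- real u" "Suc u"] that by blast
  then have "vge (- real u) (coeff C' (s + l * (q - 1)))" for l
    using z by (cases "l < d - u") auto
  then have "vge (- real u) (coeff (Z1 ^ Suc u * C') (s + d * (q - 1)))"
    using class_up[OF C0 s] by blast
  then have "vge (- real u) (coeff L (s + d * (q - 1)) + coeff (Z1 ^ Suc u * C') (s + d * (q - 1)))"
    by (intro vge_add pge_coeff[OF L(2)])
  moreover have "s + d * (q - 1) = k - u"
    unfolding s_def k_eq using u q2 by (cases q) (auto simp: algebra_simps)
  ultimately show ?thesis using L(1) EC by simp
qed

end

text \<open>Words are read from their end: \<open>l # s\<close> is a child of \<open>s\<close>.\<close>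
locale tree_sol = tree_core +
  fixes a and P :: "'b list \<Rightarrow> 'a poly" and M :: nat
  assumes degP: "degree (P s) \<le> k"
    and suppP: "s \<in> lists R \<Longrightarrow> M < length s \<Longrightarrow> P s = 0"
    and eqP: "m \<in> R \<Longrightarrow> s \<in> lists R \<Longrightarrow>
      pge 0 (pcompose (P s) [:- dg m, w:] + (\<Sum>l\<in>R. dn l (P (l # m # s))) - smult a (P (m # s)))"
begin

definition J :: "'b \<Rightarrow> 'b list \<Rightarrow> 'a poly" where "J m s = pcompose (P s) [:- dg m, w:]"

definition H :: "'b list \<Rightarrow> 'a poly" where "H y = (\<Sum>l\<in>R. dn l (P (l # y)))"

lemma eqc:
  assumes "m \<in> R" "s \<in> lists R"
  shows "vge 0 (coeff (J m s) i + coeff (H (m # s)) i - a * coeff (P (m # s)) i)"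
  using pge_coeff[OF eqP[OF assms], of i] by (simp add: J_def H_def)

lemma coeff_J: "coeff (J m s) j = w ^ j * tay (P s) (- dg m) j"
  by (simp add: J_def coeff_pcompose_linear)

lemma coeff_H:
  "coeff (H y) n = (\<Sum>l\<in>R. \<Sum>u\<le>k. bu (P (l # y)) u * (of_nat ((k - u) choose n) * dg l ^ (k - u - n)))"
  by (simp add: H_def coeff_sum coeff_dn)

lemma J_to_tay: "vge c (coeff (J m s) j) \<Longrightarrow> vge (c - real j) (tay (P s) (- dg m) j)"
  unfolding coeff_J using vge_cancel[OF v_wpow] by simp

lemma coeff_J_ge: "pge c (P s) \<Longrightarrow> m \<in> R \<Longrightarrow> vge (c + real i) (coeff (J m s) i)"
  unfolding coeff_J using vge_mult[OF vge_wpow vge_tay, of c "P s" "- dg m" i i] dg_int by (simp add: add.commute)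

text \<open>A polynomial of degree k < (d + 1) q is determined by its Taylor coefficients of orders
  0 to d at q nodes. In \<open>J\<close> order j appears multiplied by w^j, which explains the shift
  by j.\<close>

lemma P_ge_of_J:
  assumes "\<And>m j. m \<in> R \<Longrightarrow> j \<le> d \<Longrightarrow> vge (c + real j) (coeff (J m s) j)"
  shows "pge c (P s)"
proof (rule interpolate[of _ "Suc d"])
  show "degree (P s) < Suc d * q" using degP[of s] k_eq r_less by (simp add: le_less_trans)
  show "vge c (tay (P s) (- dg l) j)" if "l \<in> R" "j < Suc d" for l j
    using J_to_tay[OF assms[of l j]] that by simp
qed

lemma H_ge: "(\<And>l u. l \<in> R \<Longrightarrow> u \<le> k \<Longrightarrow> vge c (bu (P (l # y)) u)) \<Longrightarrow> pge c (H y)"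
  unfolding H_def by (intro pge_sum dn_coeff_ge) auto

text \<open>The Hecke relation holds up to integral errors only, so it transports bounds from one
  side to the other as long as they are not positive.\<close>

lemma cong_J:
  assumes "m \<in> R" "s \<in> lists R" "vge c (a * coeff (P (m # s)) i - coeff (H (m # s)) i)" "c \<le> 0"
  shows "vge c (coeff (J m s) i)"
proof -
  have "vge c ((coeff (J m s) i + coeff (H (m # s)) i - a * coeff (P (m # s)) i) +
      (a * coeff (P (m # s)) i - coeff (H (m # s)) i))"
    using assms vge_mono[OF eqc[OF assms(1,2), of i] assms(4)] by (rule_tac vge_add)
  then show ?thesis by simp
qed

lemma cong_aP:
  assumes "m \<in> R" "s \<in> lists R" "vge c (coeff (J m s) i)" "c \<le> 0"
  shows "vge c (a * coeff (P (m # s)) i - coeff (H (m # s)) i)"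
proof -
  have "vge c (coeff (J m s) i - (coeff (J m s) i + coeff (H (m # s)) i - a * coeff (P (m # s)) i))"
    using assms vge_mono[OF eqc[OF assms(1,2), of i] assms(4)] by (rule_tac vge_diff)
  then show ?thesis by simp
qed

end

section \<open>Descent for slope at most r\<close>

context tree_sol
begin

text \<open>The bound moves up one level without loss. A crude bound first makes the coefficients of
  \<open>J m s\<close> with index at least q integral, since \<open>\<nu> + d\<close> and
  \<open>2 * d\<close> do not exceed q. Through the relation this bounds the coefficients of a P at
  indices from q on. The part of degree below q is recovered from its values at the q nodes, which
  are bounded one level deeper.\<close>

lemma J_ge_step:
  assumes va: "v a = ereal \<nu>" "0 \<le> \<nu>" "\<nu> + real d \<le> real q" and s: "s \<in> lists R"
    and Jc: "\<And>m l. m \<in> R \<Longrightarrow> l \<in> R \<Longrightarrow> pge (- \<nu>) (J l (m # s))"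
    and bc: "\<And>m l u. m \<in> R \<Longrightarrow> l \<in> R \<Longrightarrow> u \<le> k \<Longrightarrow> vge (- \<nu>) (bu (P (l # m # s)) u)"
    and m: "m \<in> R"
  shows "pge (- \<nu>) (J m s)"
proof -
  \<comment> \<open>The product of a with the interpolated bound for P loses d, the sum over the
    children loses \<nu>.\<close>
  define c where "c = max (real d) \<nu>"
  have H: "pge (- \<nu>) (H (m # s))" if "m \<in> R" for m
    using bc that by (intro H_ge)
  have Pd: "pge (- \<nu> - real d) (P (m # s))" if "m \<in> R" for m
    using Jc[OF that] by (intro P_ge_of_J) (auto intro!: vge_mono[OF pge_coeff])
  have crude: "vge (- c) (coeff (J m s) i)" if "m \<in> R" for m i
  proof (rule cong_J[OF that s])
    have "vge (- c) (a * coeff (P (m # s)) i)"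
      using vge_mult'[OF vge_exact[OF va(1)] pge_coeff[OF Pd[OF that]]] by (simp add: c_def)
    moreover have "vge (- c) (coeff (H (m # s)) i)"
      using pge_coeff[OF H[OF that]] by (rule vge_mono) (simp add: c_def)
    ultimately show "vge (- c) (a * coeff (P (m # s)) i - coeff (H (m # s)) i)" by (rule vge_diff)
  qed (simp add: c_def)
  have "pge (- c - real d) (P s)"
    by (intro P_ge_of_J vge_mono[OF crude]) auto
  then have Jhi: "vge 0 (coeff (J m s) i)" if "m \<in> R" "q \<le> i" for m i
  proof -
    have "vge (- c - real d + real i) (coeff (J m s) i)"
      using coeff_J_ge \<open>pge (- c - real d) (P s)\<close> that by blast
    moreover have "c + real d \<le> real i" using va(3) dq that by (simp add: c_def)
    ultimately show ?thesis by (auto intro: vge_mono)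
  qed
  define B where "B = smult a (P (m # s))"
  have Bhi: "vge (- \<nu>) (coeff B i)" if "q \<le> i" for i
  proof -
    have "vge (- \<nu>) (a * coeff (P (m # s)) i - coeff (H (m # s)) i)"
      using cong_aP[OF m s, of 0 i] Jhi[OF m that] va by (auto intro: vge_mono)
    then have "vge (- \<nu>) (a * coeff (P (m # s)) i - coeff (H (m # s)) i + coeff (H (m # s)) i)"
      by (rule vge_add) (rule pge_coeff[OF H[OF m]])
    then show ?thesis by (simp add: B_def)
  qed
  define L where "L = poly_cutoff q B"
  have coeff_L: "coeff L i = (if i < q then coeff B i else 0)" for i
    by (simp add: L_def coeff_poly_cutoff)
  have hi: "pge (- \<nu>) (B - L)"
    unfolding pge_def coeff_diff coeff_L using Bhi by auto
  have "pge (- \<nu>) L"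
  proof (rule interpolate[of _ 1])
    have "degree L \<le> q - 1" by (rule degree_le) (auto simp: coeff_L)
    then show "degree L < 1 * q" using q2 by simp
    fix l j assume l: "l \<in> R" "j < (1::nat)"
    have "vge (- \<nu> - real 0) (tay (P (m # s)) (- dg l) 0)"
      using J_to_tay pge_coeff[OF Jc[OF m l(1)]] by blast
    then have "vge (- \<nu>) (tay B (- dg l) 0)"
      unfolding B_def tay_smult using va by (intro vge_mult'[OF vge_exact[OF va(1)]]) auto
    moreover have "vge (- \<nu>) (tay (B - L) (- dg l) 0)"
      using hi dg_int l by (intro vge_tay) auto
    ultimately have "vge (- \<nu>) (tay B (- dg l) 0 - tay (B - L) (- dg l) 0)" by (rule vge_diff)
    then show "vge (- \<nu>) (tay L (- dg l) j)" using l by (simp add: tay_diff)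
  qed
  then have B: "pge (- \<nu>) B" using pge_add[OF hi] by fastforce
  show ?thesis unfolding pge_def
  proof
    fix i
    have "vge (- \<nu>) (a * coeff (P (m # s)) i - coeff (H (m # s)) i)"
      using pge_coeff[OF B, of i] pge_coeff[OF H[OF m], of i] by (intro vge_diff) (auto simp: B_def)
    then show "vge (- \<nu>) (coeff (J m s) i)" using cong_J[OF m s] va by auto
  qed
qed

lemma P_ge_of_J_H:
  assumes va: "v a = ereal \<nu>" "0 \<le> \<nu>" and "m \<in> R" "s \<in> lists R"
    "pge (- \<nu>) (J m s)" "pge (- \<nu>) (H (m # s))"
  shows "pge (- 2 * \<nu>) (P (m # s))"
  unfolding pge_def
proof
  fix i
  have "vge (- \<nu>) (a * coeff (P (m # s)) i - coeff (H (m # s)) i)"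
    using cong_aP[of m s "- \<nu>" i] assms by (auto intro: pge_coeff)
  then have "vge (- \<nu>) (a * coeff (P (m # s)) i - coeff (H (m # s)) i + coeff (H (m # s)) i)"
    by (rule vge_add) (rule pge_coeff[OF assms(6)])
  then show "vge (- 2 * \<nu>) (coeff (P (m # s)) i)" using vge_cancel[OF va(1), of "- \<nu>"] by simp
qed

text \<open>The descent decreases \<open>n\<close>, the depth from which on the bounds are known.\<close>
definition invA :: "real \<Rightarrow> nat \<Rightarrow> bool" where
  "invA \<nu> n \<longleftrightarrow> (\<forall>s\<in>lists R. \<forall>m\<in>R. n \<le> length s \<longrightarrow> pge (- \<nu>) (J m s))"

text \<open>The strict inequality matches \<open>invA\<close>: for \<open>n \<le> length s\<close>
  the polynomials entering \<open>H (m # s)\<close> sit at \<open>l # m # s\<close>, and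
  \<open>m # s\<close> is longer than n.\<close>

definition invB :: "real \<Rightarrow> nat \<Rightarrow> bool" where
  "invB \<nu> n \<longleftrightarrow> (\<forall>s\<in>lists R. \<forall>m\<in>R. n < length s \<longrightarrow> (\<forall>u\<le>k. vge (- \<nu>) (bu (P (m # s)) u)))"

lemma invA_D: "invA \<nu> n \<Longrightarrow> s \<in> lists R \<Longrightarrow> m \<in> R \<Longrightarrow> n \<le> length s \<Longrightarrow> pge (- \<nu>) (J m s)"
  by (auto simp: invA_def)

lemma invB_D: "invB \<nu> n \<Longrightarrow> s \<in> lists R \<Longrightarrow> m \<in> R \<Longrightarrow> n < length s \<Longrightarrow> u \<le> k \<Longrightarrow> vge (- \<nu>) (bu (P (m # s)) u)"
  by (auto simp: invB_def)

lemma inv_H: "invB \<nu> n \<Longrightarrow> y \<in> lists R \<Longrightarrow> n < length y \<Longrightarrow> pge (- \<nu>) (H y)"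
  by (intro H_ge invB_D)

text \<open>One of two bounds on P that complement each other: dividing the relation by a costs
  another \<nu>, whereas interpolation in \<open>inv_Pd\<close> costs d.\<close>

lemma inv_P2:
  assumes "v a = ereal \<nu>" "0 \<le> \<nu>" "invA \<nu> n" "invB \<nu> n" "m \<in> R" "s \<in> lists R" "n \<le> length s"
  shows "pge (- 2 * \<nu>) (P (m # s))"
  using assms by (intro P_ge_of_J_H invA_D inv_H) auto

lemma inv_Pd:
  assumes "invA \<nu> n" "s \<in> lists R" "n \<le> length s"
  shows "pge (- \<nu> - real d) (P s)"
  using invA_D[OF assms(1,2) _ assms(3)] by (intro P_ge_of_J) (auto intro!: vge_mono[OF pge_coeff])

text \<open>\<open>J_ge_step\<close> renews \<open>invA\<close>, so each application only has to
  renew \<open>invB\<close>, together with a further invariant X if it wants one. At depth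
  \<open>Suc M\<close> everything vanishes.\<close>

lemma descent:
  assumes va: "v a = ereal \<nu>" "0 \<le> \<nu>" "\<nu> + real d \<le> real q"
    and X: "X (Suc M)"
    and step: "\<And>n. invA \<nu> (Suc n) \<Longrightarrow> invB \<nu> (Suc n) \<Longrightarrow> X (Suc n) \<Longrightarrow> invB \<nu> n \<and> X n"
    and s: "s \<in> lists R"
  shows "pge (- \<nu> - real d) (P s)"
proof -
  have "invA \<nu> (Suc M - i) \<and> invB \<nu> (Suc M - i) \<and> X (Suc M - i)" for i
  proof (induction i)
    case 0
    have "P s = 0" if "s \<in> lists R" "Suc M \<le> length s" for s
      using suppP that by auto
    then show ?case using X by (auto simp: invA_def invB_def J_def bu_def)
  next
    case (Suc i)
    show ?case
    proof (cases "Suc M - i = 0")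
      case True
      then show ?thesis using Suc by simp
    next
      case False
      define n where "n = Suc M - Suc i"
      have n: "Suc M - i = Suc n" using False by (simp add: n_def)
      have B: "invB \<nu> n" "X n" using step[of n] Suc n by auto
      have "pge (- \<nu>) (J m s)" if "s \<in> lists R" "m \<in> R" "n \<le> length s" for s m
      proof (rule J_ge_step[OF va that(1) _ _ that(2)])
        show "pge (- \<nu>) (J l (m # s))" if "m \<in> R" "l \<in> R" for m l
          using Suc n that \<open>s \<in> lists R\<close> \<open>n \<le> length s\<close> by (intro invA_D[of _ "Suc n"]) auto
        show "vge (- \<nu>) (bu (P (l # m # s)) u)" if "m \<in> R" "l \<in> R" "u \<le> k" for m l u
          using B that \<open>s \<in> lists R\<close> \<open>n \<le> length s\<close> by (intro invB_D) auto
      qed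
      then show ?thesis using B unfolding n_def invA_def by auto
    qed
  qed
  from this[of "Suc M"] have "invA \<nu> 0" by simp
  then show ?thesis using inv_Pd s by blast
qed

text \<open>If u is at least \<nu> or at least d, the factor w^u pays for the loss in one of the two
  bounds on P. For smaller u, \<open>top_coeff_ge\<close> is applied to a P. Its input, the lower
  coefficients in the class, comes from the relation: \<open>J\<close> is harmless there because of
  its powers of w, and \<open>H\<close> because of Lucas' theorem.\<close>

lemma bu_ge_step:
  assumes va: "v a = ereal \<nu>" "0 \<le> \<nu>" "vge \<nu> (of_nat p)" "\<nu> \<le> real r" "2 * \<nu> - 1 \<le> real r" "r + d < q"
    and teich: "\<And>l. l \<in> R \<Longrightarrow> vge (real d) (poly E (- dg l))"
    and A: "invA \<nu> n" and B: "invB \<nu> n" and y: "m \<in> R" "s \<in> lists R" "n \<le> length s" and u: "u \<le> k"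
  shows "vge (- \<nu>) (bu (P (m # s)) u)"
proof -
  let ?y = "m # s"
  have yR: "?y \<in> lists R" using y by simp
  have P2: "pge (- 2 * \<nu>) (P ?y)" using inv_P2[OF va(1,2) A B] y by blast
  have Pd: "pge (- \<nu> - real d) (P ?y)" using inv_Pd[OF A yR] y by simp
  have Ps: "pge (- \<nu> - real d) (P s)" using inv_Pd[OF A] y by simp
  consider "\<nu> \<le> real u" | "d \<le> u" | "real u < \<nu>" "u < d" by linarith
  then show ?thesis
  proof cases
    case 1
    then show ?thesis using bu_ge[OF P2, of u] by (auto intro: vge_mono)
  next
    case 2
    then show ?thesis using bu_ge[OF Pd, of u] by (auto intro: vge_mono)
  next
    case 3
    define C where "C = smult a (P ?y)"
    have "vge (- real u) (coeff C (k - u))"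
    proof (rule top_coeff_ge[OF teich])
      show "degree C \<le> k" unfolding C_def using degP degree_smult_le le_trans by blast
      show "pge (- real d) C"
        unfolding C_def using pge_smult'[OF vge_exact[OF va(1)] Pd] by simp
      show "vge (- real j) (tay C (- dg l) j)" if "l \<in> R" "j \<le> u" for l j
      proof -
        have "vge (- \<nu> - real j) (tay (P ?y) (- dg l) j)"
          using invA_D[OF A yR that(1)] y by (intro J_to_tay pge_coeff) simp
        then show ?thesis unfolding C_def tay_smult
          by (intro vge_mult'[OF vge_exact[OF va(1)]]) auto
      qed
      show "u < d" "r + d < q" using 3 va by auto
      show "vge (- real u) (coeff C (d + r - u + l * (q - 1)))" if l: "l < d - u" for l
      proof -
        define i where "i = d + r - u + l * (q - 1)"
        have i_eq: "i = l * q + (d + r - u - l)"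
          unfolding i_def using l q2 by (cases q) (auto simp: algebra_simps)
        have ui: "u \<le> d + r" using 3 by simp
        have "vge (- \<nu> - real d + real i) (coeff (J m s) i)" using coeff_J_ge[OF Ps] y by blast
        \<comment> \<open>Here \<open>\<nu> \<le> real r\<close> is used: the smallest index in the
          class is \<open>d + r - u\<close>.\<close>
        moreover have "- real u \<le> - \<nu> - real d + real i"
        proof -
          have "d + r - u \<le> i" by (simp add: i_def)
          then show ?thesis using va(4) ui by linarith
        qed
        ultimately have J: "vge (- real u) (coeff (J m s) i)" using vge_mono by blast
        have "vge 0 (coeff (H ?y) i)"
          unfolding coeff_H
        proof (intro vge_sum)
          fix l' u' assume l': "l' \<in> R" and u': "u' \<in> {..k}"
          have b1: "vge (- \<nu>) (bu (P (l' # ?y)) u')" using invB_D[OF B yR l'] y u' by simp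
          have "pge (- 2 * \<nu>) (P (l' # ?y))"
            using inv_P2[OF va(1,2) A B l' yR] y by simp
          then have b2: "vge (- 2 * \<nu> + real u') (bu (P (l' # ?y)) u')" by (rule bu_ge)
          have dl: "vge 0 (dg l' ^ x)" for x using dg_int l' by (intro vge_power0)
          show "vge 0 (bu (P (l' # ?y)) u' * (of_nat ((k - u') choose i) * dg l' ^ (k - u' - i)))"
          proof (cases "2 * \<nu> \<le> real u'")
            case True
            then show ?thesis using b2
              by (intro vge_mult_int[of "bu (P (l' # ?y)) u'"] vge_mult_int dl) (auto intro: vge_mono)
          next
            case False
            \<comment> \<open>From u' < 2 \<nu> \<le> r + 1. Hence subtracting u' from k leaves the
              leading digit d in base q unchanged, as Lucas' theorem requires.\<close>
            then have "u' \<le> r" using va(5) by linarith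
            then have ku: "k - u' = d * q + (r - u')" using k_eq by simp
            \<comment> \<open>The lower digit of the index exceeds r, because l < d - u.\<close>
            have "(r - u') choose (d + r - u - l) = 0"
              using l \<open>u' \<le> r\<close> by (intro binomial_eq_0) auto
            moreover have "vge \<nu> (of_nat ((d * q + (r - u')) choose (l * q + (d + r - u - l))) -
                of_nat ((d choose l) * ((r - u') choose (d + r - u - l))) :: 'a)"
              using va r_less by (intro lucas) auto
            ultimately have "vge \<nu> (of_nat ((k - u') choose i) :: 'a)"
              unfolding ku i_eq by (simp only: mult_zero_right of_nat_0 diff_zero)
            then have "vge \<nu> (of_nat ((k - u') choose i) * dg l' ^ (k - u' - i))"
              using vge_mult[of \<nu> _ 0] dl by fastforce
            then show ?thesis using vge_mult[OF b1] by fastforce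
          qed
        qed
        then have "vge (- real u) (coeff (H ?y) i)" by (rule vge_mono) simp
        moreover have "vge (- real u) (a * coeff (P ?y) i - coeff (H ?y) i)"
          using cong_aP[OF y(1,2) J] by simp
        ultimately have "vge (- real u) (a * coeff (P ?y) i - coeff (H ?y) i + coeff (H ?y) i)"
          by (rule_tac vge_add)
        then show ?thesis by (simp add: C_def i_def)
      qed
    qed
    then have "vge (- real u - \<nu>) (coeff (P ?y) (k - u))"
      unfolding C_def using vge_cancel[OF va(1)] by simp
    then show ?thesis unfolding bu_def by (intro vge_mult'[OF vge_wpow]) auto
  qed
qed

lemma bound_small_slope:
  assumes va: "v a = ereal \<nu>" "0 \<le> \<nu>" "vge \<nu> (of_nat p)" "\<nu> \<le> real r" "2 * \<nu> - 1 \<le> real r" "r + d < q"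
    and teich: "\<And>l. l \<in> R \<Longrightarrow> vge (real d) (poly E (- dg l))"
    and s: "s \<in> lists R"
  shows "pge (- \<nu> - real d) (P s)"
proof (rule descent[where X = "\<lambda>_. True", OF va(1,2) _ _ _ s])
  show "\<nu> + real d \<le> real q" using va by linarith
  show "invB \<nu> n \<and> True" if "invA \<nu> (Suc n)" "invB \<nu> (Suc n)" for n
    using bu_ge_step[OF va teich that] by (auto simp: invB_def)
qed simp

end

section \<open>Weights divisible by q: recursion for the top coefficients\<close>

context tree_core
begin

lemma tay_E: "tay E x j = of_nat (q choose j) * x ^ (q - j) - of_nat (1 choose j) * x ^ (1 - j)"
proof -
  have "monom (1::'c) n = [:0, 1:] ^ n" for n
    by (simp add: monom_altdef)
  then have "pcompose E [:x, 1:] = [:x, 1:] ^ q - [:x, 1:] ^ 1"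
    by (simp only: E_def pcompose_diff pcompose_power pcompose_idR pcompose_pCons) simp
  then show ?thesis by (simp only: tay_def coeff_diff coeff_X_plus_power)
qed

lemma vge_q: "vge 1 (of_nat q)"
  using vge_dvd[OF vp p_dvd_q] .

lemma vge_power_diff_sign:
  assumes "vge 1 (e + 1)" shows "vge 1 (e ^ n - (- 1) ^ n)"
proof (induction n)
  case (Suc n)
  have e: "vge 0 e" using vge_diff[of 0 "e + 1" 1] vge_mono[OF assms, of 0] by simp
  have "e ^ Suc n - (- 1) ^ Suc n = e * (e ^ n - (- 1) ^ n) + (- 1) ^ n * (e + 1)"
    by (simp add: algebra_simps)
  then show ?case using Suc assms e by (metis vge_add vge_mult_int vge_minus vge_1 vge_power0)
qed simp

text \<open>The derivative of E is -1 modulo w, since p divides q; so near a node E^n looks like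
  (-1)^n (X - x)^n.\<close>

lemma tay_E_power:
  assumes "vge 0 x" "vge 1 (poly E x)"
  shows "vge 1 (tay (E ^ n) x n - (- 1) ^ n)"
proof -
  define F where "F = pcompose E [:x, 1:]"
  obtain y E1 where F: "F = pCons y E1" by (cases F)
  have "pge 0 F" using assms degree_E unfolding F_def by (intro pge_pcompose) auto
  then have y: "vge 0 y" "pge 0 E1" using F by auto
  have yE: "y = poly E x" using F by (metis F_def coeff_pCons_0 tay_0 tay_def)
  obtain Q where Q: "pge 0 Q" "F ^ n = monom 1 n * E1 ^ n + smult y Q"
    using power_pCons_split[OF y] F by blast
  have "coeff E1 0 = tay E x 1" using F unfolding tay_def F_def[symmetric] by simp
  also have "\<dots> = of_nat q * x ^ (q - 1) - 1" by (simp add: tay_E)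
  finally have "vge 1 (coeff E1 0 + 1)"
    using vge_mult[OF vge_q vge_power0[OF assms(1)], of "q - 1"] by simp
  then have *: "vge 1 (coeff E1 0 ^ n - (- 1) ^ n)" by (rule vge_power_diff_sign)
  have "tay (E ^ n) x n = coeff (F ^ n) n" by (simp add: tay_def F_def pcompose_power)
  also have "\<dots> = coeff E1 0 ^ n + y * coeff Q n"
    by (simp add: Q coeff_monom_mult coeff_0_power)
  finally have "tay (E ^ n) x n - (- 1) ^ n = (coeff E1 0 ^ n - (- 1) ^ n) + y * coeff Q n" by simp
  moreover have "vge 1 (y * coeff Q n)"
    using vge_mult[OF _ pge_coeff[OF Q(1)], of 1 y n] assms(2) yE by simp
  ultimately show ?thesis by (simp only: vge_add[OF *])
qed

lemma class_sum_Z1: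
  assumes "coeff C 0 = 0" "s \<le> q - 1" "1 \<le> s"
  shows "(\<Sum>l\<le>n. coeff (Z1 * C) (s + l * (q - 1))) = - coeff C (s + n * (q - 1))"
proof (induction n)
  case 0
  show ?case using coeff_Z1[OF assms, of 0] by simp
next
  case (Suc n)
  then show ?case using coeff_Z1[OF assms, of "Suc n"] by simp
qed

text \<open>For r = 0 the top index k lies in the class of d modulo q - 1. Divide by E: over this
  class the multiple of \<open>Z1\<close> telescopes to one coefficient of C' at k, which is zero by
  degree, so only the integral remainder contributes.\<close>

lemma class_sum_ge:
  assumes teich: "\<And>l. l \<in> R \<Longrightarrow> vge (real d) (poly E (- dg l))"
    and B: "degree B \<le> k" "pge (- real d) B" "\<And>l. l \<in> R \<Longrightarrow> vge 0 (poly B (- dg l))"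
    and r: "r = 0" "1 \<le> d" "d < q"
  shows "vge 0 (\<Sum>l\<le>d. coeff B (d + l * (q - 1)))"
proof -
  have "vge 0 (tay B (- dg l) j)" if "l \<in> R" "j < 1" for l j
    using B(3)[of l] that by (simp add: tay_0)
  then obtain L C where L: "B = L + E ^ 1 * C" "pge 0 L" "degree L < 1 * q"
    using remainder_ge[of "real d" "- real d" B 1 0] teich B by auto
  define C' where "C' = monom 1 1 * C"
  have EC: "B = L + Z1 * C'" using L(1) by (simp add: E_Z1 C'_def mult.assoc)
  have C0: "coeff C' 0 = 0" by (simp add: C'_def coeff_monom_mult)
  have "coeff C' k = 0"
  proof (cases "C = 0")
    case False
    have "E * C = B - L" using L by simp
    moreover have "q \<le> k" using k_eq r by simp
    ultimately have "degree (E * C) \<le> k" using degree_diff_le[OF B(1), of L] L(3) by simp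
    moreover have "degree (E * C) = q + degree C"
      using False degree_E q2 by (subst degree_mult_eq) auto
    moreover have "degree C' \<le> 1 + degree C"
      unfolding C'_def using degree_mult_le[of "monom 1 1" C] by (simp add: degree_monom_eq)
    ultimately have "degree C' < k" using q2 by linarith
    then show ?thesis by (rule coeff_eq_0)
  qed (simp add: C'_def)
  moreover have dk: "d + d * (q - 1) = k" using k_eq r q2 by (cases q) auto
  ultimately have "(\<Sum>l\<le>d. coeff (Z1 * C') (d + l * (q - 1))) = 0"
    using class_sum_Z1[OF C0, of d d] r by simp
  then have "(\<Sum>l\<le>d. coeff B (d + l * (q - 1))) = (\<Sum>l\<le>d. coeff L (d + l * (q - 1)))"
    by (simp add: EC sum.distrib)
  then show ?thesis using L(2) by (auto intro!: vge_sum pge_coeff)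
qed

end

context tree_sol
begin

lemma coeff_H_top: "coeff (H y) k = (\<Sum>l\<in>R. coeff (P (l # y)) k)"
proof -
  have "(\<Sum>u\<le>k. bu (P (l # y)) u * (of_nat ((k - u) choose k) * dg l ^ (k - u - k))) =
      coeff (P (l # y)) k" for l
  proof -
    have "(\<Sum>u\<le>k. bu (P (l # y)) u * (of_nat ((k - u) choose k) * dg l ^ (k - u - k))) =
        (\<Sum>u\<in>{0}. bu (P (l # y)) u * (of_nat ((k - u) choose k) * dg l ^ (k - u - k)))"
      by (rule sum.mono_neutral_right) (auto simp: binomial_eq_0)
    then show ?thesis by (simp add: bu_def)
  qed
  then show ?thesis by (simp add: coeff_H)
qed

text \<open>When k = d q, division by E^d leaves a constant quotient, the top coefficient of
  \<open>P s\<close>. The remainder is better than \<open>P s\<close> by one unit, since only Taylor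
  coefficients of order below d enter its bound; the d-th one of E^d is (-1)^d modulo w.\<close>

lemma coeff_J_r0:
  assumes r: "r = 0" "1 \<le> d" and \<nu>: "\<nu> \<le> 1"
    and teich: "\<And>l. l \<in> R \<Longrightarrow> vge (real d) (poly E (- dg l))"
    and J: "\<And>m. m \<in> R \<Longrightarrow> pge (- \<nu>) (J m s)" and m: "m \<in> R"
  shows "vge 0 (coeff (J m s) d - (- 1) ^ d * w ^ d * coeff (P s) k)"
proof -
  have Pd: "pge (- \<nu> - real d) (P s)"
    by (intro P_ge_of_J vge_mono[OF pge_coeff[OF J]]) auto
  have "vge (- \<nu> - real d + 1) (tay (P s) (- dg l) j)" if "l \<in> R" "j < d" for l j
    using J_to_tay[OF pge_coeff[OF J[OF that(1)], of j]] that(2) by (auto intro: vge_mono)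
  then obtain L C where L: "P s = L + E ^ d * C" "pge (- \<nu> - real d + 1) L" "degree L < d * q"
    using remainder_ge[of "real d" "- \<nu> - real d" "P s" d "- \<nu> - real d + 1"] teich Pd r by auto
  have kd: "k = d * q" using k_eq r by simp
  have "degree C = 0"
  proof (cases "C = 0")
    case False
    have "E ^ d * C = P s - L" using L by simp
    then have "degree (E ^ d * C) \<le> k" using degree_diff_le[OF degP, of L] L(3) kd by simp
    moreover have "degree (E ^ d * C) = d * q + degree C"
      using False degree_E_power(1,2)[of d] by (metis degree_mult_eq leading_coeff_0_iff zero_neq_one)
    ultimately show ?thesis using kd by simp
  qed simp
  then obtain t where t: "C = [:t:]" using degree_0_id by (metis degree_eq_zeroE)
  have Ps: "P s = L + smult t (E ^ d)" using L t by simp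
  have "coeff (P s) k = coeff L k + t * coeff (E ^ d) k" by (simp add: Ps)
  moreover have "coeff L k = 0" using L(3) kd by (intro coeff_eq_0) simp
  moreover have "coeff (E ^ d) k = 1" using degree_E_power[of d] kd by simp
  ultimately have tk: "coeff (P s) k = t" by simp
  have x: "vge 0 (- dg m)" using dg_int m by simp
  have "coeff (J m s) d = w ^ d * tay L (- dg m) d + w ^ d * (t * tay (E ^ d) (- dg m) d)"
    unfolding coeff_J Ps tay_add tay_smult by (simp add: algebra_simps)
  then have "coeff (J m s) d - (- 1) ^ d * w ^ d * coeff (P s) k =
     w ^ d * tay L (- dg m) d + w ^ d * (t * (tay (E ^ d) (- dg m) d - (- 1) ^ d))"
    by (simp add: tk algebra_simps)
  moreover have "vge 0 (w ^ d * tay L (- dg m) d)"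
    using \<nu> by (intro vge_mult'[OF vge_wpow vge_tay[OF L(2) x]]) simp
  moreover have "vge 0 (w ^ d * (t * (tay (E ^ d) (- dg m) d - (- 1) ^ d)))"
  proof -
    have "vge 1 (tay (E ^ d) (- dg m) d - (- 1) ^ d)"
      using teich[OF m] r x by (intro tay_E_power) (auto intro: vge_mono)
    moreover have "vge (- \<nu> - real d) t" using pge_coeff[OF Pd, of k] tk by simp
    ultimately have "vge (- \<nu> - real d + 1) (t * (tay (E ^ d) (- dg m) d - (- 1) ^ d))"
      using vge_mult by fastforce
    then show ?thesis using \<nu> by (intro vge_mult'[OF vge_wpow]) auto
  qed
  ultimately show ?thesis by (simp add: vge_add)
qed

text \<open>Let t(y) be the top coefficient of \<open>P y\<close>. Up to integral errors, class sums
  and the relation give a t(x # s) = - (-1)^d w^d t(s) in \<open>e4\<close>, and the relation at s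
  itself gives a t(s) as the sum of the t(x # s) in \<open>e5\<close>. The latter involves the
  parent of s, hence \<open>s \<noteq> []\<close>. Elimination bounds t(s), and then
  \<open>e4\<close> bounds t(m # s). The case u = 1 is a separate invariant because w alone does not
  compensate a loss of 2 \<nu>, while w^u with u at least 2 does.\<close>

lemma inv_step_r0:
  assumes va: "v a = ereal \<nu>" "0 \<le> \<nu>" "\<nu> \<le> 1" and r: "r = 0" "2 \<le> d"
    and teich: "\<And>l. l \<in> R \<Longrightarrow> vge (real d) (poly E (- dg l))"
    and A: "invA \<nu> n" and B: "invB \<nu> n"
    and X: "\<And>m s. m \<in> R \<Longrightarrow> s \<in> lists R \<Longrightarrow> n < length s \<Longrightarrow> vge 0 (bu (P (m # s)) 1)"
    and y: "m \<in> R" "s \<in> lists R" "n \<le> length s" "s \<noteq> []"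
  shows "vge 0 (bu (P (m # s)) 1)" "u \<le> k \<Longrightarrow> vge (- \<nu>) (bu (P (m # s)) u)"
proof -
  have kd: "k = d * q" using k_eq r by simp
  have q4: "4 \<le> q" using dq r by simp
  have k4: "4 * d \<le> k" unfolding kd using mult_le_mono2[OF q4, of d] by (simp add: mult.commute)
  have b0: "vge 0 (bu (P (l # x)) u)" if "l \<in> R" "x \<in> lists R" "n < length x" "1 \<le> u" for l x u
  proof (cases "u = 1")
    case True
    then show ?thesis using X that by simp
  next
    case False
    have "pge (- 2 * \<nu>) (P (l # x))" using inv_P2[OF va(1,2) A B that(1,2)] that by simp
    then show ?thesis using bu_ge[of "- 2 * \<nu>" "P (l # x)" u] False that va by (auto intro: vge_mono)
  qed
  have t0: "vge (- \<nu>) (coeff (P (l # x)) k)" if "l \<in> R" "x \<in> lists R" "n < length x" for l x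
    using invB_D[OF B that(2,1,3), of 0] by (simp add: bu_def)
  have xs: "x # s \<in> lists R" "n < length (x # s)" if "x \<in> R" for x using that y by auto
  have Ps: "pge (- \<nu> - real d) (P s)" using inv_Pd[OF A] y by simp
  have Jhi: "vge 0 (coeff (J x s) i)" if "x \<in> R" "q \<le> i" for x i
    using coeff_J_ge[OF Ps that(1), of i] that(2) dq va r by (auto intro: vge_mono)
  have Hterm: "vge 0 (coeff (H (x # s)) i)" if x: "x \<in> R" and i: "p dvd (k choose i)" for x i
    unfolding coeff_H
  proof (intro vge_sum)
    fix l u assume l: "l \<in> R" and u: "u \<in> {..k}"
    have dl: "vge 0 (dg l ^ j)" for j using dg_int l by (intro vge_power0)
    show "vge 0 (bu (P (l # x # s)) u * (of_nat ((k - u) choose i) * dg l ^ (k - u - i)))"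
    proof (cases "u = 0")
      case True
      have "vge 1 (of_nat ((k - u) choose i) :: 'a)" using vge_dvd[OF vp i] True by simp
      then have "vge 1 (of_nat ((k - u) choose i) * dg l ^ (k - u - i))"
        using vge_mult[of 1 _ 0] dl by fastforce
      moreover have "vge (- \<nu>) (bu (P (l # x # s)) u)" using t0[OF l xs[OF x]] True by (simp add: bu_def)
      ultimately show ?thesis using va vge_mult'[of "- \<nu>" _ 1] by simp
    next
      case False
      then show ?thesis using b0[OF l xs[OF x], of u] dl by (intro vge_mult_int) auto
    qed
  qed
  show b1: "vge 0 (bu (P (m # s)) 1)"
  proof -
    have "p dvd (k choose (k - 1))"
      using p_dvd_q kd k4 r binomial_symmetric[of 1 k] by simp
    then have "vge 0 (coeff (H (m # s)) (k - 1))" using Hterm y by blast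
    moreover have "q \<le> k - 1"
      using kd r q4 by (cases d; cases "d - 1") auto
    then have "vge 0 (a * coeff (P (m # s)) (k - 1) - coeff (H (m # s)) (k - 1))"
      using cong_aP[OF y(1,2) Jhi[OF y(1)]] by simp
    ultimately have "vge 0 (a * coeff (P (m # s)) (k - 1) - coeff (H (m # s)) (k - 1) + coeff (H (m # s)) (k - 1))"
      by (rule_tac vge_add)
    then have "vge (- \<nu>) (coeff (P (m # s)) (k - 1))" using vge_cancel[OF va(1), of 0] by simp
    then show ?thesis unfolding bu_def using va by (intro vge_mult'[OF vge_wpow]) auto
  qed
  let ?t = "coeff (P s) k"
  have e3: "vge 0 (a * coeff (P (x # s)) k - (\<Sum>l\<in>R. coeff (P (l # x # s)) k))" if "x \<in> R" for x
  proof -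
    have "q \<le> k" unfolding kd using r by simp
    from cong_aP[OF that y(2) Jhi[OF that this]] show ?thesis unfolding coeff_H_top by simp
  qed
  have e1: "vge 0 ((\<Sum>l\<in>R. coeff (P (l # x # s)) k) + coeff (J x s) d)" if x: "x \<in> R" for x
  proof -
    define D where "D = smult a (P (x # s))"
    have Px: "pge (- \<nu> - real d) (P (x # s))" using inv_Pd[OF A xs(1)[OF x]] y by simp
    have S: "vge 0 (\<Sum>l\<le>d. coeff D (d + l * (q - 1)))"
    proof (rule class_sum_ge[OF teich])
      show "degree D \<le> k" unfolding D_def using degP degree_smult_le le_trans by blast
      show "pge (- real d) D" unfolding D_def using pge_smult'[OF vge_exact[OF va(1)] Px] by simp
      show "vge 0 (poly D (- dg l))" if "l \<in> R" for l
      proof -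
        have "vge (- \<nu> - real 0) (tay (P (x # s)) (- dg l) 0)"
          using invA_D[OF A xs(1)[OF x] that] y by (intro J_to_tay pge_coeff) simp
        then have "vge 0 (a * poly (P (x # s)) (- dg l))"
          by (intro vge_mult'[OF vge_exact[OF va(1)]]) (auto simp: tay_0)
        then show ?thesis by (simp add: D_def)
      qed
    qed (use r dq q4 in auto)
    have dk: "d + d * (q - 1) = k" using kd q2 by (cases q) auto
    have "vge 0 (coeff D (d + l * (q - 1)) -
        ((if l = 0 then coeff (J x s) d else 0) + (if l = d then coeff (H (x # s)) k else 0)))"
      if l: "l \<le> d" for l
    proof -
      define i where "i = d + l * (q - 1)"
      have HJ: "vge 0 (coeff (J x s) i + coeff (H (x # s)) i - coeff D i)"
        using eqc[OF x y(2), of i] by (simp add: D_def)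
      have J0: "vge 0 (coeff (J x s) i - (if l = 0 then coeff (J x s) d else 0))"
      proof (cases "l = 0")
        case False
        then have "q - 1 \<le> l * (q - 1)" by simp
        then have "q \<le> i" using r unfolding i_def by linarith
        then show ?thesis using Jhi[OF x] False by simp
      qed (simp add: i_def)
      have H0: "vge 0 (coeff (H (x # s)) i - (if l = d then coeff (H (x # s)) k else 0))"
      proof (cases "l = d")
        case True
        then have "i = k" using dk by (simp add: i_def)
        then show ?thesis using True by simp
      next
        case False
        then have i: "i = l * q + (d - l)" unfolding i_def using l q2 by (cases q) (auto simp: algebra_simps)
        have "((d * q + 0) choose (l * q + (d - l))) mod p = ((d choose l) * (0 choose (d - l))) mod p"
          using q4 dq by (intro lucas_mod p_dvd_choose) auto
        then have "p dvd (k choose i)" using False l by (simp add: i kd binomial_eq_0 mod_eq_0_iff_dvd)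
        then show ?thesis using Hterm[OF x] False by simp
      qed
      have "vge 0 ((coeff (J x s) i - (if l = 0 then coeff (J x s) d else 0)) +
          (coeff (H (x # s)) i - (if l = d then coeff (H (x # s)) k else 0)) -
          (coeff (J x s) i + coeff (H (x # s)) i - coeff D i))"
        by (intro vge_diff[OF vge_add[OF J0 H0] HJ])
      then show ?thesis by (simp add: i_def algebra_simps)
    qed
    then have "vge 0 (\<Sum>l\<le>d. coeff D (d + l * (q - 1)) -
        ((if l = 0 then coeff (J x s) d else 0) + (if l = d then coeff (H (x # s)) k else 0)))"
      by (intro vge_sum) auto
    then have "vge 0 ((\<Sum>l\<le>d. coeff D (d + l * (q - 1))) - (coeff (J x s) d + coeff (H (x # s)) k))"
      by (simp add: sum_subtractf sum.distrib)
    with S have "vge 0 (coeff (J x s) d + coeff (H (x # s)) k)"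
      using vge_cong_diff by blast
    then show ?thesis by (simp add: coeff_H_top add.commute)
  qed
  have e2: "vge 0 (coeff (J x s) d - (- 1) ^ d * w ^ d * ?t)" if "x \<in> R" for x
    using r va teich that invA_D[OF A y(2)] y(3) by (intro coeff_J_r0[of \<nu>]) auto
  have e4: "vge 0 (a * coeff (P (x # s)) k + (- 1) ^ d * w ^ d * ?t)" if "x \<in> R" for x
  proof -
    have "a * coeff (P (x # s)) k + (- 1) ^ d * w ^ d * ?t =
       (a * coeff (P (x # s)) k - (\<Sum>l\<in>R. coeff (P (l # x # s)) k)) +
       ((\<Sum>l\<in>R. coeff (P (l # x # s)) k) + coeff (J x s) d) -
       (coeff (J x s) d - (- 1) ^ d * w ^ d * ?t)" by simp
    then show ?thesis using e1[OF that] e2[OF that] e3[OF that] by (metis vge_add vge_diff)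
  qed
  obtain m0 s0 where s: "s = m0 # s0" using y by (cases s) auto
  have s0: "m0 \<in> R" "s0 \<in> lists R" using y s by auto
  have crude: "vge (- real d) (coeff (J x s0) i)" if x: "x \<in> R" for x i
  proof (rule cong_J[OF x s0(2)])
    have xs0: "x # s0 \<in> lists R" "n \<le> length (x # s0)" using x s0 y s by auto
    have "pge (- 2 * \<nu>) (H (x # s0))"
    proof (rule H_ge)
      fix l u assume "l \<in> R"
      then have "pge (- 2 * \<nu>) (P (l # x # s0))" using inv_P2[OF va(1,2) A B _ xs0] by simp
      then show "vge (- 2 * \<nu>) (bu (P (l # x # s0)) u)" by (intro vge_mono[OF bu_ge]) auto
    qed
    then have "vge (- real d) (coeff (H (x # s0)) i)" using va r by (intro vge_mono[OF pge_coeff]) auto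
    moreover have "vge (- real d) (a * coeff (P (x # s0)) i)"
      using vge_mult'[OF vge_exact[OF va(1)] pge_coeff[OF inv_Pd[OF A xs0]]] by simp
    ultimately show "vge (- real d) (a * coeff (P (x # s0)) i - coeff (H (x # s0)) i)" by (intro vge_diff)
  qed simp
  have "pge (- real d - real d) (P s0)"
    by (intro P_ge_of_J vge_mono[OF crude]) auto
  then have "vge 0 (coeff (J m0 s0) k)"
    by (rule vge_mono[OF coeff_J_ge[OF _ s0(1)]]) (use k4 in simp)
  then have e5: "vge 0 (a * ?t - (\<Sum>x\<in>R. coeff (P (x # s)) k))"
    using cong_aP[OF s0, of 0 k] s by (simp add: coeff_H_top)
  \<comment> \<open>a times \<open>e5\<close> plus the sum of \<open>e4\<close> over
    \<open>R\<close>, which has q elements.\<close>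
  have "vge 0 ((a * a + of_nat q * ((- 1) ^ d * w ^ d)) * ?t)"
  proof -
    have "(a * a + of_nat q * ((- 1) ^ d * w ^ d)) * ?t =
       a * (a * ?t - (\<Sum>x\<in>R. coeff (P (x # s)) k)) +
       (\<Sum>x\<in>R. a * coeff (P (x # s)) k + (- 1) ^ d * w ^ d * ?t)"
      by (simp add: sum.distrib sum_distrib_left R algebra_simps)
    moreover have "vge 0 (a * (a * ?t - (\<Sum>x\<in>R. coeff (P (x # s)) k)))"
      using e5 va by (intro vge_mult'[OF vge_exact[OF va(1)]]) auto
    moreover have "vge 0 (\<Sum>x\<in>R. a * coeff (P (x # s)) k + (- 1) ^ d * w ^ d * ?t)"
      using e4 by (intro vge_sum)
    ultimately show ?thesis by (simp add: vge_add)
  qed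
  moreover have "v (a * a + of_nat q * ((- 1) ^ d * w ^ d)) = ereal (2 * \<nu>)"
  proof (rule v_add_dominant[of _ _ "1 + real d"])
    show "v (a * a) = ereal (2 * \<nu>)" using va by (simp add: v_mult)
    have "vge (real d) ((- 1) ^ d * w ^ d)"
      using vge_mult_int[OF _ vge_wpow[of d]] by (simp add: vge_power0)
    then show "vge (1 + real d) (of_nat q * ((- 1) ^ d * w ^ d))" using vge_mult[OF vge_q] by blast
    show "2 * \<nu> < 1 + real d" using va r by simp
  qed
  ultimately have t2: "vge (- 2 * \<nu>) ?t" using vge_cancel by fastforce
  \<comment> \<open>Here 2 \<nu> \<le> 2 \<le> d. For d = 1 this comparison fails in general, and
    weight q needs an argument of its own.\<close>
  have "vge 0 ((- 1) ^ d * w ^ d * ?t)"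
  proof -
    have "vge (real d) ((- 1) ^ d * w ^ d)"
      using vge_mult_int[OF _ vge_wpow[of d]] by (simp add: vge_power0)
    then show ?thesis by (rule vge_mult'[OF _ t2]) (use va r in simp)
  qed
  then have "vge 0 (a * coeff (P (m # s)) k)"
    using e4[OF y(1)] vge_diff by fastforce
  then have tm: "vge (- \<nu>) (coeff (P (m # s)) k)" using vge_cancel[OF va(1), of 0] by simp
  show "vge (- \<nu>) (bu (P (m # s)) u)" if "u \<le> k"
  proof -
    consider "u = 0" | "u = 1" | "2 \<le> u" by linarith
    then show ?thesis
    proof cases
      case 1
      then show ?thesis using tm by (simp add: bu_def)
    next
      case 2
      then show ?thesis using b1 va by (auto intro: vge_mono)
    next
      case 3
      have "pge (- 2 * \<nu>) (P (m # s))" using inv_P2[OF va(1,2) A B] y by simp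
      then show ?thesis using bu_ge[of "- 2 * \<nu>" "P (m # s)" u] 3 va by (auto intro: vge_mono)
    qed
  qed
qed

lemma bound_r0:
  assumes va: "v a = ereal \<nu>" "0 \<le> \<nu>" "\<nu> \<le> 1" and r: "r = 0" "2 \<le> d"
    and teich: "\<And>l. l \<in> R \<Longrightarrow> vge (real d) (poly E (- dg l))"
    and s: "s \<in> lists R"
  shows "pge (- \<nu> - real d) (P s)"
proof (rule descent[where X = "\<lambda>n. \<forall>m\<in>R. \<forall>s\<in>lists R. n < length s \<longrightarrow> vge 0 (bu (P (m # s)) 1)",
      OF va(1,2) _ _ _ s])
  show "\<nu> + real d \<le> real q" using va dq r by linarith
  show "\<forall>m\<in>R. \<forall>s\<in>lists R. Suc M < length s \<longrightarrow> vge 0 (bu (P (m # s)) 1)"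
    using suppP by (auto simp: bu_def)
  fix n assume A: "invA \<nu> (Suc n)" and B: "invB \<nu> (Suc n)"
    and X: "\<forall>m\<in>R. \<forall>s\<in>lists R. Suc n < length s \<longrightarrow> vge 0 (bu (P (m # s)) 1)"
  have X': "vge 0 (bu (P (m # s)) 1)" if "m \<in> R" "s \<in> lists R" "Suc n < length s" for m s
    using X that by blast
  note st = inv_step_r0[OF va r teich A B X']
  have "vge 0 (bu (P (m # s)) 1)" if "m \<in> R" "s \<in> lists R" "n < length s" for m s
    using that by (intro st(1)) auto
  moreover have "vge (- \<nu>) (bu (P (m # s)) u)" if "m \<in> R" "s \<in> lists R" "n < length s" "u \<le> k" for m s u
    using that by (intro st(2)) auto
  ultimately show "invB \<nu> n \<and> (\<forall>m\<in>R. \<forall>s\<in>lists R. n < length s \<longrightarrow> vge 0 (bu (P (m # s)) 1))"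
    unfolding invB_def by blast
qed

end

section \<open>Large slope: power sums over the residue representatives\<close>

context valued_field
begin

text \<open>The relation with t = j - 1 - u contains S u with coefficient 1 and none of the later
  unknowns.\<close>

lemma binomial_triangular:
  assumes G: "\<And>t. t0 \<le> t \<Longrightarrow> t < j \<Longrightarrow> vge c (\<Sum>u<j. of_nat ((j - 1 - u) choose t) * S u)"
  shows "u < j - t0 \<Longrightarrow> vge c (S u)"
proof (induction u rule: less_induct)
  case (less u)
  let ?f = "\<lambda>u'. of_nat ((j - 1 - u') choose (j - 1 - u)) * S u'"
  have "(\<Sum>u'<j. ?f u') = (\<Sum>u'\<in>{..<u} \<union> {u}. ?f u')"
    using less.prems by (intro sum.mono_neutral_right) (auto simp: binomial_eq_0)
  also have "\<dots> = (\<Sum>u'<u. ?f u') + S u" by (subst sum.union_disjoint) auto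
  finally have "S u = (\<Sum>u'<j. ?f u') - (\<Sum>u'<u. ?f u')" by simp
  moreover have "vge c (\<Sum>u'<j. ?f u')" using G[of "j - 1 - u"] less.prems by auto
  moreover have "vge c (\<Sum>u'<u. ?f u')"
    using less by (intro vge_sum vge_mult_int) auto
  ultimately show ?case by (simp add: vge_diff)
qed

text \<open>Pascal's rule replaces r by r - 1 in the upper entries. Taken down to j - 1, the system
  becomes triangular.\<close>

lemma binomial_shift:
  assumes G: "\<And>t. t < j \<Longrightarrow> vge c (\<Sum>u<j. of_nat ((r - u) choose t) * S u)"
  shows "m + j \<le> Suc r \<Longrightarrow> t < j \<Longrightarrow> vge c (\<Sum>u<j. of_nat ((r - m - u) choose t) * S u)"
proof (induction m arbitrary: t)
  case 0
  then show ?case using G by simp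
next
  case (Suc m)
  note IHm = Suc.IH and mj = Suc.prems(1)
  show ?case using Suc.prems(2)
  proof (induction t)
    case 0
    then show ?case using IHm[of 0] mj by simp
  next
    case (Suc t)
    have "(r - m - u) choose Suc t = ((r - Suc m - u) choose t) + ((r - Suc m - u) choose Suc t)"
      if "u < j" for u
    proof -
      have "r - m - u = Suc (r - Suc m - u)" using that mj by simp
      then show ?thesis by simp
    qed
    then have "(\<Sum>u<j. of_nat ((r - m - u) choose Suc t) * S u) =
        (\<Sum>u<j. of_nat ((r - Suc m - u) choose t) * S u + of_nat ((r - Suc m - u) choose Suc t) * S u)"
      by (intro sum.cong) (auto simp: algebra_simps)
    then have "(\<Sum>u<j. of_nat ((r - Suc m - u) choose Suc t) * S u) =
        (\<Sum>u<j. of_nat ((r - m - u) choose Suc t) * S u) - (\<Sum>u<j. of_nat ((r - Suc m - u) choose t) * S u)"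
      by (simp add: sum.distrib)
    moreover have "vge c (\<Sum>u<j. of_nat ((r - m - u) choose Suc t) * S u)"
      using IHm mj Suc.prems by simp
    moreover have "vge c (\<Sum>u<j. of_nat ((r - Suc m - u) choose t) * S u)"
      using Suc by simp
    ultimately show ?case by (simp only: vge_diff)
  qed
qed

end

context tree_sol
begin

context
  fixes y :: "'b list" and j :: nat
  assumes dp: "d < p" and dr: "d \<le> Suc r"
    and teich: "\<And>l. l \<in> R \<Longrightarrow> vge (real d) (dg l ^ q - dg l)"
    and Py: "\<And>l. l \<in> R \<Longrightarrow> pge (- real d) (P (l # y))"
    and j: "1 \<le> j" "j \<le> d"
begin

text \<open>In the coefficient of \<open>H y\<close> at j + L (q - 1), the exponent of
  \<open>dg l\<close> is \<open>ex u + (d - L) * (q - 1)\<close>. Reduced modulo q - 1 it no longer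
  depends on L, so the sums \<open>S u\<close> are common unknowns of all these
  coefficients.\<close>

definition ex :: "nat \<Rightarrow> nat" where "ex u = (d - j) + (r - u)"

definition S :: "nat \<Rightarrow> 'a" where "S u = (\<Sum>l\<in>R. bu (P (l # y)) u * dg l ^ ex u)"

text \<open>Marks the one case where \<open>ex u\<close> is 0 for some u < d, namely u = r = d - 1.
  Then x^(q-1) may not be replaced by x^0 at the representative of the zero class, and the relation
  with t = 0 is lost.\<close>

definition t0 :: nat where "t0 = (if j = d \<and> r = d - 1 then 1 else 0)"

lemma bu_y: "l \<in> R \<Longrightarrow> vge (real u - real d) (bu (P (l # y)) u)"
  using bu_ge[OF Py] by (simp add: add.commute)

lemma dgp: "l \<in> R \<Longrightarrow> vge 0 (dg l ^ n)"
  using dg_int by (intro vge_power0)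

lemma S_ge: "vge (real u - real d) (S u)"
  unfolding S_def using bu_y dgp by (intro vge_sum vge_mult'[of "real u - real d" _ 0]) auto

lemma teich_power:
  assumes l: "l \<in> R" and e: "1 \<le> e"
  shows "vge (real d) (dg l ^ (e + n * (q - 1)) - dg l ^ e)"
proof (induction n)
  case (Suc n)
  let ?x = "dg l"
  define N where "N = e + n * (q - 1) - 1"
  have N: "e + Suc n * (q - 1) = N + q" "e + n * (q - 1) = N + 1" using e q2 by (auto simp: N_def)
  have "?x ^ (e + Suc n * (q - 1)) - ?x ^ (e + n * (q - 1)) = ?x ^ N * (?x ^ q - ?x)"
    unfolding N by (simp add: power_add algebra_simps)
  then have "vge (real d) (?x ^ (e + Suc n * (q - 1)) - ?x ^ (e + n * (q - 1)))"
    using vge_mult_int[OF dgp[OF l] teich[OF l]] by simp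
  then have "vge (real d) (?x ^ (e + Suc n * (q - 1)) - ?x ^ (e + n * (q - 1)) + (?x ^ (e + n * (q - 1)) - ?x ^ e))"
    using Suc by (rule vge_add)
  then show ?case by simp
qed simp

lemma lucas_y:
  assumes "L \<le> j" "u < d"
  shows "vge 1 (of_nat ((k - u) choose (j + L * (q - 1))) - of_nat ((d choose L) * ((r - u) choose (j - L))) :: 'a)"
proof -
  have "k - u = d * q + (r - u)" using assms dr k_eq by simp
  moreover have "j + L * (q - 1) = L * q + (j - L)" using assms q2 by (cases q) (auto simp: algebra_simps)
  moreover have "j - L < q" using j dq q2 by linarith
  ultimately show ?thesis using lucas[of "r - u" "j - L" 1 d L] vp r_less by simp
qed

text \<open>Terms with u at least d are integral by themselves. In the others the exponent of
  \<open>dg l\<close> may be changed by multiples of q - 1, because the precision d of the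
  representatives makes up for the loss d of the children. Where the reduced exponent is 0, the
  binomial coefficient is divisible by p and the loss is only 1.\<close>

lemma coeff_H_S:
  assumes L: "L \<le> j" "t0 = 1 \<Longrightarrow> L < j"
  shows "vge 0 (coeff (H y) (j + L * (q - 1)) - (\<Sum>u<d. of_nat ((k - u) choose (j + L * (q - 1))) * S u))"
proof -
  define n where "n = j + L * (q - 1)"
  let ?C = "\<lambda>u. of_nat ((k - u) choose n) :: 'a"
  let ?b = "\<lambda>l u. bu (P (l # y)) u"
  have dk: "d \<le> k" using k_eq q2 by (cases q) auto
  have split: "(\<Sum>u\<le>k. f u) = (\<Sum>u<d. f u) + (\<Sum>u=d..k. f u)" for f :: "nat \<Rightarrow> 'a"
    using dk sum.atLeastLessThan_concat[of 0 d "Suc k" f]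
    by (simp add: atMost_atLeast0 atLeast0LessThan[symmetric] atLeastLessThanSuc_atLeastAtMost)
  have "(\<Sum>u<d. ?C u * S u) = (\<Sum>l\<in>R. \<Sum>u<d. ?C u * (?b l u * dg l ^ ex u))"
    unfolding S_def sum_distrib_left by (rule sum.swap)
  then have eq: "coeff (H y) n - (\<Sum>u<d. ?C u * S u) =
    (\<Sum>l\<in>R. (\<Sum>u<d. ?b l u * (?C u * (dg l ^ (k - u - n) - dg l ^ ex u))) +
       (\<Sum>u=d..k. ?b l u * (?C u * dg l ^ (k - u - n))))"
  proof -
    have "(\<Sum>u<d. ?b l u * (?C u * (dg l ^ (k - u - n) - dg l ^ ex u))) =
       (\<Sum>u<d. ?b l u * (?C u * dg l ^ (k - u - n))) - (\<Sum>u<d. ?C u * (?b l u * dg l ^ ex u))" for l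
      unfolding sum_subtractf[symmetric] by (rule sum.cong) (auto simp: algebra_simps)
    then show ?thesis
      unfolding coeff_H split \<open>(\<Sum>u<d. ?C u * S u) = _\<close> sum_subtractf[symmetric]
      by (intro sum.cong) (auto simp: sum_subtractf)
  qed
  have "vge 0 (?b l u * (?C u * (dg l ^ (k - u - n) - dg l ^ ex u)))" if l: "l \<in> R" and u: "u < d" for l u
  proof (cases "ex u = 0")
    case False
    have "k - u - n = ex u + (d - L) * (q - 1)"
    proof -
      have "k - u = d * (q - 1) + d + (r - u)" using u dr k_eq q2 by (cases q) auto
      moreover have "d * (q - 1) = (d - L) * (q - 1) + L * (q - 1)" using L j
        by (metis add_mult_distrib le_add_diff_inverse2 le_trans)
      ultimately show ?thesis using j unfolding ex_def n_def by linarith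
    qed
    then have "vge (real d) (dg l ^ (k - u - n) - dg l ^ ex u)"
      using teich_power[OF l, of "ex u" "d - L"] False by simp
    then have "vge (real d) (?C u * (dg l ^ (k - u - n) - dg l ^ ex u))" by (intro vge_mult_int) auto
    from vge_mult'[OF bu_y[OF l, of u] this] show ?thesis by simp
  next
    case True
    then have *: "j = d" "u = d - 1" "r = d - 1" using j u dr unfolding ex_def by auto
    then have "t0 = 1" unfolding t0_def by simp
    then have "L < j" using L by simp
    then have "(r - u) choose (j - L) = 0" using * by (intro binomial_eq_0) auto
    then have "vge 1 (?C u)" using lucas_y[OF L(1) u] unfolding n_def
      by (simp only: mult_zero_right of_nat_0 diff_zero)
    moreover have "vge 0 (dg l ^ (k - u - n) - dg l ^ ex u)" using dgp[OF l] by (intro vge_diff)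
    ultimately have "vge 1 (?C u * (dg l ^ (k - u - n) - dg l ^ ex u))" using vge_mult by fastforce
    moreover have "vge (- 1) (?b l u)" using bu_y[OF l, of u] * j by (simp add: of_nat_diff)
    ultimately show ?thesis using vge_mult by fastforce
  qed
  moreover have "vge 0 (?b l u * (?C u * dg l ^ (k - u - n)))" if l: "l \<in> R" and u: "d \<le> u" for l u
    using vge_mono[OF bu_y[OF l, of u], of 0] u dgp[OF l] by (intro vge_mult_int) auto
  ultimately show ?thesis unfolding n_def[symmetric] eq by (intro vge_sum vge_add) auto
qed

text \<open>For d < p the factorial of d is prime to p, and the binomial coefficient divides
  it.\<close>

lemma choose_unit: "L \<le> d \<Longrightarrow> v (of_nat (d choose L)) = 0"
proof (rule v_of_nat_not_dvd[OF prime_p vp])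
  assume "L \<le> d"
  then have "fact d = (d choose L) * (fact L * fact (d - L))"
    using binomial_fact_lemma[of L d] by (simp add: mult_ac)
  then have "(d choose L) dvd fact d" by (rule dvdI)
  moreover have "\<not> p dvd fact d" using prime_dvd_fact_iff[OF prime_p] dp by simp
  ultimately show "\<not> p dvd (d choose L)" using dvd_trans by blast
qed

text \<open>Each round gains one unit. In the relations from indices beyond q, the unknowns with u
  at least j are already good enough, and replacing binomial coefficients by their Lucas values
  costs an error divisible by p, that is, one unit better than the current bound. What remains is a
  system in the S u with u < j, triangular after shifting.\<close>

lemma S_bound:
  assumes Hhi: "\<And>i. q \<le> i \<Longrightarrow> vge 0 (coeff (H y) i)"
  shows "i \<le> j - t0 \<Longrightarrow> \<forall>u<j. vge (real i - real d) (S u)"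
proof (induction i)
  case 0
  then show ?case by (auto intro!: vge_mono[OF S_ge])
next
  case (Suc i)
  then have IH: "vge (real i - real d) (S u)" if "u < j" for u using that by simp
  have ij: "Suc i \<le> j" using Suc by simp
  have t01: "t0 \<le> 1" by (simp add: t0_def)
  let ?c = "real (Suc i) - real d"
  have G: "vge ?c (\<Sum>u<j. of_nat ((r - u) choose t) * S u)" if t: "t0 \<le> t" "t < j" for t
  proof -
    \<comment> \<open>The relation with lower entry t is read off at the index j + (j - t) (q - 1),
      which is at least q because t < j.\<close>
    define L where "L = j - t"
    have L: "1 \<le> L" "L \<le> j" "t0 = 1 \<Longrightarrow> L < j" "j - L = t" using t by (auto simp: L_def)
    define n where "n = j + L * (q - 1)"
    have "q - 1 \<le> L * (q - 1)" using L(1) by simp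
    then have "q \<le> n" using j unfolding n_def by linarith
    then have "vge 0 (coeff (H y) n)" by (rule Hhi)
    then have "vge 0 (\<Sum>u<d. of_nat ((k - u) choose n) * S u)"
      using coeff_H_S[OF L(2,3)] vge_cong_diff unfolding n_def by blast
    then have s1: "vge ?c (\<Sum>u<d. of_nat ((k - u) choose n) * S u)" by (rule vge_mono) (use ij j in simp)
    have split: "(\<Sum>u<d. f u) = (\<Sum>u<j. f u) + (\<Sum>u=j..<d. f u)" for f :: "nat \<Rightarrow> 'a"
      using sum.atLeastLessThan_concat[of 0 j d f] j by (simp add: atLeast0LessThan)
    have "vge ?c (\<Sum>u=j..<d. of_nat ((k - u) choose n) * S u)"
      using ij by (intro vge_sum vge_mult_int) (auto intro!: vge_mono[OF S_ge])
    from vge_diff[OF s1[unfolded split] this]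
    have s2: "vge ?c (\<Sum>u<j. of_nat ((k - u) choose n) * S u)" by simp
    have "vge ?c ((of_nat ((k - u) choose n) - of_nat ((d choose L) * ((r - u) choose t))) * S u)"
      if "u < j" for u
      using lucas_y[OF L(2), of u] IH[OF that] that j unfolding n_def L(4)
      by (intro vge_mult'[of 1 _ "real i - real d"]) auto
    then have "vge ?c (\<Sum>u<j. (of_nat ((k - u) choose n) - of_nat ((d choose L) * ((r - u) choose t))) * S u)"
      by (intro vge_sum) auto
    moreover have "(\<Sum>u<j. (of_nat ((k - u) choose n) - of_nat ((d choose L) * ((r - u) choose t))) * S u) =
       (\<Sum>u<j. of_nat ((k - u) choose n) * S u) - of_nat (d choose L) * (\<Sum>u<j. of_nat ((r - u) choose t) * S u)"
      by (simp add: left_diff_distrib sum_subtractf sum_distrib_left mult.assoc)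
    ultimately have "vge ?c (of_nat (d choose L) * (\<Sum>u<j. of_nat ((r - u) choose t) * S u))"
      using s2 vge_cong_diff[of ?c "\<Sum>u<j. of_nat ((k - u) choose n) * S u"] by simp
    then show ?thesis using vge_cancel[of "of_nat (d choose L)" 0 ?c] choose_unit[of L] L j
      by (simp add: zero_ereal_def)
  qed
  show ?case
  proof (cases "t0 = 0")
    case True
    have "vge ?c (\<Sum>u<j. of_nat ((j - 1 - u) choose t) * S u)" if "t < j" for t
    proof -
      have "r - (Suc r - j) - u = j - 1 - u" for u using j dr by simp
      then show ?thesis using binomial_shift[of j ?c r S "Suc r - j" t] G True that j dr by simp
    qed
    then show ?thesis using binomial_triangular[of 0 j ?c S] by auto
  next
    case False
    then have *: "j = d" "r = d - 1" "t0 = 1" by (auto simp: t0_def split: if_splits)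
    have "vge ?c (\<Sum>u<j. of_nat ((j - 1 - u) choose t) * S u)" if "1 \<le> t" "t < j" for t
      using G[of t] that * by simp
    then have "vge ?c (S u)" if "u < j - 1" for u using binomial_triangular[of 1 j ?c S] that by auto
    \<comment> \<open>With one relation missing, the last unknown is not determined; but i + 1 is at
      most j - 1 here, so the trivial bound suffices.\<close>
    moreover have "vge ?c (S (j - 1))"
      by (rule vge_mono[OF S_ge]) (use Suc.prems *(3) in simp)
    moreover have "u < j - 1 \<or> u = j - 1" if "u < j" for u using that by linarith
    ultimately show ?thesis by blast
  qed
qed

text \<open>The member L = 0 of the same family of coefficients. It is not known to be integral, but
  it is a combination of the \<open>S u\<close>, which the members with L > 0 have bounded.\<close>

lemma coeff_H_low:
  assumes Hhi: "\<And>i. q \<le> i \<Longrightarrow> vge 0 (coeff (H y) i)"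
  shows "vge (real j - real d) (coeff (H y) j)"
proof -
  have "vge 0 (coeff (H y) j - (\<Sum>u<d. of_nat ((k - u) choose j) * S u))"
    using coeff_H_S[of 0] j by simp
  then have 1: "vge (real j - real d) (coeff (H y) j - (\<Sum>u<d. of_nat ((k - u) choose j) * S u))"
    by (rule vge_mono) (use j in simp)
  have "vge (real j - real d) (of_nat ((k - u) choose j) * S u)" if u: "u < d" for u
  proof (cases "j \<le> u")
    case True
    then show ?thesis by (intro vge_mult_int vge_mono[OF S_ge]) auto
  next
    case False
    then have Su: "vge (real (j - t0) - real d) (S u)" using S_bound[OF Hhi, of "j - t0"] by auto
    show ?thesis
    proof (cases "t0 = 0")
      case True
      then show ?thesis using Su by (intro vge_mult_int) auto
    next
      case False
      then have *: "j = d" "r = d - 1" "t0 = 1" by (auto simp: t0_def split: if_splits)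
      have "(r - u) choose j = 0" using * j by (intro binomial_eq_0) auto
      then have "vge 1 (of_nat ((k - u) choose j) :: 'a)"
        using lucas_y[OF le0 u]
        by (simp only: mult_0 add_0_right diff_zero mult_zero_right of_nat_0)
      then show ?thesis using Su * j by (intro vge_mult'[of 1 _ "- 1"]) (auto simp: of_nat_diff)
    qed
  qed
  then have 2: "vge (real j - real d) (\<Sum>u<d. of_nat ((k - u) choose j) * S u)" by (intro vge_sum) auto
  show ?thesis using vge_add[OF 1 2] by simp
qed

end

text \<open>By assumption a P is integral at the children, so the relation ties \<open>J\<close> to
  \<open>H\<close> alone. High coefficients of \<open>J\<close> are integral through powers of w,
  hence so are those of \<open>H\<close>; these control the low coefficients of \<open>H\<close>,
  which return the sharp bounds for \<open>J\<close>.\<close>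

lemma P_ge_step_large_slope:
  assumes va: "vge (real d) a" and dp: "d < p" and dr: "d \<le> Suc r"
    and teich: "\<And>l. l \<in> R \<Longrightarrow> vge (real d) (dg l ^ q - dg l)" and s: "s \<in> lists R"
    and P1: "\<And>m. m \<in> R \<Longrightarrow> pge (- real d) (P (m # s))"
    and P2: "\<And>m l. m \<in> R \<Longrightarrow> l \<in> R \<Longrightarrow> pge (- real d) (P (l # m # s))"
  shows "pge (- real d) (P s)"
proof -
  have aP: "vge 0 (a * coeff (P (m # s)) i)" if "m \<in> R" for m i
    using vge_mult'[OF va pge_coeff[OF P1[OF that]]] by simp
  have H: "pge (- real d) (H (m # s))" if "m \<in> R" for m
    by (intro H_ge vge_mono[OF bu_ge[OF P2[OF that]]]) auto
  have J: "vge (- real d) (coeff (J m s) i)" if "m \<in> R" for m i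
    using aP[OF that, of i] pge_coeff[OF H[OF that], of i]
    by (intro cong_J[OF that s] vge_diff) (auto intro: vge_mono)
  have "pge (- real d - real d) (P s)"
    by (intro P_ge_of_J vge_mono[OF J]) auto
  then have Jhi: "vge 0 (coeff (J m s) i)" if "m \<in> R" "q \<le> i" for m i
    by (rule vge_mono[OF coeff_J_ge[OF _ that(1)]]) (use that(2) dq in simp)
  have Hhi: "vge 0 (coeff (H (m # s)) i)" if "m \<in> R" "q \<le> i" for m i
    using cong_aP[OF that(1) s Jhi[OF that]] aP[OF that(1), of i] vge_cong_diff by blast
  show ?thesis
  proof (rule P_ge_of_J)
    fix m j assume m: "m \<in> R" and j: "j \<le> d"
    show "vge (- real d + real j) (coeff (J m s) j)"
    proof (cases "j = 0")
      case True
      then show ?thesis using J[OF m] by simp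
    next
      case False
      have "vge (real j - real d) (coeff (H (m # s)) j)"
        using False j Hhi[OF m] P2[OF m] by (intro coeff_H_low[OF dp dr teich]) auto
      moreover have "vge (real j - real d) (a * coeff (P (m # s)) j)"
        using aP[OF m, of j] j by (auto intro: vge_mono)
      ultimately have "vge (real j - real d) (coeff (J m s) j)"
        using j by (intro cong_J[OF m s] vge_diff) auto
      then show ?thesis by (simp add: add.commute)
    qed
  qed
qed

lemma bound_large_slope:
  assumes va: "vge (real d) a" and dp: "d < p" and dr: "d \<le> Suc r"
    and teich: "\<And>l. l \<in> R \<Longrightarrow> vge (real d) (dg l ^ q - dg l)" and s: "s \<in> lists R"
  shows "pge (- real d) (P s)"
proof -
  have "\<forall>s\<in>lists R. M < length s + i \<longrightarrow> pge (- real d) (P s)" for i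
  proof (induction i)
    case 0
    then show ?case using suppP by auto
  next
    case (Suc i)
    show ?case
    proof (intro ballI impI)
      fix s assume s: "s \<in> lists R" "M < length s + Suc i"
      show "pge (- real d) (P s)"
        by (rule P_ge_step_large_slope[OF va dp dr teich s(1)]) (use Suc s in auto)
    qed
  qed
  from this[of "Suc M"] s show ?thesis by simp
qed

end

section \<open>Weight q with slope below 1\<close>

context tree_core
begin

lemma dn_add: "dn l (P + Q) = dn l P + dn l Q"
  by (simp add: dn_def algebra_simps smult_add_left sum.distrib)

lemma dn_smult: "dn l (smult c P) = smult c (dn l P)"
  by (simp add: poly_eq_iff dn_def coeff_sum sum_distrib_left mult_ac)

text \<open>For k = q, \<open>psi0\<close> and \<open>psi1\<close> are the constant and the linear
  coefficient of the sum of \<open>dn l E\<close> over all letters: what the multiples of E at the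
  children contribute to \<open>H\<close>.\<close>

definition psi0 :: 'c where "psi0 = (\<Sum>l\<in>R. dg l ^ q - w ^ (q - 1) * dg l)"

definition psi1 :: 'c where "psi1 = (\<Sum>l\<in>R. of_nat q * dg l ^ (q - 1) - w ^ (q - 1))"

lemma E_l0: "l \<in> R \<Longrightarrow> vge 0 (dg l ^ q - w ^ (q - 1) * dg l)"
  using dg_int by (intro vge_diff vge_mult_int vge_power0 vge_w0) auto

lemma E_l1: "l \<in> R \<Longrightarrow> vge 1 (of_nat q * dg l ^ (q - 1) - w ^ (q - 1))"
proof (intro vge_diff)
  assume "l \<in> R"
  then show "vge 1 (of_nat q * dg l ^ (q - 1))"
    using vge_mult[OF vge_q vge_power0[OF dg_int], of l "q - 1"] by simp
  show "vge 1 (w ^ (q - 1))" using vge_wpow[of "q - 1"] q2 by (auto intro: vge_mono)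
qed

lemma psi0_ge: "vge 0 psi0" unfolding psi0_def by (intro vge_sum E_l0)

lemma psi1_ge: "vge 1 psi1" unfolding psi1_def by (intro vge_sum E_l1)

lemma coeff_E: "coeff E i = (if i = q then 1 else if i = 1 then - 1 else 0)"
  using q2 by (auto simp: E_def)

lemma dn_E: assumes "k = q" shows "dn l E = [:dg l, 1:] ^ q - smult (w ^ (q - 1)) ([:dg l, 1:] ^ 1)"
proof -
  have "dn l E = (\<Sum>i\<in>{1, q}. smult (coeff E i * w ^ (k - i)) ([:dg l, 1:] ^ i))"
    unfolding dn_def using q2 assms by (intro sum.mono_neutral_right) (auto simp: coeff_E)
  then show ?thesis using q2 assms by (simp add: coeff_E)
qed

lemma coeff_dn_E:
  assumes "k = q"
  shows "coeff (dn l E) 0 = dg l ^ q - w ^ (q - 1) * dg l"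
    "coeff (dn l E) 1 = of_nat q * dg l ^ (q - 1) - w ^ (q - 1)"
  unfolding dn_E[OF assms] coeff_diff coeff_smult coeff_X_plus_power by simp_all

text \<open>Iterate \<rho> := w / (a + \<rho> psi1), starting with w / a, whose error \<rho>^2 psi1
  has valuation at least 3 - 2 \<nu>. Each round gains 2 - 2 \<nu>, which is positive because \<nu>
  < 1.\<close>

lemma rho_exists:
  assumes va: "v a = ereal \<nu>" "0 \<le> \<nu>" "\<nu> < 1"
  shows "\<exists>\<rho>. v \<rho> = ereal (1 - \<nu>) \<and> vge (2 * \<nu>) (\<rho> * (a + \<rho> * psi1) - w)"
proof (rule bootstrap[where \<delta> = "2 - 2 * \<nu>" and ?x0.0 = "min (2 * \<nu>) (3 - 2 * \<nu>)" and c = "2 * \<nu>"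
      and Q = "\<lambda>x. \<exists>\<rho>. v \<rho> = ereal (1 - \<nu>) \<and> vge x (\<rho> * (a + \<rho> * psi1) - w)"])
  have a0: "a \<noteq> 0" using va by auto
  show "\<exists>\<rho>. v \<rho> = ereal (1 - \<nu>) \<and> vge (min (2 * \<nu>) (3 - 2 * \<nu>)) (\<rho> * (a + \<rho> * psi1) - w)"
  proof (intro exI[of _ "w / a"] conjI)
    show vr: "v (w / a) = ereal (1 - \<nu>)" using v_divide[OF vw' va(1)] .
    have "w / a * (a + w / a * psi1) - w = (w / a) * ((w / a) * psi1)" using a0 by (simp add: field_simps)
    then show "vge (min (2 * \<nu>) (3 - 2 * \<nu>)) (w / a * (a + w / a * psi1) - w)"
      using vge_mult[OF vge_exact[OF vr] vge_mult[OF vge_exact[OF vr] psi1_ge]]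
      by (auto intro: vge_mono)
  qed
  fix x assume "\<exists>\<rho>. v \<rho> = ereal (1 - \<nu>) \<and> vge x (\<rho> * (a + \<rho> * psi1) - w)"
  then obtain \<rho> where \<rho>: "v \<rho> = ereal (1 - \<nu>)" "vge x (\<rho> * (a + \<rho> * psi1) - w)" by blast
  have vb: "v (a + \<rho> * psi1) = ereal \<nu>"
    using va by (intro v_add_dominant[OF va(1) vge_mult[OF vge_exact[OF \<rho>(1)] psi1_ge]]) simp
  then have b0: "a + \<rho> * psi1 \<noteq> 0" by auto
  define \<rho>' where "\<rho>' = w / (a + \<rho> * psi1)"
  have \<rho>': "v \<rho>' = ereal (1 - \<nu>)" unfolding \<rho>'_def using v_divide[OF vw' vb] .
  have "\<rho>' - \<rho> = - (\<rho> * (a + \<rho> * psi1) - w) / (a + \<rho> * psi1)"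
    unfolding \<rho>'_def using b0 by (simp add: field_simps)
  moreover have "vge x (- (\<rho> * (a + \<rho> * psi1) - w))" using \<rho>(2) by (simp only: vge_minus)
  ultimately have diff: "vge (x - \<nu>) (\<rho>' - \<rho>)" using vge_divide[OF _ vb] by (simp only:)
  have "\<rho>' * (a + \<rho>' * psi1) - w = \<rho>' * (psi1 * (\<rho>' - \<rho>))"
  proof -
    have "\<rho>' * (a + \<rho> * psi1) = w" unfolding \<rho>'_def using b0 by simp
    then show ?thesis by (simp add: algebra_simps)
  qed
  then have "vge ((1 - \<nu>) + (1 + (x - \<nu>))) (\<rho>' * (a + \<rho>' * psi1) - w)"
    using vge_mult[OF vge_exact[OF \<rho>'] vge_mult[OF psi1_ge diff]] by simp
  then have "vge (min (2 * \<nu>) (x + (2 - 2 * \<nu>))) (\<rho>' * (a + \<rho>' * psi1) - w)"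
    by (rule vge_mono) simp
  then show "\<exists>\<rho>. v \<rho> = ereal (1 - \<nu>) \<and> vge (min (2 * \<nu>) (x + (2 - 2 * \<nu>))) (\<rho> * (a + \<rho> * psi1) - w)"
    using \<rho>' by blast
qed (use va in auto)

end

text \<open>In weight \<open>q\<close> with \<open>v a < 1\<close> the top coefficients of the \<open>P s\<close> need not be small, but up to an
  admissible error they are multiplied by \<open>\<rho>\<close> when passing to a child. The equation for \<open>\<rho>\<close> comes from
  the coefficient of \<open>X\<close> in the Hecke relation.\<close>
locale weight_q = tree_sol +
  fixes \<nu> :: real and \<rho> :: 'a
  assumes d1: "d = 1" and r0: "r = 0"
    and va: "v a = ereal \<nu>" "0 \<le> \<nu>" "\<nu> < 1"
    and teich: "\<And>l. l \<in> R \<Longrightarrow> vge 2 (poly E (- dg l))"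
    and v\<rho>: "v \<rho> = ereal (1 - \<nu>)" and \<rho>_eq: "vge (2 * \<nu>) (\<rho> * (a + \<rho> * psi1) - w)"
begin

lemma kq: "k = q" using k_eq d1 r0 by simp

definition t :: "'b list \<Rightarrow> 'a" where "t y = coeff (P y) q"
definition g :: "'b list \<Rightarrow> 'a poly" where "g y = P y - smult (t y) E"
text \<open>The solution of \<open>(a \<kappa> - \<rho> psi0) \<rho> = \<kappa>\<close>, which arises from the constant coefficient.\<close>
definition \<kappa> :: 'a where "\<kappa> = - (\<rho> * (\<rho> * psi0)) / (1 - a * \<rho>)"

text \<open>Up to errors of valuation at least -\<nu>, \<open>P y\<close> is t(y) (E + \<kappa>),
  and t is multiplied by \<rho> when passing to a child. The scalar t(y) itself may have valuation
  as low as -2 \<nu>.\<close>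

definition good :: "'b list \<Rightarrow> bool" where
  "good y \<longleftrightarrow> pge (- \<nu>) (g y - [:\<kappa> * t y:]) \<and> vge (- 2 * \<nu>) (t y) \<and>
     (\<forall>l\<in>R. vge (- \<nu>) (t (l # y) - \<rho> * t y))"

lemma P_split: "P y = g y + smult (t y) E" by (simp add: g_def)

lemma degree_g: "degree (g y) < q"
proof -
  have "coeff (g y) i = 0" if "q \<le> i" for i
  proof (cases "i = q")
    case True
    then show ?thesis by (simp add: g_def t_def coeff_E)
  next
    case False
    then have "coeff (P y) i = 0" using degP[of y] kq that by (intro coeff_eq_0) simp
    then show ?thesis using False that q2 by (simp add: g_def coeff_E)
  qed
  then have "degree (g y) \<le> q - 1" by (intro degree_le) auto
  then show ?thesis using q2 by simp
qed

lemma v_aplus: "v (a + \<rho> * psi1) = ereal \<nu>"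
  using va by (intro v_add_dominant[OF va(1) vge_mult[OF vge_exact[OF v\<rho>] psi1_ge]]) simp

lemma v_one_minus: "v (1 - a * \<rho>) = ereal 0"
proof -
  have "v (a * \<rho>) = ereal 1" using va v\<rho> by (simp add: v_mult)
  then have "vge 1 (- (a * \<rho>))" using vge_exact by simp
  then have "v (1 + - (a * \<rho>)) = ereal 0" by (intro v_add_dominant) (auto simp: zero_ereal_def)
  then show ?thesis by simp
qed

lemma \<kappa>_ge: "vge (2 - 2 * \<nu>) \<kappa>"
  unfolding \<kappa>_def
  using vge_divide[OF _ v_one_minus, of "2 - 2 * \<nu>" "- (\<rho> * (\<rho> * psi0))"]
    vge_mult[OF vge_exact[OF v\<rho>] vge_mult[OF vge_exact[OF v\<rho>] psi0_ge]] by simp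

lemma \<kappa>_eq: "(a * \<kappa> - \<rho> * psi0) * \<rho> = \<kappa>"
proof -
  have "1 - a * \<rho> \<noteq> 0" using v_one_minus by auto
  then have "\<kappa> * (1 - a * \<rho>) = - (\<rho> * (\<rho> * psi0))" by (simp add: \<kappa>_def)
  then show ?thesis by (simp add: algebra_simps)
qed

lemma mid_ge: "vge (1 - \<nu>) (a * \<kappa> - \<rho> * psi0)"
proof (intro vge_diff)
  show "vge (1 - \<nu>) (a * \<kappa>)" using va by (intro vge_mult'[OF vge_exact[OF va(1)] \<kappa>_ge]) simp
  show "vge (1 - \<nu>) (\<rho> * psi0)" by (intro vge_mult'[OF vge_exact[OF v\<rho>] psi0_ge]) simp
qed

lemma good_g:
  assumes "good y"
  shows "1 \<le> i \<Longrightarrow> vge (- \<nu>) (coeff (g y) i)" "vge (min (- \<nu>) (2 - 4 * \<nu>)) (coeff (g y) 0)"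
    "vge (- \<nu>) (coeff (g y) 0 - \<kappa> * t y)"
proof -
  have *: "vge (- \<nu>) (coeff (g y - [:\<kappa> * t y:]) i)" for i
    using assms pge_coeff unfolding good_def by blast
  show "vge (- \<nu>) (coeff (g y) i)" if "1 \<le> i" using *[of i] that by (cases i) auto
  show 0: "vge (- \<nu>) (coeff (g y) 0 - \<kappa> * t y)" using *[of 0] by simp
  have "vge (min (- \<nu>) (2 - 4 * \<nu>)) (\<kappa> * t y)"
    using assms unfolding good_def by (intro vge_mult'[OF \<kappa>_ge, of "- 2 * \<nu>"]) auto
  moreover have "vge (min (- \<nu>) (2 - 4 * \<nu>)) (coeff (g y) 0 - \<kappa> * t y)"
    by (rule vge_mono[OF 0]) simp
  ultimately show "vge (min (- \<nu>) (2 - 4 * \<nu>)) (coeff (g y) 0)" using vge_cong_diff by blast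
qed

lemma good_t: "good y \<Longrightarrow> vge (- 2 * \<nu>) (t y)"
  unfolding good_def by blast

text \<open>Since g has degree below q, the term with u = 0, the only one without a power of w, is
  absent.\<close>

lemma dn_g_ge: assumes "good y" "l \<in> R" shows "pge 0 (dn l (g y))"
proof (rule dn_coeff_ge[OF assms(2)])
  fix u assume u: "u \<le> k"
  consider "u = 0" | "1 \<le> u" "u < q" | "u = q" using u kq by linarith
  then show "vge 0 (bu (g y) u)"
  proof cases
    case 1
    then show ?thesis unfolding bu_def unfolding kq using coeff_eq_0[OF degree_g] by simp
  next
    case 2
    then have "vge (- \<nu>) (coeff (g y) (q - u))" by (intro good_g[OF assms(1)]) simp
    then show ?thesis unfolding bu_def unfolding kq by (rule vge_mult'[OF vge_wpow]) (use 2 va in simp)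
  next
    case 3
    have "vge (- 2) (coeff (g y) 0)" by (rule vge_mono[OF good_g(2)[OF assms(1)]]) (use va in simp)
    then show ?thesis unfolding bu_def unfolding kq 3 diff_self_eq_0
      by (rule vge_mult'[OF vge_wpow]) (use q2 in simp)
  qed
qed

lemma coeff_H_split:
  "coeff (H y) i = (\<Sum>l\<in>R. t (l # y) * coeff (dn l E) i) + (\<Sum>l\<in>R. coeff (dn l (g (l # y))) i)"
  unfolding H_def coeff_sum
  by (subst P_split) (simp add: dn_add dn_smult sum.distrib)

lemma H_cong:
  assumes y: "good y" and ch: "\<And>l. l \<in> R \<Longrightarrow> good (l # y)"
  shows "vge (- \<nu>) (coeff (H y) 0 - \<rho> * psi0 * t y)" "vge 0 (coeff (H y) 1 - \<rho> * psi1 * t y)"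
proof -
  have gs: "vge 0 (\<Sum>l\<in>R. coeff (dn l (g (l # y))) i)" for i
    using dn_g_ge ch by (intro vge_sum pge_coeff) auto
  have tau: "vge (- \<nu>) (t (l # y) - \<rho> * t y)" if "l \<in> R" for l using y that by (simp add: good_def)
  have psi: "psi0 = (\<Sum>l\<in>R. coeff (dn l E) 0)" "psi1 = (\<Sum>l\<in>R. coeff (dn l E) 1)"
    unfolding psi0_def psi1_def coeff_dn_E[OF kq] by simp_all
  have "coeff (H y) 0 - \<rho> * psi0 * t y =
     (\<Sum>l\<in>R. (t (l # y) - \<rho> * t y) * coeff (dn l E) 0) + (\<Sum>l\<in>R. coeff (dn l (g (l # y))) 0)"
    unfolding coeff_H_split psi(1)
    by (simp add: algebra_simps sum_subtractf sum_distrib_left)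
  moreover have "vge (- \<nu>) (\<Sum>l\<in>R. (t (l # y) - \<rho> * t y) * coeff (dn l E) 0)"
    unfolding coeff_dn_E[OF kq] using tau E_l0 by (intro vge_sum vge_mult'[of "- \<nu>" _ 0]) auto
  moreover have "vge (- \<nu>) (\<Sum>l\<in>R. coeff (dn l (g (l # y))) 0)" by (rule vge_mono[OF gs]) (use va in simp)
  ultimately show "vge (- \<nu>) (coeff (H y) 0 - \<rho> * psi0 * t y)" by (simp only: vge_add)
  have "coeff (H y) 1 - \<rho> * psi1 * t y =
     (\<Sum>l\<in>R. (t (l # y) - \<rho> * t y) * coeff (dn l E) 1) + (\<Sum>l\<in>R. coeff (dn l (g (l # y))) 1)"
    unfolding coeff_H_split psi(2)
    by (simp add: algebra_simps sum_subtractf sum_distrib_left)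
  moreover have "vge 0 (\<Sum>l\<in>R. (t (l # y) - \<rho> * t y) * coeff (dn l E) 1)"
    unfolding coeff_dn_E[OF kq] using tau E_l1 va by (intro vge_sum vge_mult'[of "- \<nu>" _ 1]) auto
  ultimately show "vge 0 (coeff (H y) 1 - \<rho> * psi1 * t y)" using gs by (simp only: vge_add)
qed

lemma H_crude:
  assumes ch: "\<And>l. l \<in> R \<Longrightarrow> good (l # y)"
  shows "vge (- 2) (coeff (H y) 0)" "vge (- 1) (coeff (H y) 1)"
proof -
  have gs: "vge 0 (\<Sum>l\<in>R. coeff (dn l (g (l # y))) i)" for i
    using dn_g_ge ch by (intro vge_sum pge_coeff) auto
  have "vge (- 2) (\<Sum>l\<in>R. t (l # y) * coeff (dn l E) 0)"
    unfolding coeff_dn_E[OF kq]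
    using good_t[OF ch] E_l0 va by (intro vge_sum vge_mult'[of "- 2 * \<nu>" _ 0]) auto
  moreover have "vge (- 1) (\<Sum>l\<in>R. t (l # y) * coeff (dn l E) 1)"
    unfolding coeff_dn_E[OF kq]
    using good_t[OF ch] E_l1 va by (intro vge_sum vge_mult'[of "- 2 * \<nu>" _ 1]) auto
  moreover have "vge (- 2) (\<Sum>l\<in>R. coeff (dn l (g (l # y))) 0)" "vge (- 1) (\<Sum>l\<in>R. coeff (dn l (g (l # y))) 1)"
    using vge_mono[OF gs] by auto
  ultimately show "vge (- 2) (coeff (H y) 0)" "vge (- 1) (coeff (H y) 1)"
    unfolding coeff_H_split by (auto intro: vge_add)
qed

lemma coeff_P01: "coeff (P y) 0 = coeff (g y) 0" "coeff (P y) 1 = coeff (g y) 1 - t y"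
  using q2 by (auto simp: g_def coeff_E)

lemma P_crude:
  assumes s: "s \<in> lists R"
    and 0: "\<And>m. m \<in> R \<Longrightarrow> vge (- 2) (a * coeff (P (m # s)) 0) \<and> vge (- 1) (a * coeff (P (m # s)) 1)"
    and ch: "\<And>m l. m \<in> R \<Longrightarrow> l \<in> R \<Longrightarrow> good (l # m # s)"
  shows "pge (- 2) (P s)"
proof (rule P_ge_of_J)
  fix m j assume m: "m \<in> R" and j: "j \<le> d"
  have "vge (- 2) (coeff (J m s) 0)" "vge (- 1) (coeff (J m s) 1)"
    using 0[OF m] H_crude[OF ch[OF m]] by (auto intro!: cong_J[OF m s] vge_diff)
  moreover have "j = 0 \<or> j = 1" using j d1 by auto
  ultimately show "vge (- 2 + real j) (coeff (J m s) j)" by auto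
qed

context
  fixes s :: "'b list"
  assumes s: "s \<in> lists R"
    and ch1: "\<And>m. m \<in> R \<Longrightarrow> good (m # s)"
    and ch2: "\<And>m l. m \<in> R \<Longrightarrow> l \<in> R \<Longrightarrow> good (l # m # s)"
begin

lemma P_s_ge: "pge (- 2) (P s)"
proof (rule P_crude[OF s _ ch2], intro conjI)
  fix m assume m: "m \<in> R"
  show "vge (- 2) (a * coeff (P (m # s)) 0)"
    unfolding coeff_P01 by (rule vge_mult'[OF vge_exact[OF va(1)] good_g(2)[OF ch1[OF m]]]) (use va in simp)
  have "vge (- 2 * \<nu>) (coeff (P (m # s)) 1)"
    unfolding coeff_P01 using good_g(1)[OF ch1[OF m], of 1] good_t[OF ch1[OF m]] va
    by (intro vge_diff) (auto intro: vge_mono)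
  then show "vge (- 1) (a * coeff (P (m # s)) 1)"
    by (rule vge_mult'[OF vge_exact[OF va(1)]]) (use va in simp)
qed

lemma t_s_ge: "vge (- 2) (t s)"
  unfolding t_def by (rule pge_coeff[OF P_s_ge])

lemma g_s_ge: "pge (- 2) (g s)"
  unfolding g_def using P_s_ge pge_smult'[OF t_s_ge degree_E(3)] by (intro pge_diff) auto

text \<open>The constant coefficient of the Hecke relation, with \<open>P (m # s)\<close> and its
  children replaced by their approximations on the line through E + \<kappa>.\<close>

lemma cong0: assumes m: "m \<in> R"
  shows "vge (- \<nu>) (poly (g s) (- dg m) - (a * \<kappa> - \<rho> * psi0) * t (m # s))"
proof -
  have J: "coeff (J m s) 0 = poly (g s) (- dg m) + t s * poly E (- dg m)"
    by (simp add: coeff_J tay_0) (subst P_split, simp)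
  have 1: "vge (- \<nu>) (coeff (J m s) 0 + coeff (H (m # s)) 0 - a * coeff (P (m # s)) 0)"
    by (rule vge_mono[OF eqc[OF m s]]) (use va in simp)
  have 2: "vge (- \<nu>) (coeff (H (m # s)) 0 - \<rho> * psi0 * t (m # s))"
    using H_cong(1)[OF ch1[OF m] ch2[OF m]] .
  have 3: "vge (- \<nu>) (a * (coeff (P (m # s)) 0 - \<kappa> * t (m # s)))"
    unfolding coeff_P01 by (rule vge_mult'[OF vge_exact[OF va(1)] good_g(3)[OF ch1[OF m]]]) (use va in simp)
  have 4: "vge (- \<nu>) (t s * poly E (- dg m))"
    by (rule vge_mult'[OF t_s_ge teich[OF m]]) (use va in simp)
  have "poly (g s) (- dg m) - (a * \<kappa> - \<rho> * psi0) * t (m # s) =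
     (coeff (J m s) 0 + coeff (H (m # s)) 0 - a * coeff (P (m # s)) 0)
     - (coeff (H (m # s)) 0 - \<rho> * psi0 * t (m # s)) + a * (coeff (P (m # s)) 0 - \<kappa> * t (m # s))
     - t s * poly E (- dg m)"
    unfolding J by (simp add: algebra_simps)
  then show ?thesis using vge_diff[OF vge_add[OF vge_diff[OF 1 2] 3] 4] by simp
qed

text \<open>The linear coefficient of the same relation. The derivative of E at a node is -1 modulo
  w, so \<open>t s\<close> enters with factor -w.\<close>

lemma cong1: assumes m: "m \<in> R"
  shows "vge 0 ((a + \<rho> * psi1) * t (m # s) - w * t s + w * tay (g s) (- dg m) 1)"
proof -
  define z where "z = of_nat q * (- dg m) ^ (q - 1)"
  have "coeff (J m s) 1 = w * (tay (g s) (- dg m) 1 + t s * tay E (- dg m) 1)"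
    unfolding coeff_J by (subst P_split) (simp add: tay_add tay_smult)
  also have "tay E (- dg m) 1 = z - 1" by (simp add: tay_E z_def)
  finally have J: "coeff (J m s) 1 = w * tay (g s) (- dg m) 1 + w * (z * t s) - w * t s"
    by (simp add: algebra_simps)
  have z: "vge 1 z" unfolding z_def
    using vge_mult[OF vge_q vge_power0, of "- dg m" "q - 1"] dg_int[OF m] by simp
  have 1: "vge 0 (coeff (J m s) 1 + coeff (H (m # s)) 1 - a * coeff (P (m # s)) 1)"
    by (rule eqc[OF m s])
  have 2: "vge 0 (coeff (H (m # s)) 1 - \<rho> * psi1 * t (m # s))"
    using H_cong(2)[OF ch1[OF m] ch2[OF m]] .
  have 3: "vge 0 (a * coeff (g (m # s)) 1)"
    by (rule vge_mult'[OF vge_exact[OF va(1)] good_g(1)[OF ch1[OF m]]]) auto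
  have 4: "vge 0 (w * (z * t s))"
    by (rule vge_mult'[OF vge_exact[OF vw'] vge_mult[OF z t_s_ge]]) simp
  have "(a + \<rho> * psi1) * t (m # s) - w * t s + w * tay (g s) (- dg m) 1 =
     (coeff (J m s) 1 + coeff (H (m # s)) 1 - a * coeff (P (m # s)) 1)
     - (coeff (H (m # s)) 1 - \<rho> * psi1 * t (m # s)) + a * coeff (g (m # s)) 1 - w * (z * t s)"
    unfolding J coeff_P01 by (simp add: algebra_simps)
  then show ?thesis using vge_diff[OF vge_add[OF vge_diff[OF 1 2] 3] 4] by simp
qed

text \<open>Comparing two children removes \<open>w * t s\<close> from \<open>cong1\<close> and the
  unknown constant from \<open>cong0\<close>. If g s differs from a constant by at least x in
  valuation, \<open>cong1\<close> bounds the difference of t at the two children by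
  \<open>min 0 (1 + x) - \<nu>\<close>, and \<open>cong0\<close> turns this into a bound improved by
  2 - 2 \<nu>.\<close>

lemma g_variation: "\<exists>c. pge (- \<nu>) (g s - [:c:])"
proof -
  have "R \<noteq> {}" using R q2 by auto
  then obtain m1 where m1: "m1 \<in> R" by blast
  define c where "c = poly (g s) (- dg m1)"
  define G where "G = g s - [:c:]"
  have tG: "tay G x 1 = tay (g s) x 1" for x by (simp add: G_def tay_diff, simp add: tay_def pcompose_pCons)
  have "pge (- \<nu>) G"
  proof (rule bootstrap[where \<delta> = "2 - 2 * \<nu>" and ?x0.0 = "- 2" and Q = "\<lambda>x. pge x G"])
    have "vge (- 2) c" unfolding c_def using vge_poly[OF g_s_ge] dg_int m1 by simp
    then show "pge (- 2) G" unfolding G_def using g_s_ge by (intro pge_diff) auto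
    fix x assume x: "x \<le> - \<nu>" "pge x G"
    show "pge (min (- \<nu>) (x + (2 - 2 * \<nu>))) G"
    proof (rule interpolate[of _ 1])
      have "degree G \<le> q - 1" unfolding G_def using degree_g[of s] q2 by (intro degree_diff_le) auto
      then show "degree G < 1 * q" using q2 by simp
      fix m j assume m: "m \<in> R" and j: "j < (1::nat)"
      let ?D = "t (m # s) - t (m1 # s)"
      have ty: "vge (1 + x) (w * tay (g s) (- dg m) 1)" if "m \<in> R" for m
        using vge_mult[OF vge_exact[OF vw'] vge_tay[OF x(2)], of "- dg m" 1] dg_int[OF that] tG by simp
      have c1: "vge (min 0 (1 + x)) ((a + \<rho> * psi1) * t (m # s) - w * t s)" if "m \<in> R" for m
      proof -
        have "vge (min 0 (1 + x)) ((a + \<rho> * psi1) * t (m # s) - w * t s + w * tay (g s) (- dg m) 1)"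
          by (rule vge_mono[OF cong1[OF that]]) simp
        moreover have "vge (min 0 (1 + x)) (w * tay (g s) (- dg m) 1)" by (rule vge_mono[OF ty[OF that]]) simp
        ultimately show ?thesis using vge_diff by fastforce
      qed
      have "vge (min 0 (1 + x)) ((a + \<rho> * psi1) * ?D)"
        using vge_diff[OF c1[OF m] c1[OF m1]] by (simp add: algebra_simps)
      then have D: "vge (min 0 (1 + x) - \<nu>) ?D" using vge_cancel[OF v_aplus] by simp
      have *: "vge (min (- \<nu>) (x + (2 - 2 * \<nu>))) ((a * \<kappa> - \<rho> * psi0) * ?D)"
        by (rule vge_mult'[OF mid_ge D]) (use va in auto)
      have "vge (- \<nu>) ((poly (g s) (- dg m) - (a * \<kappa> - \<rho> * psi0) * t (m # s)) -
          (poly (g s) (- dg m1) - (a * \<kappa> - \<rho> * psi0) * t (m1 # s)))"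
        using vge_diff[OF cong0[OF m] cong0[OF m1]] .
      then have "vge (min (- \<nu>) (x + (2 - 2 * \<nu>))) ((poly (g s) (- dg m) - (a * \<kappa> - \<rho> * psi0) * t (m # s)) -
          (poly (g s) (- dg m1) - (a * \<kappa> - \<rho> * psi0) * t (m1 # s)))"
        by (rule vge_mono) simp
      from vge_add[OF this *] have "vge (min (- \<nu>) (x + (2 - 2 * \<nu>))) (poly G (- dg m))"
        by (simp add: G_def c_def algebra_simps)
      then show "vge (min (- \<nu>) (x + (2 - 2 * \<nu>))) (tay G (- dg m) j)" using j by (simp add: tay_0)
    qed
  qed (use va in auto)
  then show ?thesis unfolding G_def by blast
qed

lemma g_s_coeff: "vge (- \<nu>) (coeff (g s) 1)" "x \<in> R \<Longrightarrow> vge (- \<nu>) (tay (g s) (- dg x) 1)"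
proof -
  obtain c where c: "pge (- \<nu>) (g s - [:c:])" using g_variation by blast
  then show "vge (- \<nu>) (coeff (g s) 1)" using pge_coeff[OF c, of 1] by simp
  show "vge (- \<nu>) (tay (g s) (- dg x) 1)" if "x \<in> R"
    using vge_tay[OF c, of "- dg x" 1] dg_int[OF that] by (simp add: tay_diff) (simp add: tay_def pcompose_pCons)
qed

lemma cong1': assumes m: "m \<in> R" shows "vge 0 ((a + \<rho> * psi1) * t (m # s) - w * t s)"
proof -
  have "vge 0 (w * tay (g s) (- dg m) 1)"
    by (rule vge_mult'[OF vge_exact[OF vw'] g_s_coeff(2)[OF m]]) (use va in simp)
  then show ?thesis using vge_diff[OF cong1[OF m]] by fastforce
qed

text \<open>So far \<open>t s\<close> is only known to be at least -2. A child improves this: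
  \<open>w * t s\<close> agrees with \<open>(a + \<rho> * psi1) * t (m # s)\<close>, which is at
  least -\<nu>. The result is the input of \<open>P_crude\<close> one level up.\<close>

lemma aP_s: "vge (- 2) (a * coeff (P s) 0)" "vge (- 1) (a * coeff (P s) 1)"
proof -
  show "vge (- 2) (a * coeff (P s) 0)"
    by (rule vge_mult'[OF vge_exact[OF va(1)] pge_coeff[OF P_s_ge]]) (use va in simp)
  have "R \<noteq> {}" using R q2 by auto
  then obtain m where m: "m \<in> R" by blast
  have "vge (- \<nu>) ((a + \<rho> * psi1) * t (m # s))"
    by (rule vge_mult'[OF vge_exact[OF v_aplus] good_t[OF ch1[OF m]]]) simp
  moreover have "vge (- \<nu>) ((a + \<rho> * psi1) * t (m # s) - w * t s)"
    by (rule vge_mono[OF cong1'[OF m]]) (use va in simp)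
  ultimately have "vge (- \<nu>) (w * t s)" using vge_cong_diff by blast
  then have "vge (- \<nu> - 1) (t s)" using vge_cancel[OF vw'] by simp
  then have "vge (- \<nu> - 1) (coeff (P s) 1)"
    unfolding coeff_P01 by (intro vge_diff vge_mono[OF g_s_coeff(1)]) auto
  then show "vge (- 1) (a * coeff (P s) 1)" by (rule vge_mult'[OF vge_exact[OF va(1)]]) simp
qed

end

text \<open>The coefficient of X^q at \<open>m0 # s0\<close> involves the parent s0. To bound
  \<open>P s0\<close>, all children x # s0 and the two generations below them are needed, not only
  those below m0. Elimination as in \<open>inv_step_r0\<close> gives \<open>t\<close>, the equation
  of \<rho> then gives the ratio to the children, and interpolation of the constant coefficients
  gives \<kappa>.\<close>

lemma good_step:
  assumes s: "m0 \<in> R" "s0 \<in> lists R"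
    and c1: "\<And>x m. x \<in> R \<Longrightarrow> m \<in> R \<Longrightarrow> good (m # x # s0)"
    and c2: "\<And>x m l. x \<in> R \<Longrightarrow> m \<in> R \<Longrightarrow> l \<in> R \<Longrightarrow> good (l # m # x # s0)"
  shows "good (m0 # s0)"
proof -
  let ?s = "m0 # s0"
  have sR: "x # s0 \<in> lists R" if "x \<in> R" for x using s that by simp
  have A: "vge (- \<nu>) (poly (g ?s) (- dg m) - (a * \<kappa> - \<rho> * psi0) * t (m # ?s))" if "m \<in> R" for m
    by (rule cong0[OF sR[OF s(1)] _ _ that]) (use s c1 c2 in auto)
  have B: "vge 0 ((a + \<rho> * psi1) * t (m # ?s) - w * t ?s)" if "m \<in> R" for m
    by (rule cong1'[OF sR[OF s(1)] _ _ that]) (use s c1 c2 in auto)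
  have "pge (- 2) (P s0)"
    using aP_s[OF sR c1 c2] by (intro P_crude[OF s(2) _ c1]) auto
  then have "vge (- 2 + real q) (coeff (J m0 s0) q)" using coeff_J_ge s by blast
  then have "vge 0 (coeff (J m0 s0) q)" by (rule vge_mono) (use q2 in simp)
  then have q: "vge 0 (a * t ?s - (\<Sum>m\<in>R. t (m # ?s)))"
    using cong_aP[OF s, of 0 q] coeff_H_top[of ?s] by (simp add: t_def kq)
  \<comment> \<open>(a + \<rho> psi1) times the congruence \<open>q\<close> plus the sum of
    \<open>B\<close> over all letters.\<close>
  have "vge 0 ((a * a + (a * \<rho> * psi1 - of_nat q * w)) * t ?s)"
  proof -
    have "vge 0 ((a + \<rho> * psi1) * (a * t ?s - (\<Sum>m\<in>R. t (m # ?s))))"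
      by (rule vge_mult'[OF vge_exact[OF v_aplus] q]) (use va in simp)
    moreover have "vge 0 (\<Sum>m\<in>R. (a + \<rho> * psi1) * t (m # ?s) - w * t ?s)" using B by (intro vge_sum)
    moreover have "(a * a + (a * \<rho> * psi1 - of_nat q * w)) * t ?s =
       (a + \<rho> * psi1) * (a * t ?s - (\<Sum>m\<in>R. t (m # ?s))) + (\<Sum>m\<in>R. (a + \<rho> * psi1) * t (m # ?s) - w * t ?s)"
      by (simp add: sum_subtractf sum_distrib_left sum.distrib R algebra_simps)
    ultimately show ?thesis by (simp only: vge_add)
  qed
  moreover have "v (a * a + (a * \<rho> * psi1 - of_nat q * w)) = ereal (2 * \<nu>)"
  proof (rule v_add_dominant[of _ _ 2])
    show "v (a * a) = ereal (2 * \<nu>)" using va by (simp add: v_mult)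
    have "v (a * \<rho>) = ereal 1" using va v\<rho> by (simp add: v_mult)
    then show "vge 2 (a * \<rho> * psi1 - of_nat q * w)"
      using vge_mult[OF vge_exact psi1_ge, of "a * \<rho>" 1] vge_mult[OF vge_q vge_exact[OF vw']]
      by (intro vge_diff) auto
    show "2 * \<nu> < 2" using va by simp
  qed
  ultimately have ts: "vge (- 2 * \<nu>) (t ?s)" using vge_cancel by fastforce
  have C: "vge (- \<nu>) (t (m # ?s) - \<rho> * t ?s)" if m: "m \<in> R" for m
  proof -
    have "vge 0 ((w - \<rho> * (a + \<rho> * psi1)) * t ?s)"
    proof (rule vge_mult'[OF _ ts])
      show "vge (2 * \<nu>) (w - \<rho> * (a + \<rho> * psi1))" using \<rho>_eq vge_minus[of _ "w - \<rho> * (a + \<rho> * psi1)"] by simp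
    qed simp
    from vge_add[OF B[OF m] this] have "vge 0 ((a + \<rho> * psi1) * (t (m # ?s) - \<rho> * t ?s))"
      by (simp add: algebra_simps)
    then show ?thesis using vge_cancel[OF v_aplus, of 0] by simp
  qed
  have "pge (- \<nu>) (g ?s - [:\<kappa> * t ?s:])"
  proof (rule interpolate[of _ 1])
    have "degree (g ?s - [:\<kappa> * t ?s:]) \<le> q - 1" using degree_g[of ?s] q2 by (intro degree_diff_le) auto
    then show "degree (g ?s - [:\<kappa> * t ?s:]) < 1 * q" using q2 by simp
    fix m j assume m: "m \<in> R" and j: "j < (1::nat)"
    have "vge (- \<nu>) ((a * \<kappa> - \<rho> * psi0) * (t (m # ?s) - \<rho> * t ?s))"
      by (rule vge_mult'[OF mid_ge C[OF m]]) (use va in simp)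
    from vge_add[OF A[OF m] this]
    have "vge (- \<nu>) (poly (g ?s) (- dg m) - (a * \<kappa> - \<rho> * psi0) * \<rho> * t ?s)" by (simp add: algebra_simps)
    then show "vge (- \<nu>) (tay (g ?s - [:\<kappa> * t ?s:]) (- dg m) j)" using j by (simp add: \<kappa>_eq tay_0)
  qed
  then show ?thesis using ts C by (simp add: good_def)
qed

lemma bound:
  assumes s: "s \<in> lists R"
  shows "pge (- 2) (P s)"
proof -
  have "\<forall>m\<in>R. \<forall>s\<in>lists R. M \<le> length s + i \<longrightarrow> good (m # s)" for i
  proof (induction i)
    case 0
    then show ?case using suppP by (auto simp: good_def g_def t_def)
  next
    case (Suc i)
    show ?case
    proof (intro ballI impI)
      fix m s assume s: "m \<in> R" "s \<in> lists R" "M \<le> length s + Suc i"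
      show "good (m # s)" by (rule good_step[OF s(1,2)]) (use Suc s in auto)
    qed
  qed
  then have G: "good (m # s)" if "m \<in> R" "s \<in> lists R" for m s using that le_add2 by blast
  show ?thesis by (rule P_s_ge[OF s]) (use G s in auto)
qed

end

section \<open>Local fields and approximate Teichmueller representatives\<close>

lemma Rep_padic_int_of_nat:
  "Rep_padic_int (of_nat m :: 'p::prime_card padic_int) n = int m mod int CARD('p) ^ n"
proof (induction m)
  case 0
  then show ?case by (simp add: zero_padic_int.rep_eq)
next
  case (Suc m)
  then show ?case by (simp add: plus_padic_int.rep_eq one_padic_int.rep_eq mod_simps)
qed

lemma padic_p_neq_0: "(of_nat CARD('p::prime_card) :: 'p padic_int) \<noteq> 0"
proof
  assume "(of_nat CARD('p) :: 'p padic_int) = 0"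
  then have "int CARD('p) mod int CARD('p) ^ 2 = 0"
    using Rep_padic_int_of_nat[where 'p='p, of "CARD('p)" 2] by (simp add: zero_padic_int.rep_eq)
  then have "int CARD('p) ^ 2 dvd int CARD('p)" by (simp add: mod_eq_0_iff_dvd)
  moreover have "1 < int CARD('p)" using prime_gt_1_nat[OF prime_card[where 'a='p]] by simp
  moreover from this have "int CARD('p) * 1 < int CARD('p) * int CARD('p)"
    by (intro mult_strict_left_mono) auto
  ultimately show False using zdvd_imp_le[of "int CARD('p) ^ 2" "int CARD('p)"]
    by (simp add: power2_eq_square)
qed

lemma padic_p_not_unit: "1 + of_nat CARD('p::prime_card) * (x :: 'p padic_int) \<noteq> 0"
proof
  assume "1 + of_nat CARD('p) * x = 0"
  then have "Rep_padic_int (1 + of_nat CARD('p) * x) 1 = 0" by (simp add: zero_padic_int.rep_eq)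
  moreover have "Rep_padic_int (1 + of_nat CARD('p) * x) 1 = 1"
    using prime_gt_1_nat[OF prime_card[where 'a='p]]
    by (simp add: plus_padic_int.rep_eq one_padic_int.rep_eq times_padic_int.rep_eq Rep_padic_int_of_nat mod_simps)
  ultimately show False by simp
qed

lemma is_ring_hom_0: assumes "is_ring_hom f" shows "f 0 = 0"
proof -
  have "f (0 + 0) = f 0 + f 0" using assms unfolding is_ring_hom_def by blast
  then show ?thesis by simp
qed

lemma is_ring_hom_uminus: assumes "is_ring_hom f" shows "f (- x) = - f x"
proof -
  have "f (- x + x) = f (- x) + f x" using assms unfolding is_ring_hom_def by blast
  then have "f (- x) + f x = 0" using is_ring_hom_0[OF assms] by simp
  then show ?thesis by (simp add: eq_neg_iff_add_eq_0)
qed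

lemma is_ring_hom_diff: assumes "is_ring_hom f" shows "f (x - y) = f x - f y"
proof -
  have "f (x + - y) = f x + f (- y)" using assms unfolding is_ring_hom_def by blast
  then show ?thesis using is_ring_hom_uminus[OF assms] by simp
qed

lemma is_ring_hom_power: "is_ring_hom f \<Longrightarrow> f (x ^ n) = f x ^ n"
  by (induction n) (auto simp: is_ring_hom_def)

lemma is_ring_hom_sum: "is_ring_hom f \<Longrightarrow> f (sum g A) = (\<Sum>x\<in>A. f (g x))"
  by (induction A rule: infinite_finite_induct) (auto simp: is_ring_hom_0, auto simp: is_ring_hom_def)

lemma is_ring_hom_of_nat: "is_ring_hom f \<Longrightarrow> f (of_nat n) = of_nat n"
  by (induction n) (auto simp: is_ring_hom_0, auto simp: is_ring_hom_def)

lemma is_ring_hom_eq_0: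
  fixes f :: "'a::field \<Rightarrow> 'b::field"
  assumes "is_ring_hom f" shows "f x = 0 \<longleftrightarrow> x = 0"
proof
  assume "f x = 0"
  show "x = 0"
  proof (rule ccontr)
    assume "x \<noteq> 0"
    then have "f x * f (inverse x) = 1" using assms unfolding is_ring_hom_def by (metis right_inverse)
    then show False using \<open>f x = 0\<close> by simp
  qed
qed (simp add: is_ring_hom_0 assms)

lemma is_ring_hom_inverse:
  fixes f :: "'a::field \<Rightarrow> 'b::field"
  assumes "is_ring_hom f" shows "f (inverse x) = inverse (f x)"
proof (cases "x = 0")
  case True
  then show ?thesis using is_ring_hom_0[OF assms] by simp
next
  case False
  then have "f x * f (inverse x) = 1" using assms unfolding is_ring_hom_def by (metis right_inverse)
  then show ?thesis by (metis inverse_unique)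
qed

lemma is_ring_hom_poly:
  assumes "is_ring_hom h" "f 0 = 0"
  shows "h (poly (map_poly f P) x) = poly (map_poly (\<lambda>c. h (f c)) P) (h x)"
proof (induction P)
  case 0
  then show ?case using is_ring_hom_0[OF assms(1)] by simp
next
  case (pCons a P)
  have "(\<lambda>c. h (f c)) 0 = 0" using assms is_ring_hom_0 by auto
  then show ?case using pCons assms by (simp add: map_poly_pCons) (simp add: is_ring_hom_def)
qed

text \<open>F is measured through the single embedding \<sigma>: integers, units and
  \<open>ord\<close> of F are all expressed by the composite of \<open>vF\<close> with
  \<sigma>.\<close>

locale field_setup = padic_setup \<iota>F \<iota>C \<pi> sq
  for \<iota>F :: "'p::prime_card padic \<Rightarrow> 'f::field" and \<iota>C :: "'p padic \<Rightarrow> 'c::field" and \<pi> sq +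
  fixes vF :: "'c \<Rightarrow> ereal" and \<sigma> :: "'f \<Rightarrow> 'c"
  assumes vF: "is_vF vF" and \<sigma>S: "\<sigma> \<in> S"
begin

sublocale vf: valued_field vF
  using vF unfolding is_vF_def by unfold_locales blast+

lemma vF_int: "x \<in> integers \<iota>C \<longleftrightarrow> vf.vge 0 x"
  using vF unfolding is_vF_def vf.vge_def zero_ereal_def by simp

lemma vF_\<pi>: "\<tau> \<in> S \<Longrightarrow> vF (\<tau> \<pi>) = ereal 1"
  using vF unfolding is_vF_def one_ereal_def by simp

lemma \<sigma>_hom: "is_ring_hom \<sigma>" and \<sigma>_\<iota>: "\<sigma> (\<iota>F x) = \<iota>C x"
  using \<sigma>S by (auto simp: embeddings_def)

lemma \<sigma>_simps [simp]:
  "\<sigma> 0 = 0" "\<sigma> 1 = 1" "\<sigma> (x + y) = \<sigma> x + \<sigma> y" "\<sigma> (x * y) = \<sigma> x * \<sigma> y" "\<sigma> (- x) = - \<sigma> x"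
  "\<sigma> (x - y) = \<sigma> x - \<sigma> y" "\<sigma> (x ^ n) = \<sigma> x ^ n" "\<sigma> (inverse x) = inverse (\<sigma> x)"
  "\<sigma> (x / y) = \<sigma> x / \<sigma> y" "\<sigma> (of_nat n) = of_nat n" "\<sigma> x = 0 \<longleftrightarrow> x = 0"
proof -
  note h = \<sigma>_hom
  show "\<sigma> (x / y) = \<sigma> x / \<sigma> y"
    unfolding divide_inverse using h is_ring_hom_inverse[OF h] by (simp add: is_ring_hom_def)
qed (use \<sigma>_hom in \<open>auto simp: is_ring_hom_0 is_ring_hom_uminus is_ring_hom_diff is_ring_hom_power
    is_ring_hom_inverse is_ring_hom_of_nat is_ring_hom_eq_0\<close>, (auto simp: is_ring_hom_def)[3])

definition vg :: "real \<Rightarrow> 'f \<Rightarrow> bool" where "vg c x \<longleftrightarrow> vf.vge c (\<sigma> x)"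

text \<open>An embedding is injective and carries a monic equation over the p-adic integers to one
  with the same coefficients, so integrality can be tested in C.\<close>

lemma int_iff: "x \<in> integers \<iota>F \<longleftrightarrow> vg 0 x"
proof -
  have hF: "is_ring_hom \<iota>F" using finite_extension_F by (simp add: finite_extension_def)
  have "(\<iota>F (Fract 0 1)) = 0" using is_ring_hom_0[OF hF] by (simp add: Zero_fract_def[symmetric])
  then have "\<sigma> (poly (map_poly (\<lambda>c. \<iota>F (Fract c 1)) P) x) = poly (map_poly (\<lambda>c. \<iota>C (Fract c 1)) P) (\<sigma> x)" for P
    using is_ring_hom_poly[OF \<sigma>_hom, of "\<lambda>c. \<iota>F (Fract c 1)" P x] \<sigma>_\<iota> by simp
  then have "poly (map_poly (\<lambda>c. \<iota>F (Fract c 1)) P) x = 0 \<longleftrightarrow> poly (map_poly (\<lambda>c. \<iota>C (Fract c 1)) P) (\<sigma> x) = 0" for P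
    by (metis \<sigma>_simps(11))
  then have "x \<in> integers \<iota>F \<longleftrightarrow> \<sigma> x \<in> integers \<iota>C" by (simp add: integers_def)
  then show ?thesis by (simp add: vF_int vg_def)
qed

lemma unit_iff: "x \<in> integer_units \<iota>F \<longleftrightarrow> vF (\<sigma> x) = 0"
proof
  assume "x \<in> integer_units \<iota>F"
  then obtain y where y: "vg 0 x" "vg 0 y" "x * y = 1" by (auto simp: integer_units_def int_iff)
  then have "vF (\<sigma> x) + vF (\<sigma> y) = 0" by (metis \<sigma>_simps(2,4) vf.v_1 vf.v_mult)
  then show "vF (\<sigma> x) = 0" using y unfolding vg_def vf.vge_def
    by (metis add_nonneg_eq_0_iff zero_ereal_def)
next
  assume x: "vF (\<sigma> x) = 0"
  then have "\<sigma> x \<noteq> 0" by auto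
  then have "x \<noteq> 0" by simp
  have "vF (\<sigma> (inverse x)) = 0" using vf.v_inverse[of "\<sigma> x" 0] x by (simp add: zero_ereal_def)
  then have "vg 0 x" "vg 0 (inverse x)" "x * inverse x = 1"
    using x \<open>x \<noteq> 0\<close> by (auto simp: vg_def vf.vge_def zero_ereal_def)
  then show "x \<in> integer_units \<iota>F" by (auto simp: integer_units_def int_iff)
qed

lemma v\<pi>: "vF (\<sigma> \<pi>) = ereal 1" using vF_\<pi> \<sigma>S by simp

lemma \<pi>_nz [simp]: "\<pi> \<noteq> 0" using v\<pi> by auto

text \<open>Discreteness: a nonunit is a multiple of the uniformizer, which excludes values strictly
  between 0 and 1.\<close>

lemma nonunit: assumes "vg 0 x" "vF (\<sigma> x) \<noteq> 0" shows "vg 1 x"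
proof -
  have "x \<in> integers \<iota>F - integer_units \<iota>F" using assms by (simp add: int_iff unit_iff)
  then have "x \<in> {\<pi> * y |y. y \<in> integers \<iota>F}" using uniformizer unfolding uniformizer_def by (simp only:)
  then obtain y where "x = \<pi> * y" "vg 0 y" by (auto simp: int_iff)
  then show ?thesis using vf.vge_mult[OF vf.vge_exact[OF v\<pi>], of 0 "\<sigma> y"] by (simp add: vg_def)
qed

lemma \<sigma>_powi: "\<sigma> (x powi n) = \<sigma> x powi n"
  by (cases n rule: int_cases2) (auto simp: power_int_minus)

lemma v_powi: "vF x = ereal c \<Longrightarrow> vF (x powi n) = ereal (c * real_of_int n)"
proof (cases n rule: int_cases2)
  case (nonneg m)
  then show "vF x = ereal c \<Longrightarrow> vF (x powi n) = ereal (c * real_of_int n)" using vf.v_power[of x c m] by simp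
next
  case (nonpos m)
  then show "vF x = ereal c \<Longrightarrow> vF (x powi n) = ereal (c * real_of_int n)"
    using vf.v_inverse[OF vf.v_power[of x c m]] by (simp add: power_int_minus)
qed

lemma v_decomp:
  assumes "x \<noteq> 0"
  shows "\<exists>n u. u \<in> integer_units \<iota>F \<and> x = \<pi> powi n * u \<and> vF (\<sigma> x) = ereal (real_of_int n)"
proof -
  obtain c where c: "vF (\<sigma> x) = ereal c" using vf.v_finite[of "\<sigma> x"] assms by auto
  define n where "n = \<lfloor>c\<rfloor>"
  define u where "u = \<pi> powi (- n) * x"
  have vu: "vF (\<sigma> u) = ereal (c - real_of_int n)"
    unfolding u_def using v_powi[OF v\<pi>, of "- n"] c by (simp add: vf.v_mult \<sigma>_powi)
  have "vg 0 u" unfolding vg_def vf.vge_def vu using n_def by simp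
  moreover have "\<not> vg 1 u" unfolding vg_def vf.vge_def vu using n_def by (simp add: not_le) linarith
  ultimately have u0: "vF (\<sigma> u) = 0" using nonunit by blast
  have "x = \<pi> powi n * u" unfolding u_def by (simp add: power_int_minus)
  moreover have "c = real_of_int n" using vu u0 by (simp add: zero_ereal_def)
  ultimately show ?thesis using u0 c unit_iff by blast
qed

lemma ord_eq: assumes "x \<noteq> 0" shows "vF (\<sigma> x) = ereal (real_of_int (ord \<iota>F \<pi> x))"
proof -
  obtain n u where n: "u \<in> integer_units \<iota>F" "x = \<pi> powi n * u" "vF (\<sigma> x) = ereal (real_of_int n)"
    using v_decomp[OF assms] by blast
  have "ord \<iota>F \<pi> x = n"
    unfolding ord_def
  proof (rule the_equality)
    show "\<exists>u\<in>integer_units \<iota>F. x = \<pi> powi n * u" using n by blast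
    fix m assume "\<exists>u\<in>integer_units \<iota>F. x = \<pi> powi m * u"
    then obtain u' where "u' \<in> integer_units \<iota>F" "x = \<pi> powi m * u'" by blast
    then have "vF (\<sigma> x) = ereal (real_of_int m)"
      using v_powi[OF v\<pi>, of m] by (simp add: unit_iff \<sigma>_powi vf.v_mult)
    then show "m = n" using n by simp
  qed
  then show ?thesis using n by simp
qed

lemma ord_mult: "x \<noteq> 0 \<Longrightarrow> y \<noteq> 0 \<Longrightarrow> ord \<iota>F \<pi> (x * y) = ord \<iota>F \<pi> x + ord \<iota>F \<pi> y"
  using ord_eq[of x] ord_eq[of y] ord_eq[of "x * y"] by (simp add: vf.v_mult flip: of_int_add)

lemma ord_\<pi>: "ord \<iota>F \<pi> \<pi> = 1"
  using ord_eq[of \<pi>] v\<pi> by simp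

lemma ord_unit: "vF (\<sigma> x) = 0 \<Longrightarrow> ord \<iota>F \<pi> x = 0"
  using ord_eq[of x] by (cases "x = 0") (auto simp: zero_ereal_def)

text \<open>If p had valuation 0 then 1/p would be integral. Multiplying its monic equation of
  degree n by p^n gives 1 + p x = 0 with a p-adic integer x, which fails modulo p.\<close>

lemma of_nat_p: "(of_nat CARD('p) :: 'f) \<noteq> 0" "vf.vge 1 (of_nat CARD('p))"
proof -
  define j where "j = (\<lambda>c :: 'p padic_int. \<iota>F (Fract c 1))"
  have hF: "is_ring_hom \<iota>F" using finite_extension_F by (simp add: finite_extension_def)
  have j: "is_ring_hom j"
  proof -
    have F: "Fract (x + y) 1 = Fract x 1 + Fract y 1" "Fract (x * y) 1 = Fract x 1 * Fract y 1"
      for x y :: "'p padic_int" by simp_all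
    show ?thesis using hF unfolding j_def is_ring_hom_def F One_fract_def[symmetric] by blast
  qed
  have j0: "j x = 0 \<longleftrightarrow> x = 0" for x
    unfolding j_def using is_ring_hom_eq_0[OF hF, of "Fract x 1"] by (simp add: Zero_fract_def eq_fract)
  show nz: "(of_nat CARD('p) :: 'f) \<noteq> 0"
    using j0[of "of_nat CARD('p)"] padic_p_neq_0 is_ring_hom_of_nat[OF j] by auto
  have "vF (\<sigma> (of_nat CARD('p))) \<noteq> 0"
  proof
    assume "vF (\<sigma> (of_nat CARD('p))) = 0"
    then have "vF (\<sigma> (inverse (of_nat CARD('p)))) = 0"
      using vf.v_inverse[of "\<sigma> (of_nat CARD('p))" 0] by (simp add: zero_ereal_def)
    then have "inverse (of_nat CARD('p)) \<in> integers \<iota>F"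
      by (simp add: int_iff vg_def vf.vge_def zero_ereal_def)
    then obtain P :: "'p padic_int poly" where P: "lead_coeff P = 1"
      "poly (map_poly j P) (inverse (of_nat CARD('p))) = 0"
      unfolding integers_def j_def by blast
    define n where "n = degree P"
    define p where "p = (of_nat CARD('p) :: 'f)"
    have dm: "degree (map_poly j P) = n" "\<And>i. coeff (map_poly j P) i = j (coeff P i)"
      using j0 is_ring_hom_0[OF j] by (auto simp: n_def coeff_map_poly degree_map_poly)
    have "0 = p ^ n * poly (map_poly j P) (inverse p)" using P by (simp add: p_def)
    also have "\<dots> = (\<Sum>i\<le>n. j (coeff P i) * p ^ (n - i))"
      unfolding poly_altdef dm sum_distrib_left
    proof (rule sum.cong)
      fix i assume "i \<in> {..n}"
      then have "p ^ n = p ^ (n - i) * p ^ i" by (simp flip: power_add)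
      then show "p ^ n * (j (coeff P i) * inverse p ^ i) = j (coeff P i) * p ^ (n - i)"
        using nz by (simp add: p_def power_inverse)
    qed simp
    also have "\<dots> = j (\<Sum>i\<le>n. coeff P i * of_nat CARD('p) ^ (n - i))"
    proof -
      have "j (c * of_nat CARD('p) ^ m) = j c * p ^ m" for c m
      proof -
        have "j (c * of_nat CARD('p) ^ m) = j c * j (of_nat CARD('p) ^ m)"
          using j unfolding is_ring_hom_def by blast
        then show ?thesis by (simp only: is_ring_hom_power[OF j] is_ring_hom_of_nat[OF j] p_def)
      qed
      then show ?thesis by (simp add: is_ring_hom_sum[OF j])
    qed
    finally have "(\<Sum>i\<le>n. coeff P i * of_nat CARD('p) ^ (n - i)) = 0" using j0 by simp
    moreover have "(\<Sum>i\<le>n. coeff P i * of_nat CARD('p) ^ (n - i)) =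
        1 + of_nat CARD('p) * (\<Sum>i<n. coeff P i * of_nat CARD('p) ^ (n - Suc i))"
    proof -
      have "coeff P i * of_nat CARD('p) ^ (n - i) = of_nat CARD('p) * (coeff P i * of_nat CARD('p) ^ (n - Suc i))"
        if "i < n" for i
      proof -
        have "n - i = Suc (n - Suc i)" using that by simp
        then show ?thesis by (simp add: mult_ac)
      qed
      then have "(\<Sum>i<n. coeff P i * of_nat CARD('p) ^ (n - i)) =
          of_nat CARD('p) * (\<Sum>i<n. coeff P i * of_nat CARD('p) ^ (n - Suc i))"
        unfolding sum_distrib_left by (intro sum.cong) auto
      then show ?thesis using P(1) by (simp add: n_def lessThan_Suc_atMost[symmetric])
    qed
    ultimately show False
      using padic_p_not_unit[of "\<Sum>i<n. coeff P i * of_nat CARD('p) ^ (n - Suc i)"] by (simp only:)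
  qed
  moreover have "vg 0 (of_nat CARD('p))" by (simp add: vg_def)
  ultimately have "vg 1 (of_nat CARD('p))" using nonunit by blast
  then show "vf.vge 1 (of_nat CARD('p))" by (simp add: vg_def)
qed

lemma vF_p: "vF (of_nat CARD('p)) = ereal (real (ramification_index \<iota>F \<pi>))"
proof -
  have "vF (of_nat CARD('p)) = ereal (real_of_int (ord \<iota>F \<pi> (of_nat CARD('p))))"
    using ord_eq[OF of_nat_p(1)] by simp
  moreover have "0 \<le> ord \<iota>F \<pi> (of_nat CARD('p))"
    using of_nat_p(2) calculation unfolding vf.vge_def by simp
  ultimately show ?thesis by (simp add: ramification_index_def)
qed

end

section \<open>Residue systems and approximate Teichmueller lifts\<close>

context field_setup
begin

definition residue_system :: "'f set \<Rightarrow> bool" where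
  "residue_system R \<longleftrightarrow> finite R \<and> card R = residue_card \<iota>F \<pi> \<and> (\<forall>x\<in>R. vg 0 x) \<and>
     (\<forall>x\<in>R. \<forall>y\<in>R. x \<noteq> y \<longrightarrow> vF (\<sigma> (x - y)) = 0) \<and>
     (\<forall>x. vg 0 x \<longrightarrow> (\<exists>l\<in>R. vg 1 (x - l)))"

lemma residue_systemD:
  assumes "residue_system R"
  shows "finite R" "card R = residue_card \<iota>F \<pi>" "\<And>x. x \<in> R \<Longrightarrow> vg 0 x"
    "\<And>x y. x \<in> R \<Longrightarrow> y \<in> R \<Longrightarrow> x \<noteq> y \<Longrightarrow> vF (\<sigma> (x - y)) = 0"
    "\<And>x. vg 0 x \<Longrightarrow> \<exists>l\<in>R. vg 1 (x - l)"
  using assms unfolding residue_system_def by blast+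

lemma vg_add: "vg c x \<Longrightarrow> vg c y \<Longrightarrow> vg c (x + y)"
  by (simp add: vg_def vf.vge_add)

lemma vg_diff: "vg c x \<Longrightarrow> vg c y \<Longrightarrow> vg c (x - y)"
  by (simp add: vg_def vf.vge_diff)

lemma vg_mult: "vg c x \<Longrightarrow> vg d y \<Longrightarrow> vg (c + d) (x * y)"
  by (simp add: vg_def vf.vge_mult)

lemma vg_mono: "vg c x \<Longrightarrow> d \<le> c \<Longrightarrow> vg d x"
  using vf.vge_mono by (auto simp: vg_def)

lemma vg_0_simps [simp]: "vg c 0" "vg 0 1" "vg c (- x) \<longleftrightarrow> vg c x"
  by (auto simp: vg_def)

lemma vg_power0: "vg 0 x \<Longrightarrow> vg 0 (x ^ n)"
  by (simp add: vg_def vf.vge_power0)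

lemma vg_prod: "(\<And>x. x \<in> A \<Longrightarrow> vg 0 (g x)) \<Longrightarrow> vg 0 (prod g A)"
proof (induction A rule: infinite_finite_induct)
  case (insert x A)
  then show ?case using vg_mult[of 0 "g x" 0 "prod g A"] by simp
qed simp_all

lemma \<pi>_ideal: "(\<exists>y. vg 0 y \<and> x = \<pi> * y) \<longleftrightarrow> vg 1 x"
proof
  assume "\<exists>y. vg 0 y \<and> x = \<pi> * y"
  then show "vg 1 x" using vf.vge_mult[OF vf.vge_exact[OF v\<pi>], of 0] by (auto simp: vg_def)
next
  assume "vg 1 x"
  then have "vg 0 (x / \<pi>)" using vf.vge_divide[OF _ v\<pi>, of 1 "\<sigma> x"] by (simp add: vg_def)
  then show "\<exists>y. vg 0 y \<and> x = \<pi> * y" by (intro exI[of _ "x / \<pi>"]) auto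
qed

lemma coset_eq_iff:
  assumes "vg 0 x" "vg 0 y"
  shows "{x + \<pi> * z |z. z \<in> integers \<iota>F} = {y + \<pi> * z |z. z \<in> integers \<iota>F} \<longleftrightarrow> vg 1 (x - y)"
proof -
  have c: "{x + \<pi> * z |z. z \<in> integers \<iota>F} = {u. vg 1 (u - x)}" for x
  proof -
    have "u \<in> {x + \<pi> * z |z. z \<in> integers \<iota>F} \<longleftrightarrow> vg 1 (u - x)" for u
    proof
      assume "u \<in> {x + \<pi> * z |z. z \<in> integers \<iota>F}"
      then obtain z where "u = x + \<pi> * z" "vg 0 z" using int_iff by blast
      then show "vg 1 (u - x)" using \<pi>_ideal[of "u - x"] by auto
    next
      assume "vg 1 (u - x)"
      then obtain y where y: "vg 0 y" "u - x = \<pi> * y" using \<pi>_ideal[of "u - x"] by blast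
      then have "u = x + \<pi> * y" by (metis add.commute diff_add_cancel)
      then show "u \<in> {x + \<pi> * z |z. z \<in> integers \<iota>F}" using y int_iff by blast
    qed
    then show ?thesis by blast
  qed
  show ?thesis unfolding c
  proof
    assume "{u. vg 1 (u - x)} = {u. vg 1 (u - y)}"
    moreover have "x \<in> {u. vg 1 (u - x)}" by simp
    ultimately show "vg 1 (x - y)" by blast
  next
    assume *: "vg 1 (x - y)"
    have "vg 1 (u - x) \<longleftrightarrow> vg 1 (u - y)" for u
      using vg_add[of 1 "u - x" "x - y"] vg_diff[of 1 "u - y" "x - y"] * by auto
    then show "{u. vg 1 (u - x)} = {u. vg 1 (u - y)}" by blast
  qed
qed

lemma unit_of_not_vg1: "vg 0 x \<Longrightarrow> \<not> vg 1 x \<Longrightarrow> vF (\<sigma> x) = 0"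
  using nonunit by blast

lemma not_vg1_of_unit: "vF (\<sigma> x) = 0 \<Longrightarrow> \<not> vg 1 x"
  by (simp add: vg_def vf.vge_def zero_ereal_def)

lemma residue_system_exists:
  assumes "0 < residue_card \<iota>F \<pi>"
  shows "\<exists>R. residue_system R"
proof -
  define c where "c = (\<lambda>x. {x + \<pi> * y |y. y \<in> integers \<iota>F})"
  have card: "card (c ` integers \<iota>F) = residue_card \<iota>F \<pi>" by (simp add: residue_card_def c_def)
  \<comment> \<open>An infinite set would have \<open>card\<close> equal to 0.\<close>
  then have fin: "finite (c ` integers \<iota>F)" using assms by (intro card_ge_0_finite) simp
  define R where "R = inv_into (integers \<iota>F) c ` (c ` integers \<iota>F)"
  have inj: "inj_on (inv_into (integers \<iota>F) c) (c ` integers \<iota>F)" by (rule inj_on_inv_into) simp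
  have c_iff: "c x = c y \<longleftrightarrow> vg 1 (x - y)" if "vg 0 x" "vg 0 y" for x y
    using coset_eq_iff[OF that] by (simp only: c_def)
  have R_int: "vg 0 x" if x: "x \<in> R" for x
  proof -
    obtain X where X: "X \<in> c ` integers \<iota>F" "x = inv_into (integers \<iota>F) c X"
      using x unfolding R_def by blast
    show ?thesis using inv_into_into[OF X(1)] X(2) by (simp add: int_iff)
  qed
  have cR: "x = y" if xy: "x \<in> R" "y \<in> R" "c x = c y" for x y
  proof -
    obtain X where X: "X \<in> c ` integers \<iota>F" "x = inv_into (integers \<iota>F) c X"
      using xy(1) unfolding R_def by blast
    obtain Y where Y: "Y \<in> c ` integers \<iota>F" "y = inv_into (integers \<iota>F) c Y"
      using xy(2) unfolding R_def by blast
    have "c x = X" "c y = Y" using f_inv_into_f X Y by metis+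
    then show ?thesis using X Y xy(3) by simp
  qed
  have "residue_system R" unfolding residue_system_def
  proof (intro conjI ballI impI allI)
    show "finite R" using fin by (simp add: R_def)
    show "card R = residue_card \<iota>F \<pi>" using card_image[OF inj] card by (simp add: R_def)
    show "vg 0 x" if "x \<in> R" for x using that by (rule R_int)
    show "vF (\<sigma> (x - y)) = 0" if xy: "x \<in> R" "y \<in> R" "x \<noteq> y" for x y
    proof (rule unit_of_not_vg1)
      have i: "vg 0 x" "vg 0 y" using xy R_int by auto
      then show "vg 0 (x - y)" by (rule vg_diff)
      show "\<not> vg 1 (x - y)" using c_iff[OF i] cR[OF xy(1,2)] xy(3) by blast
    qed
    show "\<exists>l\<in>R. vg 1 (x - l)" if "vg 0 x" for x
    proof
      have x: "x \<in> integers \<iota>F" using that int_iff by blast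
      let ?l = "inv_into (integers \<iota>F) c (c x)"
      show l: "?l \<in> R" unfolding R_def by (intro imageI x)
      have "c ?l = c x" by (rule f_inv_into_f) (rule imageI[OF x])
      then show "vg 1 (x - ?l)" using c_iff[OF that R_int[OF l]] by simp
    qed
  qed
  then show ?thesis by blast
qed

lemma residue_system_unique:
  assumes "residue_system R" "l \<in> R" "m \<in> R" "vg 1 (x - l)" "vg 1 (x - m)"
  shows "l = m"
proof (rule ccontr)
  assume "l \<noteq> m"
  then have "\<not> vg 1 (l - m)" using assms not_vg1_of_unit unfolding residue_system_def by blast
  then show False using vg_diff[OF assms(5,4)] by simp
qed

text \<open>Multiplication by a unit permutes the nonzero residue classes; compare the products over
  all of them.\<close>

lemma fermat:
  assumes R: "residue_system R" and x: "vg 0 x" and q: "2 \<le> residue_card \<iota>F \<pi>"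
  shows "vg 1 (x ^ residue_card \<iota>F \<pi> - x)"
proof (cases "vg 1 x")
  case True
  have "vg 1 (x * x ^ n)" for n using vg_mult[OF True vg_power0[OF x]] by simp
  then have "vg 1 (x ^ residue_card \<iota>F \<pi>)" using q by (cases "residue_card \<iota>F \<pi>") auto
  then show ?thesis using True by (rule vg_diff)
next
  case False
  let ?q = "residue_card \<iota>F \<pi>"
  define N where "N = {l \<in> R. \<not> vg 1 l}"
  have finR: "finite R" and Rint: "\<And>l. l \<in> R \<Longrightarrow> vg 0 l" using R by (auto simp: residue_system_def)
  obtain z where z: "z \<in> R" "vg 1 z"
  proof -
    have "\<exists>l\<in>R. vg 1 (0 - l)" using R unfolding residue_system_def using vg_0_simps(1) by blast
    then show ?thesis using that by auto
  qed
  have "R - {z} = N"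
  proof -
    have "l = z" if "l \<in> R" "vg 1 l" for l
      using residue_system_unique[OF R that(1) z(1), of 0] that z by simp
    then show ?thesis using z unfolding N_def by blast
  qed
  then have cardN: "card N = ?q - 1" using R z finR by (auto simp: residue_system_def card_Diff_singleton)
  have vx: "vF (\<sigma> x) = 0" using unit_of_not_vg1 x False by blast
  define f where "f = (\<lambda>l. SOME m. m \<in> R \<and> vg 1 (x * l - m))"
  have f: "f l \<in> R" "vg 1 (x * l - f l)" if "l \<in> R" for l
  proof -
    have "vg 0 (x * l)" using vg_mult[OF x Rint[OF that]] by simp
    then have "\<exists>m. m \<in> R \<and> vg 1 (x * l - m)" using R unfolding residue_system_def by blast
    from someI_ex[OF this] show "f l \<in> R" "vg 1 (x * l - f l)" by (auto simp: f_def)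
  qed
  have fN: "f l \<in> N" if "l \<in> N" for l
  proof -
    have l: "l \<in> R" "vF (\<sigma> l) = 0" using that Rint unit_of_not_vg1 by (auto simp: N_def)
    have "vF (\<sigma> (x * l)) = 0" using vx l by (simp add: vf.v_mult)
    then have "\<not> vg 1 (x * l)" by (rule not_vg1_of_unit)
    then have "\<not> vg 1 (f l)" using vg_add[OF f(2)[OF l(1)], of "f l"] by auto
    then show ?thesis using f l by (simp add: N_def)
  qed
  have inj: "inj_on f N"
  proof (rule inj_onI, rule ccontr)
    fix l m assume lm: "l \<in> N" "m \<in> N" "f l = f m" "l \<noteq> m"
    then have R': "l \<in> R" "m \<in> R" by (auto simp: N_def)
    have "vg 1 (x * l - f l - (x * m - f m))" by (rule vg_diff) (use f R' in auto)
    then have "vg 1 (x * (l - m))" using lm by (simp add: algebra_simps)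
    moreover have "vF (\<sigma> (l - m)) = 0" using R R' lm by (simp add: residue_system_def)
    then have "vF (\<sigma> (x * (l - m))) = 0" using vx by (simp add: vf.v_mult)
    ultimately show False using not_vg1_of_unit by blast
  qed
  have finN: "finite N" using finR by (simp add: N_def)
  have "f ` N = N" using fN inj finN by (simp add: endo_inj_surj image_subsetI)
  then have "prod (\<lambda>l. l) N = prod (\<lambda>l. f l) N" using prod.reindex[OF inj, of "\<lambda>l. l"] by simp
  moreover have "vg 1 (prod (\<lambda>l. x * l) A - prod (\<lambda>l. f l) A)" if "A \<subseteq> N" for A
    using finite_subset[OF that finN] that
  proof (induction A rule: finite_induct)
    case (insert l A)
    have l: "l \<in> R" "vg 0 (f l)" using insert f Rint by (auto simp: N_def)
    have A: "vg 0 (prod (\<lambda>l. x * l) A)"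
    proof -
      have "vg 0 (x * l)" if "l \<in> A" for l using vg_mult[OF x Rint, of l] that insert by (auto simp: N_def)
      then show ?thesis by (rule vg_prod)
    qed
    have "prod (\<lambda>l. x * l) (insert l A) - prod (\<lambda>l. f l) (insert l A) =
       (x * l - f l) * prod (\<lambda>l. x * l) A + f l * (prod (\<lambda>l. x * l) A - prod (\<lambda>l. f l) A)"
      using insert by (simp add: algebra_simps)
    moreover have "vg 1 ((x * l - f l) * prod (\<lambda>l. x * l) A)" using vg_mult[OF f(2)[OF l(1)] A] by simp
    moreover have "vg 1 (f l * (prod (\<lambda>l. x * l) A - prod (\<lambda>l. f l) A))"
      using vg_mult[OF l(2), of 1] insert by simp
    ultimately show ?case by (simp only: vg_add)
  qed simp
  then have "vg 1 (prod (\<lambda>l. x * l) N - prod (\<lambda>l. f l) N)" by simp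
  moreover have "prod (\<lambda>l. x * l) N = x ^ (?q - 1) * prod (\<lambda>l. l) N"
    by (simp add: prod.distrib cardN)
  ultimately have "vg 1 ((x ^ (?q - 1) - 1) * prod (\<lambda>l. l) N)" by (simp add: algebra_simps)
  moreover have "vF (\<sigma> (prod (\<lambda>l. l) A)) = ereal 0" if "A \<subseteq> N" for A
    using finite_subset[OF that finN] that
  proof (induction A rule: finite_induct)
    case (insert l A)
    then have "vF (\<sigma> l) = 0" using Rint unit_of_not_vg1 by (auto simp: N_def)
    with insert show ?case by (simp add: vf.v_mult zero_ereal_def)
  qed (simp add: zero_ereal_def)
  then have "vF (\<sigma> (prod (\<lambda>l. l) N)) = ereal 0" by blast
  ultimately have "vg 1 (x ^ (?q - 1) - 1)"
    using vf.vge_cancel[of "\<sigma> (prod (\<lambda>l. l) N)" 0 1 "\<sigma> (x ^ (?q - 1) - 1)"] by (simp add: vg_def mult.commute)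
  then have "vg 1 ((x ^ (?q - 1) - 1) * x)" using vg_mult[OF _ x, of 1] by simp
  moreover have "(x ^ (?q - 1) - 1) * x = x ^ ?q - x" using q by (cases ?q) (auto simp: algebra_simps)
  ultimately show ?thesis by simp
qed

text \<open>Modulo \<open>\<pi>\<close>, the polynomial \<open>(X + 1)\<^sup>q - X\<^sup>q - 1\<close> has degree less than \<open>q\<close> and vanishes at all
  \<open>q\<close> residues.\<close>
lemma p_dvd_choose_q:
  assumes q: "2 \<le> residue_card \<iota>F \<pi>" and i: "0 < i" "i < residue_card \<iota>F \<pi>"
  shows "CARD('p) dvd (residue_card \<iota>F \<pi> choose i)"
proof (rule ccontr)
  let ?q = "residue_card \<iota>F \<pi>"
  assume nd: "\<not> CARD('p) dvd (?q choose i)"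
  have "0 < ?q" using q by simp
  then obtain R where R: "residue_system R" using residue_system_exists by blast
  define D where "D = [:1, 1:] ^ ?q - monom 1 ?q - (1 :: 'c poly)"
  have cD: "coeff D j = (if 0 < j \<and> j < ?q then of_nat (?q choose j) else 0)" for j
  proof -
    have 1: "coeff D j = of_nat (?q choose j) - (if ?q = j then 1 else 0) - (if j = 0 then 1 else 0)"
      unfolding D_def coeff_diff coeff_X_plus_power by (simp add: coeff_1)
    consider "j = 0" | "0 < j" "j < ?q" | "j = ?q" | "?q < j" by linarith
    then show ?thesis
    proof cases
      case 4
      then have z: "?q choose j = 0" by (rule binomial_eq_0)
      have "coeff D j = 0" using 1 4 unfolding z by simp
      then show ?thesis using 4 by simp
    qed (use 1 q in auto)
  qed
  have "degree D \<le> ?q - 1" by (rule degree_le) (auto simp: cD)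
  then have deg: "degree D < ?q" using q by simp
  have inj: "inj_on \<sigma> R"
  proof (rule inj_onI)
    fix x y assume "\<sigma> x = \<sigma> y"
    then have "\<sigma> (x - y) = 0" by simp
    then have "x - y = 0" by (simp only: \<sigma>_simps(11))
    then show "x = y" by simp
  qed
  have "vf.pge 1 D"
  proof (rule vf.hermite[where N = "\<sigma> ` R" and m = "\<lambda>_. 1"])
    show "finite (\<sigma> ` R)" using R by (simp add: residue_system_def)
    show "vf.vge 0 x" if "x \<in> \<sigma> ` R" for x using that R by (auto simp: residue_system_def vg_def)
    show "vF (x - y) = 0" if xy: "x \<in> \<sigma> ` R" "y \<in> \<sigma> ` R" "x \<noteq> y" for x y
    proof -
      obtain l m where lm: "l \<in> R" "m \<in> R" "x = \<sigma> l" "y = \<sigma> m" using xy by auto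
      then have "l \<noteq> m" using xy by auto
      then have "vF (\<sigma> (l - m)) = 0" using residue_systemD(4)[OF R lm(1,2)] by simp
      then show ?thesis using lm by simp
    qed
    show "D = 0 \<or> degree D < sum (\<lambda>_. 1) (\<sigma> ` R)"
      using deg R by (simp add: card_image[OF inj] residue_system_def)
    fix x j assume "x \<in> \<sigma> ` R" "j < (1::nat)"
    then obtain l where l: "l \<in> R" "x = \<sigma> l" "j = 0" by auto
    then have l0: "vg 0 l" using R by (auto simp: residue_system_def)
    have "vg 1 ((l + 1) ^ ?q - (l + 1) - (l ^ ?q - l))"
      by (rule vg_diff[OF fermat[OF R _ q] fermat[OF R l0 q]]) (use vg_add[OF l0, of 1] in simp)
    moreover have "poly D x = \<sigma> ((l + 1) ^ ?q - (l + 1) - (l ^ ?q - l))"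
      by (simp add: D_def l(2) poly_monom) (simp add: add.commute)
    ultimately show "vf.vge 1 (vf.tay D x j)" using l by (simp add: vf.tay_0 vg_def)
  qed
  then have "vf.vge 1 (coeff D i)" by (rule vf.pge_coeff)
  then have "vf.vge 1 (of_nat (?q choose i))" using cD[of i] i by simp
  moreover have "vF (of_nat (?q choose i)) = 0"
    using vf.v_of_nat_not_dvd[OF prime_card of_nat_p(2) nd] .
  ultimately show False by (simp add: vf.vge_def)
qed

text \<open>A q-th power improves a congruence by one unit: the inner binomial coefficients are
  divisible by p, and h^q has valuation at least 2 c, which is at least c + 1.\<close>

lemma power_q_cong:
  assumes q: "2 \<le> residue_card \<iota>F \<pi>" and b: "vg 0 b" and h: "vg c h" "1 \<le> c"
  shows "vg (c + 1) ((b + h) ^ residue_card \<iota>F \<pi> - b ^ residue_card \<iota>F \<pi>)"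
proof -
  let ?q = "residue_card \<iota>F \<pi>"
  have "(b + h) ^ ?q - b ^ ?q = (\<Sum>i\<in>{1..?q}. of_nat (?q choose i) * (h ^ i * b ^ (?q - i)))"
  proof -
    have "(h + b) ^ ?q = (\<Sum>i\<le>?q. of_nat (?q choose i) * h ^ i * b ^ (?q - i))" by (rule binomial_ring)
    also have "\<dots> = b ^ ?q + (\<Sum>i\<in>{1..?q}. of_nat (?q choose i) * h ^ i * b ^ (?q - i))"
      by (subst atMost_atLeast0, subst sum.atLeast_Suc_atMost) auto
    finally show ?thesis by (simp add: add.commute mult.assoc)
  qed
  moreover have "vg (c + 1) (of_nat (?q choose i) * (h ^ i * b ^ (?q - i)))" if i: "i \<in> {1..?q}" for i
  proof -
    have h0: "vg 0 h" using h vg_mono by fastforce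
    have hi: "vg c (h ^ i * b ^ (?q - i))"
    proof -
      obtain i' where "i = Suc i'" using i by (cases i) auto
      then have "vg c (h ^ i)" using vg_mult[OF h(1) vg_power0[OF h0]] by simp
      then show ?thesis using vg_mult[OF _ vg_power0[OF b], of c] by simp
    qed
    show ?thesis
    proof (cases "i = ?q")
      case True
      define i' where "i' = i - 2"
      have i': "i = Suc (Suc i')" using q True by (simp add: i'_def)
      have "vg (c + (c + 0)) (h * (h * h ^ i'))" by (intro vg_mult h vg_power0 h0)
      then have "vg (c + 1) (h ^ i)" using i' h by (auto intro: vg_mono)
      then show ?thesis using True by simp
    next
      case False
      then have "CARD('p) dvd (?q choose i)" using p_dvd_choose_q[OF q, of i] i by simp
      then obtain z where "?q choose i = CARD('p) * z" by blast
      then have "vg 1 (of_nat (?q choose i))"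
        using vf.vge_mult[OF of_nat_p(2) vf.vge_of_nat[of z]] by (simp add: vg_def)
      then show ?thesis using vg_mult[OF _ hi] by (simp add: add.commute)
    qed
  qed
  moreover have "vg (c + 1) (\<Sum>i\<in>{1..?q}. g i)" if "\<And>i. i \<in> {1..?q} \<Longrightarrow> vg (c + 1) (g i)" for g
    using that vf.vge_sum[of "{1..?q}" "c + 1" "\<lambda>i. \<sigma> (g i)"]
    by (simp add: vg_def is_ring_hom_sum[OF \<sigma>_hom])
  ultimately show ?thesis by (simp only:)
qed

text \<open>The q^n-th powers of arbitrary representatives: every further q-th power gains one unit,
  and a fixed finite precision is enough, so no limit is taken.\<close>

lemma teichmuller_system:
  assumes q: "2 \<le> residue_card \<iota>F \<pi>"
  shows "\<exists>R. residue_system R \<and> (\<forall>l\<in>R. vg (real n + 1) (l ^ residue_card \<iota>F \<pi> - l))"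
proof -
  let ?q = "residue_card \<iota>F \<pi>"
  have "0 < ?q" using q by simp
  then obtain R where R: "residue_system R" using residue_system_exists by blast
  have pw: "x ^ ?q ^ Suc m = (x ^ ?q ^ m) ^ ?q" for x :: 'f and m
    by (simp only: power_Suc2 power_mult)
  have step: "vg (real n + 1) (x ^ ?q ^ Suc n - x ^ ?q ^ n)" if x: "vg 0 x" for x n
  proof (induction n)
    case 0
    then show ?case using fermat[OF R x q] by simp
  next
    case (Suc n)
    have "vg (real n + 1 + 1) ((x ^ ?q ^ n + (x ^ ?q ^ Suc n - x ^ ?q ^ n)) ^ ?q - (x ^ ?q ^ n) ^ ?q)"
      by (rule power_q_cong[OF q vg_power0[OF x] Suc]) simp
    moreover have "x ^ ?q ^ n + (x ^ ?q ^ Suc n - x ^ ?q ^ n) = x ^ ?q ^ Suc n" by simp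
    ultimately have "vg (real n + 1 + 1) (x ^ ?q ^ Suc (Suc n) - x ^ ?q ^ Suc n)"
      by (simp only: pw)
    then show ?case by (simp only: of_nat_Suc add.commute add.left_commute)
  qed
  have close: "vg 1 (x ^ ?q ^ n - x)" if x: "vg 0 x" for x n
  proof (induction n)
    case (Suc n)
    have "vg 1 (x ^ ?q ^ Suc n - x ^ ?q ^ n)" by (rule vg_mono[OF step[OF x]]) simp
    from vg_add[OF this Suc] show ?case by simp
  qed simp
  define f where "f = (\<lambda>x::'f. x ^ ?q ^ n)"
  define R' where "R' = f ` R"
  have Rint: "vg 0 x" if "x \<in> R" for x using R that by (auto simp: residue_system_def)
  have cl: "vg 1 (f x - x)" if "x \<in> R" for x using close[OF Rint[OF that]] by (simp add: f_def)
  have diff: "vF (\<sigma> (f x - f y)) = 0" if xy: "x \<in> R" "y \<in> R" "x \<noteq> y" for x y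
  proof -
    have "vF (\<sigma> (x - y)) = ereal 0" using R xy by (auto simp: residue_system_def zero_ereal_def)
    moreover have "vg 1 ((f x - x) - (f y - y))" by (rule vg_diff) (use cl xy in auto)
    ultimately have "vF (\<sigma> (x - y) + \<sigma> ((f x - x) - (f y - y))) = ereal 0"
      by (intro vf.v_add_dominant[of _ _ 1]) (auto simp: vg_def)
    then show ?thesis by (simp add: zero_ereal_def)
  qed
  have inj: "inj_on f R"
  proof (rule inj_onI, rule ccontr)
    fix x y assume "x \<in> R" "y \<in> R" "f x = f y" "x \<noteq> y"
    with diff[of x y] show False by simp
  qed
  have "residue_system R'" unfolding residue_system_def
  proof (intro conjI ballI impI allI)
    show "finite R'" "card R' = ?q" using R card_image[OF inj] by (auto simp: residue_system_def R'_def)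
    show "vg 0 x" if "x \<in> R'" for x using that Rint by (auto simp: R'_def f_def intro: vg_power0)
    show "vF (\<sigma> (x - y)) = 0" if "x \<in> R'" "y \<in> R'" "x \<noteq> y" for x y
      using that diff by (auto simp: R'_def)
    show "\<exists>l\<in>R'. vg 1 (x - l)" if x: "vg 0 x" for x
    proof -
      obtain l where l: "l \<in> R" "vg 1 (x - l)" using R x by (auto simp: residue_system_def)
      have "vg 1 (x - l - (f l - l))" by (rule vg_diff) (use l cl in auto)
      then show ?thesis using l by (auto simp: R'_def)
    qed
  qed
  moreover have "vg (real n + 1) (l ^ ?q - l)" if l: "l \<in> R'" for l
  proof -
    obtain x where x: "x \<in> R" "l = f x" using l by (auto simp: R'_def)
    then show ?thesis using step[OF Rint[OF x(1)], of n] unfolding f_def pw by simp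
  qed
  ultimately show ?thesis by blast
qed

text \<open>The interpolation nodes are the negatives of the letters, so E has to be small at -l.
  For odd q this is the same as smallness at l, for even q it is not; negating the whole system
  settles both cases.\<close>

lemma residue_system_uminus:
  assumes "residue_system R" shows "residue_system (uminus ` R)"
  unfolding residue_system_def
proof (intro conjI ballI impI allI)
  show "finite (uminus ` R)" "card (uminus ` R) = residue_card \<iota>F \<pi>"
    using assms by (auto simp: residue_system_def card_image)
  show "vg 0 x" if "x \<in> uminus ` R" for x using that assms by (auto simp: residue_system_def)
  show "vF (\<sigma> (x - y)) = 0" if xy: "x \<in> uminus ` R" "y \<in> uminus ` R" "x \<noteq> y" for x y
  proof -
    obtain l m where lm: "l \<in> R" "m \<in> R" "x = - l" "y = - m" using xy by auto
    then have "vF (\<sigma> (m - l)) = 0" using assms xy unfolding residue_system_def by auto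
    then show ?thesis using lm by simp
  qed
  show "\<exists>l\<in>uminus ` R. vg 1 (x - l)" if "vg 0 x" for x
  proof -
    have "\<exists>l\<in>R. vg 1 (- x - l)" using assms that by (simp add: residue_system_def)
    then obtain l where l: "l \<in> R" "vg 1 (- x - l)" by blast
    have "vg 1 (- (- x - l))" using l by (simp only: vg_0_simps)
    then show ?thesis using l(1) by (auto simp: add.commute)
  qed
qed

end

section \<open>The representation in one variable\<close>

lemma poly_mapping_eq_sum_single:
  "P = (\<Sum>m\<in>Poly_Mapping.keys P. Poly_Mapping.single m (Poly_Mapping.lookup P m))"
proof (rule poly_mapping_eqI)
  fix m
  have "(\<Sum>x\<in>Poly_Mapping.keys P. Poly_Mapping.lookup P x when x = m) = Poly_Mapping.lookup P m"
    by (cases "m \<in> Poly_Mapping.keys P") (auto simp: when_def in_keys_iff)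
  then show "Poly_Mapping.lookup P m =
      Poly_Mapping.lookup (\<Sum>m\<in>Poly_Mapping.keys P. Poly_Mapping.single m (Poly_Mapping.lookup P m)) m"
    by (simp add: lookup_sum lookup_single)
qed

lemma lookup_mscale: "Poly_Mapping.lookup (mscale c P) m = c * Poly_Mapping.lookup P m"
  unfolding mscale_def mult_map_scale_conv_mult[symmetric] by (simp add: Poly_Mapping.map.rep_eq when_def)

lemma mscale_simps: "mscale 1 P = P" "mscale 0 P = 0" "mscale c 0 = 0"
  "mscale c (P + Q) = mscale c P + mscale c Q" "mscale c (mscale d P) = mscale (c * d) P"
  "mscale (c + d) P = mscale c P + mscale d P"
  by (rule poly_mapping_eqI, simp add: lookup_mscale lookup_add algebra_simps)+

locale poly_weight = field_setup \<iota>F \<iota>C \<pi> sq vF \<sigma>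
  for \<iota>F :: "'p::prime_card padic \<Rightarrow> 'f::field" and \<iota>C :: "'p padic \<Rightarrow> 'c::field" and \<pi> sq vF \<sigma> +
  fixes k :: "('f \<Rightarrow> 'c) \<Rightarrow> nat"
  assumes k0: "\<And>\<tau>. \<tau> \<in> S \<Longrightarrow> \<tau> \<noteq> \<sigma> \<Longrightarrow> k \<tau> = 0"
begin

abbreviation n :: nat where "n \<equiv> k \<sigma>"

text \<open>The number of embeddings is the degree of the extension, which is positive, and a set of
  positive \<open>card\<close> is finite.\<close>

lemma finite_S: "finite S"
proof -
  have hF: "is_ring_hom \<iota>F" using finite_extension_F by (simp add: finite_extension_def)
  have h: "\<iota>F (x + y) = \<iota>F x + \<iota>F y" "\<iota>F (x * y) = \<iota>F x * \<iota>F y" "\<iota>F 1 = 1" for x y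
    using hF unfolding is_ring_hom_def by blast+
  interpret vs: vector_space "\<lambda>c x. \<iota>F c * x"
    by unfold_locales (simp_all only: h distrib_left distrib_right mult.assoc mult_1)
  obtain A where A: "finite A" "vs.span A = UNIV"
    using finite_extension_F unfolding finite_extension_def by blast
  obtain B where B: "B \<subseteq> UNIV" "vs.independent B" "UNIV \<subseteq> vs.span B" "card B = vs.dim UNIV"
    using vs.basis_exists by blast
  have "finite B" using vs.independent_span_bound[OF A(1) B(2)] A(2) by auto
  moreover have "B \<noteq> {}"
  proof
    assume "B = {}"
    moreover have "(1::'f) \<in> vs.span B" using B(3) by blast
    ultimately show False by simp
  qed
  ultimately have "0 < vs.dim UNIV" using B(4) by (metis card_gt_0_iff)
  then have "0 < card S" using card_embeddings by (simp add: ext_degree_def)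
  then show ?thesis by (rule card_ge_0_finite)
qed

definition ydeg :: "(('f \<Rightarrow> 'c) xyvar \<Rightarrow>\<^sub>0 nat) \<Rightarrow> nat" where
  "ydeg m = Poly_Mapping.lookup m (Yv \<sigma>)"

text \<open>Dehomogenization: \<open>x\<^sub>\<sigma>\<close> becomes \<open>1\<close> and \<open>y\<^sub>\<sigma>\<close> the variable.\<close>
definition ev :: "('f \<Rightarrow> 'c, 'c) mpoly \<Rightarrow> 'c poly" where
  "ev P = (\<Sum>m\<in>Poly_Mapping.keys P. monom (Poly_Mapping.lookup P m) (ydeg m))"

lemma ev_superset:
  assumes "finite A" "Poly_Mapping.keys P \<subseteq> A"
  shows "ev P = (\<Sum>m\<in>A. monom (Poly_Mapping.lookup P m) (ydeg m))"
  unfolding ev_def using assms by (intro sum.mono_neutral_left) (auto simp: in_keys_iff)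

lemma ev_add: "ev (P + Q) = ev P + ev Q"
proof -
  let ?A = "Poly_Mapping.keys P \<union> Poly_Mapping.keys Q"
  have f: "finite ?A" by simp
  show ?thesis
    using ev_superset[OF f, of P] ev_superset[OF f, of Q] ev_superset[OF f keys_add]
    by (simp add: lookup_add add_monom[symmetric] sum.distrib)
qed

lemma ev_0 [simp]: "ev 0 = 0" by (simp add: ev_def)

lemma ev_sum: "ev (sum f A) = (\<Sum>x\<in>A. ev (f x))"
  by (induction A rule: infinite_finite_induct) (auto simp: ev_add)

lemma ev_single: "ev (Poly_Mapping.single m c) = monom c (ydeg m)"
  by (cases "c = 0") (auto simp: ev_def)

lemma ydeg_add: "ydeg (m + m') = ydeg m + ydeg m'"
  by (simp add: ydeg_def lookup_add)

lemma ev_mult: "ev (P * Q) = ev P * ev Q"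
proof -
  have "ev (P * Q) = ev ((\<Sum>m\<in>Poly_Mapping.keys P. Poly_Mapping.single m (Poly_Mapping.lookup P m)) *
      (\<Sum>m\<in>Poly_Mapping.keys Q. Poly_Mapping.single m (Poly_Mapping.lookup Q m)))"
    by (simp flip: poly_mapping_eq_sum_single)
  also have "\<dots> = (\<Sum>m\<in>Poly_Mapping.keys P. \<Sum>m'\<in>Poly_Mapping.keys Q.
      monom (Poly_Mapping.lookup P m) (ydeg m) * monom (Poly_Mapping.lookup Q m') (ydeg m'))"
    by (simp add: sum_product ev_sum mult_single ev_single ydeg_add mult_monom)
  also have "\<dots> = ev P * ev Q" by (simp add: ev_def sum_product)
  finally show ?thesis .
qed

lemma ev_1 [simp]: "ev 1 = 1"
  using ev_single[of 0 1] by (simp add: ydeg_def)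

lemma ev_power: "ev (P ^ i) = ev P ^ i"
  by (induction i) (auto simp: ev_mult)

lemma ev_mscale: "ev (mscale c P) = smult c (ev P)"
  unfolding mscale_def ev_mult ev_single by (simp add: ydeg_def monom_0)

lemma ev_minus: "ev (P - Q) = ev P - ev Q"
  using ev_add[of "P - Q" Q] by simp

lemma ev_mvar: "ev (mvar (Xv \<tau>)) = 1" "ev (mvar (Yv \<sigma>)) = [:0, 1:]"
  by (auto simp: mvar_def ev_single ydeg_def lookup_single monom_altdef)

definition mon :: "nat \<Rightarrow> ('f \<Rightarrow> 'c) xyvar \<Rightarrow>\<^sub>0 nat" where
  "mon i = Poly_Mapping.single (Xv \<sigma>) (n - i) + Poly_Mapping.single (Yv \<sigma>) i"

lemma lookup_mon: "Poly_Mapping.lookup (mon i) (Xv \<tau>) = (if \<tau> = \<sigma> then n - i else 0)"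
  "Poly_Mapping.lookup (mon i) (Yv \<tau>) = (if \<tau> = \<sigma> then i else 0)"
  by (auto simp: mon_def lookup_add lookup_single when_def)

text \<open>Degree j is arbitrary, not only k \<sigma>, because the images of monomials are built up
  as products of linear forms.\<close>

definition Wm :: "nat \<Rightarrow> (('f \<Rightarrow> 'c) xyvar \<Rightarrow>\<^sub>0 nat) set" where
  "Wm j = {m. Poly_Mapping.lookup m (Xv \<sigma>) + Poly_Mapping.lookup m (Yv \<sigma>) = j \<and>
     (\<forall>\<tau>. \<tau> \<noteq> \<sigma> \<longrightarrow> Poly_Mapping.lookup m (Xv \<tau>) = 0 \<and> Poly_Mapping.lookup m (Yv \<tau>) = 0)}"

definition W :: "nat \<Rightarrow> ('f \<Rightarrow> 'c, 'c) mpoly set" where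
  "W j = {P. Poly_Mapping.keys P \<subseteq> Wm j}"

lemma monomials_eq: "monomials k = Wm n"
proof (rule set_eqI, rule iffI)
  fix m assume m: "m \<in> monomials k"
  have "Poly_Mapping.lookup m (Xv \<tau>) = 0 \<and> Poly_Mapping.lookup m (Yv \<tau>) = 0" if "\<tau> \<noteq> \<sigma>" for \<tau>
  proof (cases "\<tau> \<in> S")
    case True
    then have "Poly_Mapping.lookup m (Xv \<tau>) + Poly_Mapping.lookup m (Yv \<tau>) = k \<tau>"
      using m by (simp add: monomials_def)
    then show ?thesis using k0[OF True that] by simp
  next
    case False
    then show ?thesis using m by (simp add: monomials_def)
  qed
  then show "m \<in> Wm n" using m \<sigma>S by (simp add: monomials_def Wm_def)
next
  fix m assume m: "m \<in> Wm n"
  have "Poly_Mapping.lookup m (Xv \<tau>) + Poly_Mapping.lookup m (Yv \<tau>) = k \<tau>" if "\<tau> \<in> S" for \<tau>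
    using m k0[OF that] by (cases "\<tau> = \<sigma>") (simp_all add: Wm_def)
  moreover have "Poly_Mapping.lookup m (Xv \<tau>) = 0 \<and> Poly_Mapping.lookup m (Yv \<tau>) = 0" if "\<tau> \<notin> S" for \<tau>
    using m that \<sigma>S by (cases "\<tau> = \<sigma>") (simp_all add: Wm_def)
  ultimately show "m \<in> monomials k" by (simp add: monomials_def)
qed

lemma V_eq: "V k = W n"
  by (simp add: V_def W_def monomials_eq)

lemma Wm_n: "m \<in> Wm n \<Longrightarrow> m = mon (ydeg m) \<and> ydeg m \<le> n"
proof -
  assume m: "m \<in> Wm n"
  have "Poly_Mapping.lookup m x = Poly_Mapping.lookup (mon (ydeg m)) x" for x
    using m by (cases x) (auto simp: lookup_mon Wm_def ydeg_def)
  then have "m = mon (ydeg m)" by (rule poly_mapping_eqI)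
  moreover have "ydeg m \<le> n" using m by (simp add: Wm_def ydeg_def)
  ultimately show ?thesis by (rule conjI)
qed

lemma mon_Wm: "i \<le> n \<Longrightarrow> mon i \<in> Wm n"
  by (auto simp: Wm_def lookup_mon)

lemma ydeg_mon [simp]: "ydeg (mon i) = i" by (simp add: ydeg_def lookup_mon)

lemma V_sum_mon:
  assumes "P \<in> V k" "\<And>m. h m 0 = 0"
  shows "(\<Sum>m\<in>Poly_Mapping.keys P. h m (Poly_Mapping.lookup P m)) = (\<Sum>i\<le>n. h (mon i) (Poly_Mapping.lookup P (mon i)))"
proof -
  have K: "Poly_Mapping.keys P \<subseteq> mon ` {..n}"
    using assms(1) Wm_n unfolding V_eq W_def by blast
  have inj: "inj_on mon {..n}" by (rule inj_onI) (metis ydeg_mon)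
  have "(\<Sum>m\<in>Poly_Mapping.keys P. h m (Poly_Mapping.lookup P m)) = (\<Sum>m\<in>mon ` {..n}. h m (Poly_Mapping.lookup P m))"
    using K assms(2) by (intro sum.mono_neutral_left) (auto simp: in_keys_iff)
  then show ?thesis by (simp add: sum.reindex[OF inj])
qed

lemma coeff_ev: "P \<in> V k \<Longrightarrow> coeff (ev P) i = (if i \<le> n then Poly_Mapping.lookup P (mon i) else 0)"
proof -
  assume P: "P \<in> V k"
  have "ev P = (\<Sum>i\<le>n. monom (Poly_Mapping.lookup P (mon i)) i)"
    unfolding ev_def using V_sum_mon[OF P, of "\<lambda>m c. monom c (ydeg m)"] by simp
  then show ?thesis by (simp add: coeff_sum)
qed

lemma degree_ev: "P \<in> V k \<Longrightarrow> degree (ev P) \<le> n"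
  by (intro degree_le) (auto simp: coeff_ev)

lemma ev_inj:
  assumes "P \<in> V k" "Q \<in> V k" "ev P = ev Q" shows "P = Q"
proof (rule poly_mapping_eqI)
  fix m
  show "Poly_Mapping.lookup P m = Poly_Mapping.lookup Q m"
  proof (cases "m \<in> Wm n")
    case True
    then have m: "m = mon (ydeg m)" "ydeg m \<le> n" using Wm_n by auto
    have "Poly_Mapping.lookup P (mon (ydeg m)) = Poly_Mapping.lookup Q (mon (ydeg m))"
      using coeff_ev[OF assms(1), of "ydeg m"] coeff_ev[OF assms(2), of "ydeg m"] assms(3) m(2) by simp
    then show ?thesis using m(1) by metis
  next
    case False
    then have "m \<notin> Poly_Mapping.keys P" "m \<notin> Poly_Mapping.keys Q"
      using assms(1,2) unfolding V_eq W_def by auto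
    then show ?thesis by (simp add: in_keys_iff)
  qed
qed

lemma V0_iff: "P \<in> V0 k \<longleftrightarrow> P \<in> V k \<and> vf.pge 0 (ev P)"
proof -
  have "(\<forall>m. Poly_Mapping.lookup P m \<in> integers \<iota>C) \<longleftrightarrow> vf.pge 0 (ev P)" if P: "P \<in> V k"
  proof
    assume "\<forall>m. Poly_Mapping.lookup P m \<in> integers \<iota>C"
    then show "vf.pge 0 (ev P)" unfolding vf.pge_def by (auto simp: coeff_ev[OF P] vF_int)
  next
    assume *: "vf.pge 0 (ev P)"
    show "\<forall>m. Poly_Mapping.lookup P m \<in> integers \<iota>C"
    proof
      fix m
      show "Poly_Mapping.lookup P m \<in> integers \<iota>C"
      proof (cases "m \<in> Wm n")
        case True
        then have m: "m = mon (ydeg m)" "ydeg m \<le> n" using Wm_n by auto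
        have "vf.vge 0 (Poly_Mapping.lookup P (mon (ydeg m)))"
          using vf.pge_coeff[OF *, of "ydeg m"] m(2) coeff_ev[OF P] by simp
        then show ?thesis using m(1) by (simp add: vF_int)
      next
        case False
        then have "m \<notin> Poly_Mapping.keys P" using P unfolding V_eq W_def by auto
        then show ?thesis by (simp add: in_keys_iff vF_int)
      qed
    qed
  qed
  then show ?thesis unfolding V0_def by blast
qed

lemma W_add: "P \<in> W j \<Longrightarrow> Q \<in> W j \<Longrightarrow> P + Q \<in> W j"
  unfolding W_def using keys_add[of P Q] by blast

lemma W_0 [simp]: "0 \<in> W j" by (simp add: W_def)

lemma W_sum: "(\<And>x. x \<in> A \<Longrightarrow> f x \<in> W j) \<Longrightarrow> sum f A \<in> W j"
  by (induction A rule: infinite_finite_induct) (auto intro: W_add)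

lemma W_mscale: "P \<in> W j \<Longrightarrow> mscale c P \<in> W j"
proof -
  assume "P \<in> W j"
  moreover have "Poly_Mapping.keys (mscale c P) \<subseteq> Poly_Mapping.keys P"
    by (auto simp: in_keys_iff lookup_mscale)
  ultimately show ?thesis unfolding W_def by blast
qed

lemma W_mult: "P \<in> W i \<Longrightarrow> Q \<in> W j \<Longrightarrow> P * Q \<in> W (i + j)"
proof -
  assume P: "P \<in> W i" "Q \<in> W j"
  have "m + m' \<in> Wm (i + j)" if "m \<in> Wm i" "m' \<in> Wm j" for m m'
    using that by (auto simp: Wm_def lookup_add)
  then show ?thesis using P keys_mult[of P Q] unfolding W_def by blast
qed

lemma W_1 [simp]: "1 \<in> W 0"
proof -
  have "Poly_Mapping.keys (1 :: ('f \<Rightarrow> 'c, 'c) mpoly) \<subseteq> {0}"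
    by (subst single_one[symmetric]) (simp del: single_one)
  then show ?thesis unfolding W_def Wm_def by auto
qed

lemma W_power: "P \<in> W 1 \<Longrightarrow> P ^ i \<in> W i"
proof (induction i)
  case (Suc i)
  then show ?case using W_mult[of P 1 "P ^ i" i] by simp
qed simp

lemma W_mvar: "mvar (Xv \<sigma>) \<in> W 1" "mvar (Yv \<sigma>) \<in> W 1"
  by (auto simp: W_def Wm_def mvar_def lookup_single when_def split: if_splits)

lemma V_add: "P \<in> V k \<Longrightarrow> Q \<in> V k \<Longrightarrow> P + Q \<in> V k"
  and V_0 [simp]: "0 \<in> V k"
  and V_sum: "(\<And>x. x \<in> A \<Longrightarrow> f x \<in> V k) \<Longrightarrow> sum f A \<in> V k"
  and V_mscale: "P \<in> V k \<Longrightarrow> mscale c P \<in> V k"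
  by (simp_all add: V_eq W_add W_sum W_mscale)

lemma V_minus: "P \<in> V k \<Longrightarrow> Q \<in> V k \<Longrightarrow> P - Q \<in> V k"
proof -
  assume P: "P \<in> V k" "Q \<in> V k"
  have e: "P - Q = P + mscale (- 1) Q" by (rule poly_mapping_eqI) (simp add: lookup_add lookup_mscale lookup_minus)
  show ?thesis unfolding e by (intro V_add V_mscale P)
qed

definition lin1 :: "'f^2^2 \<Rightarrow> 'c poly" where "lin1 g = [:\<sigma> (g $ 1 $ 1), \<sigma> (g $ 2 $ 1):]"
definition lin2 :: "'f^2^2 \<Rightarrow> 'c poly" where "lin2 g = [:\<sigma> (g $ 1 $ 2), \<sigma> (g $ 2 $ 2):]"

text \<open>\<open>u\<close> is read as a binary form of degree j, into which A and B are
  substituted for the two variables.\<close>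

definition hmg :: "nat \<Rightarrow> 'c poly \<Rightarrow> 'c poly \<Rightarrow> 'c poly \<Rightarrow> 'c poly" where
  "hmg j u A B = (\<Sum>i\<le>j. smult (coeff u i) (A ^ (j - i) * B ^ i))"

definition act :: "'f^2^2 \<Rightarrow> 'c poly \<Rightarrow> 'c poly" where "act g u = hmg n u (lin1 g) (lin2 g)"

definition sc :: "'f^2^2 \<Rightarrow> 'c" where "sc g = sq \<sigma> powi (- int n * ord \<iota>F \<pi> (det g))"

lemma hmg_add: "hmg j (u + v) A B = hmg j u A B + hmg j v A B"
  by (simp add: hmg_def smult_add_left sum.distrib)

lemma hmg_smult: "hmg j (smult c u) A B = smult c (hmg j u A B)"
  by (simp add: hmg_def poly_eq_iff coeff_sum sum_distrib_left mult.assoc)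

lemma hmg_0: "hmg j 0 A B = 0" by (simp add: hmg_def)

lemma hmg_sum: "hmg j (sum f X) A B = (\<Sum>x\<in>X. hmg j (f x) A B)"
  by (induction X rule: infinite_finite_induct) (auto simp: hmg_add hmg_0)

lemma hmg_Suc:
  assumes "degree u \<le> j"
  shows "hmg (Suc j) ([:x, y:] * u) A B = (smult x A + smult y B) * hmg j u A B"
proof -
  have c: "coeff ([:x, y:] * u) i = x * coeff u i + (if i = 0 then 0 else y * coeff u (i - 1))" for i
  proof -
    have "[:x, y:] * u = smult x u + pCons 0 (smult y u)" by simp
    then show ?thesis by (cases i) simp_all
  qed
  have "hmg (Suc j) ([:x, y:] * u) A B =
     (\<Sum>i\<le>Suc j. smult (x * coeff u i) (A ^ (Suc j - i) * B ^ i)) +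
     (\<Sum>i\<le>Suc j. smult (if i = 0 then 0 else y * coeff u (i - 1)) (A ^ (Suc j - i) * B ^ i))"
    unfolding hmg_def c by (simp only: smult_add_left sum.distrib)
  also have "(\<Sum>i\<le>Suc j. smult (x * coeff u i) (A ^ (Suc j - i) * B ^ i)) = smult x A * hmg j u A B"
  proof -
    have "coeff u (Suc j) = 0" using assms by (intro coeff_eq_0) simp
    then have "(\<Sum>i\<le>Suc j. smult (x * coeff u i) (A ^ (Suc j - i) * B ^ i)) =
       (\<Sum>i\<le>j. smult (x * coeff u i) (A ^ (Suc j - i) * B ^ i))" by simp
    also have "\<dots> = (\<Sum>i\<le>j. smult x A * smult (coeff u i) (A ^ (j - i) * B ^ i))"
      by (intro sum.cong refl) (simp add: Suc_diff_le mult_ac)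
    finally show ?thesis by (simp add: hmg_def sum_distrib_left)
  qed
  also have "(\<Sum>i\<le>Suc j. smult (if i = 0 then 0 else y * coeff u (i - 1)) (A ^ (Suc j - i) * B ^ i)) =
      smult y B * hmg j u A B"
    unfolding hmg_def sum_distrib_left
    by (subst sum.atMost_Suc_shift) (simp add: mult_ac)
  finally show ?thesis by (simp add: algebra_simps)
qed

lemma hmg_powers:
  "hmg (i + j) ([:x, y:] ^ i * [:x', y':] ^ j) A B = (smult x A + smult y B) ^ i * (smult x' A + smult y' B) ^ j"
proof (induction i)
  case 0
  show ?case
  proof (induction j)
    case 0
    show ?case by (simp add: hmg_def)
  next
    case (Suc j)
    have "degree ([:x', y':] ^ j) \<le> j" using degree_power_le[of "[:x', y':]" j] degree_pCons_le[of x' "[:y':]"] by (simp add: le_trans)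
    then show ?case using Suc hmg_Suc[of "[:x', y':] ^ j" j x' y'] by simp
  qed
next
  case (Suc i)
  have d: "degree ([:x, y:] ^ i) \<le> i" for i and x y :: 'c
    using degree_power_le[of "[:x, y:]" i] degree_pCons_le[of x "[:y:]"] by (simp add: le_trans)
  have "degree ([:x, y:] ^ i * [:x', y':] ^ j) \<le> i + j"
    using degree_mult_le[of "[:x, y:] ^ i" "[:x', y':] ^ j"] d[of x y i] d[of x' y' j] by linarith
  from hmg_Suc[OF this, of x y A B] show ?case unfolding power_Suc mult.assoc add_Suc Suc .
qed

lemma lin_mult:
  "lin1 (g ** h) = smult (\<sigma> (h $ 1 $ 1)) (lin1 g) + smult (\<sigma> (h $ 2 $ 1)) (lin2 g)"
  "lin2 (g ** h) = smult (\<sigma> (h $ 1 $ 2)) (lin1 g) + smult (\<sigma> (h $ 2 $ 2)) (lin2 g)"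
  by (simp_all add: lin1_def lin2_def matrix_matrix_mult_def sum_2 mult.commute)

text \<open>Acting by h turns each monomial into a product of n linear forms, on which substitution
  is multiplicative by \<open>hmg_powers\<close>.\<close>

lemma act_mult: "act (g ** h) u = act g (act h u)"
proof -
  have "act g (act h u) = (\<Sum>i\<le>n. smult (coeff u i) (hmg n (lin1 h ^ (n - i) * lin2 h ^ i) (lin1 g) (lin2 g)))"
    unfolding act_def hmg_def[of n u] hmg_sum hmg_smult ..
  also have "\<dots> = (\<Sum>i\<le>n. smult (coeff u i) (lin1 (g ** h) ^ (n - i) * lin2 (g ** h) ^ i))"
  proof (intro sum.cong refl)
    fix i assume "i \<in> {..n}"
    then have "n = (n - i) + i" by simp
    then have "hmg n (lin1 h ^ (n - i) * lin2 h ^ i) (lin1 g) (lin2 g) =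
        lin1 (g ** h) ^ (n - i) * lin2 (g ** h) ^ i"
      using hmg_powers[of "n - i" i] unfolding lin_mult lin1_def[of h] lin2_def[of h] by metis
    then show "smult (coeff u i) (hmg n (lin1 h ^ (n - i) * lin2 h ^ i) (lin1 g) (lin2 g)) =
        smult (coeff u i) (lin1 (g ** h) ^ (n - i) * lin2 (g ** h) ^ i)" by simp
  qed
  finally show ?thesis by (simp add: act_def hmg_def)
qed

lemma act_add: "act g (u + u') = act g u + act g u'"
  by (simp add: act_def hmg_add)

lemma act_smult: "act g (smult c u) = smult c (act g u)"
  by (simp add: act_def hmg_smult)

definition rho_term :: "'f^2^2 \<Rightarrow> (('f \<Rightarrow> 'c) xyvar \<Rightarrow>\<^sub>0 nat) \<Rightarrow> ('f \<Rightarrow> 'c, 'c) mpoly" where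
  "rho_term g m = mscale (sc g)
     ((mscale (\<sigma> (g $ 1 $ 1)) (mvar (Xv \<sigma>)) + mscale (\<sigma> (g $ 2 $ 1)) (mvar (Yv \<sigma>)))
        ^ Poly_Mapping.lookup m (Xv \<sigma>) *
      (mscale (\<sigma> (g $ 1 $ 2)) (mvar (Xv \<sigma>)) + mscale (\<sigma> (g $ 2 $ 2)) (mvar (Yv \<sigma>)))
        ^ Poly_Mapping.lookup m (Yv \<sigma>))"

text \<open>The other embeddings have weight 0 and contribute the factor 1.\<close>

lemma rho_eq:
  assumes "P \<in> V k"
  shows "rho k g P = (\<Sum>m\<in>Poly_Mapping.keys P. mscale (Poly_Mapping.lookup P m) (rho_term g m))"
  unfolding rho_def
proof (intro sum.cong refl)
  fix m assume "m \<in> Poly_Mapping.keys P"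
  then have m: "m \<in> Wm n" using assms unfolding V_eq W_def by auto
  let ?f = "\<lambda>\<sigma>. mscale (sq \<sigma> powi (- int (k \<sigma>) * ord \<iota>F \<pi> (det g)))
           ((mscale (\<sigma> (g $ 1 $ 1)) (mvar (Xv \<sigma>)) + mscale (\<sigma> (g $ 2 $ 1)) (mvar (Yv \<sigma>)))
              ^ Poly_Mapping.lookup m (Xv \<sigma>) *
            (mscale (\<sigma> (g $ 1 $ 2)) (mvar (Xv \<sigma>)) + mscale (\<sigma> (g $ 2 $ 2)) (mvar (Yv \<sigma>)))
              ^ Poly_Mapping.lookup m (Yv \<sigma>))"
  have "?f \<tau> = 1" if "\<tau> \<in> S - {\<sigma>}" for \<tau>
    using that m k0[of \<tau>] by (simp add: Wm_def mscale_simps)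
  then have "prod ?f S = ?f \<sigma>" using finite_S \<sigma>S by (simp add: prod.remove)
  then show "mscale (Poly_Mapping.lookup P m) (prod ?f S) = mscale (Poly_Mapping.lookup P m) (rho_term g m)"
    by (simp add: rho_term_def sc_def)
qed

lemma ev_rho_term: "ev (rho_term g m) = smult (sc g) (lin1 g ^ Poly_Mapping.lookup m (Xv \<sigma>) * lin2 g ^ ydeg m)"
  by (simp add: rho_term_def ev_mscale ev_mult ev_power ev_add ev_mvar lin1_def lin2_def ydeg_def one_pCons)

lemma ev_rho:
  assumes "P \<in> V k" shows "ev (rho k g P) = smult (sc g) (act g (ev P))"
proof -
  have "ev (rho k g P) = (\<Sum>m\<in>Poly_Mapping.keys P. smult (Poly_Mapping.lookup P m)
      (smult (sc g) (lin1 g ^ Poly_Mapping.lookup m (Xv \<sigma>) * lin2 g ^ ydeg m)))"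
    by (simp add: rho_eq[OF assms] ev_sum ev_mscale ev_rho_term)
  also have "\<dots> = (\<Sum>i\<le>n. smult (Poly_Mapping.lookup P (mon i))
      (smult (sc g) (lin1 g ^ (n - i) * lin2 g ^ i)))"
    using V_sum_mon[OF assms, of "\<lambda>m c. smult c (smult (sc g) (lin1 g ^ Poly_Mapping.lookup m (Xv \<sigma>) * lin2 g ^ ydeg m))"]
    by (simp add: lookup_mon)
  also have "\<dots> = smult (sc g) (act g (ev P))"
    by (simp add: act_def hmg_def coeff_ev[OF assms] poly_eq_iff coeff_sum sum_distrib_left mult_ac)
  finally show ?thesis .
qed

lemma rho_V:
  assumes "P \<in> V k" shows "rho k g P \<in> V k"
  unfolding rho_eq[OF assms]
proof (intro V_sum V_mscale)
  fix m assume "m \<in> Poly_Mapping.keys P"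
  then have m: "m \<in> Wm n" using assms unfolding V_eq W_def by auto
  then have e: "n = Poly_Mapping.lookup m (Xv \<sigma>) + Poly_Mapping.lookup m (Yv \<sigma>)" by (simp add: Wm_def)
  have "rho_term g m \<in> W (Poly_Mapping.lookup m (Xv \<sigma>) + Poly_Mapping.lookup m (Yv \<sigma>))"
    unfolding rho_term_def by (intro W_mscale W_mult W_power W_add W_mvar)
  then show "rho_term g m \<in> V k" using e V_eq by simp
qed

lemma rho_add: "P \<in> V k \<Longrightarrow> Q \<in> V k \<Longrightarrow> rho k g (P + Q) = rho k g P + rho k g Q"
  by (rule ev_inj) (auto simp: V_add rho_V ev_rho ev_add act_add smult_add_right)

lemma rho_mscale: "P \<in> V k \<Longrightarrow> rho k g (mscale c P) = mscale c (rho k g P)"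
  by (rule ev_inj) (auto simp: V_mscale rho_V ev_rho ev_mscale act_smult mult.commute)

lemma rho_0 [simp]: "rho k g 0 = 0" by (simp add: rho_def)

end

section \<open>The Hecke operator\<close>

lemma fsum_eq:
  assumes "finite B" "B \<subseteq> A" "\<And>x. x \<in> A - B \<Longrightarrow> h x = 0"
  shows "fsum h A = sum h B"
  unfolding fsum_def using assms by (intro sum.mono_neutral_left) auto

definition mk :: "'f::field \<Rightarrow> 'f \<Rightarrow> 'f \<Rightarrow> 'f \<Rightarrow> 'f^2^2" where
  "mk a b c d = vector [vector [a, b], vector [c, d]]"

lemma mk_nth [simp]: "mk a b c d $ 1 $ 1 = a" "mk a b c d $ 1 $ 2 = b" "mk a b c d $ 2 $ 1 = c" "mk a b c d $ 2 $ 2 = d"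
  by (simp_all add: mk_def)

lemma mk_eta: "(g::'f::field^2^2) = mk (g $ 1 $ 1) (g $ 1 $ 2) (g $ 2 $ 1) (g $ 2 $ 2)"
  by (simp add: vec_eq_iff forall_2)

lemma mk_cases: obtains a b c d where "(g::'f::field^2^2) = mk a b c d"
  using mk_eta by blast

lemma mk_eq_iff: "mk a b c d = mk a' b' c' d' \<longleftrightarrow> a = a' \<and> b = b' \<and> c = c' \<and> d = d'"
  by (auto simp: vec_eq_iff forall_2)

lemma mk_mult: "mk a b c d ** mk a' b' c' d' = mk (a*a' + b*c') (a*b' + b*d') (c*a' + d*c') (c*b' + d*d')"
  by (simp add: vec_eq_iff forall_2 matrix_matrix_mult_def sum_2)

lemma det_mk: "det (mk a b c d) = a * d - b * c"
  by (simp add: det_2)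

lemma mat1_mk: "mat 1 = mk 1 0 0 (1::'f::field)"
  by (simp add: vec_eq_iff forall_2 mat_def)

section \<open>The groups K and KZ and their action\<close>

context poly_weight
begin

lemma G_iff: "g \<in> G \<longleftrightarrow> det g \<noteq> 0"
  by (simp add: G_def invertible_det_nz)

lemma G_mult [intro]: "g \<in> G \<Longrightarrow> h \<in> G \<Longrightarrow> g ** h \<in> G"
  by (simp add: G_iff det_mul)

lemma G_one [simp]: "mat 1 \<in> G" by (simp add: G_iff)

lemma matrix_inv_GL:
  assumes "g \<in> G"
  shows "g ** matrix_inv g = mat 1" "matrix_inv g ** g = mat 1" "matrix_inv g \<in> G"
proof -
  have "\<exists>A'. g ** A' = mat 1 \<and> A' ** g = mat 1" using assms by (auto simp: G_def invertible_def)
  from someI_ex[OF this] show 1: "g ** matrix_inv g = mat 1" "matrix_inv g ** g = mat 1"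
    by (auto simp: matrix_inv_def)
  then show "matrix_inv g \<in> G" unfolding G_def invertible_def by auto
qed

lemma matrix_inv_eq: assumes "g \<in> G" "g ** h = mat 1" shows "matrix_inv g = h"
proof -
  have "matrix_inv g ** (g ** h) = matrix_inv g" using assms(2) by simp
  then show ?thesis using matrix_inv_GL(2)[OF assms(1)] by (simp add: matrix_mul_assoc)
qed

lemma inv_cancel: "g \<in> G \<Longrightarrow> matrix_inv g ** (g ** h) = h" "g \<in> G \<Longrightarrow> g ** (matrix_inv g ** h) = h"
  by (simp_all add: matrix_mul_assoc matrix_inv_GL)

lemma matrix_inv_mult: assumes "g \<in> G" "h \<in> G" shows "matrix_inv (g ** h) = matrix_inv h ** matrix_inv g"
proof (rule matrix_inv_eq)
  show "g ** h \<in> G" using assms by blast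
  show "g ** h ** (matrix_inv h ** matrix_inv g) = mat 1"
    using assms by (simp add: matrix_mul_assoc[symmetric] inv_cancel matrix_inv_GL)
qed

lemma matrix_inv_inv: "g \<in> G \<Longrightarrow> matrix_inv (matrix_inv g) = g"
  by (rule matrix_inv_eq) (auto simp: matrix_inv_GL)

abbreviation scal :: "'f \<Rightarrow> 'f^2^2" where "scal c \<equiv> mk c 0 0 c"

lemma Z_iff: "z \<in> Z \<longleftrightarrow> (\<exists>c. c \<noteq> 0 \<and> z = scal c)"
proof
  assume z: "z \<in> Z"
  obtain a b c d where m: "z = mk a b c d" by (rule mk_cases)
  have "mk 1 1 0 1 \<in> G" "mk 1 0 1 1 \<in> G" by (simp_all add: G_iff det_mk)
  then have "z ** mk 1 1 0 1 = mk 1 1 0 1 ** z" "z ** mk 1 0 1 1 = mk 1 0 1 1 ** z"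
    using z by (auto simp: Z_def)
  then have "c = 0" "a = d" "b = 0" by (auto simp: m mk_mult mk_eq_iff)
  moreover have "det z \<noteq> 0" using z by (simp add: Z_def G_iff)
  ultimately show "\<exists>c. c \<noteq> 0 \<and> z = scal c" using m by (auto simp: det_mk)
next
  assume "\<exists>c. c \<noteq> 0 \<and> z = scal c"
  then obtain c where c: "c \<noteq> 0" "z = scal c" by blast
  have "z ** g = g ** z" for g
  proof -
    obtain x y u t where g: "g = mk x y u t" by (rule mk_cases)
    show ?thesis unfolding g c(2) by (simp add: mk_mult mk_eq_iff mult.commute)
  qed
  then show "z \<in> Z" using c by (simp add: Z_def G_iff det_mk)
qed

lemma scal_comm: "scal c ** g = g ** scal c"
proof -
  obtain x y z t where g: "g = mk x y z t" by (rule mk_cases)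
  show ?thesis unfolding g by (simp add: mk_mult mk_eq_iff mult.commute)
qed

lemma K_mk: "mk a b c d \<in> K \<longleftrightarrow> vg 0 a \<and> vg 0 b \<and> vg 0 c \<and> vg 0 d \<and> vF (\<sigma> (a * d - b * c)) = 0"
  unfolding K_def mem_Collect_eq forall_2 int_iff unit_iff det_mk mk_nth by (simp only: conj_assoc)

lemma K_mult: "g \<in> K \<Longrightarrow> h \<in> K \<Longrightarrow> g ** h \<in> K"
proof -
  assume gh: "g \<in> K" "h \<in> K"
  obtain a b c d where g: "g = mk a b c d" by (rule mk_cases)
  obtain a' b' c' d' where h: "h = mk a' b' c' d'" by (rule mk_cases)
  have "vg 0 (x * y + z * t)" if "vg 0 x" "vg 0 y" "vg 0 z" "vg 0 t" for x y z t
    using vg_add[OF _ vg_mult[OF that(3,4)], of "x * y"] vg_mult[OF that(1,2)] by simp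
  moreover have "vF (\<sigma> (det (g ** h))) = 0"
    using gh by (simp add: det_mul vf.v_mult K_def unit_iff)
  ultimately show ?thesis using gh unfolding g h mk_mult K_mk det_mk by simp
qed

lemma K_G: assumes "g \<in> K" shows "g \<in> G"
proof -
  have "vF (\<sigma> (det g)) = 0" using assms by (simp add: K_def unit_iff)
  then have "det g \<noteq> 0" by auto
  then show ?thesis by (simp add: G_iff)
qed

lemma K_inv: assumes "g \<in> K" shows "matrix_inv g \<in> K"
proof -
  obtain a b c d where g: "g = mk a b c d" by (rule mk_cases)
  define D where "D = a * d - b * c"
  have D: "vF (\<sigma> D) = ereal 0" using assms by (simp add: g K_mk D_def zero_ereal_def)
  then have D0: "D \<noteq> 0" by auto
  have i: "matrix_inv g = mk (d / D) (- b / D) (- c / D) (a / D)"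
  proof (rule matrix_inv_eq[OF K_G[OF assms]])
    have "a * (d / D) + b * (- c / D) = (a * d - b * c) / D" "c * (- b / D) + d * (a / D) = (a * d - b * c) / D"
      by (simp_all add: diff_divide_distrib mult.commute)
    moreover have "(a * d - b * c) / D = 1" using D0 by (simp add: D_def)
    ultimately show "g ** mk (d / D) (- b / D) (- c / D) (a / D) = mat 1"
      unfolding g mk_mult mat1_mk mk_eq_iff by (simp add: mult.commute)
  qed
  have "vF (\<sigma> (det g)) + vF (\<sigma> (det (matrix_inv g))) = vF (\<sigma> (det (g ** matrix_inv g)))"
    by (simp add: det_mul vf.v_mult)
  also have "\<dots> = 0" using matrix_inv_GL[OF K_G[OF assms]] by simp
  finally have vd: "vF (\<sigma> (det (matrix_inv g))) = 0"
    using assms by (simp add: K_def unit_iff)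
  have e: "vg 0 a" "vg 0 b" "vg 0 c" "vg 0 d" using assms unfolding g K_mk by simp_all
  have q: "vg 0 (x / D)" if "vg 0 x" for x using vf.vge_divide[OF _ D, of 0 "\<sigma> x"] that by (simp add: vg_def)
  show ?thesis unfolding i K_mk
  proof (intro conjI)
    show "vF (\<sigma> (d / D * (a / D) - - b / D * (- c / D))) = 0" using vd unfolding i det_mk .
  qed (use e in \<open>auto intro!: q simp del: minus_divide_left\<close>)
qed

lemma KZ_iff: "g \<in> KZ \<longleftrightarrow> (\<exists>\<kappa> c. \<kappa> \<in> K \<and> c \<noteq> 0 \<and> g = \<kappa> ** scal c)"
  unfolding KZ_def Z_iff by blast

lemma scal_mult: "scal c ** scal d = scal (c * d)" by (simp add: mk_mult)

lemma KZ_mult [intro]: assumes "g \<in> KZ" "h \<in> KZ" shows "g ** h \<in> KZ"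
proof -
  obtain \<kappa> c where g: "\<kappa> \<in> K" "c \<noteq> 0" "g = \<kappa> ** scal c" using assms(1) KZ_iff by blast
  obtain \<kappa>' c' where h: "\<kappa>' \<in> K" "c' \<noteq> 0" "h = \<kappa>' ** scal c'" using assms(2) KZ_iff by blast
  note gh = g h
  have "g ** h = \<kappa> ** (scal c ** \<kappa>') ** scal c'" by (simp add: gh matrix_mul_assoc)
  also have "\<dots> = (\<kappa> ** \<kappa>') ** (scal c ** scal c')" unfolding scal_comm[of c \<kappa>'] by (simp add: matrix_mul_assoc)
  also have "scal c ** scal c' = scal (c * c')" by (rule scal_mult)
  finally have "g ** h = (\<kappa> ** \<kappa>') ** scal (c * c')" .
  moreover have "\<kappa> ** \<kappa>' \<in> K" "c * c' \<noteq> 0" using gh K_mult by auto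
  ultimately show ?thesis using KZ_iff by blast
qed

lemma K_one: "mat 1 \<in> K" unfolding mat1_mk K_mk by simp

lemma K_KZ: "g \<in> K \<Longrightarrow> g \<in> KZ"
proof -
  assume "g \<in> K"
  moreover have "g = g ** scal 1" by (simp add: mat1_mk[symmetric])
  ultimately show ?thesis using KZ_iff zero_neq_one by metis
qed

lemma KZ_one [simp]: "mat 1 \<in> KZ" by (rule K_KZ[OF K_one])

lemma scal_KZ: "c \<noteq> 0 \<Longrightarrow> scal c \<in> KZ"
proof -
  assume "c \<noteq> 0"
  moreover have "scal c = mat 1 ** scal c" by simp
  ultimately show ?thesis using KZ_iff K_one by blast
qed

lemma KZ_G: "g \<in> KZ \<Longrightarrow> g \<in> G"
proof -
  assume "g \<in> KZ"
  then obtain \<kappa> c where "\<kappa> \<in> K" "c \<noteq> 0" "g = \<kappa> ** scal c" using KZ_iff by blast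
  then show ?thesis using K_G by (auto simp: G_iff det_mul det_mk)
qed

lemma KZ_inv: assumes "g \<in> KZ" shows "matrix_inv g \<in> KZ"
proof -
  obtain \<kappa> c where g: "\<kappa> \<in> K" "c \<noteq> 0" "g = \<kappa> ** scal c" using assms KZ_iff by blast
  have s: "scal c \<in> G" using g by (simp add: G_iff det_mk)
  have "matrix_inv (scal c) = scal (1 / c)" by (rule matrix_inv_eq[OF s]) (use g in \<open>simp add: mk_mult mat1_mk\<close>)
  then have "matrix_inv g = scal (1 / c) ** matrix_inv \<kappa>" using g s K_G by (simp add: matrix_inv_mult)
  moreover have "scal (1 / c) \<in> KZ" using g by (intro scal_KZ) simp
  ultimately show ?thesis using KZ_mult[OF _ K_KZ[OF K_inv[OF g(1)]]] by simp
qed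

lemma KZ_cancel_left: assumes "\<kappa> \<in> KZ" shows "\<kappa> ** g \<in> KZ \<longleftrightarrow> g \<in> KZ"
proof
  assume "\<kappa> ** g \<in> KZ"
  then have "matrix_inv \<kappa> ** (\<kappa> ** g) \<in> KZ" by (rule KZ_mult[OF KZ_inv[OF assms]])
  then show "g \<in> KZ" by (simp only: inv_cancel(1)[OF KZ_G[OF assms]])
qed (rule KZ_mult[OF assms])

lemma KZ_unit_det:
  assumes "g \<in> KZ" "vF (\<sigma> (det g)) = 0" shows "g \<in> K"
proof -
  obtain \<kappa> c where g: "\<kappa> \<in> K" "c \<noteq> 0" "g = \<kappa> ** scal c" using assms KZ_iff by blast
  obtain x where x: "vF (\<sigma> c) = ereal x" using vf.v_finite[of "\<sigma> c"] g by auto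
  have "vF (\<sigma> (det g)) = vF (\<sigma> (det \<kappa>)) + (vF (\<sigma> c) + vF (\<sigma> c))"
    by (simp add: g det_mul det_mk vf.v_mult)
  moreover have "vF (\<sigma> (det \<kappa>)) = ereal 0" using g(1) by (simp add: K_def unit_iff zero_ereal_def)
  ultimately have "x = 0" using assms(2) x by (simp add: zero_ereal_def)
  then have "scal c \<in> K" using x by (simp add: K_mk vg_def vf.vge_def vf.v_mult zero_ereal_def)
  then show ?thesis using g K_mult by blast
qed

lemma sq_nz: "sq \<sigma> \<noteq> 0"
proof
  assume "sq \<sigma> = 0"
  then have "\<sigma> \<pi> = 0" using sq[OF \<sigma>S] by simp
  then show False by simp
qed

lemma sc_mult: assumes "g \<in> G" "h \<in> G" shows "sc (g ** h) = sc g * sc h"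
proof -
  have "ord \<iota>F \<pi> (det (g ** h)) = ord \<iota>F \<pi> (det g) + ord \<iota>F \<pi> (det h)"
    using assms by (simp add: det_mul ord_mult G_iff)
  then have e: "- int n * ord \<iota>F \<pi> (det (g ** h)) = - int n * ord \<iota>F \<pi> (det g) + - int n * ord \<iota>F \<pi> (det h)"
    by (simp add: distrib_left)
  have pa: "sq \<sigma> powi (x + y) = sq \<sigma> powi x * sq \<sigma> powi y" for x y
    by (rule power_int_add) (simp add: sq_nz)
  show ?thesis unfolding sc_def e pa ..
qed

lemma rho_mult: "P \<in> V k \<Longrightarrow> g \<in> G \<Longrightarrow> h \<in> G \<Longrightarrow> rho k (g ** h) P = rho k g (rho k h P)"
  by (rule ev_inj) (auto simp: rho_V ev_rho act_mult act_smult sc_mult)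

lemma act_one: "degree u \<le> n \<Longrightarrow> act (mat 1) u = u"
proof -
  assume "degree u \<le> n"
  have "act (mat 1) u = (\<Sum>i\<le>n. monom (coeff u i) i)"
    by (simp add: act_def hmg_def lin1_def lin2_def mat1_mk one_pCons[symmetric] monom_altdef)
  also have "\<dots> = u" using \<open>degree u \<le> n\<close> by (rule poly_as_sum_of_monoms')
  finally show ?thesis .
qed

lemma rho_one: "P \<in> V k \<Longrightarrow> rho k (mat 1) P = P"
proof -
  assume P: "P \<in> V k"
  have "sc (mat 1) = 1" using ord_unit[of 1] by (simp add: sc_def)
  then show ?thesis using P by (intro ev_inj) (auto simp: rho_V ev_rho act_one degree_ev)
qed

lemma rho_inv_cancel: "P \<in> V k \<Longrightarrow> g \<in> G \<Longrightarrow> rho k g (rho k (matrix_inv g) P) = P"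
  using rho_mult[of P g "matrix_inv g"] by (simp add: matrix_inv_GL rho_one)

lemma rho_sum: "(\<And>x. x \<in> A \<Longrightarrow> f x \<in> V k) \<Longrightarrow> rho k g (sum f A) = (\<Sum>x\<in>A. rho k g (f x))"
  by (induction A rule: infinite_finite_induct) (auto simp: rho_add V_sum)

lemma act_scal: "degree u \<le> n \<Longrightarrow> act (scal c) u = smult (\<sigma> c ^ n) u"
proof -
  assume u: "degree u \<le> n"
  have "act (scal c) u = (\<Sum>i\<le>n. smult (\<sigma> c ^ n) (monom (coeff u i) i))"
    unfolding act_def hmg_def
  proof (intro sum.cong refl)
    fix i assume "i \<in> {..n}"
    then have "\<sigma> c ^ n = \<sigma> c ^ (n - i) * \<sigma> c ^ i" by (simp flip: power_add)
    moreover have "[:0, \<sigma> c:] = smult (\<sigma> c) [:0, 1:]" by simp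
    ultimately show "smult (coeff u i) (lin1 (scal c) ^ (n - i) * lin2 (scal c) ^ i) = smult (\<sigma> c ^ n) (monom (coeff u i) i)"
      by (simp add: lin1_def lin2_def poly_const_pow smult_power monom_altdef mult_ac del: smult_pCons)
  qed
  also have "\<dots> = smult (\<sigma> c ^ n) (\<Sum>i\<le>n. monom (coeff u i) i)"
    by (rule poly_eqI) (simp only: coeff_sum coeff_smult sum_distrib_left)
  also have "(\<Sum>i\<le>n. monom (coeff u i) i) = u" using u by (rule poly_as_sum_of_monoms')
  finally show ?thesis .
qed

lemma pge_act: "(\<And>i j. vg 0 (g $ i $ j)) \<Longrightarrow> vf.pge c u \<Longrightarrow> vf.pge c (act g u)"
proof -
  assume g: "\<And>i j. vg 0 (g $ i $ j)" and u: "vf.pge c u"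
  have l: "vf.pge 0 (lin1 g)" "vf.pge 0 (lin2 g)" using g by (auto simp: lin1_def lin2_def vg_def)
  show "vf.pge c (act g u)" unfolding act_def hmg_def
    by (intro vf.pge_sum vf.pge_smult'[OF vf.pge_coeff[OF u] vf.pge_mult_int[OF vf.pge_power0 vf.pge_power0]] l) simp
qed

text \<open>The twist by square roots serves this purpose: \<open>sq \<sigma>\<close> has valuation
  1/2, so on a scalar z the factor \<open>sc\<close> cancels the valuation of \<sigma>(z)^n.
  Elements of K act through integral matrices.\<close>

lemma pge_rho_KZ:
  assumes "\<kappa> \<in> KZ" "P \<in> V k" "vf.pge c (ev P)"
  shows "vf.pge c (ev (rho k \<kappa> P))"
proof -
  obtain g z where g: "g \<in> K" "z \<noteq> 0" "\<kappa> = g ** scal z" using assms KZ_iff by blast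
  have G: "g \<in> G" "scal z \<in> G" using g K_G by (auto simp: G_iff det_mk)
  have s1: "sc g = 1" using g ord_unit by (simp add: sc_def K_def unit_iff)
  obtain x where x: "vF (sq \<sigma>) = ereal x" using vf.v_finite sq_nz by blast
  have "vF (sq \<sigma> ^ 2) = ereal 1" using sq[OF \<sigma>S] v\<pi> by simp
  then have x2: "x = 1 / 2" using vf.v_power[OF x, of 2] by simp
  have vz: "vF (\<sigma> z) = ereal (real_of_int (ord \<iota>F \<pi> z))" using ord_eq g by blast
  have oz: "ord \<iota>F \<pi> (z * z) = 2 * ord \<iota>F \<pi> z" using ord_mult g by simp
  have "vF (sc (scal z)) = ereal (1 / 2 * real_of_int (- int n * (2 * ord \<iota>F \<pi> z)))"
    unfolding sc_def using v_powi[OF x[unfolded x2]] by (simp add: det_mk oz)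
  then have "vF (sc (scal z) * \<sigma> z ^ n) = 0"
    using vf.v_power[OF vz, of n] by (simp add: vf.v_mult zero_ereal_def)
  then have v0: "vf.vge 0 (sc (scal z) * \<sigma> z ^ n)" by (simp add: vf.vge_def zero_ereal_def)
  have "ev (rho k \<kappa> P) = act g (smult (sc (scal z) * \<sigma> z ^ n) (ev P))"
    using assms(2) G s1 by (simp add: g(3) rho_mult ev_rho rho_V act_scal degree_ev)
  moreover have "vf.pge c (smult (sc (scal z) * \<sigma> z ^ n) (ev P))"
    using vf.pge_smult[OF v0 assms(3)] by simp
  ultimately show ?thesis using g(1) by (auto simp: K_def int_iff intro!: pge_act)
qed

end

section \<open>The Hecke operator as a sum over explicit cosets\<close>

context poly_weight
begin

abbreviation w :: 'c where "w \<equiv> \<sigma> \<pi>"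

text \<open>The constant by which \<open>U\<close> differs from the action of the inverse of
  \<alpha>, see \<open>U_eq\<close>.\<close>

definition hecke_scalar :: 'c where "hecke_scalar = sq \<sigma> ^ n"

definition xm :: "'f \<Rightarrow> 'f^2^2" where "xm l = mk \<pi> l 0 1"

definition w0 :: "'f^2^2" where "w0 = mk 0 1 1 0"

lemma \<alpha>_mk: "\<alpha> = mk 1 0 0 \<pi>" by (simp add: \<alpha>_def mk_def)

lemma \<alpha>_G: "\<alpha> \<in> G" "xm l \<in> G" by (simp_all add: \<alpha>_mk xm_def G_iff det_mk)

lemma inv_\<alpha>: "matrix_inv \<alpha> = mk 1 0 0 (1 / \<pi>)"
  by (rule matrix_inv_eq[OF \<alpha>_G(1)]) (simp add: \<alpha>_mk mk_mult mat1_mk)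

lemma w0_K: "w0 \<in> K" and w0_sq: "w0 ** w0 = mat 1"
  by (simp_all add: w0_def K_mk mk_mult mat1_mk)

lemma w0_G: "w0 \<in> G" by (rule K_G[OF w0_K])

lemma w0_KZ: "w0 \<in> KZ" by (rule K_KZ[OF w0_K])

lemma w_nz: "w \<noteq> 0" by simp

lemma linear_power: "[:0, x:] ^ i = monom (x ^ i) i"
proof -
  have "[:0, x:] = monom x 1" by (simp add: monom_altdef)
  then show ?thesis by (simp add: monom_power)
qed

lemma single_V: "m \<in> Wm n \<Longrightarrow> Poly_Mapping.single m c \<in> V k"
  unfolding V_eq W_def by (cases "c = 0") auto

lemma U_eq:
  assumes P: "P \<in> V k" shows "U P = mscale hecke_scalar (rho k (matrix_inv \<alpha>) P)"
proof (rule ev_inj)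
  have keys: "m \<in> Wm n" if "m \<in> Poly_Mapping.keys P" for m using P that unfolding V_eq W_def by auto
  show "U P \<in> V k" unfolding U_def by (intro V_sum single_V keys)
  show "mscale hecke_scalar (rho k (matrix_inv \<alpha>) P) \<in> V k" by (intro V_mscale rho_V P)
  have pr: "(\<Prod>\<tau>\<in>S. \<tau> \<pi> ^ Poly_Mapping.lookup m (Xv \<tau>)) = w ^ (n - ydeg m)" if "m \<in> Wm n" for m
  proof -
    have "(\<Prod>\<tau>\<in>S. \<tau> \<pi> ^ Poly_Mapping.lookup m (Xv \<tau>)) = w ^ Poly_Mapping.lookup m (Xv \<sigma>)"
      using that finite_S \<sigma>S by (subst prod.remove[of _ \<sigma>]) (auto simp: Wm_def)
    moreover have "Poly_Mapping.lookup m (Xv \<sigma>) = n - ydeg m" using that by (auto simp: Wm_def ydeg_def)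
    ultimately show ?thesis by simp
  qed
  have "ev (U P) = (\<Sum>m\<in>Poly_Mapping.keys P. monom (w ^ (n - ydeg m) * Poly_Mapping.lookup P m) (ydeg m))"
    unfolding U_def ev_sum ev_single by (intro sum.cong refl) (simp add: pr keys)
  also have "\<dots> = (\<Sum>i\<le>n. monom (w ^ (n - i) * Poly_Mapping.lookup P (mon i)) i)"
    using V_sum_mon[OF P, of "\<lambda>m c. monom (w ^ (n - ydeg m) * c) (ydeg m)"] by simp
  finally have 1: "ev (U P) = (\<Sum>i\<le>n. monom (w ^ (n - i) * coeff (ev P) i) i)"
    by (simp add: coeff_ev[OF P])
  have "ord \<iota>F \<pi> (\<pi> * (1 / \<pi>)) = ord \<iota>F \<pi> \<pi> + ord \<iota>F \<pi> (1 / \<pi>)" by (rule ord_mult) auto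
  then have "ord \<iota>F \<pi> (1 / \<pi>) = - 1" using ord_unit[of 1] by (simp add: ord_\<pi>)
  then have "sc (matrix_inv \<alpha>) = sq \<sigma> ^ n" by (simp add: sc_def inv_\<alpha> det_mk)
  then have "hecke_scalar * sc (matrix_inv \<alpha>) = (sq \<sigma> ^ 2) ^ n"
    by (simp add: hecke_scalar_def power2_eq_square power_mult_distrib)
  then have c: "hecke_scalar * sc (matrix_inv \<alpha>) = w ^ n" using sq[OF \<sigma>S] by simp
  have "ev (mscale hecke_scalar (rho k (matrix_inv \<alpha>) P)) = smult (w ^ n) (act (matrix_inv \<alpha>) (ev P))"
    by (simp add: ev_mscale ev_rho[OF P] c)
  also have "\<dots> = (\<Sum>i\<le>n. smult (w ^ n) (monom (coeff (ev P) i * (1 / w) ^ i) i))"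
    unfolding act_def hmg_def
    by (rule poly_eqI) (simp add: coeff_sum sum_distrib_left inv_\<alpha> lin1_def lin2_def one_pCons[symmetric]
        linear_power smult_monom del: smult_pCons)
  also have "\<dots> = (\<Sum>i\<le>n. monom (w ^ (n - i) * coeff (ev P) i) i)"
  proof (intro sum.cong refl)
    fix i assume "i \<in> {..n}"
    then have "w ^ n = w ^ (n - i) * w ^ i" by (simp flip: power_add)
    then show "smult (w ^ n) (monom (coeff (ev P) i * (1 / w) ^ i) i) = monom (w ^ (n - i) * coeff (ev P) i) i"
      using w_nz by (simp add: smult_monom power_one_over field_simps)
  qed
  finally show "ev (U P) = ev (mscale hecke_scalar (rho k (matrix_inv \<alpha>) P))" using 1 by simp
qed

definition double_coset :: "('f^2^2) set" where
  "double_coset = {g. \<exists>\<kappa>1\<in>KZ. \<exists>\<kappa>2\<in>KZ. g = \<kappa>1 ** matrix_inv \<alpha> ** \<kappa>2}"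

text \<open>As \<open>U\<close> is a multiple of \<open>rho k (matrix_inv \<alpha>)\<close>, every
  decomposition of g yields the same multiple of \<open>rho k g\<close>, which makes the description
  in \<open>psi\<close> unique.\<close>

lemma psi_eq:
  assumes v: "v \<in> V k"
  shows "psi k g v = (if g \<in> double_coset then mscale hecke_scalar (rho k g v) else 0)"
proof -
  have *: "rho k \<kappa>1 (U (rho k \<kappa>2 v)) = mscale hecke_scalar (rho k (\<kappa>1 ** matrix_inv \<alpha> ** \<kappa>2) v)"
    if "\<kappa>1 \<in> KZ" "\<kappa>2 \<in> KZ" for \<kappa>1 \<kappa>2
  proof -
    have G: "\<kappa>1 \<in> G" "\<kappa>2 \<in> G" "matrix_inv \<alpha> \<in> G" using that KZ_G matrix_inv_GL \<alpha>_G by auto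
    have "rho k \<kappa>1 (U (rho k \<kappa>2 v)) = mscale hecke_scalar (rho k \<kappa>1 (rho k (matrix_inv \<alpha>) (rho k \<kappa>2 v)))"
      by (simp add: U_eq rho_V v rho_mscale)
    also have "\<dots> = mscale hecke_scalar (rho k (\<kappa>1 ** matrix_inv \<alpha> ** \<kappa>2) v)"
      using G v by (simp add: rho_mult rho_V G_mult)
    finally show ?thesis .
  qed
  show ?thesis
  proof (cases "g \<in> double_coset")
    case True
    then obtain \<kappa>1 \<kappa>2 where k12: "\<kappa>1 \<in> KZ" "\<kappa>2 \<in> KZ" "g = \<kappa>1 ** matrix_inv \<alpha> ** \<kappa>2"
      unfolding double_coset_def by blast
    have "(THE x. \<exists>\<kappa>1\<in>KZ. \<exists>\<kappa>2\<in>KZ. g = \<kappa>1 ** matrix_inv \<alpha> ** \<kappa>2 \<and> x = rho k \<kappa>1 (U (rho k \<kappa>2 v))) =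
        mscale hecke_scalar (rho k g v)"
    proof (rule the_equality)
      show "\<exists>\<kappa>1\<in>KZ. \<exists>\<kappa>2\<in>KZ. g = \<kappa>1 ** matrix_inv \<alpha> ** \<kappa>2 \<and> mscale hecke_scalar (rho k g v) = rho k \<kappa>1 (U (rho k \<kappa>2 v))"
        using k12 *[OF k12(1,2)] by metis
      fix x assume "\<exists>\<kappa>1\<in>KZ. \<exists>\<kappa>2\<in>KZ. g = \<kappa>1 ** matrix_inv \<alpha> ** \<kappa>2 \<and> x = rho k \<kappa>1 (U (rho k \<kappa>2 v))"
      then obtain \<kappa>1 \<kappa>2 where "\<kappa>1 \<in> KZ" "\<kappa>2 \<in> KZ" "g = \<kappa>1 ** matrix_inv \<alpha> ** \<kappa>2" "x = rho k \<kappa>1 (U (rho k \<kappa>2 v))"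
        by blast
      then show "x = mscale hecke_scalar (rho k g v)" using *[of \<kappa>1 \<kappa>2] by simp
    qed
    moreover have "\<exists>\<kappa>1\<in>KZ. \<exists>\<kappa>2\<in>KZ. g = \<kappa>1 ** matrix_inv \<alpha> ** \<kappa>2" using k12 by blast
    ultimately show ?thesis using True by (simp add: psi_def)
  next
    case False
    then have "\<not> (\<exists>\<kappa>1\<in>KZ. \<exists>\<kappa>2\<in>KZ. g = \<kappa>1 ** matrix_inv \<alpha> ** \<kappa>2)" by (simp add: double_coset_def)
    then have "psi k g v = 0" unfolding psi_def by (simp only: if_False)
    then show ?thesis using False by simp
  qed
qed

lemma double_coset_left: assumes "\<kappa> \<in> KZ" shows "\<kappa> ** g \<in> double_coset \<longleftrightarrow> g \<in> double_coset"
proof -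
  have *: "\<kappa> ** g \<in> double_coset" if kg: "\<kappa> \<in> KZ" "g \<in> double_coset" for \<kappa> g
  proof -
    obtain \<kappa>1 \<kappa>2 where k12: "\<kappa>1 \<in> KZ" "\<kappa>2 \<in> KZ" "g = \<kappa>1 ** matrix_inv \<alpha> ** \<kappa>2"
      using kg(2) unfolding double_coset_def by blast
    have "\<kappa> ** g = (\<kappa> ** \<kappa>1) ** matrix_inv \<alpha> ** \<kappa>2" by (simp add: k12(3) matrix_mul_assoc)
    then show ?thesis using KZ_mult[OF kg(1) k12(1)] k12(2) unfolding double_coset_def by blast
  qed
  show ?thesis
  proof
    assume "\<kappa> ** g \<in> double_coset"
    from *[OF KZ_inv[OF assms] this] show "g \<in> double_coset" by (simp only: inv_cancel(1)[OF KZ_G[OF assms]])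
  qed (rule *[OF assms])
qed

lemma inv_\<alpha>_conj: "matrix_inv \<alpha> = (scal (1 / \<pi>) ** w0) ** \<alpha> ** w0"
  unfolding inv_\<alpha> unfolding w0_def \<alpha>_mk by (simp add: mk_mult)

lemma \<alpha>_conj: "\<alpha> = (scal \<pi> ** w0) ** matrix_inv \<alpha> ** w0"
  unfolding inv_\<alpha> unfolding w0_def \<alpha>_mk by (simp add: mk_mult)

lemma KZ\<alpha>KZ_DC: assumes "\<kappa>1 \<in> KZ" "\<kappa>2 \<in> KZ" shows "\<kappa>1 ** \<alpha> ** \<kappa>2 \<in> double_coset"
proof -
  have "\<kappa>1 ** \<alpha> ** \<kappa>2 = (\<kappa>1 ** (scal \<pi> ** w0)) ** matrix_inv \<alpha> ** (w0 ** \<kappa>2)"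
    by (subst \<alpha>_conj) (simp only: matrix_mul_assoc)
  moreover have "\<kappa>1 ** (scal \<pi> ** w0) \<in> KZ" "w0 ** \<kappa>2 \<in> KZ"
    by (rule KZ_mult[OF assms(1) KZ_mult[OF scal_KZ w0_KZ]], simp) (rule KZ_mult[OF w0_KZ assms(2)])
  ultimately show ?thesis unfolding double_coset_def by blast
qed

text \<open>Scalars and \<open>w0\<close> exchange \<alpha> and its inverse up to KZ, so this is
  also the double coset of \<alpha>. For h in K, the coset of \<open>h ** \<alpha>\<close> is
  decided by the lower left entry c: it is that of \<alpha> if c is a nonunit, and otherwise that of
  \<open>xm l\<close> with l the residue of a/c.\<close>

lemma double_coset_iff:
  assumes R: "residue_system R"
  shows "g \<in> double_coset \<longleftrightarrow> (\<exists>x\<in>insert \<alpha> (xm ` R). \<exists>\<kappa>\<in>KZ. g = x ** \<kappa>)"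
proof
  assume "g \<in> double_coset"
  then obtain \<kappa>1 \<kappa>2 where k12: "\<kappa>1 \<in> KZ" "\<kappa>2 \<in> KZ" "g = \<kappa>1 ** matrix_inv \<alpha> ** \<kappa>2"
    unfolding double_coset_def by blast
  define \<kappa>3 where "\<kappa>3 = \<kappa>1 ** (scal (1 / \<pi>) ** w0)"
  have k3: "\<kappa>3 \<in> KZ" unfolding \<kappa>3_def by (rule KZ_mult[OF k12(1) KZ_mult[OF scal_KZ w0_KZ]]) simp
  obtain h z where hz: "h \<in> K" "z \<noteq> 0" "\<kappa>3 = h ** scal z" using k3 KZ_iff by blast
  obtain a b c d where h: "h = mk a b c d" by (rule mk_cases)
  have hK: "vg 0 a" "vg 0 b" "vg 0 c" "vg 0 d" "vF (\<sigma> (a * d - b * c)) = 0" using hz(1) unfolding h K_mk by auto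
  have g: "g = h ** \<alpha> ** (scal z ** (w0 ** \<kappa>2))"
  proof -
    have "g = \<kappa>3 ** \<alpha> ** (w0 ** \<kappa>2)"
      unfolding k12(3) \<kappa>3_def by (subst inv_\<alpha>_conj) (simp only: matrix_mul_assoc)
    also have "\<dots> = h ** (scal z ** \<alpha>) ** (w0 ** \<kappa>2)" unfolding hz(3) by (simp only: matrix_mul_assoc)
    finally show ?thesis unfolding scal_comm[of z \<alpha>] by (simp only: matrix_mul_assoc)
  qed
  have kz: "scal z ** (w0 ** \<kappa>2) \<in> KZ" by (rule KZ_mult[OF scal_KZ[OF hz(2)] KZ_mult[OF w0_KZ k12(2)]])
  have "\<exists>x\<in>insert \<alpha> (xm ` R). \<exists>\<kappa>\<in>K. h ** \<alpha> = x ** \<kappa>"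
  proof (cases "vg 1 c")
    case True
    obtain c' where c': "vg 0 c'" "c = \<pi> * c'" using \<pi>_ideal[of c] True by blast
    have "h ** \<alpha> = \<alpha> ** mk a (\<pi> * b) c' d"
      unfolding h \<alpha>_mk mk_mult c'(2) by (simp add: mk_eq_iff mult.commute)
    moreover have "mk a (\<pi> * b) c' d \<in> K"
    proof -
      have "vg 0 \<pi>" using v\<pi> by (simp add: vg_def vf.vge_def)
      then have "vg 0 (\<pi> * b)" using vg_mult[of 0 \<pi> 0 b] hK by simp
      moreover have "a * d - \<pi> * b * c' = a * d - b * c" by (simp add: c')
      then have "vF (\<sigma> (a * d - \<pi> * b * c')) = 0" using hK(5) by (simp only:)
      ultimately show ?thesis unfolding K_mk using hK(1,4) c'(1) by blast
    qed
    ultimately show ?thesis by blast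
  next
    case False
    then have vc: "vF (\<sigma> c) = ereal 0" using unit_of_not_vg1[OF hK(3)] by (simp add: zero_ereal_def)
    then have c0: "c \<noteq> 0" by auto
    have "vg 0 (a / c)" using vf.vge_divide[OF _ vc, of 0 "\<sigma> a"] hK(1) by (simp add: vg_def)
    then obtain l where l: "l \<in> R" "vg 1 (a / c - l)" using residue_systemD(5)[OF R] by blast
    then have "vg (0 + 1) (c * (a / c - l))" using vg_mult[OF hK(3)] by blast
    then have "vg 1 (a - l * c)" using c0 by (simp add: algebra_simps)
    then obtain a' where a': "vg 0 a'" "a - l * c = \<pi> * a'" using \<pi>_ideal[of "a - l * c"] by blast
    have "h ** \<alpha> = xm l ** mk a' (b - l * d) c (\<pi> * d)"
    proof -
      have "a = \<pi> * a' + l * c" using a'(2) by (metis diff_add_cancel)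
      then show ?thesis unfolding h \<alpha>_mk xm_def mk_mult by (simp add: mk_eq_iff algebra_simps)
    qed
    moreover have "mk a' (b - l * d) c (\<pi> * d) \<in> K"
    proof -
      have "vg 0 \<pi>" using v\<pi> by (simp add: vg_def vf.vge_def)
      then have 1: "vg 0 (\<pi> * d)" using vg_mult[of 0 \<pi> 0 d] hK by simp
      have "vg 0 (l * d)" using vg_mult[of 0 l 0 d] hK residue_systemD(3)[OF R l(1)] by simp
      then have 2: "vg 0 (b - l * d)" by (rule vg_diff[OF hK(2)])
      have "a' * (\<pi> * d) - (b - l * d) * c = (\<pi> * a') * d - b * c + l * c * d" by (simp add: algebra_simps)
      also have "\<dots> = a * d - b * c" unfolding a'(2)[symmetric] by (simp add: algebra_simps)
      finally have "vF (\<sigma> (a' * (\<pi> * d) - (b - l * d) * c)) = 0" using hK(5) by (simp only:)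
      then show ?thesis unfolding K_mk using hK(3) a'(1) 1 2 by blast
    qed
    ultimately show ?thesis using l(1) by blast
  qed
  then obtain x \<kappa> where x: "x \<in> insert \<alpha> (xm ` R)" "\<kappa> \<in> K" "h ** \<alpha> = x ** \<kappa>" by blast
  have "g = x ** (\<kappa> ** (scal z ** (w0 ** \<kappa>2)))" unfolding g x(3) by (simp only: matrix_mul_assoc)
  moreover have "\<kappa> ** (scal z ** (w0 ** \<kappa>2)) \<in> KZ" by (rule KZ_mult[OF K_KZ[OF x(2)] kz])
  ultimately show "\<exists>x\<in>insert \<alpha> (xm ` R). \<exists>\<kappa>\<in>KZ. g = x ** \<kappa>" using x(1) by blast
next
  assume "\<exists>x\<in>insert \<alpha> (xm ` R). \<exists>\<kappa>\<in>KZ. g = x ** \<kappa>"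
  then obtain x \<kappa> where x: "x \<in> insert \<alpha> (xm ` R)" "\<kappa> \<in> KZ" "g = x ** \<kappa>" by blast
  consider "x = \<alpha>" | l where "l \<in> R" "x = xm l" using x(1) by blast
  then show "g \<in> double_coset"
  proof cases
    case 1
    then show ?thesis using KZ\<alpha>KZ_DC[OF KZ_one x(2)] x(3) by simp
  next
    case 2
    have "xm l = mk l 1 1 0 ** \<alpha> ** w0" unfolding xm_def \<alpha>_mk w0_def by (simp add: mk_mult)
    then have "g = mk l 1 1 0 ** \<alpha> ** (w0 ** \<kappa>)" unfolding x(3) 2(2) by (simp only: matrix_mul_assoc)
    moreover have "mk l 1 1 0 \<in> K" unfolding K_mk using residue_systemD(3)[OF R 2(1)] by simp
    ultimately show ?thesis using KZ\<alpha>KZ_DC[OF K_KZ KZ_mult[OF w0_KZ x(2)]] by simp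
  qed
qed

text \<open>All representatives have determinant \<pi>, so two in one coset differ by an element of
  determinant 1, hence of K, and their entries can be compared modulo \<pi>.\<close>

lemma Xs_distinct:
  assumes R: "residue_system R" and x: "x \<in> insert \<alpha> (xm ` R)" "x' \<in> insert \<alpha> (xm ` R)"
    and k: "\<kappa> \<in> KZ" "x' = x ** \<kappa>"
  shows "x = x'"
proof -
  have dx: "det y = \<pi>" if "y \<in> insert \<alpha> (xm ` R)" for y using that by (auto simp: \<alpha>_mk xm_def det_mk)
  have "det x' = det x * det \<kappa>" using k by (simp add: det_mul)
  then have "det \<kappa> = 1" using dx[OF x(1)] dx[OF x(2)] by simp
  then have kK: "\<kappa> \<in> K" using KZ_unit_det[OF k(1)] by simp
  obtain a b c d where m: "\<kappa> = mk a b c d" by (rule mk_cases)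
  have i: "vg 0 a" "vg 0 b" "vg 0 c" "vg 0 d" using kK unfolding m K_mk by auto
  have n1: "\<not> vg 1 1" by (rule not_vg1_of_unit) simp
  consider "x = \<alpha>" "x' = \<alpha>" | l where "l \<in> R" "x = \<alpha>" "x' = xm l" | l where "l \<in> R" "x = xm l" "x' = \<alpha>"
    | l l' where "l \<in> R" "l' \<in> R" "x = xm l" "x' = xm l'" using x by blast
  then show ?thesis
  proof cases
    case 1
    then show ?thesis by simp
  next
    case 2
    have "mk \<pi> l 0 1 = mk 1 0 0 \<pi> ** mk a b c d" using k(2) unfolding 2 m xm_def \<alpha>_mk .
    then have "1 = \<pi> * d" unfolding mk_mult mk_eq_iff by auto
    then have "vg 1 1" using \<pi>_ideal[of 1] i(4) by blast
    then show ?thesis using n1 by simp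
  next
    case 3
    have "mk 1 0 0 \<pi> = mk \<pi> l 0 1 ** mk a b c d" using k(2) unfolding 3 m xm_def \<alpha>_mk .
    then have "1 = \<pi> * a + l * c" "0 = c" unfolding mk_mult mk_eq_iff by auto
    then have "1 = \<pi> * a" by simp
    then have "vg 1 1" using \<pi>_ideal[of 1] i(1) by blast
    then show ?thesis using n1 by simp
  next
    case 4
    have "mk \<pi> l' 0 1 = mk \<pi> l 0 1 ** mk a b c d" using k(2) unfolding 4 m xm_def .
    then have "l' = \<pi> * b + l * d" "1 = d" unfolding mk_mult mk_eq_iff by auto
    then have "l' - l = \<pi> * b" by simp
    then have "vg 1 (l' - l)" using \<pi>_ideal[of "l' - l"] i(2) by blast
    then have "vF (\<sigma> (l' - l)) \<noteq> 0" using not_vg1_of_unit by blast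
    then have "l' = l" using residue_systemD(4)[OF R 4(2,1)] by argo
    then show ?thesis using 4 by simp
  qed
qed

definition left_coset :: "'f^2^2 \<Rightarrow> ('f^2^2) set" where "left_coset g = {g ** \<kappa> |\<kappa>. \<kappa> \<in> KZ}"

lemma cosets_eq: "cosets = left_coset ` G" unfolding cosets_def left_coset_def[abs_def] image_def by blast

lemma left_coset_self: "g \<in> left_coset g" 
proof -
  have "g = g ** mat 1" by simp
  then show ?thesis unfolding left_coset_def using KZ_one by blast
qed

lemma left_coset_eq: assumes "h \<in> left_coset g" shows "left_coset h = left_coset g"
proof -
  obtain \<kappa> where \<kappa>: "\<kappa> \<in> KZ" "h = g ** \<kappa>" using assms unfolding left_coset_def by blast
  have "h ** \<kappa>' \<in> left_coset g" if "\<kappa>' \<in> KZ" for \<kappa>'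
  proof -
    have "h ** \<kappa>' = g ** (\<kappa> ** \<kappa>')" unfolding \<kappa>(2) by (simp only: matrix_mul_assoc)
    then show ?thesis unfolding left_coset_def using KZ_mult[OF \<kappa>(1) that] by blast
  qed
  moreover have "g ** \<kappa>' \<in> left_coset h" if "\<kappa>' \<in> KZ" for \<kappa>'
  proof -
    have "g ** \<kappa>' = h ** (matrix_inv \<kappa> ** \<kappa>')"
      unfolding \<kappa>(2) using inv_cancel(2)[OF KZ_G[OF \<kappa>(1)], of \<kappa>'] by (simp only: matrix_mul_assoc[symmetric])
    then show ?thesis unfolding left_coset_def using KZ_mult[OF KZ_inv[OF \<kappa>(1)] that] by blast
  qed
  ultimately show ?thesis unfolding left_coset_def[of h] left_coset_def[of g] by (auto simp: left_coset_def)
qed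

lemma rep_cs: assumes "g \<in> G" shows "\<exists>\<kappa>\<in>KZ. rep (left_coset g) = g ** \<kappa>"
proof -
  have "rep (left_coset g) \<in> left_coset g" unfolding rep_def by (rule someI[of _ g]) (rule left_coset_self)
  then show ?thesis unfolding left_coset_def by blast
qed

lemma bracket_eq: "bracket k g v x = (if x ** g \<in> KZ then rho k (x ** g) v else 0)"
  by (simp add: bracket_def)

text \<open>Only the coset of the inverse of \<open>y ** g\<close> has a bracket that does not
  vanish at y.\<close>

lemma T_gen_eq:
  assumes g: "g \<in> G" and v: "v \<in> V k" and y: "y \<in> G"
  shows "T_gen k g v y = (if y ** g \<in> double_coset then mscale hecke_scalar (rho k (y ** g) v) else 0)"
proof -
  define z where "z = y ** g"
  have z: "z \<in> G" using g y by (simp add: z_def G_mult)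
  define D0 where "D0 = left_coset (matrix_inv z)"
  let ?h = "\<lambda>D. bracket k (g ** rep D) (psi k (matrix_inv (rep D)) v) y"
  have D0: "D0 \<in> cosets" using matrix_inv_GL(3)[OF z] by (simp add: D0_def cosets_eq)
  have "?h D = 0" if D: "D \<in> cosets - {D0}" for D
  proof -
    obtain x where x: "x \<in> G" "D = left_coset x" using D by (auto simp: cosets_eq)
    obtain \<kappa> where \<kappa>: "\<kappa> \<in> KZ" "rep D = x ** \<kappa>" using rep_cs[OF x(1)] x(2) by blast
    have "y ** (g ** rep D) \<notin> KZ"
    proof
      assume "y ** (g ** rep D) \<in> KZ"
      then have "z ** rep D \<in> KZ" by (simp add: z_def matrix_mul_assoc)
      moreover have "rep D = matrix_inv z ** (z ** rep D)" by (simp add: inv_cancel z)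
      ultimately have "rep D \<in> D0" unfolding D0_def left_coset_def by blast
      moreover have "rep D \<in> left_coset x" unfolding left_coset_def using \<kappa> by blast
      ultimately have "left_coset x = D0" using left_coset_eq[of "rep D" x] left_coset_eq[of "rep D" "matrix_inv z"] by (simp add: D0_def)
      then show False using D x by simp
    qed
    then show ?thesis by (simp add: bracket_eq)
  qed
  then have "T_gen k g v y = ?h D0"
    unfolding T_gen_def using fsum_eq[of "{D0}" cosets ?h] D0 by simp
  also have "\<dots> = (if z \<in> double_coset then mscale hecke_scalar (rho k z v) else 0)"
  proof -
    obtain \<kappa> where \<kappa>: "\<kappa> \<in> KZ" "rep D0 = matrix_inv z ** \<kappa>"
      using rep_cs[OF matrix_inv_GL(3)[OF z]] by (auto simp: D0_def)
    have kG: "\<kappa> \<in> G" by (rule KZ_G[OF \<kappa>(1)])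
    have 1: "y ** (g ** rep D0) = \<kappa>"
      unfolding \<kappa>(2) using inv_cancel(2)[OF z, of \<kappa>] by (simp add: z_def matrix_mul_assoc)
    have 2: "matrix_inv (rep D0) = matrix_inv \<kappa> ** z"
      unfolding \<kappa>(2) using z kG by (simp add: matrix_inv_mult matrix_inv_GL matrix_inv_inv)
    have 3: "matrix_inv \<kappa> ** z \<in> double_coset \<longleftrightarrow> z \<in> double_coset" by (rule double_coset_left[OF KZ_inv[OF \<kappa>(1)]])
    have 4: "rho k \<kappa> (mscale hecke_scalar (rho k (matrix_inv \<kappa> ** z) v)) = mscale hecke_scalar (rho k z v)"
      using v kG z matrix_inv_GL(3)[OF kG] by (simp add: rho_mscale rho_V rho_mult rho_inv_cancel)
    show ?thesis unfolding bracket_eq 1 2 psi_eq[OF v] 3 using \<kappa>(1) 4 by simp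
  qed
  finally show ?thesis by (simp add: z_def)
qed

lemma ind_D:
  assumes "f \<in> ind k (V k)"
  shows "g \<notin> G \<Longrightarrow> f g = 0" "f g \<in> V k" "\<kappa> \<in> KZ \<Longrightarrow> g \<in> G \<Longrightarrow> f (\<kappa> ** g) = rho k \<kappa> (f g)"
proof -
  show 1: "f g = 0" if "g \<notin> G" for g using assms that by (simp add: ind_def)
  show "f g \<in> V k" using assms 1[of g] by (cases "g \<in> G") (simp_all add: ind_def)
  show "\<kappa> \<in> KZ \<Longrightarrow> g \<in> G \<Longrightarrow> f (\<kappa> ** g) = rho k \<kappa> (f g)" using assms by (simp add: ind_def)
qed

text \<open>At a fixed y the double sum over cosets collapses to the neighbours of y in the tree,
  one for each representative of the double coset.\<close>

lemma T_eq:
  assumes R: "residue_system R" and f: "f \<in> ind k (V k)" and y: "y \<in> G"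
  shows "T k f y = (\<Sum>x\<in>insert \<alpha> (xm ` R). mscale hecke_scalar (rho k x (f (matrix_inv x ** y))))"
proof -
  let ?Xs = "insert \<alpha> (xm ` R)"
  let ?D = "\<lambda>x. left_coset (matrix_inv y ** x)"
  have XG: "x \<in> G" if "x \<in> ?Xs" for x using that \<alpha>_G by auto
  have iy: "matrix_inv y \<in> G" by (rule matrix_inv_GL(3)[OF y])
  define h where "h = (\<lambda>D. T_gen k (rep D) (f (matrix_inv (rep D))) y)"
  have hval: "h (left_coset g) = (if y ** g \<in> double_coset then mscale hecke_scalar (rho k (y ** g) (f (matrix_inv g))) else 0)" if g: "g \<in> G" for g
  proof -
    obtain \<kappa> where \<kappa>: "\<kappa> \<in> KZ" "rep (left_coset g) = g ** \<kappa>" using rep_cs[OF g] by blast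
    have kG: "\<kappa> \<in> G" by (rule KZ_G[OF \<kappa>(1)])
    have fV: "f x \<in> V k" for x by (rule ind_D(2)[OF f])
    have "h (left_coset g) = (if y ** (g ** \<kappa>) \<in> double_coset then mscale hecke_scalar (rho k (y ** (g ** \<kappa>)) (f (matrix_inv (g ** \<kappa>)))) else 0)"
      unfolding h_def \<kappa>(2) by (rule T_gen_eq[OF G_mult[OF g kG] fV y])
    moreover have "y ** (g ** \<kappa>) \<in> double_coset \<longleftrightarrow> y ** g \<in> double_coset"
    proof -
      have *: "a ** \<kappa>' \<in> double_coset" if "a \<in> double_coset" "\<kappa>' \<in> KZ" for a \<kappa>'
      proof -
        obtain \<kappa>1 \<kappa>2 where k12: "\<kappa>1 \<in> KZ" "\<kappa>2 \<in> KZ" "a = \<kappa>1 ** matrix_inv \<alpha> ** \<kappa>2"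
          using \<open>a \<in> double_coset\<close> unfolding double_coset_def by blast
        have "a ** \<kappa>' = \<kappa>1 ** matrix_inv \<alpha> ** (\<kappa>2 ** \<kappa>')" by (simp add: k12(3) matrix_mul_assoc)
        then show ?thesis using KZ_mult[OF k12(2) \<open>\<kappa>' \<in> KZ\<close>] k12(1) unfolding double_coset_def by blast
      qed
      have e: "y ** (g ** \<kappa>) ** matrix_inv \<kappa> = y ** g"
        by (simp add: matrix_mul_assoc[symmetric] matrix_inv_GL[OF kG])
      show ?thesis
      proof
        assume "y ** (g ** \<kappa>) \<in> double_coset"
        from *[OF this KZ_inv[OF \<kappa>(1)]] show "y ** g \<in> double_coset" unfolding e .
      next
        assume "y ** g \<in> double_coset"
        from *[OF this \<kappa>(1)] show "y ** (g ** \<kappa>) \<in> double_coset" by (simp add: matrix_mul_assoc)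
      qed
    qed
    moreover have "rho k (y ** (g ** \<kappa>)) (f (matrix_inv (g ** \<kappa>))) = rho k (y ** g) (f (matrix_inv g))"
    proof -
      have "f (matrix_inv (g ** \<kappa>)) = rho k (matrix_inv \<kappa>) (f (matrix_inv g))"
        unfolding matrix_inv_mult[OF g kG] by (rule ind_D(3)[OF f KZ_inv[OF \<kappa>(1)] matrix_inv_GL(3)[OF g]])
      moreover have "y ** (g ** \<kappa>) = (y ** g) ** \<kappa>" by (simp add: matrix_mul_assoc)
      ultimately show ?thesis
        using y g kG fV matrix_inv_GL(3)[OF kG] by (simp add: rho_mult rho_V G_mult rho_inv_cancel)
    qed
    ultimately show ?thesis by simp
  qed
  have inj: "inj_on ?D ?Xs"
  proof (rule inj_onI)
    fix x x' assume x: "x \<in> ?Xs" "x' \<in> ?Xs" "?D x = ?D x'"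
    then have "matrix_inv y ** x' \<in> ?D x" using left_coset_self by auto
    then obtain \<kappa> where \<kappa>: "\<kappa> \<in> KZ" "matrix_inv y ** x' = matrix_inv y ** x ** \<kappa>" unfolding left_coset_def by blast
    have "y ** (matrix_inv y ** x') = y ** (matrix_inv y ** (x ** \<kappa>))" by (simp add: \<kappa>(2) matrix_mul_assoc)
    then have "x' = x ** \<kappa>" unfolding inv_cancel(2)[OF y] .
    then show "x = x'" by (rule Xs_distinct[OF R x(1,2) \<kappa>(1)])
  qed
  have fin: "finite ?Xs" using residue_systemD(1)[OF R] by simp
  have "T k f y = fsum h cosets" unfolding T_def h_def ..
  also have "\<dots> = sum h (?D ` ?Xs)"
  proof (rule fsum_eq)
    show "finite (?D ` ?Xs)" using fin by (rule finite_imageI)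
    show "?D ` ?Xs \<subseteq> cosets" unfolding cosets_eq using G_mult[OF iy XG] by blast
    fix D assume D: "D \<in> cosets - ?D ` ?Xs"
    then obtain g where g: "g \<in> G" "D = left_coset g" by (auto simp: cosets_eq)
    have "y ** g \<notin> double_coset"
    proof
      assume "y ** g \<in> double_coset"
      then obtain x \<kappa> where x: "x \<in> ?Xs" "\<kappa> \<in> KZ" "y ** g = x ** \<kappa>" using double_coset_iff[OF R] by blast
      have "matrix_inv y ** (y ** g) = matrix_inv y ** x ** \<kappa>" by (simp add: x(3) matrix_mul_assoc)
      then have "g = matrix_inv y ** x ** \<kappa>" unfolding inv_cancel(1)[OF y] .
      then have "g \<in> ?D x" unfolding left_coset_def using x(2) by blast
      then have "D = ?D x" unfolding g(2) by (rule left_coset_eq)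
      then show False using D x(1) by blast
    qed
    then show "h D = 0" using hval[OF g(1)] g(2) by simp
  qed
  also have "\<dots> = (\<Sum>x\<in>?Xs. h (?D x))" by (simp only: sum.reindex[OF inj] o_def)
  also have "\<dots> = (\<Sum>x\<in>?Xs. mscale hecke_scalar (rho k x (f (matrix_inv x ** y))))"
  proof (rule sum.cong[OF refl])
    fix x assume x: "x \<in> ?Xs"
    have "y ** (matrix_inv y ** x) = x" by (rule inv_cancel(2)[OF y])
    moreover have "x \<in> double_coset" unfolding double_coset_iff[OF R] using x KZ_one by (intro bexI[of _ x] bexI[of _ "mat 1"]) auto
    moreover have "matrix_inv (matrix_inv y ** x) = matrix_inv x ** y"
      using XG[OF x] y by (simp add: matrix_inv_mult[OF iy] matrix_inv_inv)
    ultimately show "h (?D x) = mscale hecke_scalar (rho k x (f (matrix_inv x ** y)))"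
      using hval[OF G_mult[OF iy XG[OF x]]] by simp
  qed
  finally show ?thesis .
qed

lemma T_outside: assumes y: "y \<notin> G" shows "T k f y = 0"
proof -
  have "bracket k g v y = 0" for g v
  proof -
    have "y ** g \<notin> KZ"
    proof
      assume "y ** g \<in> KZ"
      then have "det (y ** g) \<noteq> 0" using KZ_G G_iff by blast
      then show False using y by (simp add: det_mul G_iff)
    qed
    then show ?thesis by (simp add: bracket_eq)
  qed
  then show ?thesis by (simp add: T_def T_gen_def fsum_def)
qed

end

section \<open>Hecke relations along words and the support of induced functions\<close>

context poly_weight
begin

text \<open>For determinant \<pi> the constant and the twist cancel, so in one variable T involves
  only the untwisted substitutions \<open>act\<close>.\<close>

lemma hecke_scalar_sc: "det x = \<pi> \<Longrightarrow> hecke_scalar * sc x = 1"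
  using sq_nz by (simp add: hecke_scalar_def sc_def ord_\<pi> power_int_minus)

lemma det_xm: "det (xm l) = \<pi>" "det \<alpha> = \<pi>"
  by (simp_all add: xm_def \<alpha>_mk det_mk)

lemma ev_hecke_term:
  "det x = \<pi> \<Longrightarrow> P \<in> V k \<Longrightarrow> ev (mscale hecke_scalar (rho k x P)) = act x (ev P)"
  using hecke_scalar_sc[of x] by (simp add: ev_mscale ev_rho)

lemma act_xm: "act (xm l) u = (\<Sum>i\<le>n. smult (coeff u i * w ^ (n - i)) ([:\<sigma> l, 1:] ^ i))"
  unfolding act_def hmg_def lin1_def lin2_def xm_def
  by (intro sum.cong refl) (simp add: poly_const_pow)

lemma act_upper:
  assumes "degree u \<le> n"
  shows "act (mk 1 x 0 y) u = pcompose u [:\<sigma> x, \<sigma> y:]"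
proof -
  have "act (mk 1 x 0 y) u = (\<Sum>i\<le>n. smult (coeff u i) ([:\<sigma> x, \<sigma> y:] ^ i))"
    unfolding act_def hmg_def lin1_def lin2_def by (simp add: one_pCons[symmetric])
  also have "\<dots> = (\<Sum>i\<le>n. pcompose (monom (coeff u i) i) [:\<sigma> x, \<sigma> y:])"
    by (intro sum.cong refl) (simp add: monom_altdef pcompose_smult vf.pcompose_power pcompose_pCons)
  also have "\<dots> = pcompose (\<Sum>i\<le>n. monom (coeff u i) i) [:\<sigma> x, \<sigma> y:]"
    by (simp only: pcompose_sum)
  also have "(\<Sum>i\<le>n. monom (coeff u i) i) = u" using assms by (rule poly_as_sum_of_monoms')
  finally show ?thesis .
qed

lemma inv_xm: "matrix_inv (xm l) = mk (1 / \<pi>) (- l / \<pi>) 0 1"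
  by (rule matrix_inv_eq[OF \<alpha>_G(2)]) (simp add: xm_def mk_mult mat1_mk)

lemma ev_hecke_back:
  assumes u: "P \<in> V k"
  shows "ev (mscale hecke_scalar (rho k (matrix_inv (xm m)) P)) = pcompose (ev P) [:- \<sigma> m, w:]"
proof -
  have e: "matrix_inv (xm m) = mk 1 (- m) 0 \<pi> ** scal (1 / \<pi>)"
    unfolding inv_xm by (simp add: mk_mult)
  have "ord \<iota>F \<pi> (\<pi> * (1 / \<pi>)) = ord \<iota>F \<pi> \<pi> + ord \<iota>F \<pi> (1 / \<pi>)" by (rule ord_mult) auto
  then have "ord \<iota>F \<pi> (1 / \<pi>) = - 1" using ord_unit[of 1] by (simp add: ord_\<pi>)
  then have "sc (matrix_inv (xm m)) = sq \<sigma> ^ n" by (simp add: sc_def inv_xm det_mk)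
  then have "hecke_scalar * sc (matrix_inv (xm m)) = (sq \<sigma> ^ 2) ^ n"
    by (simp add: hecke_scalar_def power2_eq_square power_mult_distrib)
  then have c: "hecke_scalar * sc (matrix_inv (xm m)) = w ^ n" using sq[OF \<sigma>S] by simp
  have "ev (mscale hecke_scalar (rho k (matrix_inv (xm m)) P)) = smult (w ^ n) (act (mk 1 (- m) 0 \<pi>) (act (scal (1 / \<pi>)) (ev P)))"
    by (simp add: ev_mscale ev_rho[OF u] c) (simp add: e act_mult)
  also have "\<dots> = smult (w ^ n * (1 / w) ^ n) (act (mk 1 (- m) 0 \<pi>) (ev P))"
    using act_scal[OF degree_ev[OF u], of "1 / \<pi>"] by (simp add: act_smult)
  also have "w ^ n * (1 / w) ^ n = 1" using w_nz by (simp flip: power_mult_distrib)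
  finally show ?thesis using act_upper[OF degree_ev[OF u], of "- m" \<pi>] by simp
qed

lemma \<alpha>_notin_xm: "\<alpha> \<notin> xm ` R"
proof
  assume "\<alpha> \<in> xm ` R"
  then obtain l where "mk 1 0 0 \<pi> = mk \<pi> l 0 1" unfolding \<alpha>_mk xm_def by blast
  then have "\<pi> = 1" by (simp add: mk_eq_iff)
  then show False using v\<pi> by (simp add: one_ereal_def[symmetric])
qed

lemma inj_xm: "inj_on xm R"
  by (rule inj_onI) (simp add: xm_def mk_eq_iff)

lemma ev_T:
  assumes R: "residue_system R" and f: "f \<in> ind k (V k)" and y: "y \<in> G"
  shows "ev (T k f y) = act \<alpha> (ev (f (matrix_inv \<alpha> ** y))) + (\<Sum>l\<in>R. act (xm l) (ev (f (matrix_inv (xm l) ** y))))"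
proof -
  have "T k f y = mscale hecke_scalar (rho k \<alpha> (f (matrix_inv \<alpha> ** y))) +
      (\<Sum>l\<in>R. mscale hecke_scalar (rho k (xm l) (f (matrix_inv (xm l) ** y))))"
    unfolding T_eq[OF assms] using residue_systemD(1)[OF R] \<alpha>_notin_xm
    by (simp add: sum.reindex[OF inj_xm] o_def)
  then show ?thesis by (simp add: ev_add ev_sum ev_hecke_term det_xm ind_D(2)[OF f])
qed

lemma T_V:
  assumes R: "residue_system R" and f: "f \<in> ind k (V k)"
  shows "T k f y \<in> V k"
proof (cases "y \<in> G")
  case True
  show ?thesis unfolding T_eq[OF R f True] by (intro V_sum V_mscale rho_V ind_D(2)[OF f])
qed (simp add: T_outside)

text \<open>Seen from \<open>matrix_inv (xm m) ** z\<close>, the neighbour in direction \<alpha> is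
  z up to an element of KZ, that is, the parent; the directions \<open>xm l\<close> lead to the
  children. The parent's term becomes the substitution of w X - m.\<close>

lemma ev_T_step:
  assumes R: "residue_system R" and f: "f \<in> ind k (V k)" and z: "z \<in> G" and m: "vg 0 m"
  shows "ev (T k f (matrix_inv (xm m) ** z)) = pcompose (ev (f z)) [:- \<sigma> m, w:] +
    (\<Sum>l\<in>R. act (xm l) (ev (f (matrix_inv (xm l) ** (matrix_inv (xm m) ** z)))))"
proof -
  let ?y = "matrix_inv (xm m) ** z"
  have y: "?y \<in> G" by (rule G_mult[OF matrix_inv_GL(3)[OF \<alpha>_G(2)] z])
  define \<kappa> where "\<kappa> = mk (1 / \<pi>) (- m / \<pi>) 0 (1 / \<pi>)"
  have "\<kappa> = mk 1 (- m) 0 1 ** scal (1 / \<pi>)" by (simp add: \<kappa>_def mk_mult)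
  moreover have "mk 1 (- m) 0 1 \<in> K" using m by (simp add: K_mk vg_def)
  ultimately have \<kappa>KZ: "\<kappa> \<in> KZ" by (simp add: KZ_mult[OF K_KZ scal_KZ])
  have \<kappa>G: "\<kappa> \<in> G" by (simp add: \<kappa>_def G_iff det_mk)
  have e1: "matrix_inv \<alpha> ** matrix_inv (xm m) = \<kappa>" unfolding inv_\<alpha> inv_xm by (simp add: \<kappa>_def mk_mult)
  have e2: "\<alpha> ** \<kappa> = matrix_inv (xm m)" unfolding inv_xm unfolding \<alpha>_mk by (simp add: \<kappa>_def mk_mult)
  have fz: "f (matrix_inv \<alpha> ** ?y) = f (\<kappa> ** z)" by (simp only: matrix_mul_assoc e1)
  have "act \<alpha> (ev (f (matrix_inv \<alpha> ** ?y))) = pcompose (ev (f z)) [:- \<sigma> m, w:]"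
  proof -
    have "act \<alpha> (ev (f (matrix_inv \<alpha> ** ?y))) = ev (mscale hecke_scalar (rho k \<alpha> (rho k \<kappa> (f z))))"
      unfolding fz ind_D(3)[OF f \<kappa>KZ z] by (rule ev_hecke_term[OF det_xm(2) rho_V[OF ind_D(2)[OF f]], symmetric])
    also have "rho k \<alpha> (rho k \<kappa> (f z)) = rho k (matrix_inv (xm m)) (f z)"
      using rho_mult[OF ind_D(2)[OF f] \<alpha>_G(1) \<kappa>G, of z] by (simp only: e2)
    finally show ?thesis by (simp only: ev_hecke_back[OF ind_D(2)[OF f]])
  qed
  then show ?thesis using ev_T[OF R f y] by simp
qed

lemma T_pge:
  assumes R: "residue_system R" and f: "f \<in> ind k (V k)" and c: "\<And>y. vf.pge c (ev (f y))"
  shows "vf.pge c (ev (T k f y))"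
proof (cases "y \<in> G")
  case True
  have i: "vg 0 0" "vg 0 1" "vg 0 \<pi>" using v\<pi> by (simp_all add: vg_def vf.vge_def)
  have 1: "vg 0 (\<alpha> $ i $ j)" for i j using i exhaust_2[of i] exhaust_2[of j] by (auto simp: \<alpha>_mk)
  have 2: "vg 0 (xm l $ i $ j)" if "l \<in> R" for l i j
    using i residue_systemD(3)[OF R that] exhaust_2[of i] exhaust_2[of j] by (auto simp: xm_def)
  show ?thesis unfolding ev_T[OF R f True]
    by (rule vf.pge_add[OF pge_act[OF 1 c] vf.pge_sum[OF pge_act[OF 2 c]]])
qed (simp add: T_outside)

section \<open>Words and cosets\<close>

primrec pt :: "'f^2^2 \<Rightarrow> 'f list \<Rightarrow> 'f^2^2" where
  "pt z [] = z"
| "pt z (l # s) = matrix_inv (xm l) ** pt z s"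

lemma pt_G: "z \<in> G \<Longrightarrow> pt z s \<in> G"
  by (induction s) (auto intro!: G_mult matrix_inv_GL(3) \<alpha>_G)

lemma pt_append: "pt z (s @ t) = pt (pt z t) s"
  by (induction s) auto

lemma pt_mult: "pt (z ** y) s = pt z s ** y"
  by (induction s) (auto simp: matrix_mul_assoc)

lemma pt_one: "\<exists>B. pt (mat 1) s = mk (1 / \<pi> ^ length s) B 0 1"
proof (induction s)
  case Nil
  show ?case by (auto simp: mat1_mk)
next
  case (Cons l s)
  then obtain B where B: "pt (mat 1) s = mk (1 / \<pi> ^ length s) B 0 1" by blast
  have "pt (mat 1) (l # s) = mk (1 / \<pi> ^ length (l # s)) (1 / \<pi> * B + - l / \<pi>) 0 1"
    unfolding pt.simps B inv_xm mk_mult by (simp add: mk_eq_iff)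
  then show ?case by blast
qed

lemma ex_vg: "\<exists>c. vg c x"
  by (cases "\<sigma> x = 0") (use vf.v_finite[of "\<sigma> x"] in \<open>auto simp: vg_def vf.vge_def\<close>)

text \<open>The valuation of the determinant minus twice the minimal valuation of the entries is invariant
  under \<open>KZ\<close>; it grows with the length of the word.\<close>
lemma coset_length_bounded:
  assumes g: "g \<in> G"
  shows "\<exists>N::nat. \<forall>s. \<forall>\<kappa>\<in>KZ. pt (mat 1) s = \<kappa> ** g \<longrightarrow> length s \<le> N"
proof -
  obtain a b c d where m: "g = mk a b c d" by (rule mk_cases)
  obtain c1 c2 where c12: "vg c1 a" "vg c2 c" using ex_vg by blast
  define c0 where "c0 = min c1 c2"
  have ac: "vg c0 a" "vg c0 c" using c12 by (auto simp: c0_def intro: vg_mono)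
  obtain \<delta> where \<delta>: "vF (\<sigma> (det g)) = ereal \<delta>" using vf.v_finite[of "\<sigma> (det g)"] g by (auto simp: G_iff)
  have "real (length s) \<le> \<delta> - 2 * c0" if \<kappa>: "\<kappa> \<in> KZ" and e: "pt (mat 1) s = \<kappa> ** g" for s \<kappa>
  proof -
    obtain h y where hy: "h \<in> K" "y \<noteq> 0" "\<kappa> = h ** scal y" using \<kappa> KZ_iff by blast
    obtain a' b' c' d' where h: "h = mk a' b' c' d'" by (rule mk_cases)
    have i: "vg 0 a'" "vg 0 b'" "vF (\<sigma> (det h)) = ereal 0"
      using hy(1) unfolding h K_mk det_mk zero_ereal_def by auto
    obtain \<eta> where \<eta>: "vF (\<sigma> y) = ereal \<eta>" using vf.v_finite[of "\<sigma> y"] hy by auto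
    obtain B where B: "pt (mat 1) s = mk (1 / \<pi> ^ length s) B 0 1" using pt_one by blast
    have vl: "vF (\<sigma> (1 / \<pi> ^ length s)) = ereal (- real (length s))"
      using vf.v_inverse[OF vf.v_power[OF v\<pi>, of "length s"]] by (simp add: inverse_eq_divide)
    have E: "mk (1 / \<pi> ^ length s) B 0 1 = mk a' b' c' d' ** scal y ** mk a b c d"
      using e unfolding B hy(3) h m .
    then have "1 / \<pi> ^ length s = y * (a' * a + b' * c)"
      unfolding mk_mult mk_eq_iff by (simp add: algebra_simps)
    moreover have "vg c0 (a' * a + b' * c)"
      using vg_add vg_mult[OF i(1) ac(1)] vg_mult[OF i(2) ac(2)] by simp
    then have "vg (\<eta> + c0) (y * (a' * a + b' * c))"
      using vf.vge_mult[OF vf.vge_exact[OF \<eta>]] by (simp add: vg_def)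
    ultimately have 1: "\<eta> + c0 \<le> - real (length s)"
      using vl by (simp add: vg_def vf.vge_def)
    have "det (pt (mat 1) s) = det h * (y * y) * det g"
      unfolding e hy(3) det_mul by (simp add: det_mk)
    moreover have "det (pt (mat 1) s) = 1 / \<pi> ^ length s" unfolding B by (simp add: det_mk)
    ultimately have "vF (\<sigma> (1 / \<pi> ^ length s)) = vF (\<sigma> (det h)) + (vF (\<sigma> y) + vF (\<sigma> y)) + vF (\<sigma> (det g))"
      by (simp only: \<sigma>_simps vf.v_mult)
    then have "- real (length s) = 2 * \<eta> + \<delta>" unfolding vl i(3) \<eta> \<delta> by simp
    then show ?thesis using 1 by simp
  qed
  then have "length s \<le> nat \<lceil>\<delta> - 2 * c0\<rceil>" if "\<kappa> \<in> KZ" "pt (mat 1) s = \<kappa> ** g" for s \<kappa>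
    using that by (meson le_nat_iff le_trans nat_ceiling_le_eq of_nat_le_iff real_nat_ceiling_ge order_trans)
  then show ?thesis by blast
qed

definition right_coset :: "'f^2^2 \<Rightarrow> ('f^2^2) set" where "right_coset g = {\<kappa> ** g |\<kappa>. \<kappa> \<in> KZ}"

lemma right_coset_self: "g \<in> right_coset g"
proof -
  have "g = mat 1 ** g" by simp
  then show ?thesis unfolding right_coset_def using KZ_one by blast
qed

text \<open>The support consists of finitely many cosets, and each of them contains only words of
  bounded length.\<close>

lemma support_bounded:
  assumes f: "f \<in> ind k (V k)" and z: "z \<in> G"
  shows "\<exists>M::nat. \<forall>s. M < length s \<longrightarrow> f (pt z s) = 0"
proof -
  let ?C = "{right_coset g | g. g \<in> G \<and> f g \<noteq> 0}"
  have fin: "finite ?C" using f unfolding ind_def right_coset_def by blast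
  have "\<exists>N::nat. \<forall>s. pt z s \<in> D \<longrightarrow> length s \<le> N" if D: "D \<in> ?C" for D
  proof -
    obtain g where g: "g \<in> G" "D = right_coset g" using D by blast
    have iz: "matrix_inv z \<in> G" by (rule matrix_inv_GL(3)[OF z])
    obtain N where N: "\<And>s \<kappa>. \<kappa> \<in> KZ \<Longrightarrow> pt (mat 1) s = \<kappa> ** (g ** matrix_inv z) \<Longrightarrow> length s \<le> N"
      using coset_length_bounded[OF G_mult[OF g(1) iz]] by blast
    have "length s \<le> N" if sD: "pt z s \<in> D" for s
    proof -
      obtain \<kappa> where \<kappa>: "\<kappa> \<in> KZ" "pt z s = \<kappa> ** g" using sD unfolding g(2) right_coset_def by blast
      have "pt (mat 1) s ** z = \<kappa> ** g" using \<kappa>(2) pt_mult[of "mat 1" z s] by simp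
      then have "pt (mat 1) s ** z ** matrix_inv z = \<kappa> ** g ** matrix_inv z" by simp
      then have "pt (mat 1) s = \<kappa> ** (g ** matrix_inv z)"
        by (simp add: matrix_mul_assoc[symmetric] matrix_inv_GL(1)[OF z])
      then show ?thesis by (rule N[OF \<kappa>(1)])
    qed
    then show ?thesis by blast
  qed
  then have "\<forall>D\<in>?C. \<exists>N::nat. \<forall>s. pt z s \<in> D \<longrightarrow> length s \<le> N" by (rule ballI)
  from bchoice[OF this] obtain N :: "('f^2^2) set \<Rightarrow> nat"
    where N: "\<And>D s. D \<in> ?C \<Longrightarrow> pt z s \<in> D \<Longrightarrow> length s \<le> N D" by blast
  have "f (pt z s) = 0" if s: "Max (insert 0 (N ` ?C)) < length s" for s
  proof (rule ccontr)
    assume "f (pt z s) \<noteq> 0"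
    then have D: "right_coset (pt z s) \<in> ?C" using pt_G[OF z] by blast
    then have "length s \<le> N (right_coset (pt z s))" using right_coset_self by (rule N)
    also have "\<dots> \<le> Max (insert 0 (N ` ?C))" using fin D by (intro Max_ge) auto
    finally show False using s by simp
  qed
  then show ?thesis by blast
qed

end

section \<open>Every coset is reached by a word\<close>

context poly_weight
begin

text \<open>Both base points lie in KZ itself. Words over \<open>mat 1\<close> leave this coset in
  the directions \<open>xm l\<close> only; the remaining direction \<alpha> is reached from
  \<open>w0\<close>.\<close>

definition tree_pt :: "'f set \<Rightarrow> 'f^2^2 \<Rightarrow> bool" where
  "tree_pt R y \<longleftrightarrow> (\<exists>\<kappa>\<in>KZ. \<exists>z\<in>{mat 1, w0}. \<exists>s\<in>lists R. y = \<kappa> ** pt z s)"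

lemma tree_pt_KZ: assumes "\<kappa> \<in> KZ" "tree_pt R (\<kappa> ** y)" shows "tree_pt R y"
proof -
  obtain \<kappa>' z s where a: "\<kappa>' \<in> KZ" "z \<in> {mat 1, w0}" "s \<in> lists R" "\<kappa> ** y = \<kappa>' ** pt z s"
    using assms(2) unfolding tree_pt_def by blast
  have "matrix_inv \<kappa> ** (\<kappa> ** y) = (matrix_inv \<kappa> ** \<kappa>') ** pt z s" by (simp only: a(4) matrix_mul_assoc)
  then have "y = (matrix_inv \<kappa> ** \<kappa>') ** pt z s" by (simp only: inv_cancel(1)[OF KZ_G[OF assms(1)]])
  then show ?thesis unfolding tree_pt_def using a KZ_mult[OF KZ_inv[OF assms(1)] a(1)] by blast
qed

lemma tree_pt_w0: assumes "tree_pt R (y ** w0)" shows "tree_pt R y"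
proof -
  obtain \<kappa> z s where a: "\<kappa> \<in> KZ" "z \<in> {mat 1, w0}" "s \<in> lists R" "y ** w0 = \<kappa> ** pt z s"
    using assms(1) unfolding tree_pt_def by blast
  have "y = y ** w0 ** w0" by (simp add: matrix_mul_assoc[symmetric] w0_sq)
  also have "\<dots> = \<kappa> ** pt (z ** w0) s" unfolding a(4) pt_mult by (simp only: matrix_mul_assoc)
  finally have "y = \<kappa> ** pt (z ** w0) s" .
  moreover have "z ** w0 \<in> {mat 1, w0}" using a(2) w0_sq by auto
  ultimately show ?thesis unfolding tree_pt_def using a(1,3) by blast
qed

text \<open>The letters are the first digits of B in base \<pi>.\<close>

lemma upper_triangular_word:
  assumes R: "residue_system R"
  shows "vg 0 B \<Longrightarrow> vF (\<sigma> A) = ereal (real j) \<Longrightarrow> \<exists>\<kappa>\<in>KZ. \<exists>s\<in>lists R. mk 1 (- B) 0 A = \<kappa> ** pt (mat 1) s"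
proof (induction j arbitrary: A B)
  case 0
  have "mk 1 (- B) 0 A \<in> K" using 0 by (simp add: K_mk vg_def vf.vge_def zero_ereal_def)
  then have "mk 1 (- B) 0 A \<in> KZ" by (rule K_KZ)
  moreover have "mk 1 (- B) 0 A = mk 1 (- B) 0 A ** pt (mat 1) []" by simp
  ultimately show ?case using lists.Nil by blast
next
  case (Suc j)
  obtain l where l: "l \<in> R" "vg 1 (B - l)" using residue_systemD(5)[OF R Suc.prems(1)] by blast
  obtain B' where B': "vg 0 B'" "B - l = \<pi> * B'" using \<pi>_ideal[of "B - l"] l(2) by blast
  have "vF (\<sigma> (A / \<pi>)) = ereal (real j)" using vf.v_divide[OF Suc.prems(2) v\<pi>] by simp
  from Suc.IH[OF B'(1) this] obtain \<kappa> s where IH: "\<kappa> \<in> KZ" "s \<in> lists R" "mk 1 (- B') 0 (A / \<pi>) = \<kappa> ** pt (mat 1) s"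
    by blast
  have Bl: "B = \<pi> * B' + l" using B'(2) by (metis diff_add_cancel)
  have "mk 1 (- B) 0 A = scal \<pi> ** mk 1 (- B') 0 (A / \<pi>) ** matrix_inv (xm l)"
    unfolding inv_xm mk_mult mk_eq_iff using Bl by (simp add: field_simps)
  also have "\<dots> = (scal \<pi> ** \<kappa>) ** pt (matrix_inv (xm l)) s"
    unfolding IH(3) using pt_mult[of "mat 1" "matrix_inv (xm l)" s] by (simp add: matrix_mul_assoc)
  also have "pt (matrix_inv (xm l)) s = pt (mat 1) (s @ [l])" by (simp add: pt_append)
  finally have "mk 1 (- B) 0 A = (scal \<pi> ** \<kappa>) ** pt (mat 1) (s @ [l])" .
  moreover have "s @ [l] \<in> lists R" using IH(2) l(1) by simp
  moreover have "scal \<pi> ** \<kappa> \<in> KZ" by (rule KZ_mult[OF scal_KZ IH(1)]) simp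
  ultimately show ?case by blast
qed

lemma vg_0_divide: "a \<noteq> 0 \<Longrightarrow> vF (\<sigma> a) \<le> vF (\<sigma> b) \<Longrightarrow> vg 0 (b / a)"
proof -
  assume a: "a \<noteq> 0" "vF (\<sigma> a) \<le> vF (\<sigma> b)"
  obtain \<eta> where \<eta>: "vF (\<sigma> a) = ereal \<eta>" using vf.v_finite[of "\<sigma> a"] a by auto
  then have "vf.vge \<eta> (\<sigma> b)" using a by (simp add: vf.vge_def)
  from vf.vge_divide[OF this \<eta>] show ?thesis by (simp add: vg_def)
qed

text \<open>Elimination with pivot a: the scalar a and the lower unipotent factor with entry c/a lie
  in KZ, and an upper triangular matrix with integral entries remains.\<close>

lemma tree_pt_minimal_corner:
  assumes R: "residue_system R" and G: "mk a b c d \<in> G"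
    and m: "vF (\<sigma> a) \<le> vF (\<sigma> b)" "vF (\<sigma> a) \<le> vF (\<sigma> c)" "vF (\<sigma> a) \<le> vF (\<sigma> d)"
  shows "tree_pt R (mk a b c d)"
proof -
  have a0: "a \<noteq> 0"
  proof
    assume "a = 0"
    then have "\<sigma> b = 0" "\<sigma> c = 0" using m by (simp_all add: vf.v_infty_iff[symmetric])
    then show False using G \<open>a = 0\<close> by (simp add: G_iff det_mk)
  qed
  define A where "A = d / a - b / a * (c / a)"
  have i: "vg 0 (b / a)" "vg 0 (c / a)" "vg 0 (d / a)" using vg_0_divide[OF a0] m by blast+
  have "vg 0 (b / a * (c / a))" using vg_mult[OF i(1,2)] by simp
  with i(3) have Ai: "vg 0 A" unfolding A_def by (rule vg_diff)
  have "A = (a * d - b * c) / (a * a)" unfolding A_def using a0 by (simp add: diff_divide_distrib)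
  then have A0: "A \<noteq> 0" using G a0 by (simp add: G_iff det_mk)
  obtain j where j: "vF (\<sigma> A) = ereal (real j)"
  proof -
    have o: "vF (\<sigma> A) = ereal (real_of_int (ord \<iota>F \<pi> A))" by (rule ord_eq[OF A0])
    then have "0 \<le> ord \<iota>F \<pi> A" using Ai by (simp add: vg_def vf.vge_def)
    then have "vF (\<sigma> A) = ereal (real (nat (ord \<iota>F \<pi> A)))" using o by simp
    then show ?thesis by (rule that)
  qed
  have "vg 0 (- (b / a))" using i(1) by (simp add: vg_def)
  from upper_triangular_word[OF R this j] obtain \<kappa> s where
    ks: "\<kappa> \<in> KZ" "s \<in> lists R" "mk 1 (b / a) 0 A = \<kappa> ** pt (mat 1) s" by auto
  have "mk 1 0 (c / a) 1 \<in> K" using i by (simp add: K_mk)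
  then have kz: "scal a ** mk 1 0 (c / a) 1 ** \<kappa> \<in> KZ" by (intro KZ_mult scal_KZ K_KZ a0 ks(1))
  have "mk a b c d = scal a ** mk 1 0 (c / a) 1 ** mk 1 (b / a) 0 A"
    unfolding mk_mult mk_eq_iff using a0 by (simp add: A_def field_simps)
  also have "\<dots> = (scal a ** mk 1 0 (c / a) 1 ** \<kappa>) ** pt (mat 1) s" unfolding ks(3) by (simp only: matrix_mul_assoc)
  finally show ?thesis unfolding tree_pt_def using kz ks(2) by blast
qed

text \<open>An entry of minimal valuation is moved to the corner by \<open>w0\<close>: from the left
  this stays within the coset, from the right it exchanges the base points.\<close>

lemma tree_pt_G:
  assumes R: "residue_system R" and y: "y \<in> G"
  shows "tree_pt R y"
proof -
  obtain a b c d where m: "y = mk a b c d" by (rule mk_cases)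
  have e: "w0 ** y = mk c d a b" "y ** w0 = mk b a d c" "w0 ** y ** w0 = mk d c b a"
    unfolding m w0_def by (simp_all add: mk_mult)
  have G: "mk a b c d \<in> G" "mk c d a b \<in> G" "mk b a d c \<in> G" "mk d c b a \<in> G"
    using y by (simp_all add: m G_iff det_mk algebra_simps)
  have "tree_pt R (mk a b c d) \<or> tree_pt R (mk c d a b) \<or> tree_pt R (mk b a d c) \<or> tree_pt R (mk d c b a)"
  proof -
    let ?v = "\<lambda>x. vF (\<sigma> x)"
    have "(?v a \<le> ?v b \<and> ?v a \<le> ?v c \<and> ?v a \<le> ?v d) \<or> (?v b \<le> ?v a \<and> ?v b \<le> ?v c \<and> ?v b \<le> ?v d) \<or>
        (?v c \<le> ?v a \<and> ?v c \<le> ?v b \<and> ?v c \<le> ?v d) \<or> (?v d \<le> ?v a \<and> ?v d \<le> ?v b \<and> ?v d \<le> ?v c)"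
      by (meson linear order_trans)
    then show ?thesis using tree_pt_minimal_corner[OF R] G by blast
  qed
  moreover have "tree_pt R y" if "tree_pt R (mk c d a b)" using tree_pt_KZ[OF w0_KZ, of R y] that unfolding e .
  moreover have "tree_pt R y" if "tree_pt R (mk b a d c)" using tree_pt_w0[of R y] that unfolding e .
  moreover have "tree_pt R y" if "tree_pt R (mk d c b a)"
    using tree_pt_KZ[OF w0_KZ tree_pt_w0[of R "w0 ** y"]] that unfolding e(3) .
  ultimately show ?thesis unfolding m by blast
qed

lemma right_coset_cong: assumes "\<kappa> \<in> KZ" shows "right_coset (\<kappa> ** g) = right_coset g"
proof -
  have "\<kappa>' ** (\<kappa> ** g) \<in> right_coset g" if \<kappa>': "\<kappa>' \<in> KZ" for \<kappa>'
  proof -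
    have "\<kappa>' ** (\<kappa> ** g) = (\<kappa>' ** \<kappa>) ** g" by (simp only: matrix_mul_assoc)
    then show ?thesis unfolding right_coset_def using KZ_mult[OF \<kappa>' assms] by blast
  qed
  moreover have "\<kappa>' ** g \<in> right_coset (\<kappa> ** g)" if \<kappa>': "\<kappa>' \<in> KZ" for \<kappa>'
  proof -
    have "\<kappa>' ** g = (\<kappa>' ** matrix_inv \<kappa>) ** (\<kappa> ** g)"
      using inv_cancel(1)[OF KZ_G[OF assms], of g] by (simp only: matrix_mul_assoc[symmetric])
    then show ?thesis unfolding right_coset_def using KZ_mult[OF \<kappa>' KZ_inv[OF assms]] by blast
  qed
  ultimately show ?thesis unfolding right_coset_def[of g] right_coset_def[of "\<kappa> ** g"] unfolding right_coset_def by blast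
qed

section \<open>The induced module and linearity of T - a\<close>

lemma ind_iff:
  "f \<in> ind k W' \<longleftrightarrow> (\<forall>g. g \<notin> G \<longrightarrow> f g = 0) \<and> (\<forall>g\<in>G. f g \<in> W') \<and>
     (\<forall>\<kappa>\<in>KZ. \<forall>g\<in>G. f (\<kappa> ** g) = rho k \<kappa> (f g)) \<and> finite (right_coset ` {g\<in>G. f g \<noteq> 0})"
proof -
  have "{{\<kappa> ** g |\<kappa>. \<kappa> \<in> KZ} |g. g \<in> G \<and> f g \<noteq> 0} = right_coset ` {g\<in>G. f g \<noteq> 0}"
    unfolding right_coset_def[abs_def] by blast
  then show ?thesis unfolding ind_def by simp
qed

lemma ind_add:
  assumes f: "f \<in> ind k (V k)" and h: "h \<in> ind k (V k)"
  shows "(\<lambda>y. f y + h y) \<in> ind k (V k)"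
  unfolding ind_iff
proof (intro conjI allI impI ballI)
  have "finite (right_coset ` {g\<in>G. f g \<noteq> 0} \<union> right_coset ` {g\<in>G. h g \<noteq> 0})" using f h unfolding ind_iff by blast
  then show "finite (right_coset ` {g \<in> G. f g + h g \<noteq> 0})" by (rule finite_subset[rotated]) auto
qed (use f h in \<open>simp_all add: ind_D V_add rho_add\<close>)

lemma ind_mscale:
  assumes f: "f \<in> ind k (V k)"
  shows "(\<lambda>y. mscale c (f y)) \<in> ind k (V k)"
  unfolding ind_iff
proof (intro conjI allI impI ballI)
  have "finite (right_coset ` {g\<in>G. f g \<noteq> 0})" using f unfolding ind_iff by blast
  then show "finite (right_coset ` {g \<in> G. mscale c (f g) \<noteq> 0})" by (rule finite_subset[rotated]) (auto simp: mscale_simps)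
qed (use f in \<open>simp_all add: ind_D V_mscale rho_mscale mscale_simps\<close>)

lemma ind_0: "(\<lambda>_. 0) \<in> ind k (V k)" "(\<lambda>_. 0) \<in> ind k (V0 k)"
  unfolding ind_iff by (auto simp: V0_iff)

lemma ind_sum:
  assumes "finite A" "\<And>x. x \<in> A \<Longrightarrow> f x \<in> ind k (V k)"
  shows "(\<lambda>y. \<Sum>x\<in>A. f x y) \<in> ind k (V k)"
  using assms
proof (induction A rule: finite_induct)
  case empty
  show ?case using ind_0(1) by simp
next
  case (insert x A)
  then show ?case using ind_add[of "f x" "\<lambda>y. \<Sum>x\<in>A. f x y"] by simp
qed

lemma ind_V0: "f \<in> ind k (V0 k) \<Longrightarrow> f \<in> ind k (V k)" "f \<in> ind k (V0 k) \<Longrightarrow> vf.pge 0 (ev (f y))"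
proof -
  assume f: "f \<in> ind k (V0 k)"
  show "f \<in> ind k (V k)" using f unfolding ind_iff by (auto simp: V0_iff)
  show "vf.pge 0 (ev (f y))" using f unfolding ind_iff by (cases "y \<in> G") (auto simp: V0_iff)
qed

definition T_minus :: "'c \<Rightarrow> ('f^2^2 \<Rightarrow> ('f \<Rightarrow> 'c, 'c) mpoly) \<Rightarrow> 'f^2^2 \<Rightarrow> ('f \<Rightarrow> 'c, 'c) mpoly" where
  "T_minus a f y = T k f y - mscale a (f y)"

lemma T_minus_V:
  assumes R: "residue_system R" and f: "f \<in> ind k (V k)"
  shows "T_minus a f y \<in> V k"
  unfolding T_minus_def by (intro V_minus V_mscale T_V[OF R f] ind_D(2)[OF f])

lemma mscale_sum: "mscale c (sum f A) = (\<Sum>x\<in>A. mscale c (f x))"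
  by (induction A rule: infinite_finite_induct) (auto simp: mscale_simps)

lemma mscale_diff: "mscale c (P - Q) = mscale c P - mscale c Q"
  by (rule poly_mapping_eqI) (simp add: lookup_mscale lookup_minus algebra_simps)

lemma T_minus_add:
  assumes R: "residue_system R" and f: "f \<in> ind k (V k)" and h: "h \<in> ind k (V k)"
  shows "T_minus a (\<lambda>y. f y + h y) y = T_minus a f y + T_minus a h y"
proof -
  have "T k (\<lambda>y. f y + h y) y = T k f y + T k h y"
  proof (cases "y \<in> G")
    case True
    show ?thesis unfolding T_eq[OF R ind_add[OF f h] True] T_eq[OF R f True] T_eq[OF R h True]
      using ind_D(2)[OF f] ind_D(2)[OF h] by (simp add: rho_add mscale_simps sum.distrib)
  qed (simp add: T_outside)
  then show ?thesis by (simp add: T_minus_def mscale_simps)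
qed

lemma T_minus_mscale:
  assumes R: "residue_system R" and f: "f \<in> ind k (V k)"
  shows "T_minus a (\<lambda>y. mscale c (f y)) y = mscale c (T_minus a f y)"
proof -
  have "T k (\<lambda>y. mscale c (f y)) y = mscale c (T k f y)"
  proof (cases "y \<in> G")
    case True
    show ?thesis unfolding T_eq[OF R ind_mscale[OF f] True] T_eq[OF R f True]
      using ind_D(2)[OF f] by (simp add: rho_mscale mscale_simps mscale_sum mult.commute)
  qed (simp add: T_outside mscale_simps)
  then show ?thesis by (simp add: T_minus_def mscale_simps mscale_diff mult.commute)
qed

lemma T_minus_0: assumes R: "residue_system R" shows "T_minus a (\<lambda>_. 0) y = 0"
  using T_minus_mscale[OF R ind_0(1), of a 0 y] by (simp add: mscale_simps)

lemma T_minus_sum: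
  assumes R: "residue_system R"
  assumes "finite A" "\<And>x. x \<in> A \<Longrightarrow> f x \<in> ind k (V k)"
  shows "T_minus a (\<lambda>y. \<Sum>x\<in>A. f x y) y = (\<Sum>x\<in>A. T_minus a (f x) y)"
  using assms(2,3)
proof (induction A rule: finite_induct)
  case empty
  show ?case using T_minus_0[OF R] by simp
next
  case (insert x A)
  then show ?case using T_minus_add[OF R, of "f x" "\<lambda>y. \<Sum>x\<in>A. f x y"] ind_sum[of A f] by simp
qed

lemma T_minus_pge:
  assumes R: "residue_system R" and f: "f \<in> ind k (V k)" and c: "\<And>y. vf.pge c (ev (f y))" and a: "vf.vge 0 a"
  shows "vf.pge c (ev (T_minus a f y))"
proof -
  have "vf.pge c (smult a (ev (f y)))" using vf.pge_smult[OF a c] by simp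
  then show ?thesis unfolding T_minus_def ev_minus ev_mscale by (rule vf.pge_diff[OF T_pge[OF R f c]])
qed

text \<open>Supported on the coset of y, with the i-th monomial as its value at y.\<close>

definition basis_fun :: "'f^2^2 \<Rightarrow> nat \<Rightarrow> 'f^2^2 \<Rightarrow> ('f \<Rightarrow> 'c, 'c) mpoly" where
  "basis_fun y i = bracket k (matrix_inv y) (Poly_Mapping.single (mon i) 1)"

lemma right_coset_iff: "y \<in> G \<Longrightarrow> x ** matrix_inv y \<in> KZ \<longleftrightarrow> x \<in> right_coset y"
proof
  assume y: "y \<in> G" and x: "x ** matrix_inv y \<in> KZ"
  have "x = (x ** matrix_inv y) ** y" using matrix_inv_GL(2)[OF y] by (simp add: matrix_mul_assoc[symmetric])
  then show "x \<in> right_coset y" unfolding right_coset_def using x by blast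
next
  assume y: "y \<in> G" and "x \<in> right_coset y"
  then obtain \<kappa> where "\<kappa> \<in> KZ" "x = \<kappa> ** y" unfolding right_coset_def by blast
  then show "x ** matrix_inv y \<in> KZ" using matrix_inv_GL(1)[OF y] by (simp add: matrix_mul_assoc[symmetric])
qed

lemma bracket_ind:
  assumes y: "y \<in> G" and P: "P \<in> V k"
  shows "bracket k (matrix_inv y) P \<in> ind k (V k)"
  unfolding ind_iff
proof (intro conjI allI impI ballI)
  fix g assume g: "g \<notin> G"
  have "g \<notin> right_coset y" using g y KZ_G unfolding right_coset_def by blast
  then show "bracket k (matrix_inv y) P g = 0" unfolding bracket_eq right_coset_iff[OF y] by simp
next
  fix g show "bracket k (matrix_inv y) P g \<in> V k" unfolding bracket_eq using P by (simp add: rho_V)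
next
  fix \<kappa> g assume kg: "\<kappa> \<in> KZ" "g \<in> G"
  have e: "\<kappa> ** g ** matrix_inv y = \<kappa> ** (g ** matrix_inv y)" by (simp only: matrix_mul_assoc)
  have G: "g ** matrix_inv y \<in> G" using G_mult[OF kg(2) matrix_inv_GL(3)[OF y]] .
  show "bracket k (matrix_inv y) P (\<kappa> ** g) = rho k \<kappa> (bracket k (matrix_inv y) P g)"
    unfolding bracket_eq e KZ_cancel_left[OF kg(1)] using rho_mult[OF P KZ_G[OF kg(1)] G] by simp
next
  have "right_coset g = right_coset y" if g: "bracket k (matrix_inv y) P g \<noteq> 0" for g
  proof -
    have "g \<in> right_coset y"
    proof (rule ccontr)
      assume "g \<notin> right_coset y"
      then show False using g unfolding bracket_eq right_coset_iff[OF y] by simp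
    qed
    then obtain \<kappa> where "\<kappa> \<in> KZ" "g = \<kappa> ** y" unfolding right_coset_def by blast
    then show ?thesis using right_coset_cong[of \<kappa> y] by simp
  qed
  then have "right_coset ` {g \<in> G. bracket k (matrix_inv y) P g \<noteq> 0} \<subseteq> {right_coset y}" by blast
  then show "finite (right_coset ` {g \<in> G. bracket k (matrix_inv y) P g \<noteq> 0})" by (rule finite_subset) simp
qed

lemma V_expand: assumes P: "P \<in> V k"
  shows "P = (\<Sum>i\<le>n. mscale (coeff (ev P) i) (Poly_Mapping.single (mon i) 1))"
proof (rule ev_inj[OF P])
  have "Poly_Mapping.single (mon i) 1 \<in> V k" if "i \<le> n" for i using that by (intro single_V mon_Wm)
  then show "(\<Sum>i\<le>n. mscale (coeff (ev P) i) (Poly_Mapping.single (mon i) 1)) \<in> V k"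
    by (intro V_sum V_mscale) simp
  have "ev (\<Sum>i\<le>n. mscale (coeff (ev P) i) (Poly_Mapping.single (mon i) 1)) = (\<Sum>i\<le>n. monom (coeff (ev P) i) i)"
    unfolding ev_sum ev_mscale ev_single by (simp add: smult_monom)
  then show "ev P = ev (\<Sum>i\<le>n. mscale (coeff (ev P) i) (Poly_Mapping.single (mon i) 1))"
    using poly_as_sum_of_monoms'[OF degree_ev[OF P]] by simp
qed

lemma basis_fun_ind: "y \<in> G \<Longrightarrow> i \<le> n \<Longrightarrow> basis_fun y i \<in> ind k (V k)"
  unfolding basis_fun_def by (intro bracket_ind single_V mon_Wm)

lemma basis_fun_pge: assumes "i \<le> n" shows "vf.pge 0 (ev (basis_fun y i x))"
proof -
  have "Poly_Mapping.single (mon i) 1 \<in> V k" using assms by (intro single_V mon_Wm)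
  moreover have "vf.pge 0 (ev (Poly_Mapping.single (mon i) 1))" unfolding ev_single by (simp add: vf.pge_def)
  ultimately show ?thesis unfolding basis_fun_def bracket_eq by (simp add: pge_rho_KZ)
qed

lemma bracket_expand: assumes P: "P \<in> V k"
  shows "bracket k (matrix_inv y) P x = (\<Sum>i\<le>n. mscale (coeff (ev P) i) (basis_fun y i x))"
proof -
  have s: "Poly_Mapping.single (mon i) 1 \<in> V k" if "i \<le> n" for i using that by (intro single_V mon_Wm)
  have "rho k g P = (\<Sum>i\<le>n. mscale (coeff (ev P) i) (rho k g (Poly_Mapping.single (mon i) 1)))" for g
  proof -
    have "rho k g P = rho k g (\<Sum>i\<le>n. mscale (coeff (ev P) i) (Poly_Mapping.single (mon i) 1))"
      using V_expand[OF P] by simp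
    also have "\<dots> = (\<Sum>i\<le>n. rho k g (mscale (coeff (ev P) i) (Poly_Mapping.single (mon i) 1)))"
      by (rule rho_sum) (simp add: V_mscale s)
    also have "\<dots> = (\<Sum>i\<le>n. mscale (coeff (ev P) i) (rho k g (Poly_Mapping.single (mon i) 1)))"
      by (intro sum.cong refl) (simp add: rho_mscale s)
    finally show ?thesis .
  qed
  then show ?thesis unfolding basis_fun_def bracket_eq by (simp add: mscale_simps)
qed

text \<open>For each y in Q the bracket of the current value at y is subtracted. Several points of Q
  may represent the same coset, so the value is taken from the function e that is already cut off at
  the earlier points.\<close>

lemma cut_off:
  assumes "finite Q" "Q \<subseteq> G" and h: "h \<in> ind k (V k)"
  shows "\<exists>c. \<forall>x. h x - (\<Sum>y\<in>Q. \<Sum>i\<le>n. mscale (c y i) (basis_fun y i x)) = (if x \<in> \<Union>(right_coset ` Q) then 0 else h x)"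
  using assms(1,2)
proof (induction Q rule: finite_induct)
  case empty
  show ?case by simp
next
  case (insert y Q)
  then obtain c where c: "\<And>x. h x - (\<Sum>y\<in>Q. \<Sum>i\<le>n. mscale (c y i) (basis_fun y i x)) = (if x \<in> \<Union>(right_coset ` Q) then 0 else h x)"
    by auto
  define e where "e = (\<lambda>x. if x \<in> \<Union>(right_coset ` Q) then 0 else h x)"
  have y: "y \<in> G" using insert.prems by simp
  have eV: "e y \<in> V k" by (simp add: e_def ind_D(2)[OF h])
  define c' where "c' = c(y := coeff (ev (e y)))"
  have s: "(\<Sum>y'\<in>insert y Q. \<Sum>i\<le>n. mscale (c' y' i) (basis_fun y' i x)) =
      bracket k (matrix_inv y) (e y) x + (\<Sum>y\<in>Q. \<Sum>i\<le>n. mscale (c y i) (basis_fun y i x))" for x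
  proof -
    have "(\<Sum>y'\<in>Q. \<Sum>i\<le>n. mscale (c' y' i) (basis_fun y' i x)) = (\<Sum>y\<in>Q. \<Sum>i\<le>n. mscale (c y i) (basis_fun y i x))"
      using insert.hyps(2) by (intro sum.cong refl) (auto simp: c'_def)
    then show ?thesis using insert.hyps by (simp add: c'_def bracket_expand[OF eV])
  qed
  have "e x - bracket k (matrix_inv y) (e y) x = (if x \<in> \<Union>(right_coset ` insert y Q) then 0 else h x)" for x
  proof (cases "x \<in> right_coset y")
    case True
    then obtain \<kappa> where \<kappa>: "\<kappa> \<in> KZ" "x = \<kappa> ** y" unfolding right_coset_def by blast
    have "x ** matrix_inv y = \<kappa>" unfolding \<kappa>(2) using matrix_inv_GL(1)[OF y] by (simp add: matrix_mul_assoc[symmetric])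
    then have b: "bracket k (matrix_inv y) (e y) x = rho k \<kappa> (e y)" using \<kappa>(1) by (simp add: bracket_eq)
    have xr: "x \<in> right_coset q \<longleftrightarrow> y \<in> right_coset q" for q
    proof -
      have m: "x \<in> right_coset q \<longleftrightarrow> right_coset x = right_coset q" for x q
      proof
        assume "x \<in> right_coset q"
        then obtain \<kappa>' where "\<kappa>' \<in> KZ" "x = \<kappa>' ** q" unfolding right_coset_def by blast
        then show "right_coset x = right_coset q" using right_coset_cong by blast
      qed (use right_coset_self in blast)
      show ?thesis unfolding m using right_coset_cong[OF \<kappa>(1), of y] \<kappa>(2) by simp
    qed
    have "e x = rho k \<kappa> (e y)"
      unfolding e_def using xr ind_D(3)[OF h \<kappa>(1) y] \<kappa>(2) by simp
    then show ?thesis using b True by simp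
  next
    case False
    then have "bracket k (matrix_inv y) (e y) x = 0" unfolding bracket_eq right_coset_iff[OF y] by simp
    then show ?thesis using False by (simp add: e_def)
  qed
  then have "h x - (\<Sum>y'\<in>insert y Q. \<Sum>i\<le>n. mscale (c' y' i) (basis_fun y' i x)) =
      (if x \<in> \<Union>(right_coset ` insert y Q) then 0 else h x)" for x
  proof -
    fix x
    let ?S = "\<Sum>y\<in>Q. \<Sum>i\<le>n. mscale (c y i) (basis_fun y i x)" and ?b = "bracket k (matrix_inv y) (e y) x"
    assume *: "\<And>x. e x - bracket k (matrix_inv y) (e y) x = (if x \<in> \<Union>(right_coset ` insert y Q) then 0 else h x)"
    have "h x - (?b + ?S) = (h x - ?S) - ?b" by (simp only: diff_diff_eq add.commute)
    also have "h x - ?S = e x" unfolding c e_def ..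
    finally show "h x - (\<Sum>y'\<in>insert y Q. \<Sum>i\<le>n. mscale (c' y' i) (basis_fun y' i x)) =
      (if x \<in> \<Union>(right_coset ` insert y Q) then 0 else h x)" unfolding s using *[of x] by (simp only:)
  qed
  then show ?case by blast
qed

end

section \<open>Separatedness\<close>

context valued_field
begin

lemma eq_0_if_vge_all: assumes "\<And>m::nat. vge (real m) x" shows "x = 0"
proof (rule ccontr)
  assume "x \<noteq> 0"
  then obtain c where "v x = ereal c" using v_finite by blast
  then have "real (Suc (nat \<lceil>c\<rceil>)) \<le> c" using assms[of "Suc (nat \<lceil>c\<rceil>)"] by (simp add: vge_def)
  then show False using real_nat_ceiling_ge[of c] by simp
qed

text \<open>Gaussian elimination with a pivot coordinate; boundedness of the vectors replaces completeness
  of the field.\<close>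
lemma finite_span_closed:
  assumes "finite J" "\<And>j. j \<in> J \<Longrightarrow> \<exists>c. \<forall>i. vge c (f j i)"
    and "\<And>m::nat. \<exists>c. \<forall>i. vge (real m) (u i - (\<Sum>j\<in>J. c j * f j i))"
  shows "\<exists>c. \<forall>i. u i = (\<Sum>j\<in>J. c j * f j i)"
  using assms
proof (induction J arbitrary: u f rule: finite_induct)
  case empty
  have "u i = 0" for i using empty.prems(2) by (intro eq_0_if_vge_all) simp
  then show ?case by simp
next
  case (insert j0 J)
  have sum_insert: "(\<Sum>j\<in>insert j0 J. c j * g j) = c j0 * g j0 + (\<Sum>j\<in>J. c j * g j)" for c g :: "_ \<Rightarrow> 'c"
    using insert.hyps by simp
  have upd: "(\<Sum>j\<in>insert j0 J. (c(j0 := x)) j * g j) = x * g j0 + (\<Sum>j\<in>J. c j * g j)" for c g :: "_ \<Rightarrow> 'c" and x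
  proof -
    have "(\<Sum>j\<in>J. (c(j0 := x)) j * g j) = (\<Sum>j\<in>J. c j * g j)" using insert.hyps(2) by (intro sum.cong refl) auto
    then show ?thesis unfolding sum_insert by simp
  qed
  show ?case
  proof (cases "\<forall>i. f j0 i = 0")
    case True
    have "\<exists>c. \<forall>i. u i = (\<Sum>j\<in>J. c j * f j i)"
    proof (rule insert.IH)
      show "\<exists>c. \<forall>i. vge c (f j i)" if "j \<in> J" for j using insert.prems(1) that by blast
      show "\<exists>c. \<forall>i. vge (real m) (u i - (\<Sum>j\<in>J. c j * f j i))" for m
        using insert.prems(2)[of m] True unfolding sum_insert by simp
    qed
    then obtain c where "\<And>i. u i = (\<Sum>j\<in>J. c j * f j i)" by blast
    then show ?thesis using True unfolding sum_insert by (intro exI[of _ c]) simp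
  next
    case False
    then obtain i0 where i0: "f j0 i0 \<noteq> 0" by blast
    obtain \<eta> where \<eta>: "v (f j0 i0) = ereal \<eta>" using v_finite[OF i0] by blast
    obtain \<beta> where \<beta>: "\<And>i. vge \<beta> (f j0 i)" using insert.prems(1)[of j0] by blast
    define t where "t = (\<lambda>i. f j0 i / f j0 i0)"
    have t: "vge (\<beta> - \<eta>) (t i)" for i unfolding t_def by (rule vge_divide[OF \<beta> \<eta>])
    have "\<exists>c. \<forall>i. u i - u i0 * t i = (\<Sum>j\<in>J. c j * (f j i - f j i0 * t i))"
    proof (rule insert.IH)
      fix j assume "j \<in> J"
      then obtain \<gamma> where \<gamma>: "\<And>i. vge \<gamma> (f j i)" using insert.prems(1)[of j] by blast
      have "vge (min \<gamma> (\<gamma> + (\<beta> - \<eta>))) (f j i - f j i0 * t i)" for i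
        by (rule vge_diff[OF vge_mono[OF \<gamma>] vge_mono[OF vge_mult[OF \<gamma> t]]]) auto
      then show "\<exists>c. \<forall>i. vge c (f j i - f j i0 * t i)" by blast
    next
      fix m :: nat
      \<comment> \<open>Makes up for the precision lost through the factor t, whose valuation is at
        least \<beta> - \<eta>.\<close>
      define m' where "m' = m + nat \<lceil>\<eta> - \<beta>\<rceil>"
      obtain c where c: "\<And>i. vge (real m') (u i - (\<Sum>j\<in>insert j0 J. c j * f j i))"
        using insert.prems(2)[of m'] by blast
      have "vge (real m) (u i - u i0 * t i - (\<Sum>j\<in>J. c j * (f j i - f j i0 * t i)))" for i
      proof -
        define g where "g = (\<lambda>i. u i - (\<Sum>j\<in>insert j0 J. c j * f j i))"
        have g: "vge (real m') (g i)" for i unfolding g_def by (rule c)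
        have "f j0 i = f j0 i0 * t i" using i0 by (simp add: t_def)
        then have "u i - u i0 * t i - (\<Sum>j\<in>J. c j * (f j i - f j i0 * t i)) = g i - g i0 * t i"
          unfolding g_def sum_insert
          by (simp add: algebra_simps sum_subtractf sum_distrib_left sum_distrib_right)
        moreover have "vge (real m) (g i)" by (rule vge_mono[OF g]) (simp add: m'_def)
        moreover have "vge (real m) (g i0 * t i)"
          by (rule vge_mono[OF vge_mult[OF g t]]) (use real_nat_ceiling_ge[of "\<eta> - \<beta>"] in \<open>simp add: m'_def\<close>)
        ultimately show ?thesis by (simp add: vge_diff)
      qed
      then show "\<exists>c. \<forall>i. vge (real m) (u i - u i0 * t i - (\<Sum>j\<in>J. c j * (f j i - f j i0 * t i)))" by blast
    qed
    then obtain c where c: "\<And>i. u i - u i0 * t i = (\<Sum>j\<in>J. c j * (f j i - f j i0 * t i))" by blast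
    define x where "x = (u i0 - (\<Sum>j\<in>J. c j * f j i0)) / f j0 i0"
    have "u i = (\<Sum>j\<in>insert j0 J. (c(j0 := x)) j * f j i)" for i
    proof -
      have "u i = u i0 * t i + (\<Sum>j\<in>J. c j * (f j i - f j i0 * t i))" unfolding c[symmetric] by simp
      also have "(\<Sum>j\<in>J. c j * (f j i - f j i0 * t i)) = (\<Sum>j\<in>J. c j * f j i) - (\<Sum>j\<in>J. c j * f j i0) * t i"
        by (simp add: right_diff_distrib sum_subtractf sum_distrib_right mult.assoc)
      also have "u i0 * t i + ((\<Sum>j\<in>J. c j * f j i) - (\<Sum>j\<in>J. c j * f j i0) * t i) = x * f j0 i + (\<Sum>j\<in>J. c j * f j i)"
        by (simp add: x_def t_def left_diff_distrib diff_divide_distrib)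
      finally show ?thesis unfolding upd .
    qed
    then show ?thesis by blast
  qed
qed

end

section \<open>From the a priori bound to separatedness\<close>

context poly_weight
begin

lemma smult_sum_right: "smult c (sum f A) = (\<Sum>x\<in>A. smult c (f x :: 'c poly))"
  by (rule poly_eqI) (simp add: coeff_sum sum_distrib_left)

text \<open>The bound is asserted for all families on words, not for a given induced function, so
  that it also applies to a rescaled function seen from any root of a subtree.\<close>

definition tree_bound :: "'f set \<Rightarrow> 'c \<Rightarrow> real \<Rightarrow> bool" where
  "tree_bound R a c \<longleftrightarrow> (\<forall>P M. (\<forall>s. degree (P s) \<le> n) \<longrightarrow> (\<forall>s\<in>lists R. M < length s \<longrightarrow> P s = 0) \<longrightarrow>
     (\<forall>m\<in>R. \<forall>s\<in>lists R. vf.pge 0 (pcompose (P s) [:- \<sigma> m, w:] + (\<Sum>l\<in>R. act (xm l) (P (l # m # s))) - smult a (P (m # s)))) \<longrightarrow>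
     (\<forall>s\<in>lists R. vf.pge (- c) (P s)))"

text \<open>Beyond depth N the function f0 vanishes, so there h divided by x satisfies the Hecke
  relations with the integral right-hand side -f, and the a priori bound applies to it.\<close>

lemma deep_part_small:
  assumes R: "residue_system R" and tb: "tree_bound R a c0"
    and z: "z \<in> G" and f0: "\<And>s. N < length s \<Longrightarrow> f0 (pt z s) = 0"
    and f: "f \<in> ind k (V0 k)" and h: "h \<in> ind k (V k)" and x: "vF x = ereal (real m)"
    and eq: "\<And>y. f0 y = mscale x (f y) + T_minus a h y"
    and s: "s \<in> lists R" "N \<le> length s"
  shows "vf.pge (real m - c0) (ev (h (pt z s)))"
proof -
  define t where "t = take (length s - N) s"
  \<comment> \<open>Words start at their end, so s0 is the initial path of length N. At its
    descendants, all longer than N, f0 is zero.\<close>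
  define s0 where "s0 = drop (length s - N) s"
  have ts: "s = t @ s0" "length s0 = N" "t \<in> lists R" using s
    by (auto simp: t_def s0_def in_lists_conv_set dest: in_set_takeD)
  define z' where "z' = pt z s0"
  have z': "z' \<in> G" unfolding z'_def by (rule pt_G[OF z])
  have x0: "x \<noteq> 0" using x by auto
  define P where "P = (\<lambda>t. smult (inverse x) (ev (h (pt z' t))))"
  obtain M where M: "\<And>s. M < length s \<Longrightarrow> h (pt z' s) = 0" using support_bounded[OF h z'] by blast
  have "vf.pge 0 (pcompose (P t) [:- \<sigma> l0, w:] + (\<Sum>l\<in>R. act (xm l) (P (l # l0 # t))) - smult a (P (l0 # t)))"
    if l0: "l0 \<in> R" and t: "t \<in> lists R" for l0 t
  proof -
    let ?y = "pt z' (l0 # t)"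
    have "?y = pt z ((l0 # t) @ s0)" by (simp only: pt_append z'_def)
    then have "f0 ?y = 0" using f0[of "(l0 # t) @ s0"] ts(2) by simp
    then have "mscale x (f ?y) + T_minus a h ?y = 0" using eq[of ?y] by simp
    then have "ev (mscale x (f ?y) + T_minus a h ?y) = 0" by simp
    then have e: "ev (T_minus a h ?y) = - smult x (ev (f ?y))" by (simp add: ev_add ev_mscale eq_neg_iff_add_eq_0 add.commute)
    have T: "ev (T k h ?y) = pcompose (ev (h (pt z' t))) [:- \<sigma> l0, w:] + (\<Sum>l\<in>R. act (xm l) (ev (h (pt z' (l # l0 # t)))))"
      using ev_T_step[OF R h pt_G[OF z'] residue_systemD(3)[OF R l0], of t] by simp
    have "pcompose (P t) [:- \<sigma> l0, w:] + (\<Sum>l\<in>R. act (xm l) (P (l # l0 # t))) - smult a (P (l0 # t)) =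
        smult (inverse x) (ev (T_minus a h ?y))"
      unfolding T_minus_def ev_minus ev_mscale T P_def
      by (simp only: pcompose_smult act_smult smult_add_right smult_diff_right smult_sum_right smult_smult mult.commute)
    also have "\<dots> = - ev (f ?y)" unfolding e using x0 by simp
    finally show ?thesis using ind_V0(2)[OF f] by simp
  qed
  moreover have "degree (P s) \<le> n" for s unfolding P_def using degree_ev[OF ind_D(2)[OF h]] degree_smult_le le_trans by blast
  moreover have "\<forall>s\<in>lists R. M < length s \<longrightarrow> P s = 0" using M by (simp add: P_def)
  ultimately have "vf.pge (- c0) (P t)" using tb ts(3) unfolding tree_bound_def by blast
  then have "vf.pge (real m + - c0) (smult x (P t))" by (rule vf.pge_smult[OF vf.vge_exact[OF x]])
  moreover have "smult x (P t) = ev (h (pt z s))" using x0 by (simp add: P_def ts(1) pt_append z'_def)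
  ultimately show ?thesis by simp
qed

text \<open>The finite set Q depends on f0 only and is fixed before the precision m. This is what
  reduces the limit to a finite-dimensional span.\<close>

lemma image_closed:
  assumes R: "residue_system R" and tb: "tree_bound R a c0" and c0: "0 \<le> c0" and a: "vf.vge 0 a"
    and f0: "f0 \<in> ind k (V k)"
    and approx: "\<And>m::nat. \<exists>f\<in>ind k (V0 k). \<exists>h\<in>ind k (V k). \<exists>x. vF x = ereal (real m) \<and>
      (\<forall>y. f0 y = mscale x (f y) + T_minus a h y)"
  shows "\<exists>h\<in>ind k (V k). \<forall>y. f0 y = T_minus a h y"
proof -
  obtain M1 where M1: "\<And>s. M1 < length s \<Longrightarrow> f0 (pt (mat 1) s) = 0" using support_bounded[OF f0 G_one] by blast
  obtain M2 where M2: "\<And>s. M2 < length s \<Longrightarrow> f0 (pt w0 s) = 0" using support_bounded[OF f0 w0_G] by blast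
  define N where "N = max M1 M2"
  have N: "f0 (pt z s) = 0" if "z \<in> {mat 1, w0}" "N < length s" for z s
    using that M1 M2 by (auto simp: N_def)
  define Q where "Q = (\<Union>z\<in>{mat 1, w0}. pt z ` {s. set s \<subseteq> R \<and> length s \<le> N})"
  have Qf: "finite Q" unfolding Q_def using finite_lists_length_le[OF residue_systemD(1)[OF R], of N] by blast
  have zG: "z \<in> G" if "z \<in> {mat 1, w0}" for z using that w0_G G_one by blast
  have QG: "Q \<subseteq> G" unfolding Q_def using pt_G zG by blast
  define J where "J = Q \<times> {..n}"
  define B where "B = (\<lambda>j. basis_fun (fst j) (snd j))"
  have J: "finite J" unfolding J_def using Qf by simp
  have Bi: "B j \<in> ind k (V k)" if "j \<in> J" for j
    using that QG unfolding J_def B_def by (intro basis_fun_ind) auto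
  have Bp: "vf.pge 0 (ev (B j y))" if "j \<in> J" for j y using that unfolding J_def B_def by (intro basis_fun_pge) auto
  have comb: "(\<lambda>y. \<Sum>j\<in>J. mscale (c j) (B j y)) \<in> ind k (V k)" for c
    by (rule ind_sum[OF J]) (intro ind_mscale Bi)
  have T_minus_comb: "T_minus a (\<lambda>y. \<Sum>j\<in>J. mscale (c j) (B j y)) y = (\<Sum>j\<in>J. mscale (c j) (T_minus a (B j) y))" for c y
  proof -
    have "T_minus a (\<lambda>y. \<Sum>j\<in>J. mscale (c j) (B j y)) y = (\<Sum>j\<in>J. T_minus a (\<lambda>y. mscale (c j) (B j y)) y)"
      by (rule T_minus_sum[OF R J]) (intro ind_mscale Bi)
    also have "\<dots> = (\<Sum>j\<in>J. mscale (c j) (T_minus a (B j) y))" by (intro sum.cong refl T_minus_mscale[OF R Bi])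
    finally show ?thesis .
  qed
  have co: "coeff (ev (\<Sum>j\<in>J. mscale (c j) (T_minus a (B j) y))) i = (\<Sum>j\<in>J. c j * coeff (ev (T_minus a (B j) y)) i)" for c y i
    by (simp add: ev_sum ev_mscale coeff_sum)
  have "\<exists>c. \<forall>yi. coeff (ev (f0 (fst yi))) (snd yi) = (\<Sum>j\<in>J. c j * coeff (ev (T_minus a (B j) (fst yi))) (snd yi))"
  proof (rule vf.finite_span_closed[OF J])
    fix j assume j: "j \<in> J"
    have "vf.pge 0 (ev (T_minus a (B j) y))" for y by (rule T_minus_pge[OF R Bi[OF j] Bp[OF j] a])
    then show "\<exists>c. \<forall>yi. vf.vge c (coeff (ev (T_minus a (B j) (fst yi))) (snd yi))" unfolding vf.pge_def by blast
  next
    fix m :: nat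
    \<comment> \<open>The a priori bound costs c0, independently of m.\<close>
    define m' where "m' = m + nat \<lceil>c0\<rceil>"
    have mc: "real m \<le> real m' - c0" using real_nat_ceiling_ge[of c0] by (simp add: m'_def)
    obtain f h x where fhx: "f \<in> ind k (V0 k)" "h \<in> ind k (V k)" "vF x = ereal (real m')"
      "\<And>y. f0 y = mscale x (f y) + T_minus a h y" using approx[of m'] by blast
    obtain c' where c': "\<And>x. h x - (\<Sum>y\<in>Q. \<Sum>i\<le>n. mscale (c' y i) (basis_fun y i x)) = (if x \<in> \<Union>(right_coset ` Q) then 0 else h x)"
      using cut_off[OF Qf QG fhx(2)] by blast
    define c where "c = (\<lambda>j. c' (fst j) (snd j))"
    define b where "b = (\<lambda>y. \<Sum>j\<in>J. mscale (c j) (B j y))"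
    have bi: "b \<in> ind k (V k)" unfolding b_def by (rule comb)
    have b: "b x = (\<Sum>y\<in>Q. \<Sum>i\<le>n. mscale (c' y i) (basis_fun y i x))" for x
      unfolding b_def c_def B_def J_def sum.cartesian_product by (intro sum.cong refl) auto
    define e where "e = (\<lambda>y. h y + mscale (- 1) (b y))"
    have ei: "e \<in> ind k (V k)" unfolding e_def by (rule ind_add[OF fhx(2) ind_mscale[OF bi]])
    have eh: "e y + b y = h y" for y unfolding e_def by (rule poly_mapping_eqI) (simp add: lookup_add lookup_mscale)
    have e': "e y = (if y \<in> \<Union>(right_coset ` Q) then 0 else h y)" for y
      using c'[of y] eh[of y] unfolding b[symmetric] by (metis add_diff_cancel_right')
    have ep: "vf.pge (real m) (ev (e y))" for y
    proof (cases "y \<in> G \<and> y \<notin> \<Union>(right_coset ` Q)")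
      case True
      then obtain \<kappa> z s where y: "\<kappa> \<in> KZ" "z \<in> {mat 1, w0}" "s \<in> lists R" "y = \<kappa> ** pt z s"
        using tree_pt_G[OF R, of y] unfolding tree_pt_def by blast
      have "\<not> length s \<le> N"
      proof
        assume "length s \<le> N"
        then have "pt z s \<in> Q" using y(2,3) unfolding Q_def by auto
        moreover have "y \<in> right_coset (pt z s)" unfolding right_coset_def using y(1,4) by blast
        ultimately show False using True by blast
      qed
      then have "vf.pge (real m' - c0) (ev (h (pt z s)))"
        by (intro deep_part_small[OF R tb zG[OF y(2)] N[OF y(2)] fhx(1-4) y(3)]) auto
      then have "vf.pge (real m) (ev (h (pt z s)))" by (rule vf.pge_mono[OF _ mc])
      then have "vf.pge (real m) (ev (h y))"
        unfolding y(4) ind_D(3)[OF fhx(2) y(1) pt_G[OF zG[OF y(2)]]] by (rule pge_rho_KZ[OF y(1) ind_D(2)[OF fhx(2)]])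
      then show ?thesis using True e' by simp
    next
      case False
      then have "e y = 0" using e'[of y] ind_D(1)[OF fhx(2), of y] by auto
      then show ?thesis by simp
    qed
    have "vf.vge (real m) (coeff (ev (f0 y)) i - (\<Sum>j\<in>J. c j * coeff (ev (T_minus a (B j) y)) i))" for y i
    proof -
      have "T_minus a h y = T_minus a e y + T_minus a b y" using T_minus_add[OF R ei bi, of a y] unfolding eh .
      then have "ev (f0 y) - ev (T_minus a b y) = smult x (ev (f y)) + ev (T_minus a e y)"
        by (simp add: fhx(4)[of y] ev_add ev_mscale)
      moreover have "vf.pge (real m) (smult x (ev (f y)))"
        by (rule vf.pge_smult'[OF vf.vge_exact[OF fhx(3)] ind_V0(2)[OF fhx(1)]]) (use mc c0 in simp)
      ultimately have "vf.pge (real m) (ev (f0 y) - ev (T_minus a b y))"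
        using vf.pge_add T_minus_pge[OF R ei ep a] by simp
      from vf.pge_coeff[OF this, of i] show ?thesis unfolding b_def T_minus_comb coeff_diff co .
    qed
    then show "\<exists>c. \<forall>yi. vf.vge (real m) (coeff (ev (f0 (fst yi))) (snd yi) -
        (\<Sum>j\<in>J. c j * coeff (ev (T_minus a (B j) (fst yi))) (snd yi)))" by blast
  qed
  then obtain c where c: "\<And>y i. coeff (ev (f0 y)) i = (\<Sum>j\<in>J. c j * coeff (ev (T_minus a (B j) y)) i)" by fastforce
  have "f0 y = T_minus a (\<lambda>y. \<Sum>j\<in>J. mscale (c j) (B j y)) y" for y
  proof (rule ev_inj[OF ind_D(2)[OF f0] T_minus_V[OF R comb]])
    show "ev (f0 y) = ev (T_minus a (\<lambda>y. \<Sum>j\<in>J. mscale (c j) (B j y)) y)"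
      unfolding T_minus_comb by (rule poly_eqI) (simp only: co c)
  qed
  then show ?thesis using comb[of c] by blast
qed

lemma T_image_eq: "T_image k a = T_minus a ` ind k (V k)"
  unfolding T_image_def T_minus_def[abs_def] by blast

lemma separated_if_tree_bound:
  assumes R: "residue_system R" and tb: "tree_bound R a c0" and c0: "0 \<le> c0" and a: "vf.vge 0 a"
  shows "Theta_separated k a"
  unfolding Theta_separated_def
proof (intro ballI)
  fix \<tau> assume \<tau>: "\<tau> \<in> S"
  define Im where "Im = T_image k a"
  have add: "(\<lambda>y. b y + b' y) \<in> Im" if bb: "b \<in> Im" "b' \<in> Im" for b b'
  proof -
    obtain h h' where h: "h \<in> ind k (V k)" "h' \<in> ind k (V k)" "b = T_minus a h" "b' = T_minus a h'"
      using bb unfolding Im_def T_image_eq by blast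
    have "(\<lambda>y. b y + b' y) = T_minus a (\<lambda>y. h y + h' y)" by (rule ext) (simp only: h(3,4) T_minus_add[OF R h(1,2)])
    then show ?thesis unfolding Im_def T_image_eq using ind_add[OF h(1,2)] by blast
  qed
  have scale: "(\<lambda>y. mscale c (b y)) \<in> Im" if bI: "b \<in> Im" for b c
  proof -
    obtain h where h: "h \<in> ind k (V k)" "b = T_minus a h" using bI unfolding Im_def T_image_eq by blast
    have "(\<lambda>y. mscale c (b y)) = T_minus a (\<lambda>y. mscale c (h y))" by (rule ext) (simp only: h(2) T_minus_mscale[OF R h(1)])
    then show ?thesis unfolding Im_def T_image_eq using ind_mscale[OF h(1)] by blast
  qed
  have zero: "(\<lambda>_. 0) \<in> Im"
  proof -
    have "(\<lambda>_. 0) = T_minus a (\<lambda>_. 0)" by (rule ext) (simp only: T_minus_0[OF R])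
    then show ?thesis unfolding Im_def T_image_eq using ind_0(1) by blast
  qed
  have clI: "(\<lambda>y. f y + b y) \<in> {\<lambda>y. f y + b y |b. b \<in> Im}" if "b \<in> Im" for b
    and f :: "'f^2^2 \<Rightarrow> ('f \<Rightarrow> 'c, 'c) mpoly" using that by blast
  have cls: "Pi_class k a f = {\<lambda>y. f y + b y |b. b \<in> Im}" for f unfolding Pi_class_def Im_def ..
  have scl: "Pi_scale k a c (Pi_class k a f) = {\<lambda>y. mscale c (f y) + b y |b. b \<in> Im}" for c f
  proof (intro equalityI subsetI)
    fix g assume "g \<in> Pi_scale k a c (Pi_class k a f)"
    then obtain b b' where b: "b \<in> Im" "b' \<in> Im" "g = (\<lambda>y. mscale c (f y + b y) + b' y)"
      unfolding Pi_scale_def cls Im_def by blast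
    have "g = (\<lambda>y. mscale c (f y) + (mscale c (b y) + b' y))"
      unfolding b(3) by (simp add: mscale_simps add.assoc)
    then show "g \<in> {\<lambda>y. mscale c (f y) + b y |b. b \<in> Im}"
      using clI[OF add[OF scale[OF b(1), of c] b(2)], of "\<lambda>y. mscale c (f y)"] by simp
  next
    fix g assume "g \<in> {\<lambda>y. mscale c (f y) + b y |b. b \<in> Im}"
    then obtain b where b: "b \<in> Im" "g = (\<lambda>y. mscale c (f y) + b y)" by blast
    have "f \<in> Pi_class k a f" unfolding cls using clI[OF zero, of f] by simp
    then show "g \<in> Pi_scale k a c (Pi_class k a f)" unfolding Pi_scale_def b(2) using b(1) unfolding Im_def by blast
  qed
  have Pz: "Pi_zero k a = Im" unfolding Pi_zero_def cls by simp
  show "(\<Inter>m::nat. Pi_scale k a (\<tau> \<pi> ^ m) ` Theta k a) = {Pi_zero k a}"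
  proof (intro equalityI subsetI)
    fix D assume "D \<in> {Pi_zero k a}"
    then have D: "D = Im" using Pz by simp
    have "Pi_scale k a c (Pi_class k a (\<lambda>_. 0)) = Im" for c unfolding scl by (simp add: mscale_simps)
    moreover have "Pi_class k a (\<lambda>_. 0) \<in> Theta k a" unfolding Theta_def using ind_0(2) by blast
    ultimately show "D \<in> (\<Inter>m::nat. Pi_scale k a (\<tau> \<pi> ^ m) ` Theta k a)" unfolding D by blast
  next
    fix D assume D: "D \<in> (\<Inter>m::nat. Pi_scale k a (\<tau> \<pi> ^ m) ` Theta k a)"
    have Dm: "\<exists>f\<in>ind k (V0 k). D = {\<lambda>y. mscale (\<tau> \<pi> ^ m) (f y) + b y |b. b \<in> Im}" for m :: nat
    proof -
      have "D \<in> Pi_scale k a (\<tau> \<pi> ^ m) ` Theta k a" using D by blast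
      then obtain f where "f \<in> ind k (V0 k)" "D = Pi_scale k a (\<tau> \<pi> ^ m) (Pi_class k a f)"
        unfolding Theta_def by blast
      then show ?thesis unfolding scl by blast
    qed
    obtain f0 where f0: "f0 \<in> ind k (V0 k)" "D = {\<lambda>y. f0 y + b y |b. b \<in> Im}"
      using Dm[of 0] by (auto simp: mscale_simps)
    have f0D: "f0 \<in> D" unfolding f0(2) using clI[OF zero, of f0] by simp
    have "\<exists>h\<in>ind k (V k). \<forall>y. f0 y = T_minus a h y"
    proof (rule image_closed[OF R tb c0 a ind_V0(1)[OF f0(1)]])
      fix m :: nat
      obtain f where f: "f \<in> ind k (V0 k)" "D = {\<lambda>y. mscale (\<tau> \<pi> ^ m) (f y) + b y |b. b \<in> Im}" using Dm by blast
      then obtain b where b: "b \<in> Im" "f0 = (\<lambda>y. mscale (\<tau> \<pi> ^ m) (f y) + b y)" using f0D by blast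
      obtain h where h: "h \<in> ind k (V k)" "b = T_minus a h" using b(1) unfolding Im_def T_image_eq by blast
      have "vF (\<tau> \<pi> ^ m) = ereal (real m)" using vf.v_power[OF vF_\<pi>[OF \<tau>], of m] by simp
      moreover have "\<forall>y. f0 y = mscale (\<tau> \<pi> ^ m) (f y) + T_minus a h y" unfolding b(2) h(2) by simp
      ultimately show "\<exists>f\<in>ind k (V0 k). \<exists>h\<in>ind k (V k). \<exists>x. vF x = ereal (real m) \<and>
          (\<forall>y. f0 y = mscale x (f y) + T_minus a h y)" using f(1) h(1) by blast
    qed
    then have fI: "f0 \<in> Im" unfolding Im_def T_image_eq by (auto simp: fun_eq_iff)
    have "D = Im"
    proof (intro equalityI subsetI)
      fix g assume "g \<in> D"
      then obtain b where "b \<in> Im" "g = (\<lambda>y. f0 y + b y)" unfolding f0(2) by blast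
      then show "g \<in> Im" using add[OF fI] by simp
    next
      fix g assume g: "g \<in> Im"
      have "g = (\<lambda>y. f0 y + (g y + mscale (- 1) (f0 y)))"
        by (rule ext, rule poly_mapping_eqI) (simp add: lookup_add lookup_mscale)
      then show "g \<in> D" unfolding f0(2) using clI[OF add[OF g scale[OF fI, of "- 1"]], of f0] by simp
    qed
    then show "D \<in> {Pi_zero k a}" using Pz by simp
  qed
qed

end

section \<open>The case distinction of the theorem\<close>

context poly_weight
begin

lemma tree_coreI:
  assumes R: "residue_system R" and k: "n = d * residue_card \<iota>F \<pi> + r" "r < residue_card \<iota>F \<pi>"
    "2 \<le> residue_card \<iota>F \<pi>" "2 * d \<le> residue_card \<iota>F \<pi>"
  shows "tree_core vF w R \<sigma> CARD('p) (residue_card \<iota>F \<pi>) n d r"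
proof
  show "vF w = 1" using v\<pi> by (simp add: one_ereal_def)
  show "finite R" "card R = residue_card \<iota>F \<pi>" using residue_systemD(1,2)[OF R] .
  show "vf.vge 0 (\<sigma> x)" if "x \<in> R" for x using residue_systemD(3)[OF R that] by (simp add: vg_def)
  show "vF (\<sigma> x - \<sigma> y) = 0" if "x \<in> R" "y \<in> R" "x \<noteq> y" for x y using residue_systemD(4)[OF R that] by simp
  show "prime CARD('p)" by (rule prime_card)
  show "vf.vge 1 (of_nat CARD('p))" by (rule of_nat_p(2))
  show "CARD('p) dvd (residue_card \<iota>F \<pi> choose i)" if "0 < i" "i < residue_card \<iota>F \<pi>" for i
    by (rule p_dvd_choose_q[OF k(3) that])
qed (use k in auto)

lemma tree_boundI:
  assumes core: "tree_core vF w R \<sigma> p q n d r"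
    and bound: "\<And>P M s. tree_sol vF w R \<sigma> p q n d r a P M \<Longrightarrow> s \<in> lists R \<Longrightarrow> vf.pge (- c) (P s)"
  shows "tree_bound R a c"
  unfolding tree_bound_def
proof (intro allI impI)
  fix P M
  assume P: "\<forall>s. degree (P s) \<le> n" "\<forall>s\<in>lists R. M < length s \<longrightarrow> P s = 0"
    "\<forall>m\<in>R. \<forall>s\<in>lists R. vf.pge 0 (pcompose (P s) [:- \<sigma> m, w:] + (\<Sum>l\<in>R. act (xm l) (P (l # m # s))) - smult a (P (m # s)))"
  interpret tree_core vF w R \<sigma> p q n d r by (rule core)
  have dn: "dn l u = act (xm l) u" for l u unfolding dn_def act_xm ..
  have "tree_sol vF w R \<sigma> p q n d r a P M"
    by unfold_locales (use P in \<open>auto simp: dn\<close>)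
  then show "\<forall>s\<in>lists R. vf.pge (- c) (P s)" using bound by blast
qed

text \<open>The first condition with r > 0 and the second one fall under
  \<open>bound_small_slope\<close>, the third under \<open>bound_large_slope\<close>. For r = 0 in
  the first condition, \<open>\<nu> \<le> real r\<close> may fail: d at least 2 is
  \<open>bound_r0\<close>, d = 1 with \<nu> < 1 is weight q, and d = 1 with \<nu> = 1 is again large
  slope.\<close>

lemma separated:
  fixes d r
  defines "q \<equiv> residue_card \<iota>F \<pi>"
  assumes n0: "n \<noteq> 0" and nq: "n = d * q + r" "r < q" and a: "vf.vge 0 a"
    and cond:
      "(real n \<le> 1 / 2 * real q ^ 2 \<and> int r < int q - int d \<and> 0 \<le> vF a \<and> vF a \<le> 1) \<or>
       (real n \<le> 1 / 2 * real q ^ 2 \<and> 2 * vF a - 1 \<le> ereal (real r) \<and> int r < int q - int d \<and>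
          1 \<le> vF a \<and> vF a \<le> ereal (real (ramification_index \<iota>F \<pi>))) \<or>
       (real n \<le> min (real CARD('p) * real q - 1) (1 / 2 * real q ^ 2) \<and>
          int d - 1 \<le> int r \<and> ereal (real d) \<le> vF a)"
  shows "Theta_separated k a"
proof -
  have "real n \<le> 1 / 2 * real q ^ 2" using cond by auto
  then have "real (2 * n) \<le> real (q ^ 2)" by simp
  then have n2: "2 * n \<le> q * q" by (simp only: of_nat_le_iff power2_eq_square)
  \<comment> \<open>q is defined as a \<open>card\<close>; that it is neither 0 nor 1 is read off
    from n being nonzero and at most half of q^2.\<close>
  have q2: "2 \<le> q"
  proof (rule ccontr)
    assume "\<not> 2 \<le> q"
    then have "q * q \<le> 1 * 1" by (intro mult_le_mono) auto
    then show False using n2 n0 by simp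
  qed
  have dq: "2 * d \<le> q"
  proof -
    have "(2 * d) * q \<le> 2 * n" unfolding nq(1) by simp
    then have "(2 * d) * q \<le> q * q" using n2 by (rule le_trans)
    then show ?thesis using q2 by simp
  qed
  \<comment> \<open>Precision d + 2 serves all cases: the bounds for E and for the power sums use d,
    weight q uses 2.\<close>
  obtain R0 where R0: "residue_system R0" "\<And>l. l \<in> R0 \<Longrightarrow> vg (real (d + 1) + 1) (l ^ q - l)"
    using teichmuller_system[of "d + 1"] q2 unfolding q_def by blast
  define R1 where "R1 = uminus ` R0"
  have R1: "residue_system R1" unfolding R1_def by (rule residue_system_uminus[OF R0(1)])
  have core0: "tree_core vF w R0 \<sigma> CARD('p) q n d r" and core1: "tree_core vF w R1 \<sigma> CARD('p) q n d r"
    using tree_coreI[OF R0(1)] tree_coreI[OF R1] nq q2 dq unfolding q_def by blast+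
  have t0: "vf.vge c (\<sigma> l ^ q - \<sigma> l)" if "l \<in> R0" "c \<le> real d + 2" for l c
    using vg_mono[OF R0(2)[OF that(1)], of c] that(2) by (simp add: vg_def)
  have t1: "vf.vge c (poly (tree_core.E q) (- \<sigma> l))" if "l \<in> R1" "c \<le> real d + 2" for l c
  proof -
    obtain l0 where "l0 \<in> R0" "l = - l0" using \<open>l \<in> R1\<close> unfolding R1_def by blast
    then show ?thesis using t0[OF _ that(2), of l0] unfolding tree_core.E_def[OF core1] by (simp add: poly_monom)
  qed
  \<comment> \<open>In the first case a may be zero, hence a lower bound instead of a value for its
    valuation.\<close>
  consider (large) "vf.vge (real d) a" "d < CARD('p)" "d \<le> Suc r"
    | (small) \<nu> where "vF a = ereal \<nu>" "0 \<le> \<nu>" "vf.vge \<nu> (of_nat CARD('p))" "\<nu> \<le> real r" "2 * \<nu> - 1 \<le> real r" "r + d < q"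
    | (r0) \<nu> where "vF a = ereal \<nu>" "0 \<le> \<nu>" "\<nu> \<le> 1" "r = 0" "2 \<le> d"
    | (one) \<nu> where "vF a = ereal \<nu>" "0 \<le> \<nu>" "\<nu> < 1" "r = 0" "d = 1"
  proof -
    from cond consider (i) "int r < int q - int d" "0 \<le> vF a" "vF a \<le> 1"
      | (ii) "2 * vF a - 1 \<le> ereal (real r)" "int r < int q - int d" "1 \<le> vF a" "vF a \<le> ereal (real (ramification_index \<iota>F \<pi>))"
      | (iii) "real n \<le> real CARD('p) * real q - 1" "int d - 1 \<le> int r" "ereal (real d) \<le> vF a" by fastforce
    then show ?thesis
    proof cases
      case i
      obtain \<nu> where \<nu>: "vF a = ereal \<nu>" "0 \<le> \<nu>" "\<nu> \<le> 1" using i by (cases "vF a") auto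
      show ?thesis
      proof (cases "r = 0")
        case False
        then have "1 \<le> real r" by simp
        then show ?thesis using i(1) \<nu> vf.vge_mono[OF of_nat_p(2) \<nu>(3)] by (intro small) auto
      next
        case True
        then have "d \<noteq> 0" using nq(1) n0 by auto
        then consider "2 \<le> d" | "d = 1" by linarith
        then show ?thesis
        proof cases
          case 1
          then show ?thesis by (rule r0[OF \<nu> True])
        next
          case 2
          show ?thesis
          proof (cases "\<nu> < 1")
            case True
            then show ?thesis using one[OF \<nu>(1,2) True \<open>r = 0\<close> 2] by simp
          next
            case False
            then have "vf.vge (real d) a" using \<nu> 2 by (simp add: vf.vge_def)
            then show ?thesis using 2 prime_gt_1_nat[OF prime_card[where 'a='p]] by (intro large) auto
          qed
        qed
      qed
    next
      case ii
      obtain \<nu> where \<nu>: "vF a = ereal \<nu>" using ii(3,4) by (cases "vF a") auto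
      have "1 \<le> \<nu>" "\<nu> \<le> real (ramification_index \<iota>F \<pi>)" using ii(3,4) by (simp_all add: \<nu>)
      moreover have "2 * \<nu> - 1 \<le> real r" using ii(1) unfolding \<nu> by (simp add: one_ereal_def numeral_eq_ereal)
      moreover have "vf.vge \<nu> (of_nat CARD('p))" using \<open>\<nu> \<le> real (ramification_index \<iota>F \<pi>)\<close> by (simp add: vf.vge_def vF_p)
      ultimately show ?thesis using ii(2) by (intro small[OF \<nu>]) auto
    next
      case iii
      have "real (d * q) \<le> real n" unfolding nq(1) by simp
      then have "real (d * q) < real (CARD('p) * q)" using iii(1) by simp
      then have "d < CARD('p)" by (simp only: of_nat_less_iff mult_less_cancel2)
      then show ?thesis using iii by (intro large) (auto simp: vf.vge_def)
    qed
  qed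
  then show ?thesis
  proof cases
    case large
    have "tree_bound R0 a (real d)"
    proof (rule tree_boundI[OF core0])
      fix P M s assume sol: "tree_sol vF w R0 \<sigma> CARD('p) q n d r a P M" and s: "s \<in> lists R0"
      show "vf.pge (- real d) (P s)" by (rule tree_sol.bound_large_slope[OF sol large t0 s]) auto
    qed
    then show ?thesis by (rule separated_if_tree_bound[OF R0(1) _ _ a]) simp
  next
    case small
    have "tree_bound R1 a (\<nu> + real d)"
    proof (rule tree_boundI[OF core1])
      fix P M s assume sol: "tree_sol vF w R1 \<sigma> CARD('p) q n d r a P M" and s: "s \<in> lists R1"
      have "vf.pge (- \<nu> - real d) (P s)" by (rule tree_sol.bound_small_slope[OF sol small t1 s]) auto
      then show "vf.pge (- (\<nu> + real d)) (P s)" by (simp add: algebra_simps)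
    qed
    then show ?thesis by (rule separated_if_tree_bound[OF R1 _ _ a]) (use small in simp)
  next
    case r0
    have "tree_bound R1 a (\<nu> + real d)"
    proof (rule tree_boundI[OF core1])
      fix P M s assume sol: "tree_sol vF w R1 \<sigma> CARD('p) q n d r a P M" and s: "s \<in> lists R1"
      have "vf.pge (- \<nu> - real d) (P s)" by (rule tree_sol.bound_r0[OF sol r0 t1 s]) auto
      then show "vf.pge (- (\<nu> + real d)) (P s)" by (simp add: algebra_simps)
    qed
    then show ?thesis by (rule separated_if_tree_bound[OF R1 _ _ a]) (use r0 in simp)
  next
    case one
    obtain \<rho> where \<rho>: "vF \<rho> = ereal (1 - \<nu>)" "vf.vge (2 * \<nu>) (\<rho> * (a + \<rho> * tree_core.psi1 w R1 \<sigma> q) - w)"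
      using tree_core.rho_exists[OF core1 one(1-3)] by blast
    have "tree_bound R1 a 2"
    proof (rule tree_boundI[OF core1])
      fix P M s assume sol: "tree_sol vF w R1 \<sigma> CARD('p) q n d r a P M" and s: "s \<in> lists R1"
      have "weight_q vF w R1 \<sigma> CARD('p) q n d r a P M \<nu> \<rho>"
        by (intro weight_q.intro sol weight_q_axioms.intro one \<rho> t1) auto
      then show "vf.pge (- 2) (P s)" using s by (rule weight_q.bound)
    qed
    then show ?thesis by (rule separated_if_tree_bound[OF R1 _ _ a]) simp
  qed
qed

end

theorem theorem1p5:
  fixes \<iota>F :: "'p::prime_card padic \<Rightarrow> 'f::field"
    and \<iota>C :: "'p padic \<Rightarrow> 'c::field"
    and \<pi> :: 'f
    and sq :: "('f \<Rightarrow> 'c) \<Rightarrow> 'c"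
    and vF :: "'c \<Rightarrow> ereal"
    and k :: "('f \<Rightarrow> 'c) \<Rightarrow> nat"
    and \<sigma> :: "'f \<Rightarrow> 'c"
    and p q e d r :: nat
    and a :: 'c
  assumes data: "padic_setup \<iota>F \<iota>C \<pi> sq"
    and vF: "padic_setup.is_vF \<iota>F \<iota>C \<pi> vF"
    and p: "p = CARD('p)"
    and q: "q = residue_card \<iota>F \<pi>"
    and e: "e = ramification_index \<iota>F \<pi>"
    and \<sigma>: "\<sigma> \<in> embeddings \<iota>F \<iota>C"
    and k: "k \<sigma> \<noteq> 0" "\<And>\<tau>. \<tau> \<in> embeddings \<iota>F \<iota>C \<Longrightarrow> \<tau> \<noteq> \<sigma> \<Longrightarrow> k \<tau> = 0"
    and dr: "k \<sigma> = d * q + r" "r < q"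
    and a: "a \<in> integers \<iota>C"
    and cond:
      "(real (k \<sigma>) \<le> 1 / 2 * real q ^ 2 \<and> int r < int q - int d \<and>
          0 \<le> vF a \<and> vF a \<le> 1) \<or>
       (real (k \<sigma>) \<le> 1 / 2 * real q ^ 2 \<and>
          2 * vF a - 1 \<le> ereal (real r) \<and> int r < int q - int d \<and>
          1 \<le> vF a \<and> vF a \<le> ereal (real e)) \<or>
       (real (k \<sigma>) \<le> min (real p * real q - 1) (1 / 2 * real q ^ 2) \<and>
          int d - 1 \<le> int r \<and> ereal (real d) \<le> vF a)"
  shows "padic_setup.Theta_separated \<iota>F \<iota>C \<pi> sq k a"
proof -
  interpret padic_setup \<iota>F \<iota>C \<pi> sq by (rule data)
  interpret poly_weight \<iota>F \<iota>C \<pi> sq vF \<sigma> k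
    by unfold_locales (use vF \<sigma> k(2) in auto)
  show ?thesis
    by (rule separated[OF k(1) dr[unfolded q]]) (use a cond in \<open>simp_all add: vF_int p q e\<close>)
qed

end
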